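(* Let $\mathcal{A}$ be a skeletally small abelian category and let $S\subseteq\mathsf{M}(\mathcal{A})$ be any subset. Let $\langle S\rangle_{\mathrm{face}}$ be the smallest face of $\mathsf{M}(\mathcal{A})$ containing $S$, and put $\mathcal{F}:=\{X\in\mathcal{A}\mid[X]\in\langle S\rangle_{\mathrm{face}}\}$. Then $\mathcal{F}$ is a Serre subcategory of $\mathcal{A}$ (in particular a torsionfree class), $\{[F]\mid F\in\mathcal{F}\}=\langle S\rangle_{\mathrm{face}}$, and there is an isomorphism of monoids $$\mathsf{M}(\mathcal{A})_S\cong\mathsf{M}(\mathcal{F}[1]*\mathcal{A}).$$ Thus every localization of $\mathsf{M}(\mathcal{A})$ with respect to a subset is realized as the Grothendieck monoid of an intermediate subcategory of $\mathsf{D}^{\mathrm b}(\mathcal{A})$.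
   Context: Subcategories are full, closed under isomorphisms and additive. A torsionfree class in $\mathcal{A}$ is a subcategory closed under subobjects and extensions. $\mathsf{D}^{\mathrm b}(\mathcal{A})$ is the bounded derived category, with $\mathcal{A}$ identified with the objects having cohomology concentrated in degree $0$. For subcategories $\mathcal{B},\mathcal{B}'\subseteq\mathcal{A}$, $\mathcal{B}[1]*\mathcal{B}'$ is the subcategory of objects $X$ admitting a triangle $B[1]\to X\to B'\to B[2]$ with $B\in\mathcal{B}$, $B'\in\mathcal{B}'$. An intermediate subcategory is a subcategory $\mathcal{C}$ with $\mathcal{A}\subseteq\mathcal{C}\subseteq\mathcal{A}[1]*\mathcal{A}$ closed under extensions and direct summands in $\mathsf{D}^{\mathrm b}(\mathcal{A})$; for a torsionfree class $\mathcal{F}$, $\mathcal{F}[1]*\mathcal{A}$ is one. It is an extriangulated category (Nakaoka--Palu) whose conflations $X\to Y\to Z\dashrightarrow$ are given by the triangles of $\mathsf{D}^{\mathrm b}(\mathcal{A})$ with all three terms in it; in $\mathcal{A}$ conflations are short exact sequences. All monoids are commutative. The Grothendieck monoid $\mathsf{M}(\mathcal{C})$ of a skeletally small extriangulated category is the monoid with a map $X\mapsto[X]$ from isomorphism classes of objects, universal among maps $f$ to monoids with $f[0]=0$ and $f[Y]=f[X]+f[Z]$ for every conflation $X\to Y\to Z\dashrightarrow$. A face of a monoid $M$ is a submonoid $F$ such that $a+b\in F$ iff $a\in F$ and $b\in F$. For a subset $S\subseteq M$, the localization $M\to M_S$ is the universal monoid homomorphism sending every element of $S$ to an invertible eleme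nt. *)

theory Defs
  imports "HOL-Library.Multiset" "HOL-Algebra.Group"
begin

section \<open>Categories\<close>

text \<open>
  Objects form a set, so a category here is small up to the choice of the type; every skeletally
  small category is equivalent to one of these. Hom-sets are not required to be disjoint, hence
  predicates on arrows take the source and the target as arguments.
\<close>

record ('o, 'm) cat =
  obj :: "'o set"
  mor :: "'o \<Rightarrow> 'o \<Rightarrow> 'm set"
  idt :: "'o \<Rightarrow> 'm"
  cmp :: "'m \<Rightarrow> 'm \<Rightarrow> 'm"   (* cmp C g f is "g after f" *)

locale category =
  fixes C :: "('o, 'm, 'z) cat_scheme"
  assumes mor_obj: "f \<in> mor C X Y \<Longrightarrow> X \<in> obj C \<and> Y \<in> obj C"
    and idt_mor: "X \<in> obj C \<Longrightarrow> idt C X \<in> mor C X X"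
    and cmp_mor: "f \<in> mor C X Y \<Longrightarrow> g \<in> mor C Y Z \<Longrightarrow> cmp C g f \<in> mor C X Z"
    and cmp_assoc: "f \<in> mor C W X \<Longrightarrow> g \<in> mor C X Y \<Longrightarrow> h \<in> mor C Y Z \<Longrightarrow>
          cmp C h (cmp C g f) = cmp C (cmp C h g) f"
    and idt_left: "f \<in> mor C X Y \<Longrightarrow> cmp C (idt C Y) f = f"
    and idt_right: "f \<in> mor C X Y \<Longrightarrow> cmp C f (idt C X) = f"

definition iso_arrow :: "('o, 'm, 'z) cat_scheme \<Rightarrow> 'o \<Rightarrow> 'o \<Rightarrow> 'm \<Rightarrow> bool" where
  "iso_arrow C X Y f \<longleftrightarrow> f \<in> mor C X Y \<and>
     (\<exists>g \<in> mor C Y X. cmp C g f = idt C X \<and> cmp C f g = idt C Y)"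

definition isomorphic :: "('o, 'm, 'z) cat_scheme \<Rightarrow> 'o \<Rightarrow> 'o \<Rightarrow> bool" where
  "isomorphic C X Y \<longleftrightarrow> (\<exists>f. iso_arrow C X Y f)"

definition zero_object :: "('o, 'm, 'z) cat_scheme \<Rightarrow> 'o \<Rightarrow> bool" where
  "zero_object C Z \<longleftrightarrow> Z \<in> obj C \<and>
     (\<forall>X \<in> obj C. (\<exists>!f. f \<in> mor C X Z) \<and> (\<exists>!f. f \<in> mor C Z X))"

definition zero_arrow :: "('o, 'm, 'z) cat_scheme \<Rightarrow> 'o \<Rightarrow> 'o \<Rightarrow> 'm \<Rightarrow> bool" where
  "zero_arrow C X Y f \<longleftrightarrow>
     (\<exists>Z g h. zero_object C Z \<and> g \<in> mor C X Z \<and> h \<in> mor C Z Y \<and> f = cmp C h g)"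

definition is_product :: "('o, 'm, 'z) cat_scheme \<Rightarrow> 'o \<Rightarrow> 'o \<Rightarrow> 'o \<Rightarrow> 'm \<Rightarrow> 'm \<Rightarrow> bool" where
  "is_product C X Y P p q \<longleftrightarrow> p \<in> mor C P X \<and> q \<in> mor C P Y \<and>
     (\<forall>T. \<forall>f \<in> mor C T X. \<forall>g \<in> mor C T Y.
        \<exists>!h. h \<in> mor C T P \<and> cmp C p h = f \<and> cmp C q h = g)"

definition is_coproduct :: "('o, 'm, 'z) cat_scheme \<Rightarrow> 'o \<Rightarrow> 'o \<Rightarrow> 'o \<Rightarrow> 'm \<Rightarrow> 'm \<Rightarrow> bool" where
  "is_coproduct C X Y P i j \<longleftrightarrow> i \<in> mor C X P \<and> j \<in> mor C Y P \<and>
     (\<forall>T. \<forall>f \<in> mor C X T. \<forall>g \<in> mor C Y T.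
        \<exists>!h. h \<in> mor C P T \<and> cmp C h i = f \<and> cmp C h j = g)"

definition direct_sum ::
    "('o, 'm, 'z) cat_scheme \<Rightarrow> 'o \<Rightarrow> 'o \<Rightarrow> 'o \<Rightarrow> 'm \<Rightarrow> 'm \<Rightarrow> 'm \<Rightarrow> 'm \<Rightarrow> bool" where
  "direct_sum C X Y P i j p q \<longleftrightarrow> is_product C X Y P p q \<and> is_coproduct C X Y P i j \<and>
     cmp C p i = idt C X \<and> cmp C q j = idt C Y \<and>
     zero_arrow C X Y (cmp C q i) \<and> zero_arrow C Y X (cmp C p j)"

text \<open>Subcategories are full, so they are given by their sets of objects.\<close>

definition subcategory :: "('o, 'm, 'z) cat_scheme \<Rightarrow> 'o set \<Rightarrow> bool" where
  "subcategory C U \<longleftrightarrow> U \<subseteq> obj C \<and>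
     (\<forall>X Y. X \<in> U \<and> isomorphic C X Y \<longrightarrow> Y \<in> U) \<and>
     (\<forall>Z. zero_object C Z \<longrightarrow> Z \<in> U) \<and>
     (\<forall>X Y P i j p q. X \<in> U \<and> Y \<in> U \<and> direct_sum C X Y P i j p q \<longrightarrow> P \<in> U)"


section \<open>Abelian categories\<close>

record ('o, 'm) addcat = "('o, 'm) cat" +
  madd :: "'m \<Rightarrow> 'm \<Rightarrow> 'm"
  mzero :: "'o \<Rightarrow> 'o \<Rightarrow> 'm"

definition hom_group :: "('o, 'm, 'z) addcat_scheme \<Rightarrow> 'o \<Rightarrow> 'o \<Rightarrow> 'm monoid" where
  "hom_group A X Y = \<lparr>carrier = mor A X Y, mult = madd A, one = mzero A X Y\<rparr>"

definition is_kernel ::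
    "('o, 'm, 'z) addcat_scheme \<Rightarrow> 'o \<Rightarrow> 'o \<Rightarrow> 'm \<Rightarrow> 'o \<Rightarrow> 'm \<Rightarrow> bool" where
  "is_kernel A X Y f K k \<longleftrightarrow> f \<in> mor A X Y \<and> k \<in> mor A K X \<and> cmp A f k = mzero A K Y \<and>
     (\<forall>T. \<forall>t \<in> mor A T X. cmp A f t = mzero A T Y \<longrightarrow>
        (\<exists>!u. u \<in> mor A T K \<and> cmp A k u = t))"

definition is_cokernel ::
    "('o, 'm, 'z) addcat_scheme \<Rightarrow> 'o \<Rightarrow> 'o \<Rightarrow> 'm \<Rightarrow> 'o \<Rightarrow> 'm \<Rightarrow> bool" where
  "is_cokernel A X Y f Q c \<longleftrightarrow> f \<in> mor A X Y \<and> c \<in> mor A Y Q \<and> cmp A c f = mzero A X Q \<and>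
     (\<forall>T. \<forall>t \<in> mor A Y T. cmp A t f = mzero A X T \<longrightarrow>
        (\<exists>!u. u \<in> mor A Q T \<and> cmp A u c = t))"

definition monic :: "('o, 'm, 'z) cat_scheme \<Rightarrow> 'o \<Rightarrow> 'o \<Rightarrow> 'm \<Rightarrow> bool" where
  "monic C X Y f \<longleftrightarrow> f \<in> mor C X Y \<and>
     (\<forall>T. \<forall>s \<in> mor C T X. \<forall>t \<in> mor C T X. cmp C f s = cmp C f t \<longrightarrow> s = t)"

definition epic :: "('o, 'm, 'z) cat_scheme \<Rightarrow> 'o \<Rightarrow> 'o \<Rightarrow> 'm \<Rightarrow> bool" where
  "epic C X Y f \<longleftrightarrow> f \<in> mor C X Y \<and>
     (\<forall>T. \<forall>s \<in> mor C Y T. \<forall>t \<in> mor C Y T. cmp C s f = cmp C t f \<longrightarrow> s = t)"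

locale abelian_category = category A
  for A :: "('o, 'm, 'z) addcat_scheme" +
  assumes hom_group: "X \<in> obj A \<Longrightarrow> Y \<in> obj A \<Longrightarrow> comm_group (hom_group A X Y)"
    and cmp_add_right: "f \<in> mor A X Y \<Longrightarrow> f' \<in> mor A X Y \<Longrightarrow> g \<in> mor A Y Z \<Longrightarrow>
          cmp A g (madd A f f') = madd A (cmp A g f) (cmp A g f')"
    and cmp_add_left: "f \<in> mor A X Y \<Longrightarrow> g \<in> mor A Y Z \<Longrightarrow> g' \<in> mor A Y Z \<Longrightarrow>
          cmp A (madd A g g') f = madd A (cmp A g f) (cmp A g' f)"
    and ex_zero: "\<exists>Z. zero_object A Z"
    and ex_direct_sum: "X \<in> obj A \<Longrightarrow> Y \<in> obj A \<Longrightarrow> \<exists>P i j p q. direct_sum A X Y P i j p q"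
    and ex_kernel: "f \<in> mor A X Y \<Longrightarrow> \<exists>K k. is_kernel A X Y f K k"
    and ex_cokernel: "f \<in> mor A X Y \<Longrightarrow> \<exists>Q c. is_cokernel A X Y f Q c"
    and monic_is_kernel: "monic A X Y f \<Longrightarrow> \<exists>Z g. is_kernel A Y Z g X f"
    and epic_is_cokernel: "epic A X Y f \<Longrightarrow> \<exists>W g. is_cokernel A W X g Y f"

definition short_exact :: "('o, 'm, 'z) addcat_scheme \<Rightarrow> 'o \<Rightarrow> 'o \<Rightarrow> 'o \<Rightarrow> bool" where
  "short_exact A X Y Z \<longleftrightarrow> (\<exists>f g. is_kernel A Y Z g X f \<and> is_cokernel A X Y f Z g)"

definition closed_under_subobjects :: "('o, 'm, 'z) addcat_scheme \<Rightarrow> 'o set \<Rightarrow> bool" where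
  "closed_under_subobjects A U \<longleftrightarrow> (\<forall>X Y f. monic A X Y f \<and> Y \<in> U \<longrightarrow> X \<in> U)"

definition closed_under_quotients :: "('o, 'm, 'z) addcat_scheme \<Rightarrow> 'o set \<Rightarrow> bool" where
  "closed_under_quotients A U \<longleftrightarrow> (\<forall>X Y f. epic A X Y f \<and> X \<in> U \<longrightarrow> Y \<in> U)"

definition closed_under_extensions :: "('o, 'm, 'z) addcat_scheme \<Rightarrow> 'o set \<Rightarrow> bool" where
  "closed_under_extensions A U \<longleftrightarrow>
     (\<forall>X Y Z. short_exact A X Y Z \<and> X \<in> U \<and> Z \<in> U \<longrightarrow> Y \<in> U)"

definition torsionfree_class :: "('o, 'm, 'z) addcat_scheme \<Rightarrow> 'o set \<Rightarrow> bool" where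
  "torsionfree_class A U \<longleftrightarrow>
     subcategory A U \<and> closed_under_subobjects A U \<and> closed_under_extensions A U"

definition serre_subcategory :: "('o, 'm, 'z) addcat_scheme \<Rightarrow> 'o set \<Rightarrow> bool" where
  "serre_subcategory A U \<longleftrightarrow> subcategory A U \<and> closed_under_subobjects A U \<and>
     closed_under_quotients A U \<and> closed_under_extensions A U"


section \<open>Localization of a category\<close>

text \<open>
  The localization \<open>C[W\<^sup>-\<^sup>1]\<close> in the sense of Gabriel and Zisman: its arrows are formal composites of
  arrows of \<open>C\<close> and of formal inverses of arrows in \<open>W\<close>, modulo the congruence generated by the
  category axioms, functoriality of \<open>Fwd\<close>, and the inverse laws. The term \<open>Bwd X Y w\<close> is the formal
  inverse of \<open>w : X \<rightarrow> Y\<close>, so it goes from \<open>Y\<close> to \<open>X\<close>. Well-typed terms \<open>X \<rightarrow> Y\<close> are the \<open>t\<close> with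
  \<open>loc_eq C W X Y t t\<close>. The universal property is \<open>loc_cat_universal\<close> below.
\<close>

datatype ('o, 'm) zigzag =
    Fwd 'o 'o 'm
  | Bwd 'o 'o 'm
  | After "('o, 'm) zigzag" "('o, 'm) zigzag"

inductive loc_eq ::
    "('o, 'm, 'z) cat_scheme \<Rightarrow> ('o \<Rightarrow> 'o \<Rightarrow> 'm \<Rightarrow> bool) \<Rightarrow>
     'o \<Rightarrow> 'o \<Rightarrow> ('o, 'm) zigzag \<Rightarrow> ('o, 'm) zigzag \<Rightarrow> bool"
  for C :: "('o, 'm, 'z) cat_scheme" and W :: "'o \<Rightarrow> 'o \<Rightarrow> 'm \<Rightarrow> bool"
where
  Fwd: "f \<in> mor C X Y \<Longrightarrow> loc_eq C W X Y (Fwd X Y f) (Fwd X Y f)"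
| Bwd: "w \<in> mor C X Y \<Longrightarrow> W X Y w \<Longrightarrow> loc_eq C W Y X (Bwd X Y w) (Bwd X Y w)"
| After: "loc_eq C W Y Z t t' \<Longrightarrow> loc_eq C W X Y u u' \<Longrightarrow>
    loc_eq C W X Z (After t u) (After t' u')"
| sym: "loc_eq C W X Y t u \<Longrightarrow> loc_eq C W X Y u t"
| trans: "loc_eq C W X Y t u \<Longrightarrow> loc_eq C W X Y u v \<Longrightarrow> loc_eq C W X Y t v"
| assoc: "loc_eq C W Y Z t t \<Longrightarrow> loc_eq C W X Y u u \<Longrightarrow> loc_eq C W V X v v \<Longrightarrow>
    loc_eq C W V Z (After t (After u v)) (After (After t u) v)"
| unit_left: "loc_eq C W X Y t t \<Longrightarrow> loc_eq C W X Y (After (Fwd Y Y (idt C Y)) t) t"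
| unit_right: "loc_eq C W X Y t t \<Longrightarrow> loc_eq C W X Y (After t (Fwd X X (idt C X))) t"
| cmp: "f \<in> mor C X Y \<Longrightarrow> g \<in> mor C Y Z \<Longrightarrow>
    loc_eq C W X Z (Fwd X Z (cmp C g f)) (After (Fwd Y Z g) (Fwd X Y f))"
| inv_left: "w \<in> mor C X Y \<Longrightarrow> W X Y w \<Longrightarrow>
    loc_eq C W X X (After (Bwd X Y w) (Fwd X Y w)) (Fwd X X (idt C X))"
| inv_right: "w \<in> mor C X Y \<Longrightarrow> W X Y w \<Longrightarrow>
    loc_eq C W Y Y (After (Fwd X Y w) (Bwd X Y w)) (Fwd Y Y (idt C Y))"

definition loc_cat ::
    "('o, 'm, 'z) cat_scheme \<Rightarrow> ('o \<Rightarrow> 'o \<Rightarrow> 'm \<Rightarrow> bool) \<Rightarrow> ('o, ('o, 'm) zigzag set) cat" where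
  "loc_cat C W = \<lparr>
     obj = obj C,
     mor = (\<lambda>X Y. {Collect (loc_eq C W X Y t) | t. loc_eq C W X Y t t}),
     idt = (\<lambda>X. Collect (loc_eq C W X X (Fwd X X (idt C X)))),
     cmp = (\<lambda>G F. {r. \<exists>X Z. \<exists>t \<in> G. \<exists>u \<in> F. loc_eq C W X Z (After t u) r})\<rparr>"

definition loc_arrow ::
    "('o, 'm, 'z) cat_scheme \<Rightarrow> ('o \<Rightarrow> 'o \<Rightarrow> 'm \<Rightarrow> bool) \<Rightarrow> 'o \<Rightarrow> 'o \<Rightarrow> 'm \<Rightarrow> ('o, 'm) zigzag set" where
  "loc_arrow C W X Y f = Collect (loc_eq C W X Y (Fwd X Y f))"


text \<open>\<open>G\<close> acts on objects; \<open>H X Y\<close> acts on arrows from \<open>X\<close> to \<open>Y\<close>.\<close>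

definition is_functor ::
    "('o, 'm, 'z) cat_scheme \<Rightarrow> ('p, 'n, 'y) cat_scheme \<Rightarrow>
     ('o \<Rightarrow> 'p) \<Rightarrow> ('o \<Rightarrow> 'o \<Rightarrow> 'm \<Rightarrow> 'n) \<Rightarrow> bool" where
  "is_functor C D G H \<longleftrightarrow>
     (\<forall>X \<in> obj C. G X \<in> obj D \<and> H X X (idt C X) = idt D (G X)) \<and>
     (\<forall>X Y. \<forall>f \<in> mor C X Y. H X Y f \<in> mor D (G X) (G Y)) \<and>
     (\<forall>X Y Z. \<forall>f \<in> mor C X Y. \<forall>g \<in> mor C Y Z. H X Z (cmp C g f) = cmp D (H Y Z g) (H X Y f))"

primrec zsrc :: "('o, 'm) zigzag \<Rightarrow> 'o" where
  "zsrc (Fwd X Y f) = X"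
| "zsrc (Bwd X Y f) = Y"
| "zsrc (After t u) = zsrc u"

primrec ztgt :: "('o, 'm) zigzag \<Rightarrow> 'o" where
  "ztgt (Fwd X Y f) = Y"
| "ztgt (Bwd X Y f) = X"
| "ztgt (After t u) = ztgt t"

context category
begin

primrec zwf :: "('o \<Rightarrow> 'o \<Rightarrow> 'm \<Rightarrow> bool) \<Rightarrow> ('o, 'm) zigzag \<Rightarrow> bool" where
  "zwf W (Fwd X Y f) \<longleftrightarrow> f \<in> mor C X Y"
| "zwf W (Bwd X Y f) \<longleftrightarrow> f \<in> mor C X Y \<and> W X Y f"
| "zwf W (After t u) \<longleftrightarrow> zwf W t \<and> zwf W u \<and> zsrc t = ztgt u"

lemma loc_eq_zwf: "zwf W t \<Longrightarrow> loc_eq C W (zsrc t) (ztgt t) t t"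
  by (induction t) (auto intro: loc_eq.Fwd loc_eq.Bwd loc_eq.After)

lemma zwf_obj: "zwf W t \<Longrightarrow> zsrc t \<in> obj C \<and> ztgt t \<in> obj C"
  by (induction t) (auto dest: mor_obj)

lemma loc_eq_typed:
  "loc_eq C W X Y t u \<Longrightarrow> zwf W t \<and> zwf W u \<and>
     zsrc t = X \<and> zsrc u = X \<and> ztgt t = Y \<and> ztgt u = Y"
proof (induction rule: loc_eq.induct)
  case (unit_left X Y t) then show ?case using zwf_obj idt_mor by auto
next
  case (unit_right X Y t) then show ?case using zwf_obj idt_mor by auto
qed (auto simp: cmp_mor idt_mor mor_obj dest: mor_obj intro!: idt_mor)

lemma loc_mor_cases:
  assumes "a \<in> mor (loc_cat C W) X Y"
  obtains t where "a = Collect (loc_eq C W X Y t)" "loc_eq C W X Y t t"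
  using assms by (auto simp: loc_cat_def)

lemma loc_mor_in: "loc_eq C W X Y t t \<Longrightarrow> Collect (loc_eq C W X Y t) \<in> mor (loc_cat C W) X Y"
  by (auto simp: loc_cat_def)

lemma loc_class_eq:
  "loc_eq C W X Y t u \<Longrightarrow> Collect (loc_eq C W X Y t) = Collect (loc_eq C W X Y u)"
  by (intro Collect_cong iffI) (erule loc_eq.trans[OF loc_eq.sym], assumption, erule loc_eq.trans)

lemma loc_cmp:
  assumes "loc_eq C W X Y u u" "loc_eq C W Y Z t t"
  shows "cmp (loc_cat C W) (Collect (loc_eq C W Y Z t)) (Collect (loc_eq C W X Y u))
       = Collect (loc_eq C W X Z (After t u))"
proof -
  have "loc_eq C W X Z (After t u) r"
    if "loc_eq C W Y Z t t'" "loc_eq C W X Y u u'" "loc_eq C W V V' (After t' u') r" for t' u' V V' r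
  proof -
    have "V = X" "V' = Z"
      using loc_eq_typed[OF that(1)] loc_eq_typed[OF that(2)] loc_eq_typed[OF that(3)] by auto
    then show ?thesis using that loc_eq.trans[OF loc_eq.After[OF that(1,2)]] by simp
  qed
  then show ?thesis using assms by (auto simp: loc_cat_def)
qed

lemma loc_idt: "idt (loc_cat C W) X = Collect (loc_eq C W X X (Fwd X X (idt C X)))"
  by (simp add: loc_cat_def)

lemma category_loc_cat: "category (loc_cat C W)"
proof
  fix X Y f assume f: "f \<in> mor (loc_cat C W) X Y"
  show "X \<in> obj (loc_cat C W) \<and> Y \<in> obj (loc_cat C W)"
    using f loc_eq_typed zwf_obj by (fastforce simp: loc_cat_def)
  from f obtain t where t: "f = Collect (loc_eq C W X Y t)" "loc_eq C W X Y t t"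
    by (rule loc_mor_cases)
  have o: "X \<in> obj C" "Y \<in> obj C" using loc_eq_typed[OF t(2)] zwf_obj by auto
  show "cmp (loc_cat C W) (idt (loc_cat C W) Y) f = f"
    unfolding t loc_idt using t o
    by (subst loc_cmp) (auto intro!: loc_class_eq loc_eq.Fwd loc_eq.unit_left idt_mor)
  show "cmp (loc_cat C W) f (idt (loc_cat C W) X) = f"
    unfolding t loc_idt using t o
    by (subst loc_cmp) (auto intro!: loc_class_eq loc_eq.Fwd loc_eq.unit_right idt_mor)
  fix Z g assume g: "g \<in> mor (loc_cat C W) Y Z"
  from g obtain u where u: "g = Collect (loc_eq C W Y Z u)" "loc_eq C W Y Z u u"
    by (rule loc_mor_cases)
  show "cmp (loc_cat C W) g f \<in> mor (loc_cat C W) X Z"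
    unfolding t u using t u by (subst loc_cmp) (auto intro!: loc_mor_in loc_eq.After)
  fix V h assume h: "h \<in> mor (loc_cat C W) Z V"
  from h obtain v where v: "h = Collect (loc_eq C W Z V v)" "loc_eq C W Z V v v"
    by (rule loc_mor_cases)
  show "cmp (loc_cat C W) h (cmp (loc_cat C W) g f) = cmp (loc_cat C W) (cmp (loc_cat C W) h g) f"
    unfolding t u v using t u v
    by (simp add: loc_cmp loc_eq.After loc_class_eq[OF loc_eq.assoc])
next
  fix X assume "X \<in> obj (loc_cat C W)"
  then show "idt (loc_cat C W) X \<in> mor (loc_cat C W) X X"
    by (auto simp: loc_idt loc_cat_def intro!: exI loc_eq.Fwd idt_mor)
qed

lemma loc_cat_universal:
  assumes D: "category D"
    and F: "is_functor C D G H"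
    and inv: "\<And>X Y w. w \<in> mor C X Y \<Longrightarrow> W X Y w \<Longrightarrow> iso_arrow D (G X) (G Y) (H X Y w)"
  shows "\<exists>K. is_functor (loc_cat C W) D G K \<and>
           (\<forall>X Y. \<forall>f \<in> mor C X Y. K X Y (loc_arrow C W X Y f) = H X Y f) \<and>
           (\<forall>K'. is_functor (loc_cat C W) D G K' \<and>
              (\<forall>X Y. \<forall>f \<in> mor C X Y. K' X Y (loc_arrow C W X Y f) = H X Y f) \<longrightarrow>
              (\<forall>X Y. \<forall>a \<in> mor (loc_cat C W) X Y. K' X Y a = K X Y a))"
proof -
  interpret D: category D by (rule D)
  note Fd = F[unfolded is_functor_def]
  define iv where "iv = (\<lambda>X Y w. SOME g. g \<in> mor D (G Y) (G X) \<and>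
    cmp D g (H X Y w) = idt D (G X) \<and> cmp D (H X Y w) g = idt D (G Y))"
  have iv: "iv X Y w \<in> mor D (G Y) (G X) \<and>
    cmp D (iv X Y w) (H X Y w) = idt D (G X) \<and> cmp D (H X Y w) (iv X Y w) = idt D (G Y)"
    if "w \<in> mor C X Y" "W X Y w" for X Y w
    unfolding iv_def using inv[OF that] by - (rule someI_ex, auto simp: iso_arrow_def)
  define ev where "ev = rec_zigzag H iv (\<lambda>_ _ a b. cmp D a b)"
  have ev [simp]: "ev (Fwd X Y f) = H X Y f" "ev (Bwd X Y f) = iv X Y f"
    "ev (After t u) = cmp D (ev t) (ev u)" for X Y f t u
    by (simp_all add: ev_def)
  have ev_eq: "ev t = ev u \<and> ev t \<in> mor D (G X) (G Y) \<and> X \<in> obj C \<and> Y \<in> obj C"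
    if "loc_eq C W X Y t u" for X Y t u
    using that
  proof (induction rule: loc_eq.induct)
    case (unit_left X Y t)
    then show ?case using Fd D.idt_left D.idt_mor D.cmp_mor by auto
  next
    case (unit_right X Y t)
    then show ?case using Fd D.idt_right D.idt_mor D.cmp_mor by auto
  next
    case (assoc Y Z t X u V v)
    then show ?case using D.cmp_assoc D.cmp_mor by auto
  next
    case (inv_left w X Y)
    then show ?case using iv[OF inv_left] Fd mor_obj by (auto intro!: D.idt_mor)
  next
    case (inv_right w X Y)
    then show ?case using iv[OF inv_right] Fd mor_obj by (auto intro!: D.idt_mor)
  next
    case (cmp f X Y g Z)
    then have "H X Y f \<in> mor D (G X) (G Y)" "H Y Z g \<in> mor D (G Y) (G Z)"
      "H X Z (cmp C g f) = cmp D (H Y Z g) (H X Y f)" "X \<in> obj C" "Z \<in> obj C"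
      using Fd mor_obj by blast+
    then show ?case by (simp add: D.cmp_mor)
  next
    case (Bwd w X Y)
    then show ?case using iv mor_obj by auto
  next
    case (Fwd f X Y)
    then show ?case using Fd mor_obj by auto
  next
    case (After Y Z t t' X u u')
    then show ?case by (auto simp: D.cmp_mor)
  qed auto
  define K where "K = (\<lambda>(X::'o) (Y::'o) a. the_elem (ev ` a))"
  have K: "K X Y (Collect (loc_eq C W X Y t)) = ev t" if "loc_eq C W X Y t t" for X Y t
  proof -
    have "ev ` Collect (loc_eq C W X Y t) = {ev t}" using that by (auto dest: ev_eq)
    then show ?thesis by (simp add: K_def)
  qed
  have Kf: "is_functor (loc_cat C W) D G K"
    unfolding is_functor_def
  proof (intro conjI ballI allI)
    fix X assume "X \<in> obj (loc_cat C W)"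
    then have X: "X \<in> obj C" by (simp add: loc_cat_def)
    then show "G X \<in> obj D" using Fd by auto
    show "K X X (idt (loc_cat C W) X) = idt D (G X)"
      using X Fd by (simp add: loc_idt K loc_eq.Fwd idt_mor)
  next
    fix X Y a assume "a \<in> mor (loc_cat C W) X Y"
    then obtain t where t: "a = Collect (loc_eq C W X Y t)" "loc_eq C W X Y t t"
      by (rule loc_mor_cases)
    show "K X Y a \<in> mor D (G X) (G Y)"
      unfolding t(1) K[OF t(2)] using ev_eq[OF t(2)] by blast
    fix Z b assume "b \<in> mor (loc_cat C W) Y Z"
    then obtain u where u: "b = Collect (loc_eq C W Y Z u)" "loc_eq C W Y Z u u"
      by (rule loc_mor_cases)
    show "K X Z (cmp (loc_cat C W) b a) = cmp D (K Y Z b) (K X Y a)"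
      unfolding t(1) u(1) loc_cmp[OF t(2) u(2)] K[OF t(2)] K[OF u(2)]
        K[OF loc_eq.After[OF u(2) t(2)]] by simp
  qed
  have KQ: "K X Y (loc_arrow C W X Y f) = H X Y f" if "f \<in> mor C X Y" for X Y f
    using that by (simp add: loc_arrow_def K loc_eq.Fwd)
  have "K' X Y a = K X Y a"
    if K': "is_functor (loc_cat C W) D G K'"
      "\<forall>X Y. \<forall>f \<in> mor C X Y. K' X Y (loc_arrow C W X Y f) = H X Y f"
      and a: "a \<in> mor (loc_cat C W) X Y" for K' X Y a
  proof -
    note K'd = K'(1)[unfolded is_functor_def]
    have *: "K' (zsrc t) (ztgt t) (Collect (loc_eq C W (zsrc t) (ztgt t) t)) = ev t" if "zwf W t" for t
      using that
    proof (induction t)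
      case (Fwd A B f)
      then show ?case using K'(2) by (auto simp: loc_arrow_def)
    next
      case (Bwd A B w)
      then have w: "w \<in> mor C A B" "W A B w" by auto
      let ?b = "Collect (loc_eq C W B A (Bwd A B w))" and ?f = "loc_arrow C W A B w"
      have eqs: "loc_eq C W A B (Fwd A B w) (Fwd A B w)" "loc_eq C W B A (Bwd A B w) (Bwd A B w)"
        using w by (auto intro: loc_eq.Fwd loc_eq.Bwd)
      have inv: "loc_eq C W B B (After (Fwd A B w) (Bwd A B w)) (Fwd B B (idt C B))"
        using w by (rule loc_eq.inv_right)
      have m: "?b \<in> mor (loc_cat C W) B A" "?f \<in> mor (loc_cat C W) A B"
        using eqs by (auto simp: loc_arrow_def intro!: loc_mor_in)
      have "cmp (loc_cat C W) ?f ?b = idt (loc_cat C W) B"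
        unfolding loc_arrow_def loc_idt
        using eqs by (simp add: loc_cmp loc_class_eq[OF inv])
      moreover have "B \<in> obj (loc_cat C W)" using mor_obj[OF w(1)] by (simp add: loc_cat_def)
      ultimately have 1: "cmp D (H A B w) (K' B A ?b) = idt D (G B)"
        using K'd m K'(2) w by metis
      have mb: "K' B A ?b \<in> mor D (G B) (G A)" using K'd m by blast
      have mw: "H A B w \<in> mor D (G A) (G B)" using Fd w by blast
      have mi: "iv A B w \<in> mor D (G B) (G A)" using iv[OF w] by blast
      have "K' B A ?b = cmp D (cmp D (iv A B w) (H A B w)) (K' B A ?b)"
        using iv[OF w] mb by (simp add: D.idt_left)
      also have "\<dots> = iv A B w"
        using D.cmp_assoc[OF mb mw mi] 1 D.idt_right[OF mi] by simp
      finally show ?case by simp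
    next
      case (After t u)
      then have wf: "zwf W t" "zwf W u" "zsrc t = ztgt u" by auto
      note e = loc_eq_zwf[OF wf(1)] loc_eq_zwf[OF wf(2)]
      have m: "Collect (loc_eq C W (zsrc t) (ztgt t) t) \<in> mor (loc_cat C W) (ztgt u) (ztgt t)"
        "Collect (loc_eq C W (zsrc u) (ztgt u) u) \<in> mor (loc_cat C W) (zsrc u) (ztgt u)"
        using e wf(3) by (auto intro!: loc_mor_in)
      have "Collect (loc_eq C W (zsrc u) (ztgt t) (After t u)) =
          cmp (loc_cat C W) (Collect (loc_eq C W (zsrc t) (ztgt t) t))
            (Collect (loc_eq C W (zsrc u) (ztgt u) u))"
        using e wf(3) by (simp add: loc_cmp)
      then have "K' (zsrc u) (ztgt t) (Collect (loc_eq C W (zsrc u) (ztgt t) (After t u))) =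
          cmp D (K' (ztgt u) (ztgt t) (Collect (loc_eq C W (zsrc t) (ztgt t) t)))
            (K' (zsrc u) (ztgt u) (Collect (loc_eq C W (zsrc u) (ztgt u) u)))"
        using K'd m by simp
      then show ?case using After.IH wf by simp
    qed
    from a obtain t where t: "a = Collect (loc_eq C W X Y t)" "loc_eq C W X Y t t"
      by (rule loc_mor_cases)
    then show ?thesis using *[of t] loc_eq_typed[OF t(2)] by (simp add: K)
  qed
  then show ?thesis using Kf KQ by blast
qed

end


section \<open>The bounded derived category\<close>

record ('o, 'm) cochain =
  deg :: "int \<Rightarrow> 'o"
  dif :: "int \<Rightarrow> 'm"   (* dif X n : deg X n \<rightarrow> deg X (n + 1) *)

definition bounded_complex :: "('o, 'm, 'z) addcat_scheme \<Rightarrow> ('o, 'm) cochain \<Rightarrow> bool" where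
  "bounded_complex A X \<longleftrightarrow>
     (\<forall>n. deg X n \<in> obj A) \<and>
     (\<forall>n. dif X n \<in> mor A (deg X n) (deg X (n + 1))) \<and>
     (\<forall>n. cmp A (dif X (n + 1)) (dif X n) = mzero A (deg X n) (deg X (n + 2))) \<and>
     (\<exists>N. \<forall>n. \<bar>n\<bar> > N \<longrightarrow> zero_object A (deg X n))"

definition chain_map ::
    "('o, 'm, 'z) addcat_scheme \<Rightarrow> ('o, 'm) cochain \<Rightarrow> ('o, 'm) cochain \<Rightarrow> (int \<Rightarrow> 'm) \<Rightarrow> bool" where
  "chain_map A X Y f \<longleftrightarrow>
     (\<forall>n. f n \<in> mor A (deg X n) (deg Y n)) \<and>
     (\<forall>n. cmp A (f (n + 1)) (dif X n) = cmp A (dif Y n) (f n))"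

definition Cb :: "('o, 'm, 'z) addcat_scheme \<Rightarrow> (('o, 'm) cochain, int \<Rightarrow> 'm) cat" where
  "Cb A = \<lparr>
     obj = {X. bounded_complex A X},
     mor = (\<lambda>X Y. {f. bounded_complex A X \<and> bounded_complex A Y \<and> chain_map A X Y f}),
     idt = (\<lambda>X n. idt A (deg X n)),
     cmp = (\<lambda>g f n. cmp A (g n) (f n))\<rparr>"

text \<open>
  \<open>H\<close> is the cokernel, via \<open>c\<close>, of the arrow \<open>deg X (n - 1) \<rightarrow> K\<close> induced by the differential, where
  \<open>k\<close> is the kernel of \<open>dif X n\<close>.
\<close>

definition cohomology_data ::
    "('o, 'm, 'z) addcat_scheme \<Rightarrow> ('o, 'm) cochain \<Rightarrow> int \<Rightarrow> 'o \<Rightarrow> 'm \<Rightarrow> 'o \<Rightarrow> 'm \<Rightarrow> bool" where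
  "cohomology_data A X n K k H c \<longleftrightarrow>
     is_kernel A (deg X n) (deg X (n + 1)) (dif X n) K k \<and>
     (\<exists>e \<in> mor A (deg X (n - 1)) K.
        cmp A k e = dif X (n - 1) \<and> is_cokernel A (deg X (n - 1)) K e H c)"

definition is_cohomology ::
    "('o, 'm, 'z) addcat_scheme \<Rightarrow> ('o, 'm) cochain \<Rightarrow> int \<Rightarrow> 'o \<Rightarrow> bool" where
  "is_cohomology A X n H \<longleftrightarrow> (\<exists>K k c. cohomology_data A X n K k H c)"

definition quasi_iso ::
    "('o, 'm, 'z) addcat_scheme \<Rightarrow> ('o, 'm) cochain \<Rightarrow> ('o, 'm) cochain \<Rightarrow> (int \<Rightarrow> 'm) \<Rightarrow> bool" where
  "quasi_iso A X Y f \<longleftrightarrow> f \<in> mor (Cb A) X Y \<and>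
     (\<forall>n K k H c K' k' H' c' u v.
        cohomology_data A X n K k H c \<and> cohomology_data A Y n K' k' H' c' \<and>
        u \<in> mor A K K' \<and> cmp A k' u = cmp A (f n) k \<and>
        v \<in> mor A H H' \<and> cmp A v c = cmp A c' u \<longrightarrow> iso_arrow A H H' v)"

text \<open>
  Inverting the quasi-isomorphisms already in the category of bounded complexes identifies homotopic
  maps, so passing through the homotopy category first would give the same category.
\<close>

definition Db ::
    "('o, 'm, 'z) addcat_scheme \<Rightarrow>
     (('o, 'm) cochain, (('o, 'm) cochain, int \<Rightarrow> 'm) zigzag set) cat" where
  "Db A = loc_cat (Cb A) (quasi_iso A)"

abbreviation Db_arrow ::
    "('o, 'm, 'z) addcat_scheme \<Rightarrow> ('o, 'm) cochain \<Rightarrow> ('o, 'm) cochain \<Rightarrow> (int \<Rightarrow> 'm) \<Rightarrow>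
     (('o, 'm) cochain, int \<Rightarrow> 'm) zigzag set" where
  "Db_arrow A \<equiv> loc_arrow (Cb A) (quasi_iso A)"

definition shift :: "('o, 'm, 'z) addcat_scheme \<Rightarrow> ('o, 'm) cochain \<Rightarrow> ('o, 'm) cochain" where
  "shift A X = \<lparr>
     deg = (\<lambda>n. deg X (n + 1)),
     dif = (\<lambda>n. inv\<^bsub>hom_group A (deg X (n + 1)) (deg X (n + 2))\<^esub> dif X (n + 1))\<rparr>"

definition shift_map :: "(int \<Rightarrow> 'm) \<Rightarrow> int \<Rightarrow> 'm" where
  "shift_map f = (\<lambda>n. f (n + 1))"

text \<open>The action of \<open>shift\<close> on an arrow \<open>a : X \<rightarrow> Y\<close> of the derived category.\<close>

definition Db_shift ::
    "('o, 'm, 'z) addcat_scheme \<Rightarrow> ('o, 'm) cochain \<Rightarrow> ('o, 'm) cochain \<Rightarrow>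
     (('o, 'm) cochain, int \<Rightarrow> 'm) zigzag set \<Rightarrow> (('o, 'm) cochain, int \<Rightarrow> 'm) zigzag set" where
  "Db_shift A X Y a = {r. \<exists>t \<in> a. loc_eq (Cb A) (quasi_iso A) (shift A X) (shift A Y)
                              (map_zigzag (shift A) shift_map t) r}"

text \<open>
  \<open>X \<rightarrow> Y \<rightarrow> Z \<rightarrow> X[1]\<close> is the mapping cone sequence of \<open>f\<close>: degreewise \<open>Z = X[1] \<oplus> Y\<close>, with
  \<open>g\<close> the inclusion, \<open>h\<close> the projection, and differential
  \<open>(x, y) \<mapsto> (- d x, f x + d y)\<close>.
\<close>

definition cone_triangle ::
    "('o, 'm, 'z) addcat_scheme \<Rightarrow> ('o, 'm) cochain \<Rightarrow> ('o, 'm) cochain \<Rightarrow> ('o, 'm) cochain \<Rightarrow>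
     (int \<Rightarrow> 'm) \<Rightarrow> (int \<Rightarrow> 'm) \<Rightarrow> (int \<Rightarrow> 'm) \<Rightarrow> bool" where
  "cone_triangle A X Y Z f g h \<longleftrightarrow>
     f \<in> mor (Cb A) X Y \<and> g \<in> mor (Cb A) Y Z \<and> h \<in> mor (Cb A) Z (shift A X) \<and>
     (\<exists>i q. \<forall>n.
        direct_sum A (deg (shift A X) n) (deg Y n) (deg Z n) (i n) (g n) (h n) (q n) \<and>
        dif Z n =
          madd A (cmp A (i (n + 1)) (cmp A (dif (shift A X) n) (h n)))
                 (madd A (cmp A (g (n + 1)) (cmp A (f (n + 1)) (h n)))
                         (cmp A (g (n + 1)) (cmp A (dif Y n) (q n)))))"

definition triangle ::
    "('o, 'm, 'z) addcat_scheme \<Rightarrow> ('o, 'm) cochain \<Rightarrow> ('o, 'm) cochain \<Rightarrow> ('o, 'm) cochain \<Rightarrow>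
     (('o, 'm) cochain, int \<Rightarrow> 'm) zigzag set \<Rightarrow> (('o, 'm) cochain, int \<Rightarrow> 'm) zigzag set \<Rightarrow>
     (('o, 'm) cochain, int \<Rightarrow> 'm) zigzag set \<Rightarrow> bool" where
  "triangle A X Y Z u v w \<longleftrightarrow>
     u \<in> mor (Db A) X Y \<and> v \<in> mor (Db A) Y Z \<and> w \<in> mor (Db A) Z (shift A X) \<and>
     (\<exists>X' Y' Z' f g h a b c.
        cone_triangle A X' Y' Z' f g h \<and>
        iso_arrow (Db A) X' X a \<and> iso_arrow (Db A) Y' Y b \<and> iso_arrow (Db A) Z' Z c \<and>
        cmp (Db A) b (Db_arrow A X' Y' f) = cmp (Db A) u a \<and>
        cmp (Db A) c (Db_arrow A Y' Z' g) = cmp (Db A) v b \<and>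
        cmp (Db A) (Db_shift A X' X a) (Db_arrow A Z' (shift A X') h) = cmp (Db A) w c)"

text \<open>
  A subcategory \<open>U\<close> of \<open>A\<close>, seen in the derived category: the complexes with cohomology concentrated
  in degree \<open>0\<close>, and \<open>H\<^sup>0\<close> in \<open>U\<close>.
\<close>

definition in_degree_0 :: "('o, 'm, 'z) addcat_scheme \<Rightarrow> 'o set \<Rightarrow> ('o, 'm) cochain set" where
  "in_degree_0 A U = {X \<in> obj (Db A).
     (\<forall>n. n \<noteq> 0 \<longrightarrow> (\<exists>Z. zero_object A Z \<and> is_cohomology A X n Z)) \<and>
     (\<exists>H \<in> U. is_cohomology A X 0 H)}"

definition shift_star ::
    "('o, 'm, 'z) addcat_scheme \<Rightarrow> 'o set \<Rightarrow> 'o set \<Rightarrow> ('o, 'm) cochain set" where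
  "shift_star A U V = {X \<in> obj (Db A).
     \<exists>B \<in> in_degree_0 A U. \<exists>B' \<in> in_degree_0 A V. \<exists>u v w. triangle A (shift A B) X B' u v w}"

definition intermediate_subcategory ::
    "('o, 'm, 'z) addcat_scheme \<Rightarrow> ('o, 'm) cochain set \<Rightarrow> bool" where
  "intermediate_subcategory A U \<longleftrightarrow>
     subcategory (Db A) U \<and>
     in_degree_0 A (obj A) \<subseteq> U \<and> U \<subseteq> shift_star A (obj A) (obj A) \<and>
     (\<forall>X Y Z u v w. triangle A X Y Z u v w \<and> X \<in> U \<and> Z \<in> U \<longrightarrow> Y \<in> U) \<and>
     (\<forall>X Y P i j p q. direct_sum (Db A) X Y P i j p q \<and> P \<in> U \<longrightarrow> X \<in> U \<and> Y \<in> U)"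


section \<open>Commutative monoids\<close>

text \<open>Monoids are written multiplicatively, following the library.\<close>

definition face :: "'a set \<Rightarrow> ('a, 'z) monoid_scheme \<Rightarrow> bool" where
  "face F M \<longleftrightarrow> submonoid F M \<and>
     (\<forall>a \<in> carrier M. \<forall>b \<in> carrier M. a \<otimes>\<^bsub>M\<^esub> b \<in> F \<longleftrightarrow> a \<in> F \<and> b \<in> F)"

definition face_hull :: "('a, 'z) monoid_scheme \<Rightarrow> 'a set \<Rightarrow> 'a set" where
  "face_hull M S = \<Inter> {F. face F M \<and> S \<subseteq> F}"

lemma face_carrier: "comm_monoid M \<Longrightarrow> face (carrier M) M"
  unfolding face_def submonoid_def
  by (auto dest: comm_monoid.axioms(1) simp: monoid.m_closed monoid.one_closed)

lemma face_face_hull: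
  assumes "comm_monoid M" "S \<subseteq> carrier M"
  shows "face (face_hull M S) M" and "S \<subseteq> face_hull M S"
    and "\<And>F. face F M \<Longrightarrow> S \<subseteq> F \<Longrightarrow> face_hull M S \<subseteq> F"
proof -
  have c: "face (carrier M) M" "S \<subseteq> carrier M"
    using assms by (auto intro: face_carrier)
  show "face (face_hull M S) M"
    unfolding face_def submonoid_def
  proof (intro conjI ballI allI impI)
    show "face_hull M S \<subseteq> carrier M" using c by (auto simp: face_hull_def)
    show "x \<otimes>\<^bsub>M\<^esub> y \<in> face_hull M S" if "x \<in> face_hull M S" "y \<in> face_hull M S" for x y
      using that by (auto simp: face_hull_def face_def submonoid.m_closed)
    show "\<one>\<^bsub>M\<^esub> \<in> face_hull M S"
      by (auto simp: face_hull_def face_def submonoid.one_closed)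
    show "a \<otimes>\<^bsub>M\<^esub> b \<in> face_hull M S \<longleftrightarrow> a \<in> face_hull M S \<and> b \<in> face_hull M S"
      if "a \<in> carrier M" "b \<in> carrier M" for a b
      using that by (auto simp: face_hull_def face_def)
  qed
qed (auto simp: face_hull_def)

definition submonoid_hull :: "('a, 'z) monoid_scheme \<Rightarrow> 'a set \<Rightarrow> 'a set" where
  "submonoid_hull M S = \<Inter> {H. submonoid H M \<and> S \<subseteq> H}"

text \<open>
  The localization of \<open>M\<close> at \<open>S\<close>, as fractions \<open>a / s\<close> with \<open>s\<close> in the submonoid generated by \<open>S\<close>;
  its universal property is \<open>mon_loc_universal\<close> below.
\<close>

definition frac_rel :: "('a, 'z) monoid_scheme \<Rightarrow> 'a set \<Rightarrow> (('a \<times> 'a) \<times> ('a \<times> 'a)) set" where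
  "frac_rel M S = {((a, s), (b, t)). a \<in> carrier M \<and> b \<in> carrier M \<and>
     s \<in> submonoid_hull M S \<and> t \<in> submonoid_hull M S \<and>
     (\<exists>u \<in> submonoid_hull M S. u \<otimes>\<^bsub>M\<^esub> (t \<otimes>\<^bsub>M\<^esub> a) = u \<otimes>\<^bsub>M\<^esub> (s \<otimes>\<^bsub>M\<^esub> b))}"

definition mon_loc :: "('a, 'z) monoid_scheme \<Rightarrow> 'a set \<Rightarrow> ('a \<times> 'a) set monoid" where
  "mon_loc M S = \<lparr>
     carrier = (carrier M \<times> submonoid_hull M S) // frac_rel M S,
     mult = (\<lambda>P Q. \<Union>(a, s) \<in> P. \<Union>(b, t) \<in> Q. frac_rel M S `` {(a \<otimes>\<^bsub>M\<^esub> b, s \<otimes>\<^bsub>M\<^esub> t)}),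
     one = frac_rel M S `` {(\<one>\<^bsub>M\<^esub>, \<one>\<^bsub>M\<^esub>)}\<rparr>"

definition mon_loc_map :: "('a, 'z) monoid_scheme \<Rightarrow> 'a set \<Rightarrow> 'a \<Rightarrow> ('a \<times> 'a) set" where
  "mon_loc_map M S a = frac_rel M S `` {(a, \<one>\<^bsub>M\<^esub>)}"


lemma submonoid_submonoid_hull:
  assumes "comm_monoid M" "S \<subseteq> carrier M"
  shows "submonoid (submonoid_hull M S) M" and "S \<subseteq> submonoid_hull M S"
proof -
  interpret comm_monoid M by fact
  have c: "submonoid (carrier M) M" by (simp add: submonoid_def)
  show "submonoid (submonoid_hull M S) M"
    unfolding submonoid_def
  proof (intro conjI allI impI)
    show "submonoid_hull M S \<subseteq> carrier M" using c assms(2) by (auto simp: submonoid_hull_def)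
  qed (auto simp: submonoid_hull_def submonoid.m_closed submonoid.one_closed)
qed (auto simp: submonoid_hull_def)

context
  fixes M :: "('a, 'z) monoid_scheme" and S :: "'a set"
  assumes M: "comm_monoid M" and S: "S \<subseteq> carrier M"
begin

interpretation M: comm_monoid M by (rule M)
interpretation T: submonoid "submonoid_hull M S" M
  by (rule submonoid_submonoid_hull[OF M S])

lemma hull_carrier: "s \<in> submonoid_hull M S \<Longrightarrow> s \<in> carrier M"
  using T.subset by blast

lemma equiv_frac_rel: "equiv (carrier M \<times> submonoid_hull M S) (frac_rel M S)"
proof (rule equivI)
  show "frac_rel M S \<subseteq>
      (carrier M \<times> submonoid_hull M S) \<times> (carrier M \<times> submonoid_hull M S)"
    by (auto simp: frac_rel_def)
  show "refl_on (carrier M \<times> submonoid_hull M S) (frac_rel M S)"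
    using T.one_closed by (auto simp: refl_on_def frac_rel_def)
  show "sym (frac_rel M S)"
    by (auto simp: sym_def frac_rel_def) metis
  show "trans (frac_rel M S)"
  proof (rule transI, clarify)
    fix a s b t c r
    assume 1: "((a, s), (b, t)) \<in> frac_rel M S" and 2: "((b, t), (c, r)) \<in> frac_rel M S"
    let ?T = "submonoid_hull M S"
    obtain u where u: "u \<in> ?T" "u \<otimes>\<^bsub>M\<^esub> (t \<otimes>\<^bsub>M\<^esub> a) = u \<otimes>\<^bsub>M\<^esub> (s \<otimes>\<^bsub>M\<^esub> b)"
      using 1 by (auto simp: frac_rel_def)
    obtain v where v: "v \<in> ?T" "v \<otimes>\<^bsub>M\<^esub> (r \<otimes>\<^bsub>M\<^esub> b) = v \<otimes>\<^bsub>M\<^esub> (t \<otimes>\<^bsub>M\<^esub> c)"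
      using 2 by (auto simp: frac_rel_def)
    have mem: "a \<in> carrier M" "b \<in> carrier M" "c \<in> carrier M" "s \<in> ?T" "t \<in> ?T" "r \<in> ?T"
      using 1 2 by (auto simp: frac_rel_def)
    have cc: "s \<in> carrier M" "t \<in> carrier M" "r \<in> carrier M" "u \<in> carrier M" "v \<in> carrier M"
      using mem u v by (auto intro: hull_carrier)
    let ?w = "u \<otimes>\<^bsub>M\<^esub> (v \<otimes>\<^bsub>M\<^esub> t)"
    have "?w \<otimes>\<^bsub>M\<^esub> (r \<otimes>\<^bsub>M\<^esub> a) = (v \<otimes>\<^bsub>M\<^esub> r) \<otimes>\<^bsub>M\<^esub> (u \<otimes>\<^bsub>M\<^esub> (t \<otimes>\<^bsub>M\<^esub> a))"
      using mem cc by (simp add: M.m_ac)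
    also have "\<dots> = (u \<otimes>\<^bsub>M\<^esub> s) \<otimes>\<^bsub>M\<^esub> (v \<otimes>\<^bsub>M\<^esub> (r \<otimes>\<^bsub>M\<^esub> b))"
      unfolding u(2) using mem cc by (simp add: M.m_ac)
    also have "\<dots> = ?w \<otimes>\<^bsub>M\<^esub> (s \<otimes>\<^bsub>M\<^esub> c)"
      unfolding v(2) using mem cc by (simp add: M.m_ac)
    finally have "?w \<otimes>\<^bsub>M\<^esub> (r \<otimes>\<^bsub>M\<^esub> a) = ?w \<otimes>\<^bsub>M\<^esub> (s \<otimes>\<^bsub>M\<^esub> c)" .
    moreover have "?w \<in> ?T" using u v mem by simp
    ultimately show "((a, s), (c, r)) \<in> frac_rel M S"
      using mem by (auto simp: frac_rel_def)
  qed
qed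

private abbreviation (input) frac where "frac a s \<equiv> frac_rel M S `` {(a, s)}"

lemma mult_frac_congruent:
  "(\<lambda>p q. (\<lambda>(a, s). \<lambda>(b, t). frac (a \<otimes>\<^bsub>M\<^esub> b) (s \<otimes>\<^bsub>M\<^esub> t)) p q) respects2 (frac_rel M S)"
proof (rule congruent2_commuteI[OF equiv_frac_rel])
  show "(case p of (a, s) \<Rightarrow> \<lambda>(b, t). frac (a \<otimes>\<^bsub>M\<^esub> b) (s \<otimes>\<^bsub>M\<^esub> t)) q =
        (case q of (a, s) \<Rightarrow> \<lambda>(b, t). frac (a \<otimes>\<^bsub>M\<^esub> b) (s \<otimes>\<^bsub>M\<^esub> t)) p"
    if "p \<in> carrier M \<times> submonoid_hull M S" "q \<in> carrier M \<times> submonoid_hull M S" for p q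
    using that by (auto simp: M.m_comm hull_carrier split: prod.splits)
next
  fix p q r
  assume r: "r \<in> carrier M \<times> submonoid_hull M S" and pq: "(p, q) \<in> frac_rel M S"
  obtain a s b t c d where e: "p = (a, s)" "q = (b, t)" "r = (c, d)" by (metis surj_pair)
  let ?T = "submonoid_hull M S"
  obtain u where u: "u \<in> ?T" "u \<otimes>\<^bsub>M\<^esub> (t \<otimes>\<^bsub>M\<^esub> a) = u \<otimes>\<^bsub>M\<^esub> (s \<otimes>\<^bsub>M\<^esub> b)"
    using pq e by (auto simp: frac_rel_def)
  have mem: "a \<in> carrier M" "b \<in> carrier M" "c \<in> carrier M" "s \<in> ?T" "t \<in> ?T" "d \<in> ?T"
    using pq r e by (auto simp: frac_rel_def)
  have cc: "s \<in> carrier M" "t \<in> carrier M" "d \<in> carrier M" "u \<in> carrier M"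
    using mem u by (auto intro: hull_carrier)
  have "u \<otimes>\<^bsub>M\<^esub> ((d \<otimes>\<^bsub>M\<^esub> t) \<otimes>\<^bsub>M\<^esub> (c \<otimes>\<^bsub>M\<^esub> a)) = (c \<otimes>\<^bsub>M\<^esub> d) \<otimes>\<^bsub>M\<^esub> (u \<otimes>\<^bsub>M\<^esub> (t \<otimes>\<^bsub>M\<^esub> a))"
    using mem cc by (simp add: M.m_ac)
  also have "\<dots> = u \<otimes>\<^bsub>M\<^esub> ((d \<otimes>\<^bsub>M\<^esub> s) \<otimes>\<^bsub>M\<^esub> (c \<otimes>\<^bsub>M\<^esub> b))"
    unfolding u(2) using mem cc by (simp add: M.m_ac)
  finally have "((c \<otimes>\<^bsub>M\<^esub> a, d \<otimes>\<^bsub>M\<^esub> s), (c \<otimes>\<^bsub>M\<^esub> b, d \<otimes>\<^bsub>M\<^esub> t)) \<in> frac_rel M S"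
    using mem u by (auto simp: frac_rel_def)
  then show "(case r of (a, s) \<Rightarrow> \<lambda>(b, t). frac (a \<otimes>\<^bsub>M\<^esub> b) (s \<otimes>\<^bsub>M\<^esub> t)) p =
        (case r of (a, s) \<Rightarrow> \<lambda>(b, t). frac (a \<otimes>\<^bsub>M\<^esub> b) (s \<otimes>\<^bsub>M\<^esub> t)) q"
    unfolding e by (simp add: equiv_class_eq[OF equiv_frac_rel])
qed

lemma mult_frac:
  assumes "a \<in> carrier M" "b \<in> carrier M" "s \<in> submonoid_hull M S" "t \<in> submonoid_hull M S"
  shows "frac a s \<otimes>\<^bsub>mon_loc M S\<^esub> frac b t = frac (a \<otimes>\<^bsub>M\<^esub> b) (s \<otimes>\<^bsub>M\<^esub> t)"
  using UN_equiv_class2[OF equiv_frac_rel equiv_frac_rel mult_frac_congruent,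
      of "(a, s)" "(b, t)"] assms
  by (simp add: mon_loc_def case_prod_unfold)

lemma frac_cases:
  assumes "P \<in> carrier (mon_loc M S)"
  obtains a s where "a \<in> carrier M" "s \<in> submonoid_hull M S" "P = frac a s"
  using assms by (auto simp: mon_loc_def elim!: quotientE)

lemma frac_in: "a \<in> carrier M \<Longrightarrow> s \<in> submonoid_hull M S \<Longrightarrow> frac a s \<in> carrier (mon_loc M S)"
  by (auto simp: mon_loc_def intro: quotientI)

lemma one_frac: "\<one>\<^bsub>mon_loc M S\<^esub> = frac \<one>\<^bsub>M\<^esub> \<one>\<^bsub>M\<^esub>"
  by (simp add: mon_loc_def)

lemma comm_monoid_mon_loc: "comm_monoid (mon_loc M S)"
proof (rule comm_monoidI)
  show "\<one>\<^bsub>mon_loc M S\<^esub> \<in> carrier (mon_loc M S)"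
    by (simp add: one_frac frac_in)
qed (auto elim!: frac_cases simp: one_frac mult_frac frac_in hull_carrier M.m_ac)

lemma frac_cancel: "s \<in> submonoid_hull M S \<Longrightarrow> frac s s = frac \<one>\<^bsub>M\<^esub> \<one>\<^bsub>M\<^esub>"
  using T.one_closed
  by (intro equiv_class_eq[OF equiv_frac_rel]) (auto simp: frac_rel_def hull_carrier)

lemma frac_decomp:
  assumes "a \<in> carrier M" "s \<in> submonoid_hull M S"
  shows "frac a s \<otimes>\<^bsub>mon_loc M S\<^esub> mon_loc_map M S s = mon_loc_map M S a"
proof -
  have "frac (a \<otimes>\<^bsub>M\<^esub> s) s = frac a \<one>\<^bsub>M\<^esub>"
    using assms T.one_closed
    by (intro equiv_class_eq[OF equiv_frac_rel])
       (auto simp: frac_rel_def hull_carrier M.m_comm intro!: bexI[of _ "\<one>\<^bsub>M\<^esub>"])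
  then show ?thesis
    using assms by (simp add: mon_loc_map_def mult_frac hull_carrier)
qed

lemma mon_loc_map_hom:
  "mon_loc_map M S \<in> hom M (mon_loc M S)"
  "mon_loc_map M S \<one>\<^bsub>M\<^esub> = \<one>\<^bsub>mon_loc M S\<^esub>"
  by (auto simp: hom_def mon_loc_map_def frac_in mult_frac one_frac)

lemma mon_loc_map_unit:
  assumes "s \<in> S"
  shows "mon_loc_map M S s \<in> Units (mon_loc M S)"
proof -
  have s: "s \<in> submonoid_hull M S" using submonoid_submonoid_hull[OF M S] assms by auto
  have "mon_loc_map M S s \<otimes>\<^bsub>mon_loc M S\<^esub> frac \<one>\<^bsub>M\<^esub> s = \<one>\<^bsub>mon_loc M S\<^esub>"
    "frac \<one>\<^bsub>M\<^esub> s \<otimes>\<^bsub>mon_loc M S\<^esub> mon_loc_map M S s = \<one>\<^bsub>mon_loc M S\<^esub>"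
    using s frac_cancel[OF s] by (simp_all add: mon_loc_map_def mult_frac hull_carrier one_frac)
  moreover have "mon_loc_map M S s \<in> carrier (mon_loc M S)"
    using s by (simp add: mon_loc_map_def frac_in hull_carrier)
  ultimately show ?thesis using s by (auto simp: Units_def frac_in intro!: bexI[of _ "frac \<one>\<^bsub>M\<^esub> s"])
qed

theorem mon_loc_universal:
  assumes N: "comm_monoid N"
    and g: "g \<in> hom M N" "g \<one>\<^bsub>M\<^esub> = \<one>\<^bsub>N\<^esub>" and unit: "g ` S \<subseteq> Units N"
  shows "\<exists>!h. h \<in> extensional (carrier (mon_loc M S)) \<and> h \<in> hom (mon_loc M S) N \<and>
           h \<one>\<^bsub>mon_loc M S\<^esub> = \<one>\<^bsub>N\<^esub> \<and> (\<forall>a \<in> carrier M. h (mon_loc_map M S a) = g a)"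
proof -
  interpret N: comm_monoid N by (rule N)
  let ?T = "submonoid_hull M S" and ?L = "mon_loc M S"
  have gc: "g a \<in> carrier N" if "a \<in> carrier M" for a using g that by (auto simp: hom_def)
  have gm: "g (a \<otimes>\<^bsub>M\<^esub> b) = g a \<otimes>\<^bsub>N\<^esub> g b" if "a \<in> carrier M" "b \<in> carrier M" for a b
    using g that by (auto simp: hom_def)
  have "submonoid {s \<in> carrier M. g s \<in> Units N} M"
    using g by (auto simp: submonoid_def gm)
  then have "?T \<subseteq> {s \<in> carrier M. g s \<in> Units N}"
    using unit S unfolding submonoid_hull_def by (intro Inter_lower) auto
  then have gT: "g s \<in> Units N" if "s \<in> ?T" for s using that by auto
  define k where "k = (\<lambda>(a, s). g a \<otimes>\<^bsub>N\<^esub> inv\<^bsub>N\<^esub> g s)"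
  have k_eq: "k (a, s) = k (b, t)" if r: "((a, s), (b, t)) \<in> frac_rel M S" for a s b t
  proof -
    obtain u where u: "u \<in> ?T" "u \<otimes>\<^bsub>M\<^esub> (t \<otimes>\<^bsub>M\<^esub> a) = u \<otimes>\<^bsub>M\<^esub> (s \<otimes>\<^bsub>M\<^esub> b)"
      using r by (auto simp: frac_rel_def)
    have mem: "a \<in> carrier M" "b \<in> carrier M" "s \<in> ?T" "t \<in> ?T"
      using r by (auto simp: frac_rel_def)
    note c = gT[OF mem(3)] gT[OF mem(4)] gT[OF u(1)]
    have "g u \<otimes>\<^bsub>N\<^esub> (g t \<otimes>\<^bsub>N\<^esub> g a) = g u \<otimes>\<^bsub>N\<^esub> (g s \<otimes>\<^bsub>N\<^esub> g b)"
      using arg_cong[OF u(2), of g] mem u(1) by (simp add: gm hull_carrier)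
    then have 1: "g t \<otimes>\<^bsub>N\<^esub> g a = g s \<otimes>\<^bsub>N\<^esub> g b"
      using N.Units_l_cancel[OF c(3)] mem by (simp add: gc hull_carrier)
    have "k (a, s) = (g t \<otimes>\<^bsub>N\<^esub> g a) \<otimes>\<^bsub>N\<^esub> (inv\<^bsub>N\<^esub> g s \<otimes>\<^bsub>N\<^esub> inv\<^bsub>N\<^esub> g t)"
    proof -
      have "(g t \<otimes>\<^bsub>N\<^esub> g a) \<otimes>\<^bsub>N\<^esub> (inv\<^bsub>N\<^esub> g s \<otimes>\<^bsub>N\<^esub> inv\<^bsub>N\<^esub> g t)
          = (g t \<otimes>\<^bsub>N\<^esub> inv\<^bsub>N\<^esub> g t) \<otimes>\<^bsub>N\<^esub> (g a \<otimes>\<^bsub>N\<^esub> inv\<^bsub>N\<^esub> g s)"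
        using c mem by (simp add: gc N.m_ac N.Units_closed del: N.Units_r_inv N.Units_l_inv)
      then show ?thesis using c mem by (simp add: k_def gc N.Units_closed)
    qed
    also have "\<dots> = (g s \<otimes>\<^bsub>N\<^esub> inv\<^bsub>N\<^esub> g s) \<otimes>\<^bsub>N\<^esub> (g b \<otimes>\<^bsub>N\<^esub> inv\<^bsub>N\<^esub> g t)"
      unfolding 1 using c mem by (simp add: gc N.m_ac N.Units_closed del: N.Units_r_inv N.Units_l_inv)
    also have "\<dots> = k (b, t)" using c mem by (simp add: k_def gc N.Units_closed)
    finally show ?thesis .
  qed
  define h where "h = restrict (\<lambda>P. the_elem (k ` P)) (carrier ?L)"
  have h_frac: "h (frac a s) = k (a, s)" if "a \<in> carrier M" "s \<in> ?T" for a s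
  proof -
    have "k p = k (a, s)" if "p \<in> frac a s" for p
      using that k_eq[of a s "fst p" "snd p"] by simp
    moreover have "(a, s) \<in> frac a s"
      using equiv_class_self[OF equiv_frac_rel, of "(a, s)"] that by simp
    ultimately have "k ` frac a s = {k (a, s)}" by blast
    then show ?thesis using that by (simp add: h_def frac_in)
  qed
  have k_mult: "k (a \<otimes>\<^bsub>M\<^esub> b, s \<otimes>\<^bsub>M\<^esub> t) = k (a, s) \<otimes>\<^bsub>N\<^esub> k (b, t)"
    if "a \<in> carrier M" "b \<in> carrier M" "s \<in> ?T" "t \<in> ?T" for a b s t
  proof -
    note c = gT[OF that(3)] gT[OF that(4)]
    have "inv\<^bsub>N\<^esub> (g s \<otimes>\<^bsub>N\<^esub> g t) = inv\<^bsub>N\<^esub> g s \<otimes>\<^bsub>N\<^esub> inv\<^bsub>N\<^esub> g t"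
    proof (rule N.inv_unique'[symmetric])
      have *: "(g s \<otimes>\<^bsub>N\<^esub> g t) \<otimes>\<^bsub>N\<^esub> (inv\<^bsub>N\<^esub> g s \<otimes>\<^bsub>N\<^esub> inv\<^bsub>N\<^esub> g t)
          = (g s \<otimes>\<^bsub>N\<^esub> inv\<^bsub>N\<^esub> g s) \<otimes>\<^bsub>N\<^esub> (g t \<otimes>\<^bsub>N\<^esub> inv\<^bsub>N\<^esub> g t)"
        using c by (simp add: N.m_ac N.Units_closed del: N.Units_r_inv N.Units_l_inv)
      then show "(g s \<otimes>\<^bsub>N\<^esub> g t) \<otimes>\<^bsub>N\<^esub> (inv\<^bsub>N\<^esub> g s \<otimes>\<^bsub>N\<^esub> inv\<^bsub>N\<^esub> g t) = \<one>\<^bsub>N\<^esub>"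
        using c by (simp add: N.Units_closed)
      then show "(inv\<^bsub>N\<^esub> g s \<otimes>\<^bsub>N\<^esub> inv\<^bsub>N\<^esub> g t) \<otimes>\<^bsub>N\<^esub> (g s \<otimes>\<^bsub>N\<^esub> g t) = \<one>\<^bsub>N\<^esub>"
        using c by (subst N.m_comm) (simp_all add: N.Units_closed)
    qed (use c in \<open>simp_all add: N.Units_closed\<close>)
    then show ?thesis
      using that c by (simp add: k_def gm gc hull_carrier N.m_ac N.Units_closed)
  qed
  have h: "h \<in> extensional (carrier ?L) \<and> h \<in> hom ?L N \<and> h \<one>\<^bsub>?L\<^esub> = \<one>\<^bsub>N\<^esub> \<and>
           (\<forall>a \<in> carrier M. h (mon_loc_map M S a) = g a)"
  proof (intro conjI ballI)
    show "h \<in> hom ?L N"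
    proof (rule homI)
      show "h P \<in> carrier N" if "P \<in> carrier ?L" for P
        using that by (auto elim!: frac_cases simp: h_frac k_def gc gT N.Units_closed)
      show "h (P \<otimes>\<^bsub>?L\<^esub> Q) = h P \<otimes>\<^bsub>N\<^esub> h Q" if PQ: "P \<in> carrier ?L" "Q \<in> carrier ?L" for P Q
        using PQ by (auto elim!: frac_cases simp: mult_frac h_frac k_mult)
    qed
    show "h (mon_loc_map M S a) = g a" if "a \<in> carrier M" for a
      using that g by (simp add: mon_loc_map_def h_frac k_def gc)
    then show "h \<one>\<^bsub>?L\<^esub> = \<one>\<^bsub>N\<^esub>" using g by (metis M.one_closed mon_loc_map_hom(2))
  qed (simp add: h_def)
  moreover have "h' = h"
    if h': "h' \<in> extensional (carrier ?L) \<and> h' \<in> hom ?L N \<and> h' \<one>\<^bsub>?L\<^esub> = \<one>\<^bsub>N\<^esub> \<and>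
           (\<forall>a \<in> carrier M. h' (mon_loc_map M S a) = g a)" for h'
  proof (rule extensionalityI)
    fix P assume P: "P \<in> carrier ?L"
    then obtain a s where as: "a \<in> carrier M" "s \<in> ?T" "P = frac a s" by (rule frac_cases)
    have m: "mon_loc_map M S s \<in> carrier ?L"
      using mon_loc_map_hom(1) as hull_carrier by (auto simp: hom_def)
    have *: "f P \<otimes>\<^bsub>N\<^esub> g s = g a" if f: "f \<in> hom ?L N" "\<forall>a \<in> carrier M. f (mon_loc_map M S a) = g a" for f
    proof -
      have "f (P \<otimes>\<^bsub>?L\<^esub> mon_loc_map M S s) = f P \<otimes>\<^bsub>N\<^esub> f (mon_loc_map M S s)"
        using f(1) P m by (auto simp: hom_def)
      then show ?thesis using f(2) as frac_decomp hull_carrier by auto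
    qed
    have "h' P \<in> carrier N" "h P \<in> carrier N" using h h' P by (auto simp: hom_def)
    moreover have "g s \<otimes>\<^bsub>N\<^esub> h' P = g s \<otimes>\<^bsub>N\<^esub> h P"
      using *[of h] *[of h'] h h' calculation gc as hull_carrier by (metis N.m_comm)
    ultimately show "h' P = h P" using N.Units_l_cancel[OF gT[OF as(2)]] by blast
  qed (use h h' in auto)
  ultimately show ?thesis by blast
qed

end


section \<open>Grothendieck monoids\<close>

text \<open>
  The Grothendieck monoid of the full subcategory \<open>U\<close> of \<open>C\<close> with the class of conflations \<open>E\<close>: the
  free commutative monoid on \<open>U\<close> modulo the congruence generated by the required relations; its
  universal property is \<open>groth_universal\<close> below.
\<close>

inductive groth_eq ::
    "('o, 'm, 'z) cat_scheme \<Rightarrow> 'o set \<Rightarrow> ('o \<Rightarrow> 'o \<Rightarrow> 'o \<Rightarrow> bool) \<Rightarrow>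
     'o multiset \<Rightarrow> 'o multiset \<Rightarrow> bool"
  for C :: "('o, 'm, 'z) cat_scheme" and U :: "'o set" and E :: "'o \<Rightarrow> 'o \<Rightarrow> 'o \<Rightarrow> bool"
where
  refl: "set_mset m \<subseteq> U \<Longrightarrow> groth_eq C U E m m"
| sym: "groth_eq C U E m n \<Longrightarrow> groth_eq C U E n m"
| trans: "groth_eq C U E m n \<Longrightarrow> groth_eq C U E n r \<Longrightarrow> groth_eq C U E m r"
| add: "groth_eq C U E m m' \<Longrightarrow> groth_eq C U E n n' \<Longrightarrow> groth_eq C U E (m + n) (m' + n')"
| iso: "X \<in> U \<Longrightarrow> Y \<in> U \<Longrightarrow> isomorphic C X Y \<Longrightarrow> groth_eq C U E {#X#} {#Y#}"
| zero: "Z \<in> U \<Longrightarrow> zero_object C Z \<Longrightarrow> groth_eq C U E {#Z#} {#}"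
| conflation: "X \<in> U \<Longrightarrow> Y \<in> U \<Longrightarrow> Z \<in> U \<Longrightarrow> E X Y Z \<Longrightarrow> groth_eq C U E {#Y#} {#X, Z#}"

definition groth_monoid ::
    "('o, 'm, 'z) cat_scheme \<Rightarrow> 'o set \<Rightarrow> ('o \<Rightarrow> 'o \<Rightarrow> 'o \<Rightarrow> bool) \<Rightarrow> 'o multiset set monoid" where
  "groth_monoid C U E = \<lparr>
     carrier = {Collect (groth_eq C U E m) | m. set_mset m \<subseteq> U},
     mult = (\<lambda>P Q. {r. \<exists>m \<in> P. \<exists>n \<in> Q. groth_eq C U E (m + n) r}),
     one = Collect (groth_eq C U E {#})\<rparr>"

definition groth_class ::
    "('o, 'm, 'z) cat_scheme \<Rightarrow> 'o set \<Rightarrow> ('o \<Rightarrow> 'o \<Rightarrow> 'o \<Rightarrow> bool) \<Rightarrow> 'o \<Rightarrow> 'o multiset set" where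
  "groth_class C U E X = Collect (groth_eq C U E {#X#})"

context
  fixes C :: "('o, 'm, 'z) cat_scheme" and U :: "'o set" and E :: "'o \<Rightarrow> 'o \<Rightarrow> 'o \<Rightarrow> bool"
begin

lemma groth_eq_subset:
  "groth_eq C U E m n \<Longrightarrow> set_mset m \<subseteq> U \<and> set_mset n \<subseteq> U"
  by (induction rule: groth_eq.induct) auto

lemma groth_eq_iff:
  assumes "set_mset m \<subseteq> U"
  shows "Collect (groth_eq C U E m) = Collect (groth_eq C U E n) \<longleftrightarrow> groth_eq C U E m n"
proof
  assume "Collect (groth_eq C U E m) = Collect (groth_eq C U E n)"
  then have "groth_eq C U E n m"
    using groth_eq.refl[OF assms, of C E] by auto
  then show "groth_eq C U E m n" by (rule groth_eq.sym)
next
  assume "groth_eq C U E m n"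
  then show "Collect (groth_eq C U E m) = Collect (groth_eq C U E n)"
    by (intro Collect_cong iffI) (erule groth_eq.trans[OF groth_eq.sym], assumption, erule groth_eq.trans)
qed

lemma mult_groth:
  assumes "set_mset m \<subseteq> U" "set_mset n \<subseteq> U"
  shows "Collect (groth_eq C U E m) \<otimes>\<^bsub>groth_monoid C U E\<^esub> Collect (groth_eq C U E n)
       = Collect (groth_eq C U E (m + n))"
proof -
  have "groth_eq C U E (m + n) r"
    if "groth_eq C U E m m'" "groth_eq C U E n n'" "groth_eq C U E (m' + n') r" for m' n' r
    using groth_eq.trans[OF groth_eq.add[OF that(1,2)] that(3)] .
  moreover have "groth_eq C U E m m" "groth_eq C U E n n"
    using assms by (simp_all add: groth_eq.refl)
  ultimately show ?thesis by (auto simp: groth_monoid_def)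
qed

lemma comm_monoid_groth: "comm_monoid (groth_monoid C U E)"
proof (rule comm_monoidI)
  let ?G = "groth_monoid C U E"
  have 1: "\<one>\<^bsub>?G\<^esub> = Collect (groth_eq C U E {#})" by (simp add: groth_monoid_def)
  have c: "\<exists>m. P = Collect (groth_eq C U E m) \<and> set_mset m \<subseteq> U" if "P \<in> carrier ?G" for P
    using that by (auto simp: groth_monoid_def)
  have i: "Collect (groth_eq C U E m) \<in> carrier ?G" if "set_mset m \<subseteq> U" for m
    using that by (auto simp: groth_monoid_def)
  show "\<one>\<^bsub>?G\<^esub> \<in> carrier ?G" by (simp add: 1 i)
  show "P \<otimes>\<^bsub>?G\<^esub> Q \<in> carrier ?G" if "P \<in> carrier ?G" "Q \<in> carrier ?G" for P Q
    using c[OF that(1)] c[OF that(2)] by (force simp: mult_groth intro!: i)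
  show "P \<otimes>\<^bsub>?G\<^esub> Q \<otimes>\<^bsub>?G\<^esub> R = P \<otimes>\<^bsub>?G\<^esub> (Q \<otimes>\<^bsub>?G\<^esub> R)"
    if "P \<in> carrier ?G" "Q \<in> carrier ?G" "R \<in> carrier ?G" for P Q R
    using c[OF that(1)] c[OF that(2)] c[OF that(3)] by (auto simp: mult_groth ac_simps)
  show "\<one>\<^bsub>?G\<^esub> \<otimes>\<^bsub>?G\<^esub> P = P" if "P \<in> carrier ?G" for P
    using c[OF that] by (auto simp: 1 mult_groth)
  show "P \<otimes>\<^bsub>?G\<^esub> Q = Q \<otimes>\<^bsub>?G\<^esub> P" if "P \<in> carrier ?G" "Q \<in> carrier ?G" for P Q
    using c[OF that(1)] c[OF that(2)] by (auto simp: mult_groth ac_simps)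
qed

theorem groth_universal:
  assumes N: "comm_monoid N"
    and f: "\<And>X. X \<in> U \<Longrightarrow> f X \<in> carrier N"
    and iso: "\<And>X Y. X \<in> U \<Longrightarrow> Y \<in> U \<Longrightarrow> isomorphic C X Y \<Longrightarrow> f X = f Y"
    and zero: "\<And>Z. Z \<in> U \<Longrightarrow> zero_object C Z \<Longrightarrow> f Z = \<one>\<^bsub>N\<^esub>"
    and conf: "\<And>X Y Z. X \<in> U \<Longrightarrow> Y \<in> U \<Longrightarrow> Z \<in> U \<Longrightarrow> E X Y Z \<Longrightarrow> f Y = f X \<otimes>\<^bsub>N\<^esub> f Z"
  shows "\<exists>!h. h \<in> extensional (carrier (groth_monoid C U E)) \<and> h \<in> hom (groth_monoid C U E) N \<and>
           h \<one>\<^bsub>groth_monoid C U E\<^esub> = \<one>\<^bsub>N\<^esub> \<and> (\<forall>X \<in> U. h (groth_class C U E X) = f X)"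
proof -
  interpret N: comm_monoid N by (rule N)
  let ?G = "groth_monoid C U E"
  interpret G: comm_monoid ?G by (rule comm_monoid_groth)
  have one: "\<one>\<^bsub>?G\<^esub> = Collect (groth_eq C U E {#})" by (simp add: groth_monoid_def)
  have i: "Collect (groth_eq C U E m) \<in> carrier ?G" if "set_mset m \<subseteq> U" for m
    using that by (auto simp: groth_monoid_def)
  have c: "\<exists>m. P = Collect (groth_eq C U E m) \<and> set_mset m \<subseteq> U" if "P \<in> carrier ?G" for P
    using that by (auto simp: groth_monoid_def)
  define op where "op = (\<lambda>X a. if X \<in> U \<and> a \<in> carrier N then f X \<otimes>\<^bsub>N\<^esub> a else a)"
  interpret comp_fun_commute op
    by standard (auto simp: op_def fun_eq_iff f N.m_lcomm)
  define ev where "ev = fold_mset op \<one>\<^bsub>N\<^esub>"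
  have ev_in: "ev m \<in> carrier N" for m
  proof (induction m)
    case (add X m)
    have "ev (add_mset X m) = op X (ev m)" by (simp add: ev_def)
    then show ?case using add by (simp add: op_def f)
  qed (simp add: ev_def)
  have ev_empty: "ev {#} = \<one>\<^bsub>N\<^esub>" by (simp add: ev_def)
  have ev_add1: "ev (add_mset X m) = f X \<otimes>\<^bsub>N\<^esub> ev m" if "X \<in> U" for X m
  proof -
    have "ev (add_mset X m) = op X (ev m)" by (simp add: ev_def)
    then show ?thesis using that ev_in[of m] by (simp add: op_def)
  qed
  have ev_add: "ev (m + n) = ev m \<otimes>\<^bsub>N\<^esub> ev n" if "set_mset m \<subseteq> U" for m n
    using that by (induction m) (auto simp: ev_empty ev_add1 ev_in f N.m_assoc)
  have ev_eq: "ev m = ev n" if "groth_eq C U E m n" for m n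
    using that
  proof (induction rule: groth_eq.induct)
    case (add m m' n n')
    then show ?case using groth_eq_subset ev_add by metis
  next
    case (iso X Y)
    then show ?case using assms(3) by (simp add: ev_add1)
  qed (auto simp: ev_add1 ev_empty zero conf f)
  define h where "h = restrict (\<lambda>P. the_elem (ev ` P)) (carrier ?G)"
  have h_c: "h (Collect (groth_eq C U E m)) = ev m" if "set_mset m \<subseteq> U" for m
  proof -
    have "ev ` Collect (groth_eq C U E m) = {ev m}"
      using ev_eq groth_eq.refl[OF that] by force
    then show ?thesis using that by (simp add: h_def i)
  qed
  have h: "h \<in> extensional (carrier ?G) \<and> h \<in> hom ?G N \<and> h \<one>\<^bsub>?G\<^esub> = \<one>\<^bsub>N\<^esub> \<and>
        (\<forall>X \<in> U. h (groth_class C U E X) = f X)"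
  proof (intro conjI ballI)
    show "h \<in> hom ?G N"
    proof (rule homI)
      show "h P \<in> carrier N" if "P \<in> carrier ?G" for P
        using c[OF that] by (auto simp: h_c ev_in)
      show "h (P \<otimes>\<^bsub>?G\<^esub> Q) = h P \<otimes>\<^bsub>N\<^esub> h Q" if "P \<in> carrier ?G" "Q \<in> carrier ?G" for P Q
        using c[OF that(1)] c[OF that(2)] by (auto simp: mult_groth h_c ev_add)
    qed
    show "h \<in> extensional (carrier ?G)" by (simp add: h_def)
  qed (auto simp: one h_c ev_empty groth_class_def ev_add1 f)
  moreover have "h' = h"
    if h': "h' \<in> extensional (carrier ?G) \<and> h' \<in> hom ?G N \<and> h' \<one>\<^bsub>?G\<^esub> = \<one>\<^bsub>N\<^esub> \<and>
           (\<forall>X \<in> U. h' (groth_class C U E X) = f X)" for h'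
  proof (rule extensionalityI)
    have *: "h' (Collect (groth_eq C U E m)) = ev m" if "set_mset m \<subseteq> U" for m
      using that
    proof (induction m)
      case empty
      then show ?case using h' by (simp add: one ev_empty)
    next
      case (add X m)
      then have "Collect (groth_eq C U E (add_mset X m))
          = Collect (groth_eq C U E {#X#}) \<otimes>\<^bsub>?G\<^esub> Collect (groth_eq C U E m)"
        by (subst mult_groth) auto
      then have "h' (Collect (groth_eq C U E (add_mset X m)))
          = h' (groth_class C U E X) \<otimes>\<^bsub>N\<^esub> h' (Collect (groth_eq C U E m))"
        using h' add.prems by (simp add: hom_def groth_class_def i)
      then show ?case using add h' by (simp add: ev_add1)
    qed
    show "h' P = h P" if "P \<in> carrier ?G" for P
      using c[OF that] * h_c by auto
  qed (use h h' in auto)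
  ultimately show ?thesis by blast
qed

end

definition M_ab :: "('o, 'm, 'z) addcat_scheme \<Rightarrow> 'o multiset set monoid" where
  "M_ab A = groth_monoid A (obj A) (short_exact A)"

definition M_ab_class :: "('o, 'm, 'z) addcat_scheme \<Rightarrow> 'o \<Rightarrow> 'o multiset set" where
  "M_ab_class A X = groth_class A (obj A) (short_exact A) X"

definition M_Db ::
    "('o, 'm, 'z) addcat_scheme \<Rightarrow> ('o, 'm) cochain set \<Rightarrow> ('o, 'm) cochain multiset set monoid" where
  "M_Db A U = groth_monoid (Db A) U (\<lambda>X Y Z. \<exists>u v w. triangle A X Y Z u v w)"

end

theory Submission
  imports Defs
begin

text \<open>
  The face \<open>\<langle>S\<rangle>\<close> pulls back to a Serre subcategory \<open>F\<close>, so \<open>F[1] * A\<close> consists of the complexes whose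
  cohomology vanishes outside degrees \<open>-1\<close> and \<open>0\<close> and satisfies \<open>H\<^sup>-\<^sup>1 \<in> F\<close>; all its closure properties
  follow from the long exact sequence. The isomorphism sends \<open>[X]\<close> to the class of the stalk complex of
  \<open>X\<close>: for \<open>X \<in> F\<close> that class is invertible because of the triangle \<open>X \<rightarrow> 0 \<rightarrow> X[1]\<close>. Its inverse sends
  \<open>X\<close> to \<open>[H\<^sup>0 X] - [H\<^sup>-\<^sup>1 X]\<close>, which is defined in the localization since \<open>[H\<^sup>-\<^sup>1 X]\<close> lies in the face,
  and which is additive on triangles by the long exact sequence.
\<close>

section \<open>Generalities on categories and their localizations\<close>

text \<open>\<open>Db A\<close> is a bare localization at the quasi-isomorphisms: its arrows are
  classes of zigzags, with no calculus of fractions, no addition and no axioms of a triangulated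
  category at hand. Facts about it come from four sources only: the functors H^n given by the
  universal property, quasi-isomorphisms becoming invertible, survival of zero objects, and
  triangles being isomorphic to mapping cones, whose long exact sequences are computed on complexes.
  Additivity of [H^0] - [H^-1] needs more than exactness. The sequence also contains the image of
  the connecting map from H^-1 of the third term to H^0 of the first, whose class has to cancel
  although M(A) need not be cancellative. It cancels because it is a factor of the invertible class
  [H^-1] of the third term, and factors of units are units. That the two homomorphisms are mutually
  inverse is then checked on generators: each object of F[1] * A is an extension of an object of A
  by some B[1], and [B[1]] is inverse to [B].\<close>

context category
begin

lemma isomorphic_refl: "X \<in> obj C \<Longrightarrow> isomorphic C X X"
  unfolding isomorphic_def iso_arrow_def using idt_mor idt_left by blast

lemma iso_arrow_comp:
  assumes "iso_arrow C X Y f" "iso_arrow C Y Z g" shows "iso_arrow C X Z (cmp C g f)"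
proof -
  obtain f' g' where f: "f \<in> mor C X Y" "f' \<in> mor C Y X" "cmp C f' f = idt C X" "cmp C f f' = idt C Y"
    and g: "g \<in> mor C Y Z" "g' \<in> mor C Z Y" "cmp C g' g = idt C Y" "cmp C g g' = idt C Z"
    using assms by (auto simp: iso_arrow_def)
  have "cmp C (cmp C f' g') (cmp C g f) = cmp C f' (cmp C g' (cmp C g f))"
    using cmp_assoc[OF cmp_mor[OF f(1) g(1)] g(2) f(2)] by simp
  also have "\<dots> = idt C X" using cmp_assoc[OF f(1) g(1,2)] g(3) idt_left[OF f(1)] f(3) by simp
  finally have 1: "cmp C (cmp C f' g') (cmp C g f) = idt C X" .
  have "cmp C (cmp C g f) (cmp C f' g') = cmp C g (cmp C f (cmp C f' g'))"
    using cmp_assoc[OF cmp_mor[OF g(2) f(2)] f(1) g(1)] by simp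
  also have "\<dots> = idt C Z" using cmp_assoc[OF g(2) f(2,1)] f(4) idt_left[OF g(2)] g(4) by simp
  finally have 2: "cmp C (cmp C g f) (cmp C f' g') = idt C Z" .
  show ?thesis unfolding iso_arrow_def
    using 1 2 cmp_mor[OF f(1) g(1)] cmp_mor[OF g(2) f(2)] by blast
qed

lemma isomorphic_sym: "isomorphic C X Y \<Longrightarrow> isomorphic C Y X"
  by (auto simp: isomorphic_def iso_arrow_def)

lemma isomorphic_trans: "isomorphic C X Y \<Longrightarrow> isomorphic C Y Z \<Longrightarrow> isomorphic C X Z"
  unfolding isomorphic_def using iso_arrow_comp by blast

section \<open>Arrows, terminal and initial objects of a localization\<close>

lemma loc_arrow_mor: "f \<in> mor C X Y \<Longrightarrow> loc_arrow C W X Y f \<in> mor (loc_cat C W) X Y"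
  unfolding loc_arrow_def by (intro loc_mor_in loc_eq.Fwd)

lemma loc_arrow_cmp:
  assumes "f \<in> mor C X Y" "g \<in> mor C Y Z"
  shows "cmp (loc_cat C W) (loc_arrow C W Y Z g) (loc_arrow C W X Y f) = loc_arrow C W X Z (cmp C g f)"
  unfolding loc_arrow_def loc_cmp[OF loc_eq.Fwd[OF assms(1)] loc_eq.Fwd[OF assms(2)]]
  using loc_class_eq[OF loc_eq.cmp[OF assms]] by simp

lemma loc_arrow_idt: "loc_arrow C W X X (idt C X) = idt (loc_cat C W) X"
  by (simp add: loc_arrow_def loc_idt)

lemma loc_arrow_iso:
  assumes "w \<in> mor C X Y" "W X Y w" shows "iso_arrow (loc_cat C W) X Y (loc_arrow C W X Y w)"
  unfolding iso_arrow_def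
proof (intro conjI bexI)
  let ?b = "Collect (loc_eq C W Y X (Bwd X Y w))"
  note f = loc_eq.Fwd[OF assms(1), of W] and b = loc_eq.Bwd[where W = W, OF assms]
  show "loc_arrow C W X Y w \<in> mor (loc_cat C W) X Y" using loc_arrow_mor assms by blast
  show "?b \<in> mor (loc_cat C W) Y X" using loc_mor_in[OF b] .
  show "cmp (loc_cat C W) ?b (loc_arrow C W X Y w) = idt (loc_cat C W) X"
    unfolding loc_arrow_def loc_cmp[OF f b] loc_idt using loc_class_eq[OF loc_eq.inv_left[where W = W, OF assms]] .
  show "cmp (loc_cat C W) (loc_arrow C W X Y w) ?b = idt (loc_cat C W) Y"
    unfolding loc_arrow_def loc_cmp[OF b f] loc_idt using loc_class_eq[OF loc_eq.inv_right[where W = W, OF assms]] .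
qed

text \<open>Arrows of the localization are accessible only by induction on zigzags. Postcomposing a
  zigzag with the canonical arrow \<open>T\<close> of its target gives the canonical arrow of its
  source; for the formal inverse v of w : A -> B this is T_A v = (T_B w) v = T_B. For a zigzag
  ending in \<open>Z\<close> the postcomposed arrow is the identity.\<close>

lemma loc_terminal:
  assumes Z: "\<And>X. X \<in> obj C \<Longrightarrow> \<exists>!f. f \<in> mor C X Z"
    and a: "a \<in> mor (loc_cat C W) X Z" "b \<in> mor (loc_cat C W) X Z"
  shows "a = b"
proof -
  note [trans] = loc_eq.trans
  define T where "T = (\<lambda>X. THE f. f \<in> mor C X Z)"
  have T: "T X \<in> mor C X Z" "f \<in> mor C X Z \<Longrightarrow> f = T X" if "X \<in> obj C" for X f
    using theI'[OF Z[OF that]] Z[OF that] unfolding T_def by blast+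
  have key: "loc_eq C W (zsrc t) Z (After (Fwd (ztgt t) Z (T (ztgt t))) t) (Fwd (zsrc t) Z (T (zsrc t)))"
    if "zwf W t" for t
    using that
  proof (induction t)
    case (Fwd A B f)
    then have f: "f \<in> mor C A B" by simp
    then have o: "A \<in> obj C" "B \<in> obj C" using mor_obj by auto
    have "cmp C (T B) f = T A" using T(2)[OF o(1)] cmp_mor[OF f T(1)[OF o(2)]] by blast
    then show ?case using loc_eq.sym[OF loc_eq.cmp[OF f T(1)[OF o(2)], of W]] by simp
  next
    case (Bwd A B w)
    then have w: "w \<in> mor C A B" "W A B w" by auto
    then have o: "A \<in> obj C" "B \<in> obj C" using mor_obj by auto
    have e: "cmp C (T B) w = T A" using T(2)[OF o(1)] cmp_mor[OF w(1) T(1)[OF o(2)]] by blast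
    let ?TB = "Fwd B Z (T B)" and ?w = "Fwd A B w" and ?v = "Bwd A B w"
    note tb = loc_eq.Fwd[OF T(1)[OF o(2)], of W] and fw = loc_eq.Fwd[OF w(1), of W] and bw = loc_eq.Bwd[where W = W, OF w]
    have "loc_eq C W B Z (After (Fwd A Z (T A)) ?v) (After (After ?TB ?w) ?v)"
      using loc_eq.After[OF loc_eq.cmp[OF w(1) T(1)[OF o(2)], of W] bw] unfolding e .
    also have "loc_eq C W B Z (After (After ?TB ?w) ?v) (After ?TB (After ?w ?v))"
      using loc_eq.sym[OF loc_eq.assoc[OF tb fw bw]] .
    also have "loc_eq C W B Z (After ?TB (After ?w ?v)) (After ?TB (Fwd B B (idt C B)))"
      using loc_eq.After[OF tb loc_eq.inv_right[where W = W, OF w]] .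
    also have "loc_eq C W B Z (After ?TB (Fwd B B (idt C B))) ?TB" using loc_eq.unit_right[OF tb] .
    finally show ?case by simp
  next
    case (After t u)
    then have wf: "zwf W t" "zwf W u" "zsrc t = ztgt u" by auto
    note IH = After.IH(1)[OF wf(1)] After.IH(2)[OF wf(2)]
    note et = loc_eq_zwf[OF wf(1)] and eu = loc_eq_zwf[OF wf(2)]
    have o: "ztgt t \<in> obj C" using zwf_obj[OF wf(1)] by blast
    note tt = loc_eq.Fwd[OF T(1)[OF o], of W]
    have "loc_eq C W (zsrc u) Z (After (Fwd (ztgt t) Z (T (ztgt t))) (After t u))
        (After (After (Fwd (ztgt t) Z (T (ztgt t))) t) u)"
      using loc_eq.assoc[OF tt et] eu wf(3) by simp
    also have "loc_eq C W (zsrc u) Z (After (After (Fwd (ztgt t) Z (T (ztgt t))) t) u)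
        (After (Fwd (ztgt u) Z (T (ztgt u))) u)"
      using loc_eq.After[OF IH(1)] eu wf(3) by simp
    also note IH(2)
    finally show ?case by simp
  qed
  have *: "a = loc_arrow C W X Z (T X)" if "a \<in> mor (loc_cat C W) X Z" for a
  proof -
    obtain t where t: "a = Collect (loc_eq C W X Z t)" "loc_eq C W X Z t t"
      using \<open>a \<in> _\<close> by (rule loc_mor_cases)
    note ty = loc_eq_typed[OF t(2)]
    then have o: "Z \<in> obj C" using zwf_obj by blast
    have "idt C Z = T Z" using T(2)[OF o] idt_mor[OF o] by blast
    then have "loc_eq C W X Z (After (Fwd Z Z (T Z)) t) t"
      using loc_eq.unit_left[OF t(2)] by simp
    then have "loc_eq C W X Z t (Fwd X Z (T X))"
      using key[of t] ty loc_eq.sym loc_eq.trans by metis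
    then show ?thesis unfolding t(1) loc_arrow_def by (rule loc_class_eq)
  qed
  show ?thesis using *[OF a(1)] *[OF a(2)] by simp
qed

text \<open>Mirror image of \<open>loc_terminal\<close>, with the canonical arrows out of
  \<open>Z\<close> composed on the source side.\<close>

lemma loc_initial:
  assumes Z: "\<And>X. X \<in> obj C \<Longrightarrow> \<exists>!f. f \<in> mor C Z X"
    and a: "a \<in> mor (loc_cat C W) Z X" "b \<in> mor (loc_cat C W) Z X"
  shows "a = b"
proof -
  note [trans] = loc_eq.trans
  define T where "T = (\<lambda>X. THE f. f \<in> mor C Z X)"
  have T: "T X \<in> mor C Z X" "f \<in> mor C Z X \<Longrightarrow> f = T X" if "X \<in> obj C" for X f
    using theI'[OF Z[OF that]] Z[OF that] unfolding T_def by blast+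
  have key: "loc_eq C W Z (ztgt t) (After t (Fwd Z (zsrc t) (T (zsrc t)))) (Fwd Z (ztgt t) (T (ztgt t)))"
    if "zwf W t" for t
    using that
  proof (induction t)
    case (Fwd A B f)
    then have f: "f \<in> mor C A B" by simp
    then have o: "A \<in> obj C" "B \<in> obj C" using mor_obj by auto
    have "cmp C f (T A) = T B" using T(2)[OF o(2)] cmp_mor[OF T(1)[OF o(1)] f] by blast
    then show ?case using loc_eq.sym[OF loc_eq.cmp[OF T(1)[OF o(1)] f, of W]] by simp
  next
    case (Bwd A B w)
    then have w: "w \<in> mor C A B" "W A B w" by auto
    then have o: "A \<in> obj C" "B \<in> obj C" using mor_obj by auto
    have e: "cmp C w (T A) = T B" using T(2)[OF o(2)] cmp_mor[OF T(1)[OF o(1)] w(1)] by blast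
    let ?TA = "Fwd Z A (T A)" and ?w = "Fwd A B w" and ?v = "Bwd A B w"
    note tb = loc_eq.Fwd[OF T(1)[OF o(1)], of W] and fw = loc_eq.Fwd[OF w(1), of W] and bw = loc_eq.Bwd[where W = W, OF w]
    have "loc_eq C W Z A (After ?v (Fwd Z B (T B))) (After ?v (After ?w ?TA))"
      using loc_eq.After[OF bw loc_eq.cmp[OF T(1)[OF o(1)] w(1), of W]] unfolding e .
    also have "loc_eq C W Z A (After ?v (After ?w ?TA)) (After (After ?v ?w) ?TA)"
      using loc_eq.assoc[OF bw fw tb] .
    also have "loc_eq C W Z A (After (After ?v ?w) ?TA) (After (Fwd A A (idt C A)) ?TA)"
      using loc_eq.After[OF loc_eq.inv_left[where W = W, OF w] tb] .
    also have "loc_eq C W Z A (After (Fwd A A (idt C A)) ?TA) ?TA" using loc_eq.unit_left[OF tb] .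
    finally show ?case by simp
  next
    case (After t u)
    then have wf: "zwf W t" "zwf W u" "zsrc t = ztgt u" by auto
    note IH = After.IH(1)[OF wf(1)] After.IH(2)[OF wf(2)]
    note et = loc_eq_zwf[OF wf(1)] and eu = loc_eq_zwf[OF wf(2)]
    have o: "zsrc u \<in> obj C" using zwf_obj[OF wf(2)] by blast
    note tt = loc_eq.Fwd[OF T(1)[OF o], of W]
    have "loc_eq C W Z (ztgt t) (After (After t u) (Fwd Z (zsrc u) (T (zsrc u))))
        (After t (After u (Fwd Z (zsrc u) (T (zsrc u)))))"
      using loc_eq.sym[OF loc_eq.assoc[OF et _ tt]] eu wf(3) by simp
    also have "loc_eq C W Z (ztgt t) (After t (After u (Fwd Z (zsrc u) (T (zsrc u)))))
        (After t (Fwd Z (ztgt u) (T (ztgt u))))"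
      using loc_eq.After[OF et] IH(2) wf(3) by simp
    also have "loc_eq C W Z (ztgt t) (After t (Fwd Z (ztgt u) (T (ztgt u)))) (Fwd Z (ztgt t) (T (ztgt t)))"
      using IH(1) wf(3) by simp
    finally show ?case by simp
  qed
  have *: "a = loc_arrow C W Z X (T X)" if "a \<in> mor (loc_cat C W) Z X" for a
  proof -
    obtain t where t: "a = Collect (loc_eq C W Z X t)" "loc_eq C W Z X t t"
      using \<open>a \<in> _\<close> by (rule loc_mor_cases)
    note ty = loc_eq_typed[OF t(2)]
    then have o: "Z \<in> obj C" using zwf_obj by blast
    have "idt C Z = T Z" using T(2)[OF o] idt_mor[OF o] by blast
    then have "loc_eq C W Z X (After t (Fwd Z Z (T Z))) t"
      using loc_eq.unit_right[OF t(2)] by simp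
    then have "loc_eq C W Z X t (Fwd Z X (T X))"
      using key[of t] ty loc_eq.sym loc_eq.trans by metis
    then show ?thesis unfolding t(1) loc_arrow_def by (rule loc_class_eq)
  qed
  show ?thesis using *[OF a(1)] *[OF a(2)] by simp
qed

text \<open>Gives zero objects, and with them zero arrows, in the derived category without any
  description of its hom-sets.\<close>

lemma zero_object_loc:
  assumes "zero_object C Z" shows "zero_object (loc_cat C W) Z"
proof -
  have o: "obj (loc_cat C W) = obj C" by (simp add: loc_cat_def)
  have Z: "\<exists>!f. f \<in> mor C X Z" "\<exists>!f. f \<in> mor C Z X" if "X \<in> obj C" for X
    using assms that by (auto simp: zero_object_def)
  show ?thesis
    unfolding zero_object_def o
  proof (intro conjI ballI)
    show "Z \<in> obj C" using assms by (simp add: zero_object_def)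
    fix X assume X: "X \<in> obj C"
    obtain f where "f \<in> mor C X Z" using Z(1)[OF X] by blast
    then show "\<exists>!f. f \<in> mor (loc_cat C W) X Z" using loc_arrow_mor loc_terminal[OF Z(1)] by metis
    obtain f where "f \<in> mor C Z X" using Z(2)[OF X] by blast
    then show "\<exists>!f. f \<in> mor (loc_cat C W) Z X" using loc_arrow_mor loc_initial[OF Z(2)] by metis
  qed
qed

text \<open>Factorizations through two zero objects are compared along the arrow \<open>k\<close>
  between them. This replaces the neutral element of a hom-group in a category without
  addition.\<close>

lemma zero_arrow_unique:
  assumes "zero_arrow C X Y f" "zero_arrow C X Y g" shows "f = g"
proof -
  obtain Z a b where f: "zero_object C Z" "a \<in> mor C X Z" "b \<in> mor C Z Y" "f = cmp C b a"
    using assms(1) by (auto simp: zero_arrow_def)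
  obtain Z' a' b' where g: "zero_object C Z'" "a' \<in> mor C X Z'" "b' \<in> mor C Z' Y" "g = cmp C b' a'"
    using assms(2) by (auto simp: zero_arrow_def)
  have o: "X \<in> obj C" "Y \<in> obj C" "Z \<in> obj C" "Z' \<in> obj C" using f g mor_obj by blast+
  obtain k where k: "k \<in> mor C Z Z'" using f(1) o by (auto simp: zero_object_def)
  have "cmp C k a = a'" using g(1,2) o cmp_mor[OF f(2) k] by (auto simp: zero_object_def)
  moreover have "cmp C b' k = b" using f(1,3) o cmp_mor[OF k g(3)] by (auto simp: zero_object_def)
  ultimately show ?thesis using cmp_assoc[OF f(2) k g(3)] f g by simp
qed

lemma zero_objects_isomorphic:
  assumes "zero_object C Z" "zero_object C Z'" shows "isomorphic C Z Z'"
proof -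
  have o: "Z \<in> obj C" "Z' \<in> obj C" using assms by (auto simp: zero_object_def)
  obtain f g where f: "f \<in> mor C Z Z'" "g \<in> mor C Z' Z" using assms o by (meson zero_object_def)
  have "cmp C g f = idt C Z" using assms(1) o(1) cmp_mor[OF f] idt_mor[OF o(1)] by (auto simp: zero_object_def)
  moreover have "cmp C f g = idt C Z'" using assms(2) o(2) cmp_mor[OF f(2,1)] idt_mor[OF o(2)] by (auto simp: zero_object_def)
  ultimately show ?thesis using f unfolding isomorphic_def iso_arrow_def by blast
qed

text \<open>
  No addition of arrows is available in the localization, so it is not known there that chain-level
  direct sums remain direct sums; it suffices that a direct sum is a retract of the chain-level one.
\<close>

lemma direct_sum_retract:
  assumes d: "direct_sum C X Y P i j p q"
    and m: "i' \<in> mor C X Z" "j' \<in> mor C Y Z" "p' \<in> mor C Z X" "q' \<in> mor C Z Y"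
    and e: "cmp C p' i' = idt C X" "cmp C q' j' = idt C Y"
      "zero_arrow C X Y (cmp C q' i')" "zero_arrow C Y X (cmp C p' j')"
  obtains h k where "h \<in> mor C P Z" "k \<in> mor C Z P" "cmp C k h = idt C P"
proof -
  note D = d[unfolded direct_sum_def is_product_def is_coproduct_def]
  have md: "i \<in> mor C X P" "j \<in> mor C Y P" "p \<in> mor C P X" "q \<in> mor C P Y" using D by blast+
  obtain h where h: "h \<in> mor C P Z" "cmp C h i = i'" "cmp C h j = j'" using D m by meson
  obtain k where k: "k \<in> mor C Z P" "cmp C p k = p'" "cmp C q k = q'" using D m by meson
  \<comment> \<open>The off-diagonal composites are zero arrows on both sides, so they agree
    although they pass through different objects.\<close>
  have "cmp C q' i' = cmp C q i" "cmp C p' j' = cmp C p j"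
    using zero_arrow_unique e D by blast+
  then have "cmp C (cmp C p' h) i = cmp C p i" "cmp C (cmp C p' h) j = cmp C p j"
    "cmp C (cmp C q' h) i = cmp C q i" "cmp C (cmp C q' h) j = cmp C q j"
    using cmp_assoc[OF md(1) h(1) m(3)] cmp_assoc[OF md(2) h(1) m(3)]
      cmp_assoc[OF md(1) h(1) m(4)] cmp_assoc[OF md(2) h(1) m(4)] h e D by simp_all
  moreover have "\<And>T s t. s \<in> mor C P T \<Longrightarrow> t \<in> mor C P T \<Longrightarrow> cmp C s i = cmp C t i \<Longrightarrow> cmp C s j = cmp C t j \<Longrightarrow> s = t"
  proof -
    fix T s t assume s: "s \<in> mor C P T" "t \<in> mor C P T" "cmp C s i = cmp C t i" "cmp C s j = cmp C t j"
    have "\<exists>!h. h \<in> mor C P T \<and> cmp C h i = cmp C t i \<and> cmp C h j = cmp C t j"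
      using D cmp_mor[OF md(1) s(2)] cmp_mor[OF md(2) s(2)] by blast
    then show "s = t" using s by blast
  qed
  ultimately have "cmp C p' h = p" "cmp C q' h = q"
    using cmp_mor[OF h(1) m(3)] cmp_mor[OF h(1) m(4)] md by blast+
  then have pq: "cmp C p (cmp C k h) = p" "cmp C q (cmp C k h) = q"
    using cmp_assoc[OF h(1) k(1) md(3)] cmp_assoc[OF h(1) k(1) md(4)] k by simp_all
  have o: "P \<in> obj C" using mor_obj md by blast
  have "\<exists>!h. h \<in> mor C P P \<and> cmp C p h = p \<and> cmp C q h = q" using D md by blast
  then have "cmp C k h = idt C P"
    using pq cmp_mor[OF h(1) k(1)] idt_mor[OF o] idt_right[OF md(3)] idt_right[OF md(4)] by blast
  then show ?thesis using that h k by blast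
qed

end


section \<open>Arrows with recorded source and target\<close>

context abelian_category
begin

lemma hom_carrier [simp]: "carrier (hom_group A X Y) = mor A X Y"
  and hom_mult [simp]: "x \<otimes>\<^bsub>hom_group A X Y\<^esub> y = madd A x y"
  and hom_one [simp]: "\<one>\<^bsub>hom_group A X Y\<^esub> = mzero A X Y"
  by (simp_all add: hom_group_def)

text \<open>
  An arrow is stored together with its source and target, and the operations below are total, with
  value \<open>None\<close> on ill-typed arguments. This makes associativity and distributivity unconditional
  rewrite rules.
\<close>

definition wt :: "('o \<times> 'o \<times> 'm) option \<Rightarrow> bool" where
  "wt a \<longleftrightarrow> (\<exists>X Y f. a = Some (X, Y, f) \<and> f \<in> mor A X Y)"

definition src :: "('o \<times> 'o \<times> 'm) option \<Rightarrow> 'o" where "src a = fst (the a)"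
definition tgt :: "('o \<times> 'o \<times> 'm) option \<Rightarrow> 'o" where "tgt a = fst (snd (the a))"
definition und :: "('o \<times> 'o \<times> 'm) option \<Rightarrow> 'm" where "und a = snd (snd (the a))"

definition compose (infixr "\<cdot>" 75) where
  "a \<cdot> b = (if wt a \<and> wt b \<and> src a = tgt b
     then Some (src b, tgt a, cmp A (und a) (und b)) else None)"

definition plus_arr (infixl "\<oplus>" 65) where
  "a \<oplus> b = (if wt a \<and> wt b \<and> src a = src b \<and> tgt a = tgt b
     then Some (src a, tgt a, madd A (und a) (und b)) else None)"

definition minus_arr ("\<ominus> _" [80] 80) where
  "\<ominus> a = (if wt a then Some (src a, tgt a, inv\<^bsub>hom_group A (src a) (tgt a)\<^esub> (und a)) else None)"

definition zarr :: "'o \<Rightarrow> 'o \<Rightarrow> ('o \<times> 'o \<times> 'm) option" where "zarr X Y = Some (X, Y, mzero A X Y)"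
definition ident :: "'o \<Rightarrow> ('o \<times> 'o \<times> 'm) option" where "ident X = Some (X, X, idt A X)"

lemma wt_Some [simp]: "wt (Some (X, Y, f)) \<longleftrightarrow> f \<in> mor A X Y"
  and src_Some [simp]: "src (Some (X, Y, f)) = X"
  and tgt_Some [simp]: "tgt (Some (X, Y, f)) = Y"
  and und_Some [simp]: "und (Some (X, Y, f)) = f"
  and wt_None [simp]: "\<not> wt None"
  by (auto simp: wt_def src_def tgt_def und_def)

lemma und_mor: "wt a \<Longrightarrow> und a \<in> mor A (src a) (tgt a)"
  by (auto simp: wt_def)

lemma wt_eta: "wt a \<Longrightarrow> Some (src a, tgt a, und a) = a"
  by (auto simp: wt_def)

lemma wt_obj [simp]: "wt a \<Longrightarrow> src a \<in> obj A" "wt a \<Longrightarrow> tgt a \<in> obj A"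
  using mor_obj by (auto simp: wt_def)

lemma all_wt: "(\<forall>t. wt t \<longrightarrow> P t) \<longleftrightarrow> (\<forall>X Y. \<forall>f \<in> mor A X Y. P (Some (X, Y, f)))"
  by (auto simp: wt_def)

section \<open>Additive structure of the hom-sets\<close>

lemma madd_mor: "f \<in> mor A X Y \<Longrightarrow> g \<in> mor A X Y \<Longrightarrow> madd A f g \<in> mor A X Y"
  using comm_group.axioms(1)[OF hom_group[of X Y]] mor_obj
  by (metis comm_monoid.axioms(1) hom_carrier hom_mult monoid.m_closed)

lemma madd_comm: "f \<in> mor A X Y \<Longrightarrow> g \<in> mor A X Y \<Longrightarrow> madd A f g = madd A g f"
  using comm_group.axioms(1)[OF hom_group[of X Y]] mor_obj
  by (metis comm_monoid.m_comm hom_carrier hom_mult)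

lemma madd_assoc: "f \<in> mor A X Y \<Longrightarrow> g \<in> mor A X Y \<Longrightarrow> h \<in> mor A X Y \<Longrightarrow>
    madd A (madd A f g) h = madd A f (madd A g h)"
  using comm_group.axioms(1)[OF hom_group[of X Y]] mor_obj
  by (metis comm_monoid.axioms(1) monoid.m_assoc hom_carrier hom_mult)

lemma mzero_mor: "X \<in> obj A \<Longrightarrow> Y \<in> obj A \<Longrightarrow> mzero A X Y \<in> mor A X Y"
  using comm_group.axioms(1)[OF hom_group[of X Y]]
  by (metis comm_monoid.axioms(1) hom_carrier hom_one monoid.one_closed)

lemma madd_mzero: "f \<in> mor A X Y \<Longrightarrow> madd A f (mzero A X Y) = f"
  using comm_group.axioms(1)[OF hom_group[of X Y]] mor_obj
  by (metis comm_monoid.axioms(1) hom_carrier hom_one hom_mult monoid.r_one)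

lemma group_hom: "f \<in> mor A X Y \<Longrightarrow> group (hom_group A X Y)"
  using hom_group[of X Y] mor_obj by (auto simp: comm_group_def)

lemma neg_mor: "f \<in> mor A X Y \<Longrightarrow> inv\<^bsub>hom_group A X Y\<^esub> f \<in> mor A X Y"
  using group.inv_closed[OF group_hom] by fastforce

lemma madd_neg: "f \<in> mor A X Y \<Longrightarrow> madd A f (inv\<^bsub>hom_group A X Y\<^esub> f) = mzero A X Y"
  using group.r_inv[OF group_hom] by fastforce

text \<open>Serves to show that composing with a zero arrow gives zero, because g0 + g0 = g(0 + 0) =
  g0.\<close>

lemma madd_idem:
  assumes "f \<in> mor A X Y" "madd A f f = f" shows "f = mzero A X Y"
  using group.l_cancel_one[OF group_hom[OF assms(1)], of f f] assms by simp

lemma cmp_mzero: "g \<in> mor A Y Z \<Longrightarrow> X \<in> obj A \<Longrightarrow> cmp A g (mzero A X Y) = mzero A X Z"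
  using cmp_add_right[of "mzero A X Y" X Y "mzero A X Y" g Z] madd_mzero[of "mzero A X Y"] mzero_mor
    mor_obj cmp_mor madd_idem by metis

lemma mzero_cmp: "f \<in> mor A X Y \<Longrightarrow> Z \<in> obj A \<Longrightarrow> cmp A (mzero A Y Z) f = mzero A X Z"
  using cmp_add_left[of f X Y "mzero A Y Z" Z "mzero A Y Z"] madd_mzero[of "mzero A Y Z"] mzero_mor
    mor_obj cmp_mor madd_idem by metis

section \<open>Rewrite rules for typed arrows\<close>

lemma wt_compose [simp]: "wt (a \<cdot> b) \<longleftrightarrow> wt a \<and> wt b \<and> src a = tgt b"
  and src_compose [simp]: "wt a \<Longrightarrow> wt b \<Longrightarrow> src a = tgt b \<Longrightarrow> src (a \<cdot> b) = src b"
  and tgt_compose [simp]: "wt a \<Longrightarrow> wt b \<Longrightarrow> src a = tgt b \<Longrightarrow> tgt (a \<cdot> b) = tgt a"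
  by (auto simp: compose_def intro: cmp_mor und_mor dest: und_mor)
     (metis cmp_mor und_mor)

lemma wt_plus_arr [simp]: "wt (a \<oplus> b) \<longleftrightarrow> wt a \<and> wt b \<and> src a = src b \<and> tgt a = tgt b"
  and src_plus_arr [simp]: "wt a \<Longrightarrow> wt b \<Longrightarrow> src a = src b \<Longrightarrow> tgt a = tgt b \<Longrightarrow> src (a \<oplus> b) = src b"
  and tgt_plus_arr [simp]: "wt a \<Longrightarrow> wt b \<Longrightarrow> src a = src b \<Longrightarrow> tgt a = tgt b \<Longrightarrow> tgt (a \<oplus> b) = tgt b"
  by (auto simp: plus_arr_def) (metis madd_mor und_mor)

lemma wt_minus_arr [simp]: "wt (\<ominus> a) \<longleftrightarrow> wt a"
  and src_minus_arr [simp]: "wt a \<Longrightarrow> src (\<ominus> a) = src a"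
  and tgt_minus_arr [simp]: "wt a \<Longrightarrow> tgt (\<ominus> a) = tgt a"
  by (auto simp: minus_arr_def neg_mor und_mor)

lemma wt_zarr [simp]: "wt (zarr X Y) \<longleftrightarrow> X \<in> obj A \<and> Y \<in> obj A"
  and src_zarr [simp]: "src (zarr X Y) = X"
  and tgt_zarr [simp]: "tgt (zarr X Y) = Y"
  and wt_ident [simp]: "wt (ident X) \<longleftrightarrow> X \<in> obj A"
  and src_ident [simp]: "src (ident X) = X"
  and tgt_ident [simp]: "tgt (ident X) = X"
  using mor_obj by (auto simp: zarr_def ident_def mzero_mor idt_mor)

lemma compose_Some: "f \<in> mor A X Y \<Longrightarrow> g \<in> mor A Y Z \<Longrightarrow>
    Some (Y, Z, g) \<cdot> Some (X, Y, f) = Some (X, Z, cmp A g f)"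
  by (simp add: compose_def)

lemma plus_arr_Some: "f \<in> mor A X Y \<Longrightarrow> g \<in> mor A X Y \<Longrightarrow>
    Some (X, Y, f) \<oplus> Some (X, Y, g) = Some (X, Y, madd A f g)"
  by (simp add: plus_arr_def)

lemma minus_arr_Some: "f \<in> mor A X Y \<Longrightarrow>
    \<ominus> Some (X, Y, f) = Some (X, Y, inv\<^bsub>hom_group A X Y\<^esub> f)"
  by (simp add: minus_arr_def)

text \<open>Unconditional rules must also hold for ill-typed arguments. There both sides are
  \<open>None\<close>, which is what these facts supply.\<close>

lemma not_wt: "\<not> wt (a \<cdot> b) \<Longrightarrow> a \<cdot> b = None"
  "\<not> wt (a \<oplus> b) \<Longrightarrow> a \<oplus> b = None"
  "\<not> wt (\<ominus> a) \<Longrightarrow> \<ominus> a = None"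
  unfolding wt_compose wt_plus_arr wt_minus_arr by (auto simp: compose_def plus_arr_def minus_arr_def)

lemma compose_assoc [simp]: "(a \<cdot> b) \<cdot> c = a \<cdot> (b \<cdot> c)"
  by (cases a; cases b; cases c) (auto simp: compose_def cmp_mor intro: cmp_assoc[symmetric])

lemma plus_arr_comm: "a \<oplus> b = b \<oplus> a"
  by (cases a; cases b) (auto simp: plus_arr_def intro: madd_comm)

lemma plus_arr_assoc: "(a \<oplus> b) \<oplus> c = a \<oplus> (b \<oplus> c)"
  by (cases a; cases b; cases c) (auto simp: plus_arr_def madd_mor intro: madd_assoc)

lemma plus_arr_left_comm: "a \<oplus> (b \<oplus> c) = b \<oplus> (a \<oplus> c)"
  unfolding plus_arr_assoc[symmetric] by (simp only: plus_arr_comm[of a b])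

lemmas plus_arr_ac = plus_arr_assoc plus_arr_comm plus_arr_left_comm

lemma compose_plus_arr [simp]: "a \<cdot> (b \<oplus> c) = a \<cdot> b \<oplus> a \<cdot> c"
  by (cases a; cases b; cases c) (auto simp: compose_def plus_arr_def cmp_mor madd_mor intro: cmp_add_right)

lemma plus_arr_compose [simp]: "(b \<oplus> c) \<cdot> a = b \<cdot> a \<oplus> c \<cdot> a"
  by (cases a; cases b; cases c) (auto simp: compose_def plus_arr_def cmp_mor madd_mor intro: cmp_add_left)

lemma compose_zarr [simp]: "wt a \<Longrightarrow> src a = Y \<Longrightarrow> X \<in> obj A \<Longrightarrow> a \<cdot> zarr X Y = zarr X (tgt a)"
  by (auto simp: wt_def zarr_def compose_def mzero_mor mor_obj cmp_mzero dest: mor_obj)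

lemma zarr_compose [simp]: "wt a \<Longrightarrow> tgt a = X \<Longrightarrow> Y \<in> obj A \<Longrightarrow> zarr X Y \<cdot> a = zarr (src a) Y"
  by (auto simp: wt_def zarr_def compose_def mzero_mor mor_obj mzero_cmp dest: mor_obj)

lemma compose_ident [simp]: "wt a \<Longrightarrow> src a = X \<Longrightarrow> a \<cdot> ident X = a"
  and ident_compose [simp]: "wt a \<Longrightarrow> tgt a = X \<Longrightarrow> ident X \<cdot> a = a"
  by (auto simp: wt_def ident_def compose_def idt_mor mor_obj idt_left idt_right dest: mor_obj)

lemma plus_arr_zarr [simp]: "wt a \<Longrightarrow> src a = X \<Longrightarrow> tgt a = Y \<Longrightarrow> a \<oplus> zarr X Y = a"
  by (auto simp: wt_def zarr_def plus_arr_def mzero_mor mor_obj madd_mzero dest: mor_obj)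

lemma zarr_plus_arr [simp]: "wt a \<Longrightarrow> src a = X \<Longrightarrow> tgt a = Y \<Longrightarrow> zarr X Y \<oplus> a = a"
  using plus_arr_zarr plus_arr_comm by metis

lemma plus_arr_minus_arr [simp]: "wt a \<Longrightarrow> a \<oplus> \<ominus> a = zarr (src a) (tgt a)"
  by (auto simp: wt_def zarr_def plus_arr_def neg_mor minus_arr_def madd_neg)

lemma minus_arr_plus_arr_self [simp]: "wt a \<Longrightarrow> \<ominus> a \<oplus> a = zarr (src a) (tgt a)"
  using plus_arr_minus_arr plus_arr_comm by metis

lemma plus_arr_minus_arr_cancel [simp]: "wt b \<Longrightarrow> wt a \<Longrightarrow> src a = src b \<Longrightarrow> tgt a = tgt b \<Longrightarrow> a \<oplus> (\<ominus> a \<oplus> b) = b"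
  by (metis plus_arr_assoc plus_arr_minus_arr zarr_plus_arr)

lemma minus_arr_plus_arr_cancel [simp]: "wt b \<Longrightarrow> wt a \<Longrightarrow> src a = src b \<Longrightarrow> tgt a = tgt b \<Longrightarrow> \<ominus> a \<oplus> (a \<oplus> b) = b"
  by (metis plus_arr_assoc minus_arr_plus_arr_self zarr_plus_arr)

lemma plus_arr_eq_zarr:
  assumes "wt a" "wt b" "src a = X" "src b = X" "tgt a = Y" "tgt b = Y" "a \<oplus> b = zarr X Y"
  shows "b = \<ominus> a"
  using assms minus_arr_plus_arr_cancel[of b a] by simp

lemma minus_arr_minus_arr [simp]: "wt a \<Longrightarrow> \<ominus> \<ominus> a = a"
  using plus_arr_eq_zarr[of "\<ominus> a" a "src a" "tgt a"] by simp

lemma minus_arr_plus_arr [simp]: "\<ominus> (a \<oplus> b) = \<ominus> a \<oplus> \<ominus> b"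
proof (cases "wt (a \<oplus> b)")
  case True
  then have w: "wt a" "wt b" "src a = src b" "tgt a = tgt b" by auto
  have "(a \<oplus> b) \<oplus> (\<ominus> a \<oplus> \<ominus> b) = (a \<oplus> \<ominus> a) \<oplus> (b \<oplus> \<ominus> b)"
    by (simp only: plus_arr_ac)
  also have "\<dots> = zarr (src b) (tgt b)" using w by simp
  finally show ?thesis using w plus_arr_eq_zarr[of "a \<oplus> b" "\<ominus> a \<oplus> \<ominus> b" "src b" "tgt b"] by simp
next
  case False
  then have "\<not> wt (\<ominus> (a \<oplus> b))" "\<not> wt (\<ominus> a \<oplus> \<ominus> b)"
    by (metis wt_minus_arr) (metis False wt_plus_arr wt_minus_arr src_minus_arr tgt_minus_arr)
  then show ?thesis using not_wt(3)[of "a \<oplus> b"] not_wt(2)[of "\<ominus> a" "\<ominus> b"] by metis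
qed

lemma compose_minus_arr [simp]: "a \<cdot> \<ominus> b = \<ominus> (a \<cdot> b)"
proof (cases "wt (a \<cdot> b)")
  case True
  then have w: "wt a" "wt b" "src a = tgt b" by auto
  have "a \<cdot> b \<oplus> a \<cdot> \<ominus> b = zarr (src b) (tgt a)"
    using w by (simp flip: compose_plus_arr)
  then show ?thesis using w by (intro plus_arr_eq_zarr[of "a \<cdot> b" "a \<cdot> \<ominus> b" "src b" "tgt a"]) simp_all
next
  case False
  then have "\<not> wt (a \<cdot> \<ominus> b)" "\<not> wt (\<ominus> (a \<cdot> b))"
    by (metis wt_compose wt_minus_arr tgt_minus_arr) (metis False wt_minus_arr)
  then show ?thesis using not_wt(1)[of a "\<ominus> b"] not_wt(3)[of "a \<cdot> b"] by metis
qed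

lemma minus_arr_compose [simp]: "\<ominus> a \<cdot> b = \<ominus> (a \<cdot> b)"
proof (cases "wt (a \<cdot> b)")
  case True
  then have w: "wt a" "wt b" "src a = tgt b" by auto
  have "a \<cdot> b \<oplus> \<ominus> a \<cdot> b = zarr (src b) (tgt a)"
    using w by (simp flip: plus_arr_compose)
  then show ?thesis using w by (intro plus_arr_eq_zarr[of "a \<cdot> b" "\<ominus> a \<cdot> b" "src b" "tgt a"]) simp_all
next
  case False
  then have "\<not> wt (\<ominus> a \<cdot> b)" "\<not> wt (\<ominus> (a \<cdot> b))"
    by (metis wt_compose wt_minus_arr src_minus_arr) (metis False wt_minus_arr)
  then show ?thesis using not_wt(1)[of "\<ominus> a" b] not_wt(3)[of "a \<cdot> b"] by metis
qed

lemma minus_arr_zarr [simp]: "X \<in> obj A \<Longrightarrow> Y \<in> obj A \<Longrightarrow> \<ominus> zarr X Y = zarr X Y"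
  using plus_arr_eq_zarr[of "zarr X Y" "zarr X Y" X Y] by simp

lemma minus_arr_eq_zarr: "wt a \<Longrightarrow> \<ominus> a = zarr X Y \<longleftrightarrow> a = zarr X Y"
  by (metis minus_arr_minus_arr minus_arr_zarr src_minus_arr tgt_minus_arr wt_minus_arr wt_obj src_zarr tgt_zarr)

text \<open>Normal forms are associated to the right, so a known composite inside a longer chain is
  visible only in this form.\<close>

lemma compose_cong_right: "a \<cdot> b = c \<Longrightarrow> a \<cdot> (b \<cdot> x) = c \<cdot> x"
  by (metis compose_assoc)

section \<open>Monomorphisms, epimorphisms, kernels and cokernels\<close>

definition mon where
  "mon a \<longleftrightarrow> wt a \<and> (\<forall>s. wt s \<longrightarrow> tgt s = src a \<longrightarrow> a \<cdot> s = zarr (src s) (tgt a) \<longrightarrow> s = zarr (src s) (src a))"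

definition epi where
  "epi a \<longleftrightarrow> wt a \<and> (\<forall>s. wt s \<longrightarrow> src s = tgt a \<longrightarrow> s \<cdot> a = zarr (src a) (tgt s) \<longrightarrow> s = zarr (tgt a) (tgt s))"

lemma mon_wt [simp]: "mon a \<Longrightarrow> wt a" and epi_wt [simp]: "epi a \<Longrightarrow> wt a"
  by (auto simp: mon_def epi_def)

lemma moD:
  assumes "mon a" "wt s" "tgt s = src a" "src s = T" "src a = X" "tgt a = Y" "a \<cdot> s = zarr T Y"
  shows "s = zarr T X"
  using assms unfolding mon_def by blast

lemma epD:
  assumes "epi a" "wt s" "src s = tgt a" "tgt s = T" "src a = X" "tgt a = Y" "s \<cdot> a = zarr X T"
  shows "s = zarr Y T"
  using assms unfolding epi_def by blast

text \<open>The definition of \<open>mon\<close> tests only against zero composites. This suffices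
  because hom-sets are groups: apply the test to the difference of the two arrows.\<close>

lemma mon_cancel:
  assumes "mon a" "wt s" "wt t" "tgt s = src a" "tgt t = src a" "src s = src t" "a \<cdot> s = a \<cdot> t"
  shows "s = t"
proof -
  have "a \<cdot> (s \<oplus> \<ominus> t) = zarr (src t) (tgt a)" using assms by simp
  then have "s \<oplus> \<ominus> t = zarr (src t) (src a)" using moD[of a "s \<oplus> \<ominus> t" "src t" "src a" "tgt a"] assms by simp
  then have "\<ominus> t = \<ominus> s" using plus_arr_eq_zarr[of s "\<ominus> t" "src t" "src a"] assms by simp
  then show ?thesis using assms by (metis minus_arr_minus_arr)
qed

lemma epi_cancel:
  assumes "epi a" "wt s" "wt t" "src s = tgt a" "src t = tgt a" "tgt s = tgt t" "s \<cdot> a = t \<cdot> a"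
  shows "s = t"
proof -
  have "(s \<oplus> \<ominus> t) \<cdot> a = zarr (src a) (tgt t)" using assms by simp
  then have "s \<oplus> \<ominus> t = zarr (tgt a) (tgt t)" using epD[of a "s \<oplus> \<ominus> t" "tgt t" "src a" "tgt a"] assms by simp
  then have "\<ominus> t = \<ominus> s" using plus_arr_eq_zarr[of s "\<ominus> t" "tgt a" "tgt t"] assms by simp
  then show ?thesis using assms by (metis minus_arr_minus_arr)
qed

lemma mon_compose:
  assumes "mon a" "mon b" "src a = tgt b" shows "mon (a \<cdot> b)"
  unfolding mon_def
proof (intro conjI allI impI)
  fix s assume s: "wt s" "tgt s = src (a \<cdot> b)" "(a \<cdot> b) \<cdot> s = zarr (src s) (tgt (a \<cdot> b))"
  then have "b \<cdot> s = zarr (src s) (src a)"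
    using moD[of a "b \<cdot> s" "src s" "src a" "tgt a"] assms by simp
  then show "s = zarr (src s) (src (a \<cdot> b))"
    using moD[of b s "src s" "src b" "tgt b"] s assms by simp
qed (use assms in simp)

lemma epi_compose:
  assumes "epi a" "epi b" "src a = tgt b" shows "epi (a \<cdot> b)"
  unfolding epi_def
proof (intro conjI allI impI)
  fix s assume s: "wt s" "src s = tgt (a \<cdot> b)" "s \<cdot> a \<cdot> b = zarr (src (a \<cdot> b)) (tgt s)"
  then have "s \<cdot> a = zarr (src a) (tgt s)"
    using epD[of b "s \<cdot> a" "tgt s" "src b" "tgt b"] assms by simp
  then show "s = zarr (tgt (a \<cdot> b)) (tgt s)"
    using epD[of a s "tgt s" "src a" "tgt a"] s assms by simp
qed (use assms in simp)

lemma mon_ident [simp]: "X \<in> obj A \<Longrightarrow> mon (ident X)" and epi_ident [simp]: "X \<in> obj A \<Longrightarrow> epi (ident X)"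
  unfolding mon_def epi_def by (simp_all only: wt_ident src_ident tgt_ident ident_compose compose_ident) auto

lemma monic_iff: "monic A X Y f \<longleftrightarrow> mon (Some (X, Y, f))"
proof
  assume m: "monic A X Y f"
  then have f: "f \<in> mor A X Y" by (simp add: monic_def)
  show "mon (Some (X, Y, f))"
    unfolding mon_def all_wt
  proof (intro conjI ballI allI impI)
    fix T X' s assume s: "s \<in> mor A T X'" "tgt (Some (T, X', s)) = src (Some (X, Y, f))"
      "Some (X, Y, f) \<cdot> Some (T, X', s) = zarr (src (Some (T, X', s))) (tgt (Some (X, Y, f)))"
    then have "cmp A f s = cmp A f (mzero A T X)" "T \<in> obj A" "X \<in> obj A"
      using f mor_obj by (auto simp: compose_Some zarr_def cmp_mzero)
    then show "Some (T, X', s) = zarr (src (Some (T, X', s))) (src (Some (X, Y, f)))"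
      using m s mzero_mor by (auto simp: monic_def zarr_def)
  qed (simp add: f)
next
  assume m: "mon (Some (X, Y, f))"
  then have f: "f \<in> mor A X Y" using mon_wt by fastforce
  have "s = t" if "s \<in> mor A T X" "t \<in> mor A T X" "cmp A f s = cmp A f t" for T s t
    using mon_cancel[OF m, of "Some (T, X, s)" "Some (T, X, t)"] that f by (simp add: compose_Some)
  then show "monic A X Y f" using f by (auto simp: monic_def)
qed

lemma epic_iff: "epic A X Y f \<longleftrightarrow> epi (Some (X, Y, f))"
proof
  assume m: "epic A X Y f"
  then have f: "f \<in> mor A X Y" by (simp add: epic_def)
  show "epi (Some (X, Y, f))"
    unfolding epi_def all_wt
  proof (intro conjI ballI allI impI)
    fix Y' T s assume s: "s \<in> mor A Y' T" "src (Some (Y', T, s)) = tgt (Some (X, Y, f))"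
      "Some (Y', T, s) \<cdot> Some (X, Y, f) = zarr (src (Some (X, Y, f))) (tgt (Some (Y', T, s)))"
    then have "cmp A s f = cmp A (mzero A Y T) f" "T \<in> obj A" "Y \<in> obj A"
      using f mor_obj by (auto simp: compose_Some zarr_def mzero_cmp)
    then show "Some (Y', T, s) = zarr (tgt (Some (X, Y, f))) (tgt (Some (Y', T, s)))"
      using m s mzero_mor by (auto simp: epic_def zarr_def)
  qed (simp add: f)
next
  assume m: "epi (Some (X, Y, f))"
  then have f: "f \<in> mor A X Y" using epi_wt by fastforce
  have "s = t" if "s \<in> mor A Y T" "t \<in> mor A Y T" "cmp A s f = cmp A t f" for T s t
    using epi_cancel[OF m, of "Some (Y, T, s)" "Some (Y, T, t)"] that f by (simp add: compose_Some)
  then show "epic A X Y f" using f by (auto simp: epic_def)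
qed

text \<open>Uniqueness of the factorization is encoded by asking \<open>k\<close> to be a
  monomorphism. The link to the original notion is \<open>is_kernel_iff\<close>.\<close>

definition ker where
  "ker f k \<longleftrightarrow> wt f \<and> mon k \<and> tgt k = src f \<and> f \<cdot> k = zarr (src k) (tgt f) \<and>
    (\<forall>t. wt t \<longrightarrow> tgt t = src f \<longrightarrow> f \<cdot> t = zarr (src t) (tgt f) \<longrightarrow>
      (\<exists>u. wt u \<and> src u = src t \<and> tgt u = src k \<and> k \<cdot> u = t))"

definition coker where
  "coker f c \<longleftrightarrow> wt f \<and> epi c \<and> src c = tgt f \<and> c \<cdot> f = zarr (src f) (tgt c) \<and>
    (\<forall>t. wt t \<longrightarrow> src t = tgt f \<longrightarrow> t \<cdot> f = zarr (src f) (tgt t) \<longrightarrow>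
      (\<exists>u. wt u \<and> src u = tgt c \<and> tgt u = tgt t \<and> u \<cdot> c = t))"

lemma krD:
  assumes "ker f k" shows "wt f" "mon k" "wt k" "tgt k = src f" "f \<cdot> k = zarr (src k) (tgt f)"
  using assms by (auto simp: ker_def)

lemma ckD:
  assumes "coker f c" shows "wt f" "epi c" "wt c" "src c = tgt f" "c \<cdot> f = zarr (src f) (tgt c)"
  using assms by (auto simp: coker_def)

lemma ker_lift:
  assumes "ker f k" "wt t" "tgt t = src f" "f \<cdot> t = zarr (src t) (tgt f)"
  obtains u where "wt u" "src u = src t" "tgt u = src k" "k \<cdot> u = t"
  using assms by (auto simp: ker_def)

lemma coker_desc:
  assumes "coker f c" "wt t" "src t = tgt f" "t \<cdot> f = zarr (src f) (tgt t)"
  obtains u where "wt u" "src u = tgt c" "tgt u = tgt t" "u \<cdot> c = t"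
  using assms by (auto simp: coker_def)

lemma is_kernel_iff: "is_kernel A X Y f K k \<longleftrightarrow> ker (Some (X, Y, f)) (Some (K, X, k))"
proof
  assume i: "is_kernel A X Y f K k"
  then have m: "f \<in> mor A X Y" "k \<in> mor A K X" and z: "cmp A f k = mzero A K Y"
    by (auto simp: is_kernel_def)
  have u: "\<exists>!u. u \<in> mor A T K \<and> cmp A k u = t" if "t \<in> mor A T X" "cmp A f t = mzero A T Y" for T t
    using i that by (auto simp: is_kernel_def)
  have "monic A K X k"
    unfolding monic_def
  proof (intro conjI allI ballI impI m)
    fix T s t assume stalk: "s \<in> mor A T K" "t \<in> mor A T K" "cmp A k s = cmp A k t"
    have "cmp A f (cmp A k t) = mzero A T Y"
      using cmp_assoc[OF stalk(2) m(2,1)] z mzero_cmp[OF stalk(2)] mor_obj[OF m(1)] by simp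
    then show "s = t" using u[of "cmp A k t" T] stalk m cmp_mor by metis
  qed
  then show "ker (Some (X, Y, f)) (Some (K, X, k))"
    unfolding ker_def
  proof (intro conjI allI impI)
    fix t assume t: "wt t" "tgt t = src (Some (X, Y, f))"
      "Some (X, Y, f) \<cdot> t = zarr (src t) (tgt (Some (X, Y, f)))"
    then have "und t \<in> mor A (src t) X" "cmp A f (und t) = mzero A (src t) Y"
      using m und_mor[of t] by (auto simp: compose_def zarr_def)
    then obtain v where "v \<in> mor A (src t) K" "cmp A k v = und t" using u by blast
    then show "\<exists>u. wt u \<and> src u = src t \<and> tgt u = src (Some (K, X, k)) \<and> Some (K, X, k) \<cdot> u = t"
      using t m wt_eta[of t] by (intro exI[of _ "Some (src t, K, v)"]) (auto simp: compose_Some)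
  qed (use m z in \<open>auto simp: monic_iff compose_Some zarr_def\<close>)
next
  assume k: "ker (Some (X, Y, f)) (Some (K, X, k))"
  note d = krD[OF k]
  then have m: "f \<in> mor A X Y" "k \<in> mor A K X" by simp_all
  show "is_kernel A X Y f K k"
    unfolding is_kernel_def
  proof (intro conjI allI ballI impI m)
    show "cmp A f k = mzero A K Y" using d(5) m by (simp add: compose_Some zarr_def)
    fix T t assume t: "t \<in> mor A T X" "cmp A f t = mzero A T Y"
    obtain u where u: "wt u" "src u = T" "tgt u = K" "Some (K, X, k) \<cdot> u = Some (T, X, t)"
      using ker_lift[OF k, of "Some (T, X, t)"] t m by (auto simp: compose_Some zarr_def)
    have "und u \<in> mor A T K" "cmp A k (und u) = t"
      using u m und_mor[of u] by (auto simp: compose_def split: if_splits)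
    then show "\<exists>!u. u \<in> mor A T K \<and> cmp A k u = t"
      using d(2) unfolding monic_iff[symmetric] monic_def by blast
  qed
qed

lemma is_cokernel_iff: "is_cokernel A X Y f Q c \<longleftrightarrow> coker (Some (X, Y, f)) (Some (Y, Q, c))"
proof
  assume i: "is_cokernel A X Y f Q c"
  then have m: "f \<in> mor A X Y" "c \<in> mor A Y Q" and z: "cmp A c f = mzero A X Q"
    by (auto simp: is_cokernel_def)
  have u: "\<exists>!u. u \<in> mor A Q T \<and> cmp A u c = t" if "t \<in> mor A Y T" "cmp A t f = mzero A X T" for T t
    using i that by (auto simp: is_cokernel_def)
  have "epic A Y Q c"
    unfolding epic_def
  proof (intro conjI allI ballI impI m)
    fix T s t assume stalk: "s \<in> mor A Q T" "t \<in> mor A Q T" "cmp A s c = cmp A t c"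
    have "cmp A (cmp A t c) f = mzero A X T"
      using cmp_assoc[OF m stalk(2)] z cmp_mzero[OF stalk(2)] mor_obj[OF m(1)] by simp
    then show "s = t" using u[of "cmp A t c" T] stalk m cmp_mor by metis
  qed
  then show "coker (Some (X, Y, f)) (Some (Y, Q, c))"
    unfolding coker_def
  proof (intro conjI allI impI)
    fix t assume t: "wt t" "src t = tgt (Some (X, Y, f))"
      "t \<cdot> Some (X, Y, f) = zarr (src (Some (X, Y, f))) (tgt t)"
    then have "und t \<in> mor A Y (tgt t)" "cmp A (und t) f = mzero A X (tgt t)"
      using m und_mor[of t] by (auto simp: compose_def zarr_def)
    then obtain v where "v \<in> mor A Q (tgt t)" "cmp A v c = und t" using u by blast
    then show "\<exists>u. wt u \<and> src u = tgt (Some (Y, Q, c)) \<and> tgt u = tgt t \<and> u \<cdot> Some (Y, Q, c) = t"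
      using t m wt_eta[of t] by (intro exI[of _ "Some (Q, tgt t, v)"]) (auto simp: compose_Some)
  qed (use m z in \<open>auto simp: epic_iff compose_Some zarr_def\<close>)
next
  assume k: "coker (Some (X, Y, f)) (Some (Y, Q, c))"
  note d = ckD[OF k]
  then have m: "f \<in> mor A X Y" "c \<in> mor A Y Q" by simp_all
  show "is_cokernel A X Y f Q c"
    unfolding is_cokernel_def
  proof (intro conjI allI ballI impI m)
    show "cmp A c f = mzero A X Q" using d(5) m by (simp add: compose_Some zarr_def)
    fix T t assume t: "t \<in> mor A Y T" "cmp A t f = mzero A X T"
    obtain u where u: "wt u" "src u = Q" "tgt u = T" "u \<cdot> Some (Y, Q, c) = Some (Y, T, t)"
      using coker_desc[OF k, of "Some (Y, T, t)"] t m by (auto simp: compose_Some zarr_def)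
    have "und u \<in> mor A Q T" "cmp A (und u) c = t"
      using u m und_mor[of u] by (auto simp: compose_def split: if_splits)
    then show "\<exists>!u. u \<in> mor A Q T \<and> cmp A u c = t"
      using d(2) unfolding epic_iff[symmetric] epic_def by blast
  qed
qed

lemma ex_ker: assumes "wt f" obtains k where "ker f k"
  using assms ex_kernel unfolding wt_def is_kernel_iff by blast

lemma ex_coker: assumes "wt f" obtains c where "coker f c"
  using assms ex_cokernel unfolding wt_def is_cokernel_iff by blast

lemma mon_ker: assumes "mon f" obtains g where "ker g f"
proof -
  obtain X Y f' where "f = Some (X, Y, f')" using mon_wt[OF assms] by (auto simp: wt_def)
  then show ?thesis using that assms monic_is_kernel[of X Y f'] by (auto simp: monic_iff is_kernel_iff)
qed

lemma epi_coker: assumes "epi f" obtains g where "coker g f"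
proof -
  obtain X Y f' where "f = Some (X, Y, f')" using epi_wt[OF assms] by (auto simp: wt_def)
  then show ?thesis using that assms epic_is_cokernel[of X Y f'] by (auto simp: epic_iff is_cokernel_iff)
qed

section \<open>Isomorphisms, zero objects and zero arrows\<close>

lemma iso_arrow_iff:
  "iso_arrow A X Y f \<longleftrightarrow> f \<in> mor A X Y \<and> (\<exists>g. wt g \<and> src g = Y \<and> tgt g = X \<and>
     g \<cdot> Some (X, Y, f) = ident X \<and> Some (X, Y, f) \<cdot> g = ident Y)"
proof
  assume "iso_arrow A X Y f"
  then obtain g where "f \<in> mor A X Y" "g \<in> mor A Y X" "cmp A g f = idt A X" "cmp A f g = idt A Y"
    by (auto simp: iso_arrow_def)
  then show "f \<in> mor A X Y \<and> (\<exists>g. wt g \<and> src g = Y \<and> tgt g = X \<and>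
     g \<cdot> Some (X, Y, f) = ident X \<and> Some (X, Y, f) \<cdot> g = ident Y)"
    by (auto simp: compose_Some ident_def intro!: exI[of _ "Some (Y, X, g)"])
next
  assume r: "f \<in> mor A X Y \<and> (\<exists>g. wt g \<and> src g = Y \<and> tgt g = X \<and>
     g \<cdot> Some (X, Y, f) = ident X \<and> Some (X, Y, f) \<cdot> g = ident Y)"
  then obtain g where g: "wt g" "src g = Y" "tgt g = X"
     "g \<cdot> Some (X, Y, f) = ident X" "Some (X, Y, f) \<cdot> g = ident Y" by blast
  then show "iso_arrow A X Y f"
    using r und_mor[of g] by (auto simp: iso_arrow_def compose_def ident_def intro!: bexI[of _ "und g"])
qed

text \<open>The epimorphism \<open>f\<close> is a cokernel of some \<open>h\<close>. Since f h = 0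
  and \<open>f\<close> is mono, h = 0; hence the identity of the source factors through
  \<open>f\<close>, and the factor is the inverse.\<close>

lemma mon_epi_iso:
  assumes "mon f" "epi f"
  obtains g where "wt g" "src g = tgt f" "tgt g = src f" "g \<cdot> f = ident (src f)" "f \<cdot> g = ident (tgt f)"
proof -
  obtain h where h: "coker h f" using epi_coker assms by blast
  note d = ckD[OF h]
  have "h = zarr (src h) (src f)" using moD[OF assms(1), of h "src h" "src f" "tgt f"] d by simp
  then have "ident (src f) \<cdot> h = zarr (src h) (tgt (ident (src f)))" using d by simp
  then obtain u where u: "wt u" "src u = tgt f" "tgt u = src f" "u \<cdot> f = ident (src f)"
    using coker_desc[OF h, of "ident (src f)"] d by auto
  have "(f \<cdot> u) \<cdot> f = ident (tgt f) \<cdot> f" using u d by simp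
  then have "f \<cdot> u = ident (tgt f)"
    using epi_cancel[OF assms(2), of "f \<cdot> u" "ident (tgt f)"] u d by simp
  then show ?thesis using that u by blast
qed

lemma iso_arrowI: "mon (Some (X, Y, f)) \<Longrightarrow> epi (Some (X, Y, f)) \<Longrightarrow> iso_arrow A X Y f"
  using mon_epi_iso[of "Some (X, Y, f)"] mon_wt[of "Some (X, Y, f)"] unfolding iso_arrow_iff
  by (metis src_Some tgt_Some wt_Some)

lemma isomorphicI: "mon f \<Longrightarrow> epi f \<Longrightarrow> isomorphic A (src f) (tgt f)"
  unfolding isomorphic_def using iso_arrowI[of "src f" "tgt f" "und f"] wt_eta[of f] by auto

lemma inv_mon_epi:
  assumes "wt f" "wt g" "src g = tgt f" "tgt g = src f" "g \<cdot> f = ident (src f)" "f \<cdot> g = ident (tgt f)"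
  shows "mon f" "epi f"
proof -
  show "mon f"
    unfolding mon_def
  proof (intro conjI allI impI assms)
    fix s assume s: "wt s" "tgt s = src f" "f \<cdot> s = zarr (src s) (tgt f)"
    have "s = (g \<cdot> f) \<cdot> s" unfolding assms(5) using s by simp
    also have "\<dots> = zarr (src s) (src f)" unfolding compose_assoc s(3) using assms s by simp
    finally show "s = zarr (src s) (src f)" .
  qed
  show "epi f"
    unfolding epi_def
  proof (intro conjI allI impI assms)
    fix s assume s: "wt s" "src s = tgt f" "s \<cdot> f = zarr (src f) (tgt s)"
    have "s = s \<cdot> (f \<cdot> g)" unfolding assms(6) using s by simp
    also have "\<dots> = zarr (tgt f) (tgt s)" unfolding compose_assoc[symmetric] s(3) using assms s by simp
    finally show "s = zarr (tgt f) (tgt s)" .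
  qed
qed

lemma isomorphicE:
  assumes "isomorphic A X Y"
  obtains f where "mon f" "epi f" "src f = X" "tgt f = Y"
proof -
  obtain f where "iso_arrow A X Y f" using assms by (auto simp: isomorphic_def)
  then obtain g where "wt (Some (X, Y, f))" "wt g" "src g = Y" "tgt g = X"
     "g \<cdot> Some (X, Y, f) = ident X" "Some (X, Y, f) \<cdot> g = ident Y" by (auto simp: iso_arrow_iff)
  then show ?thesis using that[of "Some (X, Y, f)"] inv_mon_epi[of "Some (X, Y, f)" g] by simp
qed

lemma zero_object_iff: "zero_object A Z \<longleftrightarrow> Z \<in> obj A \<and> ident Z = zarr Z Z"
proof
  assume z: "zero_object A Z"
  then have "Z \<in> obj A" by (simp add: zero_object_def)
  then show "Z \<in> obj A \<and> ident Z = zarr Z Z"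
    using z idt_mor[of Z] mzero_mor[of Z Z] by (auto simp: zero_object_def ident_def zarr_def)
next
  assume z: "Z \<in> obj A \<and> ident Z = zarr Z Z"
  then have i: "idt A Z = mzero A Z Z" by (simp add: ident_def zarr_def)
  show "zero_object A Z"
    unfolding zero_object_def
  proof (intro conjI ballI ex1I)
    show "Z \<in> obj A" using z by simp
    fix X assume X: "X \<in> obj A"
    show "mzero A X Z \<in> mor A X Z" "mzero A Z X \<in> mor A Z X" using X z mzero_mor by auto
    show "f = mzero A X Z" if "f \<in> mor A X Z" for f
      using idt_left[OF that] mzero_cmp[OF that, of Z] z i by simp
    show "f = mzero A Z X" if "f \<in> mor A Z X" for f
      using idt_right[OF that] cmp_mzero[OF that, of Z] z i by simp
  qed
qed

lemma to_zero: "zero_object A Z \<Longrightarrow> wt a \<Longrightarrow> tgt a = Z \<Longrightarrow> src a = X \<Longrightarrow> a = zarr X Z"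
  by (metis zero_object_iff ident_compose zarr_compose)

lemma from_zero: "zero_object A Z \<Longrightarrow> wt a \<Longrightarrow> src a = Z \<Longrightarrow> tgt a = X \<Longrightarrow> a = zarr Z X"
  by (metis zero_object_iff compose_ident compose_zarr)

lemma zero_obj: "zero_object A Z \<Longrightarrow> Z \<in> obj A"
  by (simp add: zero_object_def)

lemma zero_arrow_iff: "f \<in> mor A X Y \<Longrightarrow> zero_arrow A X Y f \<longleftrightarrow> f = mzero A X Y"
proof
  assume "zero_arrow A X Y f"
  then obtain Z g h where Z: "zero_object A Z" "g \<in> mor A X Z" "h \<in> mor A Z Y" "f = cmp A h g"
    by (auto simp: zero_arrow_def)
  then have "g = mzero A X Z" using to_zero[OF Z(1), of "Some (X, Z, g)"] by (simp add: zarr_def)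
  then show "f = mzero A X Y" using Z cmp_mzero mor_obj by metis
next
  assume f: "f \<in> mor A X Y" "f = mzero A X Y"
  obtain Z where Z: "zero_object A Z" using ex_zero by blast
  have "X \<in> obj A" "Y \<in> obj A" "Z \<in> obj A" using f mor_obj Z by (auto simp: zero_object_def)
  then show "zero_arrow A X Y f"
    unfolding zero_arrow_def using Z f mzero_mor cmp_mzero by metis
qed

lemma mon_to_zero:
  assumes "mon f" "zero_object A (tgt f)" shows "zero_object A (src f)"
proof -
  have "f \<cdot> ident (src f) = zarr (src f) (tgt f)"
    using to_zero[OF assms(2), of f] assms by simp
  then show ?thesis using moD[OF assms(1), of "ident (src f)" "src f" "src f" "tgt f"] assms by (simp add: zero_object_iff)
qed

lemma epi_from_zero:
  assumes "epi f" "zero_object A (src f)" shows "zero_object A (tgt f)"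
proof -
  have "ident (tgt f) \<cdot> f = zarr (src f) (tgt f)"
    using from_zero[OF assms(2), of f] assms by simp
  then show ?thesis using epD[OF assms(1), of "ident (tgt f)" "tgt f" "src f" "tgt f"] assms by (simp add: zero_object_iff)
qed

lemma zero_isomorphic: "isomorphic A X Y \<Longrightarrow> zero_object A X \<Longrightarrow> zero_object A Y"
  by (metis isomorphicE epi_from_zero)

section \<open>Biproducts\<close>

definition biprod where
  "biprod i j p q \<longleftrightarrow> wt i \<and> wt j \<and> wt p \<and> wt q \<and> tgt j = tgt i \<and> src p = tgt i \<and> src q = tgt i \<and>
     tgt p = src i \<and> tgt q = src j \<and> p \<cdot> i = ident (src i) \<and> q \<cdot> j = ident (src j) \<and>
     q \<cdot> i = zarr (src i) (src j) \<and> p \<cdot> j = zarr (src j) (src i) \<and> i \<cdot> p \<oplus> j \<cdot> q = ident (tgt i)"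

text \<open>Diagram chases need the equation i p + j q = 1 instead of universal properties. Its left
  side has the projections p and q, so it is the identity by uniqueness in the product; conversely
  the equation yields existence and uniqueness of the mediating arrows.\<close>

lemma direct_sum_iff:
  "direct_sum A X Y P i j p q \<longleftrightarrow>
     biprod (Some (X, P, i)) (Some (Y, P, j)) (Some (P, X, p)) (Some (P, Y, q))"
proof
  assume d: "direct_sum A X Y P i j p q"
  then have m: "i \<in> mor A X P" "j \<in> mor A Y P" "p \<in> mor A P X" "q \<in> mor A P Y"
    by (auto simp: direct_sum_def is_product_def is_coproduct_def)
  note o = mor_obj[OF m(1)] mor_obj[OF m(2)]
  have e: "cmp A p i = idt A X" "cmp A q j = idt A Y" "cmp A q i = mzero A X Y" "cmp A p j = mzero A Y X"
    using d m cmp_mor[OF m(1,4)] cmp_mor[OF m(2,3)] by (auto simp: direct_sum_def zero_arrow_iff)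
  let ?s = "madd A (cmp A i p) (cmp A j q)"
  have s: "?s \<in> mor A P P" using m cmp_mor madd_mor by metis
  let ?i = "Some (X, P, i)" and ?j = "Some (Y, P, j)" and ?p = "Some (P, X, p)" and ?q = "Some (P, Y, q)"
  have S: "Some (P, P, ?s) = ?i \<cdot> ?p \<oplus> ?j \<cdot> ?q"
    using m cmp_mor[OF m(3,1)] cmp_mor[OF m(4,2)] by (simp add: compose_Some plus_arr_Some)
  have E: "?p \<cdot> ?i = ident X" "?q \<cdot> ?j = ident Y" "?q \<cdot> ?i = zarr X Y" "?p \<cdot> ?j = zarr Y X"
    using m e by (simp_all add: compose_Some ident_def zarr_def)
  have E': "?p \<cdot> ?i \<cdot> x = ident X \<cdot> x" "?q \<cdot> ?j \<cdot> x = ident Y \<cdot> x" "?q \<cdot> ?i \<cdot> x = zarr X Y \<cdot> x"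
    "?p \<cdot> ?j \<cdot> x = zarr Y X \<cdot> x" for x
    by (simp_all add: E flip: compose_assoc)
  have "?p \<cdot> Some (P, P, ?s) = ?p" "?q \<cdot> Some (P, P, ?s) = ?q"
    unfolding S using m o by (simp_all add: E')
  then have "cmp A p ?s = p" "cmp A q ?s = q" using m s by (simp_all add: compose_Some)
  moreover have "cmp A p (idt A P) = p" "cmp A q (idt A P) = q" "idt A P \<in> mor A P P"
    using m idt_right idt_mor o by auto
  ultimately have "?s = idt A P"
    using d m s unfolding direct_sum_def is_product_def by blast
  then show "biprod ?i ?j ?p ?q"
    using E S m by (simp add: biprod_def ident_def)
next
  let ?i = "Some (X, P, i)" and ?j = "Some (Y, P, j)" and ?p = "Some (P, X, p)" and ?q = "Some (P, Y, q)"
  assume d: "biprod ?i ?j ?p ?q"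
  then have m: "i \<in> mor A X P" "j \<in> mor A Y P" "p \<in> mor A P X" "q \<in> mor A P Y"
    by (auto simp: biprod_def)
  have E: "?p \<cdot> ?i = ident X" "?q \<cdot> ?j = ident Y" "?q \<cdot> ?i = zarr X Y" "?p \<cdot> ?j = zarr Y X"
    and S: "?i \<cdot> ?p \<oplus> ?j \<cdot> ?q = ident P"
    using d by (simp_all add: biprod_def)
  have E': "?p \<cdot> ?i \<cdot> x = ident X \<cdot> x" "?q \<cdot> ?j \<cdot> x = ident Y \<cdot> x" "?q \<cdot> ?i \<cdot> x = zarr X Y \<cdot> x"
    "?p \<cdot> ?j \<cdot> x = zarr Y X \<cdot> x" for x
    by (simp_all add: E flip: compose_assoc)
  note o = mor_obj[OF m(1)] mor_obj[OF m(2)]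
  have "is_product A X Y P p q"
    unfolding is_product_def
  proof (intro conjI allI ballI m)
    fix T f g assume fg: "f \<in> mor A T X" "g \<in> mor A T Y"
    let ?h = "madd A (cmp A i f) (cmp A j g)"
    have h: "?h \<in> mor A T P" using m fg cmp_mor madd_mor by metis
    have H: "Some (T, P, ?h) = ?i \<cdot> Some (T, X, f) \<oplus> ?j \<cdot> Some (T, Y, g)"
      using m fg cmp_mor[OF fg(1) m(1)] cmp_mor[OF fg(2) m(2)] by (simp add: compose_Some plus_arr_Some)
    have "?p \<cdot> Some (T, P, ?h) = Some (T, X, f)" "?q \<cdot> Some (T, P, ?h) = Some (T, Y, g)"
      unfolding H using m o fg by (simp_all add: E')
    then have *: "cmp A p ?h = f" "cmp A q ?h = g" using m h by (simp_all add: compose_Some)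
    have "k = ?h" if k: "k \<in> mor A T P" "cmp A p k = f" "cmp A q k = g" for k
    proof -
      have "Some (T, P, k) = (?i \<cdot> ?p \<oplus> ?j \<cdot> ?q) \<cdot> Some (T, P, k)"
        unfolding S using k by simp
      also have "\<dots> = Some (T, P, ?h)"
        unfolding H plus_arr_compose compose_assoc compose_Some[OF k(1) m(3)] compose_Some[OF k(1) m(4)] k(2,3) ..
      finally show ?thesis by simp
    qed
    then show "\<exists>!h. h \<in> mor A T P \<and> cmp A p h = f \<and> cmp A q h = g"
      by (intro ex1I[of _ ?h] conjI h *) (elim conjE)
  qed
  moreover have "is_coproduct A X Y P i j"
    unfolding is_coproduct_def
  proof (intro conjI allI ballI m)
    fix T f g assume fg: "f \<in> mor A X T" "g \<in> mor A Y T"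
    let ?h = "madd A (cmp A f p) (cmp A g q)"
    have h: "?h \<in> mor A P T" using m fg cmp_mor madd_mor by metis
    have H: "Some (P, T, ?h) = Some (X, T, f) \<cdot> ?p \<oplus> Some (Y, T, g) \<cdot> ?q"
      using m fg cmp_mor[OF m(3) fg(1)] cmp_mor[OF m(4) fg(2)] by (simp add: compose_Some plus_arr_Some)
    have "Some (P, T, ?h) \<cdot> ?i = Some (X, T, f)" "Some (P, T, ?h) \<cdot> ?j = Some (Y, T, g)"
      unfolding H using m o fg mor_obj[OF fg(1)] by (simp_all add: E)
    then have *: "cmp A ?h i = f" "cmp A ?h j = g" using m h by (simp_all add: compose_Some)
    have "k = ?h" if k: "k \<in> mor A P T" "cmp A k i = f" "cmp A k j = g" for k
    proof -
      have "Some (P, T, k) = Some (P, T, k) \<cdot> (?i \<cdot> ?p \<oplus> ?j \<cdot> ?q)"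
        unfolding S using k by simp
      also have "\<dots> = (Some (P, T, k) \<cdot> ?i) \<cdot> ?p \<oplus> (Some (P, T, k) \<cdot> ?j) \<cdot> ?q" by simp
      also have "\<dots> = Some (P, T, ?h)"
        unfolding H compose_Some[OF m(1) k(1)] compose_Some[OF m(2) k(1)] k(2,3) ..
      finally show ?thesis by simp
    qed
    then show "\<exists>!h. h \<in> mor A P T \<and> cmp A h i = f \<and> cmp A h j = g"
      by (intro ex1I[of _ ?h] conjI h *) (elim conjE)
  qed
  moreover have "cmp A p i = idt A X" "cmp A q j = idt A Y" "cmp A q i = mzero A X Y" "cmp A p j = mzero A Y X"
    using E m by (simp_all add: compose_Some ident_def zarr_def)
  moreover have "mzero A X Y \<in> mor A X Y" "mzero A Y X \<in> mor A Y X" using o mzero_mor by auto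
  ultimately show "direct_sum A X Y P i j p q"
    by (simp add: direct_sum_def zero_arrow_iff)
qed

lemma ex_biprod:
  assumes "X \<in> obj A" "Y \<in> obj A"
  obtains i j p q where "biprod i j p q" "src i = X" "src j = Y"
  using ex_direct_sum[OF assms] by (metis direct_sum_iff src_Some)

end


section \<open>Exactness by generalized elements\<close>

context abelian_category
begin

lemma biprod_rw:
  assumes "biprod i j p q"
  shows "wt i" "wt j" "wt p" "wt q" "tgt j = tgt i" "src p = tgt i" "src q = tgt i"
    "tgt p = src i" "tgt q = src j" "p \<cdot> i = ident (src i)" "q \<cdot> j = ident (src j)"
    "q \<cdot> i = zarr (src i) (src j)" "p \<cdot> j = zarr (src j) (src i)" "i \<cdot> p \<oplus> j \<cdot> q = ident (tgt i)"
    "p \<cdot> i \<cdot> x = ident (src i) \<cdot> x" "q \<cdot> j \<cdot> x = ident (src j) \<cdot> x"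
    "q \<cdot> i \<cdot> x = zarr (src i) (src j) \<cdot> x" "p \<cdot> j \<cdot> x = zarr (src j) (src i) \<cdot> x"
  using assms by (simp_all add: biprod_def flip: compose_assoc)

lemma biprod_decomp:
  assumes "biprod i j p q" "wt z" "tgt z = tgt i" shows "i \<cdot> p \<cdot> z \<oplus> j \<cdot> q \<cdot> z = z"
proof -
  have "i \<cdot> p \<cdot> z \<oplus> j \<cdot> q \<cdot> z = (i \<cdot> p \<oplus> j \<cdot> q) \<cdot> z" by simp
  also have "\<dots> = z" unfolding biprod_rw(14)[OF assms(1)] using assms by simp
  finally show ?thesis .
qed

text \<open>
  Arrows \<open>x : T \<rightarrow> X\<close> serve as elements of \<open>X\<close>; diagram chases work with elements as long as
  existence is only claimed after precomposition with an epimorphism.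
\<close>

lemma epi_lift:
  assumes "epi p" "wt x" "tgt x = tgt p"
  obtains e y where "epi e" "tgt e = src x" "wt y" "src y = src e" "tgt y = src p" "p \<cdot> y = x \<cdot> e"
proof -
  obtain i j a b where d: "biprod i j a b" "src i = src p" "src j = src x"
    using ex_biprod[OF wt_obj(1)[OF epi_wt[OF assms(1)]] wt_obj(1)[OF assms(2)]] by blast
  note r = biprod_rw[OF d(1)]
  \<comment> \<open>The kernel of \<open>f\<close> is the fibre product of \<open>p\<close> and
    \<open>x\<close>, so the claim amounts to stability of epimorphisms under pullback.\<close>
  define f where "f = p \<cdot> a \<oplus> \<ominus> (x \<cdot> b)"
  have f: "wt f" "src f = tgt i" "tgt f = tgt p" using assms r d by (simp_all add: f_def)
  have fi: "f \<cdot> i = p" using assms r d by (simp add: f_def)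
  obtain k where k: "ker f k" using ex_ker f by blast
  note kd = krD[OF k]
  have "epi f"
    unfolding epi_def
  proof (intro conjI allI impI f)
    fix s assume s: "wt s" "src s = tgt f" "s \<cdot> f = zarr (src f) (tgt s)"
    have "(s \<cdot> f) \<cdot> i = zarr (src p) (tgt s)" unfolding s(3) using f r d s by simp
    then have "s \<cdot> p = zarr (src p) (tgt s)" using fi by simp
    then show "s = zarr (tgt f) (tgt s)" using epD[OF assms(1), of s] s f by simp
  qed
  then obtain g where g: "coker g f" using epi_coker by blast
  note gd = ckD[OF g]
  obtain g' where g': "wt g'" "src g' = src g" "tgt g' = src k" "k \<cdot> g' = g"
    using ker_lift[OF k, of g] gd f by auto
  \<comment> \<open>\<open>f\<close> is a cokernel of \<open>g\<close>, and \<open>g\<close> factors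
    through \<open>k\<close>. If \<open>s\<close> kills b k, then s b kills \<open>g\<close> and
    equals h f for some \<open>h\<close>; composing with \<open>i\<close> gives h p = 0, so h = 0, s
    b = 0 and s = s b j = 0.\<close>
  have "epi (b \<cdot> k)"
    unfolding epi_def
  proof (intro conjI allI impI)
    show "wt (b \<cdot> k)" using kd f r by simp
    fix s assume s: "wt s" "src s = tgt (b \<cdot> k)" "s \<cdot> b \<cdot> k = zarr (src (b \<cdot> k)) (tgt s)"
    have src_bk: "src (b \<cdot> k) = src k" and tgt_bk: "tgt (b \<cdot> k) = src x" using r kd f d by simp_all
    have ss: "src s = src x" using s(2) tgt_bk by simp
    have "(s \<cdot> b \<cdot> k) \<cdot> g' = zarr (src g) (tgt s)"
      unfolding s(3) src_bk using g' s(1) kd f r ss d by simp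
    then have "s \<cdot> b \<cdot> k \<cdot> g' = zarr (src g) (tgt s)" by (simp only: compose_assoc)
    then have "(s \<cdot> b) \<cdot> g = zarr (src g) (tgt (s \<cdot> b))"
      unfolding g'(4) using s(1) r ss d by simp
    then obtain h where h: "wt h" "src h = tgt f" "tgt h = tgt s" "h \<cdot> f = s \<cdot> b"
      using coker_desc[OF g, of "s \<cdot> b"] gd f r s(1) ss d by auto
    have "(h \<cdot> f) \<cdot> i = zarr (src p) (tgt s)" unfolding h(4) using assms(1) r s(1) ss d by simp
    then have "h \<cdot> p = zarr (src p) (tgt s)" using fi by simp
    then have "h = zarr (tgt p) (tgt s)" using epD[OF assms(1), of h] h f by simp
    then have "s \<cdot> b = zarr (tgt i) (tgt s)" using h f ss by simp
    then have "(s \<cdot> b) \<cdot> j = zarr (src x) (tgt s)" using r s(1) ss d by simp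
    then have "s = zarr (src x) (tgt s)" using r s(1) ss d by simp
    then show "s = zarr (tgt (b \<cdot> k)) (tgt s)" unfolding tgt_bk .
  qed
  moreover have "p \<cdot> a \<cdot> k = x \<cdot> b \<cdot> k"
  proof -
    have "p \<cdot> a \<cdot> k \<oplus> \<ominus> (x \<cdot> b \<cdot> k) = zarr (src k) (tgt p)"
      using kd(5) f by (simp add: f_def)
    then have "\<ominus> (x \<cdot> b \<cdot> k) = \<ominus> (p \<cdot> a \<cdot> k)"
      using assms kd f r d by (intro plus_arr_eq_zarr) simp_all
    then have "\<ominus> \<ominus> (x \<cdot> b \<cdot> k) = \<ominus> \<ominus> (p \<cdot> a \<cdot> k)" by simp
    then show ?thesis using assms kd f r d by simp
  qed
  ultimately show ?thesis using that[of "b \<cdot> k" "a \<cdot> k"] kd f r d by simp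
qed

text \<open>If s e = 0, then \<open>f\<close> already factors through the subobject m k with k = ker
  s. That subobject is the kernel of some \<open>g\<close>. From g f = 0 it follows that
  \<open>g\<close> factors through \<open>c\<close>, so g m = 0 and \<open>m\<close> itself factors
  through m k. Hence \<open>k\<close> is a split epimorphism and s = 0.\<close>

lemma image:
  assumes "coker f c" "ker c m"
  obtains e where "epi e" "src e = src f" "tgt e = src m" "m \<cdot> e = f"
proof -
  note cd = ckD[OF assms(1)] and md = krD[OF assms(2)]
  obtain e where e: "wt e" "src e = src f" "tgt e = src m" "m \<cdot> e = f"
    using ker_lift[OF assms(2), of f] cd by auto
  have "epi e"
    unfolding epi_def
  proof (intro conjI allI impI e)
    fix s assume s: "wt s" "src s = tgt e" "s \<cdot> e = zarr (src e) (tgt s)"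
    obtain k where k: "ker s k" using ex_ker s by blast
    note kd = krD[OF k]
    obtain e' where e': "wt e'" "src e' = src e" "tgt e' = src k" "k \<cdot> e' = e"
      using ker_lift[OF k, of e] s e by auto
    have "mon (m \<cdot> k)" using mon_compose[of m k] md kd s e by simp
    then obtain g where g: "ker g (m \<cdot> k)" using mon_ker by blast
    note gd = krD[OF g]
    have mk: "src (m \<cdot> k) = src k" "tgt (m \<cdot> k) = src c" using md kd s e by simp_all
    have "g \<cdot> f = (g \<cdot> m \<cdot> k) \<cdot> e'" using e e' by simp
    also have "\<dots> = zarr (src f) (tgt g)" unfolding gd(5) mk using gd e' e by simp
    finally obtain r where r: "wt r" "src r = tgt c" "tgt r = tgt g" "r \<cdot> c = g"
      using coker_desc[OF assms(1), of g] gd mk cd by auto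
    have "g \<cdot> m = r \<cdot> c \<cdot> m" using r by (simp flip: compose_assoc)
    also have "\<dots> = zarr (src m) (tgt g)" unfolding md(5) using r md by simp
    finally obtain l where l: "wt l" "src l = src m" "tgt l = src k" "(m \<cdot> k) \<cdot> l = m"
      using ker_lift[OF g, of m] gd mk md by auto
    have "m \<cdot> k \<cdot> l = m \<cdot> ident (src m)" using l md by simp
    then have kl: "k \<cdot> l = ident (src m)" using mon_cancel[OF md(2), of "k \<cdot> l" "ident (src m)"] l kd s e md by simp
    have "(s \<cdot> k) \<cdot> l = s \<cdot> k \<cdot> l" by simp
    also have "\<dots> = s" unfolding kl using s e by simp
    finally have "(s \<cdot> k) \<cdot> l = s" .
    moreover have "(s \<cdot> k) \<cdot> l = zarr (tgt e) (tgt s)" unfolding kd(5) using l s kd e by simp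
    ultimately show "s = zarr (tgt e) (tgt s)" by simp
  qed
  then show ?thesis using that e by blast
qed

text \<open>Exactness in the language of elements; the usual form with images is derived in
  \<open>exact_img\<close>.\<close>

definition exact where
  "exact f g \<longleftrightarrow> wt f \<and> wt g \<and> tgt f = src g \<and> g \<cdot> f = zarr (src f) (tgt g) \<and>
    (\<forall>y. wt y \<longrightarrow> tgt y = src g \<longrightarrow> g \<cdot> y = zarr (src y) (tgt g) \<longrightarrow>
      (\<exists>e x. epi e \<and> tgt e = src y \<and> wt x \<and> src x = src e \<and> tgt x = src f \<and> f \<cdot> x = y \<cdot> e))"

lemma exactE:
  assumes "exact f g" "wt y" "tgt y = src g" "g \<cdot> y = zarr (src y) (tgt g)"
  obtains e x where "epi e" "tgt e = src y" "wt x" "src x = src e" "tgt x = src f" "f \<cdot> x = y \<cdot> e"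
  using assms unfolding exact_def by blast

lemma exactD:
  assumes "exact f g" shows "wt f" "wt g" "tgt f = src g" "g \<cdot> f = zarr (src f) (tgt g)"
  using assms by (auto simp: exact_def)

text \<open>An element killed by \<open>c\<close> factors through ker c, which is the image of
  \<open>f\<close>, and lifts locally along the epimorphism of \<open>f\<close> onto its
  image.\<close>

lemma coker_exact:
  assumes "coker f c" shows "exact f c"
  unfolding exact_def
proof (intro conjI allI impI)
  note cd = ckD[OF assms]
  obtain m where m: "ker c m" using ex_ker cd by blast
  note md = krD[OF m]
  obtain e where e: "epi e" "src e = src f" "tgt e = src m" "m \<cdot> e = f" using image[OF assms m] by blast
  fix y assume y: "wt y" "tgt y = src c" "c \<cdot> y = zarr (src y) (tgt c)"
  obtain u where u: "wt u" "src u = src y" "tgt u = src m" "m \<cdot> u = y" using ker_lift[OF m y] by blast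
  obtain e' x where x: "epi e'" "tgt e' = src u" "wt x" "src x = src e'" "tgt x = src e" "e \<cdot> x = u \<cdot> e'"
    using epi_lift[of e u] e u by metis
  have "f \<cdot> x = m \<cdot> e \<cdot> x" using e by (simp flip: compose_assoc)
  also have "\<dots> = y \<cdot> e'" unfolding x(6) using u by (simp flip: compose_assoc)
  finally show "\<exists>e x. epi e \<and> tgt e = src y \<and> wt x \<and> src x = src e \<and> tgt x = src f \<and> f \<cdot> x = y \<cdot> e"
    using x u e by metis
qed (use ckD[OF assms] in simp_all)

text \<open>Local factorization through a monomorphism is global: \<open>f\<close> is a kernel of
  some \<open>h\<close>, and h t = 0 may be tested after an epimorphism.\<close>

lemma exact_ker:
  assumes "mon f" "exact f g" shows "ker g f"
  unfolding ker_def
proof (intro conjI allI impI)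
  obtain h where h: "ker h f" using mon_ker assms by blast
  fix t assume t: "wt t" "tgt t = src g" "g \<cdot> t = zarr (src t) (tgt g)"
  obtain e x where e: "epi e" "tgt e = src t" "wt x" "src x = src e" "tgt x = src f" "f \<cdot> x = t \<cdot> e"
    using exactE[OF assms(2) t] by blast
  note hd = krD[OF h]
  have "(h \<cdot> t) \<cdot> e = (h \<cdot> f) \<cdot> x" using e by simp
  also have "\<dots> = zarr (src e) (tgt h)" unfolding hd(5) using hd e by simp
  finally have "h \<cdot> t = zarr (src t) (tgt h)"
    using epD[OF e(1), of "h \<cdot> t"] hd t e exactD[OF assms(2)] by simp
  then show "\<exists>u. wt u \<and> src u = src t \<and> tgt u = src f \<and> f \<cdot> u = t"
    using ker_lift[OF h, of t] t hd exactD[OF assms(2)] by metis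
qed (use exactD[OF assms(2)] assms in simp_all)

text \<open>\<open>g\<close> is a cokernel of some \<open>w\<close>, and \<open>w\<close> factors
  locally through \<open>f\<close>; so every \<open>t\<close> that kills \<open>f\<close> kills
  \<open>w\<close> as well.\<close>

lemma exact_coker:
  assumes "epi g" "exact f g" shows "coker f g"
  unfolding coker_def
proof (intro conjI allI impI)
  obtain w where w: "coker w g" using epi_coker assms by blast
  note wd = ckD[OF w] and d = exactD[OF assms(2)]
  fix t assume t: "wt t" "src t = tgt f" "t \<cdot> f = zarr (src f) (tgt t)"
  have "wt w" "tgt w = src g" "g \<cdot> w = zarr (src w) (tgt g)" using wd by simp_all
  then obtain e x where e: "epi e" "tgt e = src w" "wt x" "src x = src e" "tgt x = src f" "f \<cdot> x = w \<cdot> e"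
    using exactE[OF assms(2)] by blast
  have "(t \<cdot> w) \<cdot> e = (t \<cdot> f) \<cdot> x" using e by simp
  also have "\<dots> = zarr (src e) (tgt t)" unfolding t(3) using t e by simp
  finally have "t \<cdot> w = zarr (src w) (tgt t)"
    using epD[OF e(1), of "t \<cdot> w"] wd t e d by simp
  then show "\<exists>u. wt u \<and> src u = tgt g \<and> tgt u = tgt t \<and> u \<cdot> g = t"
    using coker_desc[OF w, of t] t wd d by metis
qed (use exactD[OF assms(2)] assms in simp_all)

lemma short_exactI:
  assumes "mon f" "epi g" "exact f g" "src f = X" "tgt f = Y" "tgt g = Z"
  shows "short_exact A X Y Z"
proof -
  note d = exactD[OF assms(3)]
  have "ker (Some (Y, Z, und g)) (Some (X, Y, und f))" "coker (Some (X, Y, und f)) (Some (Y, Z, und g))"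
    using exact_ker[OF assms(1,3)] exact_coker[OF assms(2,3)] wt_eta[of f] wt_eta[of g] assms d by auto
  then show ?thesis by (auto simp: short_exact_def is_kernel_iff is_cokernel_iff)
qed

lemma short_exactE:
  assumes "short_exact A X Y Z"
  obtains f g where "mon f" "epi g" "exact f g" "src f = X" "tgt f = Y" "src g = Y" "tgt g = Z"
    "ker g f" "coker f g"
proof -
  obtain f g where "ker (Some (Y, Z, g)) (Some (X, Y, f))" "coker (Some (X, Y, f)) (Some (Y, Z, g))"
    using assms by (auto simp: short_exact_def is_kernel_iff is_cokernel_iff)
  then show ?thesis using that[of "Some (X, Y, f)" "Some (Y, Z, g)"] krD ckD coker_exact by auto
qed

text \<open>Only the object is chosen, as nothing more enters into classes in the Grothendieck
  monoid; the two arrows are recovered when needed.\<close>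

definition img where
  "img f = (SOME I. \<exists>m e. mon m \<and> epi e \<and> src m = I \<and> tgt e = I \<and> src e = src f \<and> tgt m = tgt f \<and> m \<cdot> e = f)"

lemma img:
  assumes "wt f"
  obtains m e where "mon m" "epi e" "src m = img f" "tgt e = img f" "src e = src f" "tgt m = tgt f" "m \<cdot> e = f"
proof -
  obtain c where c: "coker f c" using ex_coker assms by blast
  obtain m where m: "ker c m" using ex_ker[OF ckD(3)[OF c]] by blast
  obtain e where e: "epi e" "src e = src f" "tgt e = src m" "m \<cdot> e = f" using image[OF c m] by blast
  have "\<exists>I m e. mon m \<and> epi e \<and> src m = I \<and> tgt e = I \<and> src e = src f \<and> tgt m = tgt f \<and> m \<cdot> e = f"
    using e krD[OF m] ckD[OF c] by (intro exI[of _ "src m"] exI[of _ m] exI[of _ e]) simp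
  from someI_ex[OF this] show ?thesis using that unfolding img_def by blast
qed

text \<open>Cuts a long exact sequence into short ones. In this form exactness yields relations
  between classes and membership in extension-closed subcategories.\<close>

lemma exact_img:
  assumes "exact f g" shows "short_exact A (img f) (src g) (img g)"
proof -
  note d = exactD[OF assms]
  obtain m e where f: "mon m" "epi e" "src m = img f" "tgt e = img f" "src e = src f" "tgt m = tgt f" "m \<cdot> e = f"
    using img d by blast
  obtain m' e' where g: "mon m'" "epi e'" "src m' = img g" "tgt e' = img g" "src e' = src g" "tgt m' = tgt g" "m' \<cdot> e' = g"
    using img d by blast
  have "m' \<cdot> ((e' \<cdot> m) \<cdot> e) = (m' \<cdot> e') \<cdot> (m \<cdot> e)" by simp
  also have "\<dots> = zarr (src f) (tgt g)" unfolding f(7) g(7) by (rule d(4))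
  finally have "m' \<cdot> ((e' \<cdot> m) \<cdot> e) = zarr (src f) (tgt g)" .
  then have "(e' \<cdot> m) \<cdot> e = zarr (src f) (img g)"
    using moD[OF g(1), of "(e' \<cdot> m) \<cdot> e"] d f g by simp
  then have em: "e' \<cdot> m = zarr (img f) (img g)"
    using epD[OF f(2), of "e' \<cdot> m"] d f g by simp
  have "exact m e'"
    unfolding exact_def
  proof (intro conjI allI impI)
    fix y assume y: "wt y" "tgt y = src e'" "e' \<cdot> y = zarr (src y) (tgt e')"
    have "g \<cdot> y = m' \<cdot> (e' \<cdot> y)" using g by (simp flip: compose_assoc)
    also have "\<dots> = zarr (src y) (tgt g)" unfolding y(3) using g y by simp
    finally have "g \<cdot> y = zarr (src y) (tgt g)" .
    moreover have "tgt y = src g" using y g by simp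
    ultimately obtain e1 x where x: "epi e1" "tgt e1 = src y" "wt x" "src x = src e1" "tgt x = src f" "f \<cdot> x = y \<cdot> e1"
      using exactE[OF assms y(1)] by blast
    have "m \<cdot> (e \<cdot> x) = (m \<cdot> e) \<cdot> x" by simp
    also have "\<dots> = y \<cdot> e1" unfolding f(7) by (rule x(6))
    finally show "\<exists>e1 x. epi e1 \<and> tgt e1 = src y \<and> wt x \<and> src x = src e1 \<and> tgt x = src m \<and> m \<cdot> x = y \<cdot> e1"
      using x f by (intro exI[of _ e1] exI[of _ "e \<cdot> x"]) simp
  qed (use f g d em in simp_all)
  then show ?thesis using short_exactI[of m e'] f g d by simp
qed

lemma img_src_zero: "wt f \<Longrightarrow> zero_object A (src f) \<Longrightarrow> zero_object A (img f)"
  by (metis img epi_from_zero)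

lemma img_tgt_zero: "wt f \<Longrightarrow> zero_object A (tgt f) \<Longrightarrow> zero_object A (img f)"
  by (metis img mon_to_zero)

lemma exact_zero:
  assumes "exact f g" "zero_object A (src f)" "zero_object A (tgt g)"
  shows "zero_object A (src g)"
proof -
  note d = exactD[OF assms(1)]
  have "g \<cdot> ident (src g) = zarr (src (ident (src g))) (tgt g)"
    using to_zero[OF assms(3), of g] d by simp
  moreover have "wt (ident (src g))" "tgt (ident (src g)) = src g" using d by simp_all
  ultimately obtain e x where x: "epi e" "tgt e = src (ident (src g))" "wt x" "src x = src e" "tgt x = src f" "f \<cdot> x = ident (src g) \<cdot> e"
    using exactE[OF assms(1)] by blast
  have "f \<cdot> x = zarr (src e) (src g)"
    using to_zero[OF assms(2), of x] x d by simp
  then have "ident (src g) = zarr (src g) (src g)" using epD[OF x(1), of "ident (src g)"] x d by simp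
  then show ?thesis using d by (simp add: zero_object_iff)
qed

end


section \<open>Cohomology\<close>

context abelian_category
begin

definition diff :: "('o, 'm) cochain \<Rightarrow> int \<Rightarrow> ('o \<times> 'o \<times> 'm) option" where
  "diff X n = Some (deg X n, deg X (n + 1), dif X n)"

lemma bc_obj [simp]: "bounded_complex A X \<Longrightarrow> deg X n \<in> obj A"
  by (simp add: bounded_complex_def)

lemma wt_diff [simp]: "bounded_complex A X \<Longrightarrow> wt (diff X n)"
  and src_diff [simp]: "src (diff X n) = deg X n"
  and tgt_diff [simp]: "tgt (diff X n) = deg X (n + 1)"
  by (simp_all add: diff_def bounded_complex_def)

lemma DD [simp]:
  assumes "bounded_complex A X" "m = n + 1"
  shows "diff X m \<cdot> diff X n = zarr (deg X n) (deg X (m + 1))"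
proof -
  have "dif X n \<in> mor A (deg X n) (deg X (n + 1))" "dif X (n + 1) \<in> mor A (deg X (n + 1)) (deg X (n + 1 + 1))"
    "cmp A (dif X (n + 1)) (dif X n) = mzero A (deg X n) (deg X (n + 2))"
    using assms(1) unfolding bounded_complex_def by blast+
  then show ?thesis using assms(2) by (simp add: diff_def compose_Some zarr_def add.commute[of n 2])
qed

lemma DDx [simp]:
  assumes "bounded_complex A X" "m = n + 1" "wt x" "tgt x = deg X n"
  shows "diff X m \<cdot> diff X n \<cdot> x = zarr (src x) (deg X (m + 1))"
proof -
  have "diff X m \<cdot> diff X n \<cdot> x = (diff X m \<cdot> diff X n) \<cdot> x" by simp
  also have "\<dots> = zarr (src x) (deg X (m + 1))" unfolding DD[OF assms(1,2)] using assms by simp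
  finally show ?thesis .
qed

section \<open>Cocycles and the classes they represent\<close>

definition cocycle where
  "cocycle X n z \<longleftrightarrow> wt z \<and> tgt z = deg X n \<and> diff X n \<cdot> z = zarr (src z) (deg X (n + 1))"

lemma cocycleI:
  "wt z \<Longrightarrow> tgt z = deg X n \<Longrightarrow> diff X n \<cdot> z = zarr (src z) (deg X (n + 1)) \<Longrightarrow> cocycle X n z"
  by (simp add: cocycle_def)

lemma cocycleD:
  assumes "cocycle X n z"
  shows "wt z" "tgt z = deg X n" "diff X n \<cdot> z = zarr (src z) (deg X (n + 1))"
  using assms by (auto simp: cocycle_def)

text \<open>For a cocycle this is the vanishing of its cohomology class, see
  \<open>represents_zero_iff\<close>; an actual preimage under the differential need not
  exist.\<close>

definition local_bd where
  "local_bd X n z \<longleftrightarrow> (\<exists>e w. epi e \<and> tgt e = src z \<and> wt w \<and> src w = src e \<and> tgt w = deg X (n - 1) \<and>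
     diff X (n - 1) \<cdot> w = z \<cdot> e)"

lemma lbdI:
  assumes "epi e" "tgt e = src z" "wt w" "src w = src e" "tgt w = deg X (n - 1)" "diff X (n - 1) \<cdot> w = z \<cdot> e"
  shows "local_bd X n z"
  using assms unfolding local_bd_def by blast

lemma lbdE:
  assumes "local_bd X n z"
  obtains e w where "epi e" "tgt e = src z" "wt w" "src w = src e" "tgt w = deg X (n - 1)" "diff X (n - 1) \<cdot> w = z \<cdot> e"
  using assms unfolding local_bd_def by blast

definition hdata where
  "hdata X n k c \<longleftrightarrow> ker (diff X n) k \<and>
     (\<exists>e. wt e \<and> src e = deg X (n - 1) \<and> tgt e = src k \<and> k \<cdot> e = diff X (n - 1) \<and> coker e c)"

lemma hdatD:
  assumes "hdata X n k c"
  shows "wt k" "mon k" "tgt k = deg X n" "diff X n \<cdot> k = zarr (src k) (deg X (n + 1))"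
    "wt c" "epi c" "src c = src k"
proof -
  obtain e where "ker (diff X n) k" "coker e c" "tgt e = src k" using assms by (auto simp: hdata_def)
  then show "wt k" "mon k" "tgt k = deg X n" "diff X n \<cdot> k = zarr (src k) (deg X (n + 1))"
    "wt c" "epi c" "src c = src k"
    using krD[of "diff X n" k] ckD[of e c] by simp_all
qed

lemma cohomology_data_iff:
  assumes "bounded_complex A X"
  shows "cohomology_data A X n K k H c \<longleftrightarrow> hdata X n (Some (K, deg X n, k)) (Some (K, H, c))"
proof
  assume d: "cohomology_data A X n K k H c"
  then obtain e where e: "e \<in> mor A (deg X (n - 1)) K" "cmp A k e = dif X (n - 1)"
    "coker (Some (deg X (n - 1), K, e)) (Some (K, H, c))" "ker (diff X n) (Some (K, deg X n, k))"
    by (auto simp: cohomology_data_def is_kernel_iff is_cokernel_iff diff_def)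
  moreover have "k \<in> mor A K (deg X n)" using krD(3)[OF e(4)] by simp
  ultimately show "hdata X n (Some (K, deg X n, k)) (Some (K, H, c))"
    unfolding hdata_def by (intro conjI exI[of _ "Some (deg X (n - 1), K, e)"]) (simp_all add: diff_def compose_Some)
next
  assume d: "hdata X n (Some (K, deg X n, k)) (Some (K, H, c))"
  then obtain e where e: "wt e" "src e = deg X (n - 1)" "tgt e = K"
    "Some (K, deg X n, k) \<cdot> e = diff X (n - 1)" "coker e (Some (K, H, c))" "ker (diff X n) (Some (K, deg X n, k))"
    by (auto simp: hdata_def)
  have k: "k \<in> mor A K (deg X n)" using krD(3)[OF e(6)] by simp
  have ee: "und e \<in> mor A (deg X (n - 1)) K" "e = Some (deg X (n - 1), K, und e)"
    using und_mor[OF e(1)] wt_eta[OF e(1)] e by auto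
  have "cmp A k (und e) = dif X (n - 1)"
    using e(4) compose_Some[OF ee(1) k] ee(2) by (simp add: diff_def)
  then show "cohomology_data A X n K k H c"
    using ee e unfolding cohomology_data_def is_kernel_iff is_cokernel_iff by (auto simp: diff_def)
qed

lemma ex_hdata:
  assumes "bounded_complex A X" obtains k c where "hdata X n k c"
proof -
  obtain k where k: "ker (diff X n) k" using ex_ker[OF wt_diff[OF assms]] by blast
  have "wt (diff X (n - 1))" "tgt (diff X (n - 1)) = src (diff X n)"
    "diff X n \<cdot> diff X (n - 1) = zarr (src (diff X (n - 1))) (tgt (diff X n))"
    using assms by simp_all
  then obtain e where e: "wt e" "src e = src (diff X (n - 1))" "tgt e = src k" "k \<cdot> e = diff X (n - 1)"
    using ker_lift[OF k] by blast
  obtain c where "coker e c" using ex_coker[OF e(1)] by blast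
  then have "hdata X n k c" unfolding hdata_def using k e by auto
  then show ?thesis by (rule that)
qed

text \<open>The cocycle \<open>z\<close> has class \<open>h\<close> in the cohomology given by the
  kernel \<open>k\<close> and the projection \<open>c\<close>; the arrow \<open>u\<close> is
  \<open>z\<close> regarded as an element of the kernel.\<close>

definition represents where
  "represents k c z h \<longleftrightarrow> (\<exists>u. wt u \<and> tgt u = src k \<and> z = k \<cdot> u \<and> h = c \<cdot> u)"

lemma represents_cocycle:
  assumes "hdata X n k c" "represents k c z h" "bounded_complex A X"
  shows "cocycle X n z" "wt h" "tgt h = tgt c" "src h = src z"
proof -
  note d = hdatD[OF assms(1)]
  obtain u where u: "wt u" "tgt u = src k" "z = k \<cdot> u" "h = c \<cdot> u" using assms(2) by (auto simp: represents_def)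
  have "diff X n \<cdot> k \<cdot> u = (diff X n \<cdot> k) \<cdot> u" by simp
  also have "\<dots> = zarr (src u) (deg X (n + 1))" unfolding d(4) using u assms(3) by simp
  finally show "cocycle X n z" using u d(1,3) by (intro cocycleI) simp_all
  show "wt h" "tgt h = tgt c" "src h = src z" using u d by simp_all
qed

lemma cocycle_represents:
  assumes "hdata X n k c" "cocycle X n z"
  obtains h where "represents k c z h"
proof -
  have "ker (diff X n) k" using assms(1) by (simp add: hdata_def)
  then obtain u where "wt u" "tgt u = src k" "k \<cdot> u = z"
    using ker_lift[of "diff X n" k z] cocycleD[OF assms(2)] unfolding src_diff tgt_diff by blast
  then show ?thesis using that[of "c \<cdot> u"] unfolding represents_def by blast
qed

text \<open>A class lifts along the epimorphism \<open>c\<close> only locally, hence the epimorphism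
  \<open>e\<close>.\<close>

lemma represents_ex:
  assumes "hdata X n k c" "wt h" "tgt h = tgt c"
  obtains e z where "epi e" "tgt e = src h" "represents k c z (h \<cdot> e)" "src z = src e"
proof -
  note d = hdatD[OF assms(1)]
  obtain e u where e: "epi e" "tgt e = src h" "wt u" "src u = src e" "tgt u = src c" "c \<cdot> u = h \<cdot> e"
    using epi_lift[OF d(6) assms(2,3)] by blast
  then have "represents k c (k \<cdot> u) (h \<cdot> e)" unfolding represents_def using d by metis
  then show ?thesis using that[of e "k \<cdot> u"] e d by simp
qed

text \<open>\<open>c\<close> is a cokernel of the differential corestricted to the kernel
  \<open>k\<close>, so \<open>coker_exact\<close> produces the local preimage.\<close>

lemma represents_zero_iff:
  assumes "hdata X n k c" "represents k c z h" "bounded_complex A X"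
  shows "h = zarr (src z) (tgt c) \<longleftrightarrow> local_bd X n z"
proof -
  note d = hdatD[OF assms(1)]
  obtain u where u: "wt u" "tgt u = src k" "z = k \<cdot> u" "h = c \<cdot> u" using assms(2) by (auto simp: represents_def)
  obtain e where e: "wt e" "src e = deg X (n - 1)" "tgt e = src k" "k \<cdot> e = diff X (n - 1)" "coker e c"
    using assms(1) by (auto simp: hdata_def)
  have s: "src z = src u" using u d by simp
  show ?thesis
  proof
    assume "h = zarr (src z) (tgt c)"
    then have "c \<cdot> u = zarr (src u) (tgt c)" "tgt u = src c" using u s d by simp_all
    then obtain e1 w where w: "epi e1" "tgt e1 = src u" "wt w" "src w = src e1" "tgt w = src e" "e \<cdot> w = u \<cdot> e1"
      using exactE[OF coker_exact[OF e(5)] u(1)] by blast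
    have "diff X (n - 1) \<cdot> w = k \<cdot> (e \<cdot> w)" unfolding e(4)[symmetric] by simp
    also have "\<dots> = z \<cdot> e1" unfolding w(6) u(3) by simp
    finally show "local_bd X n z" using w e s by (intro lbdI[of e1 z w]) simp_all
  next
    assume "local_bd X n z"
    then obtain e1 w where w: "epi e1" "tgt e1 = src z" "wt w" "src w = src e1" "tgt w = deg X (n - 1)"
      "diff X (n - 1) \<cdot> w = z \<cdot> e1" by (rule lbdE)
    have "k \<cdot> (e \<cdot> w) = diff X (n - 1) \<cdot> w" unfolding e(4)[symmetric] by simp
    also have "\<dots> = k \<cdot> (u \<cdot> e1)" unfolding w(6) u(3) by simp
    finally have "e \<cdot> w = u \<cdot> e1"
      using mon_cancel[OF d(2), of "e \<cdot> w" "u \<cdot> e1"] w e u s by simp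
    then have "c \<cdot> (u \<cdot> e1) = (c \<cdot> e) \<cdot> w" by simp
    also have "\<dots> = zarr (src e1) (tgt c)" unfolding ckD(5)[OF e(5)] using w e d by simp
    finally have "(c \<cdot> u) \<cdot> e1 = zarr (src e1) (tgt c)" by simp
    then show "h = zarr (src z) (tgt c)"
      using epD[OF w(1), of "c \<cdot> u" "tgt c" "src e1" "src z"] w u s d by simp
  qed
qed

lemma represents_compose: "hdata X n k c \<Longrightarrow> represents k c z h \<Longrightarrow> represents k c (z \<cdot> e) (h \<cdot> e)" if "wt e" "tgt e = src z"
proof -
  assume a: "hdata X n k c" "represents k c z h"
  then obtain u where "wt u" "tgt u = src k" "z = k \<cdot> u" "h = c \<cdot> u" by (auto simp: represents_def)
  then show ?thesis using that hdatD[OF a(1)] unfolding represents_def by (intro exI[of _ "u \<cdot> e"]) simp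
qed

lemma represents_diff:
  assumes "hdata X n k c" "represents k c z h" "represents k c z' h'" "src z = src z'"
  shows "represents k c (z \<oplus> \<ominus> z') (h \<oplus> \<ominus> h')"
proof -
  obtain u where u: "wt u" "tgt u = src k" "z = k \<cdot> u" "h = c \<cdot> u" using assms(2) by (auto simp: represents_def)
  obtain u' where u': "wt u'" "tgt u' = src k" "z' = k \<cdot> u'" "h' = c \<cdot> u'" using assms(3) by (auto simp: represents_def)
  show ?thesis unfolding represents_def
    using u u' hdatD[OF assms(1)] assms(4) by (intro exI[of _ "u \<oplus> \<ominus> u'"]) simp
qed

lemma represents_self: "hdata X n k c \<Longrightarrow> represents k c k c"
  unfolding represents_def using hdatD[of X n k c] by (intro exI[of _ "ident (src k)"]) simp

lemma represents_unique:
  assumes "hdata X n k c" "represents k c z h" "represents k c z h'"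
  shows "h = h'"
proof -
  note d = hdatD[OF assms(1)]
  obtain u where u: "wt u" "tgt u = src k" "z = k \<cdot> u" "h = c \<cdot> u" using assms(2) by (auto simp: represents_def)
  obtain u' where u': "wt u'" "tgt u' = src k" "z = k \<cdot> u'" "h' = c \<cdot> u'" using assms(3) by (auto simp: represents_def)
  have "src (k \<cdot> u) = src u" "src (k \<cdot> u') = src u'" using u(1,2) u'(1,2) d by simp_all
  then have "src u = src u'" using u(3) u'(3) by simp
  then have "u = u'" using mon_cancel[OF d(2) u(1) u'(1)] u u' by simp
  then show ?thesis using u u' by simp
qed

section \<open>Chain maps and their effect on cohomology\<close>

definition chmap where
  "chmap X Y F \<longleftrightarrow> (\<forall>n. wt (F n) \<and> src (F n) = deg X n \<and> tgt (F n) = deg Y n \<and>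
     diff Y n \<cdot> F n = F (n + 1) \<cdot> diff X n)"

lemma chD:
  assumes "chmap X Y F"
  shows "wt (F n)" "src (F n) = deg X n" "tgt (F n) = deg Y n"
    "diff Y n \<cdot> F n = F (n + 1) \<cdot> diff X n" "diff Y n \<cdot> F n \<cdot> x = F (n + 1) \<cdot> diff X n \<cdot> x"
proof -
  show a: "wt (F n)" "src (F n) = deg X n" "tgt (F n) = deg Y n" "diff Y n \<cdot> F n = F (n + 1) \<cdot> diff X n"
    using assms by (auto simp: chmap_def)
  show "diff Y n \<cdot> F n \<cdot> x = F (n + 1) \<cdot> diff X n \<cdot> x"
    using a(4) by (simp flip: compose_assoc)
qed

lemma chmap_cocycle:
  assumes "chmap X Y F" "cocycle X n z"
  shows "cocycle Y n (F n \<cdot> z)"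
  using cocycleD[OF assms(2)] chD[OF assms(1)] by (intro cocycleI) simp_all

text \<open>The induced map is described by its effect on classes of cocycles, for arbitrary
  cohomology data on both sides. This determines it by \<open>induces_unique\<close> and makes
  functoriality immediate.\<close>

definition induces where
  "induces F n k c k' c' v \<longleftrightarrow> wt v \<and> src v = tgt c \<and> tgt v = tgt c' \<and>
     (\<forall>z h. represents k c z h \<longrightarrow> represents k' c' (F n \<cdot> z) (v \<cdot> h))"

lemma indD:
  assumes "induces F n k c k' c' v"
  shows "wt v" "src v = tgt c" "tgt v = tgt c'" "represents k c z h \<Longrightarrow> represents k' c' (F n \<cdot> z) (v \<cdot> h)"
  using assms by (auto simp: induces_def)

lemma indI:
  assumes "hdata X n k c" "hdata Y n k' c'" "wt u" "src u = src k" "tgt u = src k'" "k' \<cdot> u = F n \<cdot> k"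
    "wt v" "src v = tgt c" "tgt v = tgt c'" "v \<cdot> c = c' \<cdot> u"
  shows "induces F n k c k' c' v"
  unfolding induces_def
proof (intro conjI allI impI assms)
  fix z h assume "represents k c z h"
  then obtain w where w: "wt w" "tgt w = src k" "z = k \<cdot> w" "h = c \<cdot> w" by (auto simp: represents_def)
  have "F n \<cdot> z = k' \<cdot> (u \<cdot> w)" unfolding w compose_assoc[symmetric] assms by simp
  moreover have "v \<cdot> h = c' \<cdot> (u \<cdot> w)" unfolding w compose_assoc[symmetric] assms by simp
  ultimately show "represents k' c' (F n \<cdot> z) (v \<cdot> h)"
    unfolding represents_def using w assms by (intro exI[of _ "u \<cdot> w"]) simp
qed

lemma ex_induces:
  assumes "hdata X n k c" "hdata Y n k' c'" "chmap X Y F" "bounded_complex A X" "bounded_complex A Y"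
  obtains v where "induces F n k c k' c' v"
proof -
  note d = hdatD[OF assms(1)] and d' = hdatD[OF assms(2)] and f = chD[OF assms(3)]
  have kk: "cocycle X n k" using d by (intro cocycleI)
  have "cocycle Y n (F n \<cdot> k)" using chmap_cocycle[OF assms(3) kk] .
  moreover have "ker (diff Y n) k'" using assms(2) by (simp add: hdata_def)
  ultimately obtain u where u: "wt u" "src u = src (F n \<cdot> k)" "tgt u = src k'" "k' \<cdot> u = F n \<cdot> k"
    using ker_lift[of "diff Y n" k' "F n \<cdot> k"] cocycleD[of Y n "F n \<cdot> k"] unfolding src_diff tgt_diff by blast
  have su: "src u = src k" using u f d by simp
  obtain e where e: "wt e" "src e = deg X (n - 1)" "tgt e = src k" "k \<cdot> e = diff X (n - 1)" "coker e c"
    using assms(1) by (auto simp: hdata_def)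
  obtain e' where e': "wt e'" "src e' = deg Y (n - 1)" "tgt e' = src k'" "k' \<cdot> e' = diff Y (n - 1)" "coker e' c'"
    using assms(2) by (auto simp: hdata_def)
  have "k' \<cdot> (u \<cdot> e) = (k' \<cdot> u) \<cdot> e" by simp
  also have "\<dots> = F n \<cdot> (k \<cdot> e)" unfolding u by simp
  also have "\<dots> = diff Y (n - 1) \<cdot> F (n - 1)" unfolding e using f(4)[of "n - 1"] by simp
  also have "\<dots> = k' \<cdot> (e' \<cdot> F (n - 1))" unfolding e'(4)[symmetric] by simp
  finally have ue: "u \<cdot> e = e' \<cdot> F (n - 1)"
    using mon_cancel[OF d'(2), of "u \<cdot> e" "e' \<cdot> F (n - 1)"] u su e e' f by simp
  have "c' \<cdot> u \<cdot> e = (c' \<cdot> e') \<cdot> F (n - 1)" unfolding ue by simp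
  also have "\<dots> = zarr (src e) (tgt c')" unfolding ckD(5)[OF e'(5)] using e e' f d' by simp
  finally have "(c' \<cdot> u) \<cdot> e = zarr (src e) (tgt (c' \<cdot> u))" using d' u by simp
  then obtain v where v: "wt v" "src v = tgt c" "tgt v = tgt c'" "v \<cdot> c = c' \<cdot> u"
    using coker_desc[OF e(5), of "c' \<cdot> u"] u su e d' by auto
  have "induces F n k c k' c' v" using assms(1,2) u(1) su u(3,4) v by (rule indI)
  then show ?thesis by (rule that)
qed

lemma induces_unique:
  assumes "hdata X n k c" "hdata Y n k' c'" "induces F n k c k' c' v" "induces F n k c k' c' v'"
  shows "v = v'"
proof -
  have "represents k' c' (F n \<cdot> k) (v \<cdot> c)" "represents k' c' (F n \<cdot> k) (v' \<cdot> c)"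
    using indD(4)[OF assms(3)] indD(4)[OF assms(4)] represents_self[OF assms(1)] by auto
  then have "v \<cdot> c = v' \<cdot> c" using represents_unique[OF assms(2)] by blast
  then show ?thesis
    using epi_cancel[OF hdatD(6)[OF assms(1)], of v v'] indD[OF assms(3)] indD[OF assms(4)] by simp
qed

text \<open>Injectivity, and in \<open>hsurj\<close> surjectivity, on H^n in terms of cocycles,
  independent of any choice of cohomology. The hypothesis may ask for a true preimage
  \<open>y\<close> instead of a local one, since an epimorphism can be absorbed into
  \<open>z\<close>.\<close>

definition hinj where
  "hinj X Y F n \<longleftrightarrow> (\<forall>z y. cocycle X n z \<longrightarrow> wt y \<longrightarrow> src y = src z \<longrightarrow> tgt y = deg Y (n - 1) \<longrightarrow>
     diff Y (n - 1) \<cdot> y = F n \<cdot> z \<longrightarrow> local_bd X n z)"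

definition hsurj where
  "hsurj X Y F n \<longleftrightarrow> (\<forall>z'. cocycle Y n z' \<longrightarrow> (\<exists>e z. epi e \<and> tgt e = src z' \<and> cocycle X n z \<and> src z = src e \<and>
     local_bd Y n (F n \<cdot> z \<oplus> \<ominus> (z' \<cdot> e))))"

lemma hinj_mon:
  assumes "hdata X n k c" "hdata Y n k' c'" "induces F n k c k' c' v" "chmap X Y F"
    "bounded_complex A X" "bounded_complex A Y" "hinj X Y F n"
  shows "mon v"
  unfolding mon_def
proof (intro conjI allI impI)
  note d = hdatD[OF assms(1)] and d' = hdatD[OF assms(2)] and f = chD[OF assms(4)] and v = indD[OF assms(3)]
  show "wt v" by (fact v)
  fix s assume s: "wt s" "tgt s = src v" "v \<cdot> s = zarr (src s) (tgt v)"
  then obtain e z where e: "epi e" "tgt e = src s" "represents k c z (s \<cdot> e)" "src z = src e"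
    using represents_ex[OF assms(1), of s] v by auto
  have "(v \<cdot> s) \<cdot> e = zarr (src e) (tgt c')" unfolding s(3) using s v e d' by simp
  then have r0: "represents k' c' (F n \<cdot> z) (zarr (src e) (tgt c'))" using v(4)[OF e(3)] by simp
  have zc: "cocycle X n z" using represents_cocycle(1)[OF assms(1) e(3) assms(5)] .
  have "zarr (src e) (tgt c') = zarr (src (F n \<cdot> z)) (tgt c')" using f e cocycleD[OF zc] by simp
  then have "local_bd Y n (F n \<cdot> z)" using represents_zero_iff[OF assms(2) r0 assms(6)] by blast
  then obtain e1 w where w: "epi e1" "tgt e1 = src (F n \<cdot> z)" "wt w" "src w = src e1" "tgt w = deg Y (n - 1)"
    "diff Y (n - 1) \<cdot> w = (F n \<cdot> z) \<cdot> e1" by (rule lbdE)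
  have te1: "tgt e1 = src z" using w cocycleD[OF zc] f by simp
  have r: "represents k c (z \<cdot> e1) ((s \<cdot> e) \<cdot> e1)" using represents_compose[OF _ te1 assms(1) e(3)] w by simp
  have "local_bd X n (z \<cdot> e1)"
    using assms(7) represents_cocycle(1)[OF assms(1) r assms(5)] w te1 zc cocycleD[OF zc] unfolding hinj_def by simp
  then have "(s \<cdot> e) \<cdot> e1 = zarr (src e1) (tgt c)"
    using represents_zero_iff[OF assms(1) r assms(5)] w te1 cocycleD[OF zc] by simp
  then have "s \<cdot> (e \<cdot> e1) = zarr (src e1) (tgt c)" by simp
  then show "s = zarr (src s) (src v)"
    using epD[OF epi_compose[OF e(1) w(1)], of s "tgt c" "src e1" "src s"] s v e w te1 by simp
qed

lemma hsurj_epi: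
  assumes "hdata X n k c" "hdata Y n k' c'" "induces F n k c k' c' v" "chmap X Y F"
    "bounded_complex A X" "bounded_complex A Y" "hsurj X Y F n"
  shows "epi v"
  unfolding epi_def
proof (intro conjI allI impI)
  note d = hdatD[OF assms(1)] and d' = hdatD[OF assms(2)] and f = chD[OF assms(4)] and v = indD[OF assms(3)]
  show "wt v" by (fact v)
  fix s assume s: "wt s" "src s = tgt v" "s \<cdot> v = zarr (src v) (tgt s)"
  have r': "represents k' c' k' c'" using represents_self[OF assms(2)] .
  obtain e z where e: "epi e" "tgt e = src k'" "cocycle X n z" "src z = src e"
      "local_bd Y n (F n \<cdot> z \<oplus> \<ominus> (k' \<cdot> e))"
    using assms(7) represents_cocycle(1)[OF assms(2) r' assms(6)] unfolding hsurj_def by blast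
  obtain h where h: "represents k c z h" using cocycle_represents[OF assms(1) e(3)] by blast
  note hh = represents_cocycle[OF assms(1) h assms(5)]
  have r1: "represents k' c' (F n \<cdot> z) (v \<cdot> h)" using v(4)[OF h] .
  have r2: "represents k' c' (k' \<cdot> e) (c' \<cdot> e)" using represents_compose[OF _ e(2) assms(2) r'] e by simp
  have "represents k' c' (F n \<cdot> z \<oplus> \<ominus> (k' \<cdot> e)) (v \<cdot> h \<oplus> \<ominus> (c' \<cdot> e))"
    using represents_diff[OF assms(2) r1 r2] e cocycleD[OF e(3)] f d' by simp
  then have "v \<cdot> h \<oplus> \<ominus> (c' \<cdot> e) = zarr (src (F n \<cdot> z \<oplus> \<ominus> (k' \<cdot> e))) (tgt c')"
    using represents_zero_iff[OF assms(2) _ assms(6)] e(5) by blast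
  then have "\<ominus> (c' \<cdot> e) = \<ominus> (v \<cdot> h)"
    using hh v e cocycleD[OF e(3)] f d' by (intro plus_arr_eq_zarr[of _ _ "src e" "tgt c'"]) simp_all
  then have "\<ominus> \<ominus> (c' \<cdot> e) = \<ominus> \<ominus> (v \<cdot> h)" by simp
  then have ce: "c' \<cdot> e = v \<cdot> h" using hh v e f d' by simp
  have "s \<cdot> (c' \<cdot> e) = (s \<cdot> v) \<cdot> h" unfolding ce by simp
  also have "\<dots> = zarr (src e) (tgt s)" unfolding s(3) using hh v e s by simp
  finally show "s = zarr (tgt v) (tgt s)"
    using epD[OF epi_compose[OF d'(6) e(1)], of s "tgt s" "src e" "tgt c'"] s v e d' by simp
qed

section \<open>Chosen cohomology objects and the functor H^n on complexes\<close>

definition hsel where "hsel X n = (SOME p. hdata X n (fst p) (snd p))"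
definition hker where "hker X n = fst (hsel X n)"
definition hproj where "hproj X n = snd (hsel X n)"
definition Hob where "Hob X n = tgt (hproj X n)"

lemma hdata_sel: "bounded_complex A X \<Longrightarrow> hdata X n (hker X n) (hproj X n)"
  unfolding hker_def hproj_def hsel_def by (rule someI_ex) (metis ex_hdata fst_conv snd_conv)

abbreviation hrep where "hrep X n \<equiv> represents (hker X n) (hproj X n)"

definition Hmap where
  "Hmap X Y F n = (SOME v. induces F n (hker X n) (hproj X n) (hker Y n) (hproj Y n) v)"

lemma Hob_obj [simp]: "bounded_complex A X \<Longrightarrow> Hob X n \<in> obj A"
  using hdatD(5)[OF hdata_sel, of X n] by (simp add: Hob_def)

lemma Hmap_induces:
  assumes "bounded_complex A X" "bounded_complex A Y" "chmap X Y F"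
  shows "induces F n (hker X n) (hproj X n) (hker Y n) (hproj Y n) (Hmap X Y F n)"
  unfolding Hmap_def using ex_induces[OF hdata_sel[OF assms(1)] hdata_sel[OF assms(2)] assms(3,1,2)] by (metis someI_ex)

lemma Hmap:
  assumes "bounded_complex A X" "bounded_complex A Y" "chmap X Y F"
  shows "wt (Hmap X Y F n)" "src (Hmap X Y F n) = Hob X n" "tgt (Hmap X Y F n) = Hob Y n"
    "hrep X n z h \<Longrightarrow> hrep Y n (F n \<cdot> z) (Hmap X Y F n \<cdot> h)"
  using indD[OF Hmap_induces[OF assms]] by (simp_all add: Hob_def)

lemma Hmap_eqI:
  assumes "bounded_complex A X" "bounded_complex A Y" "chmap X Y F"
    "wt v" "src v = Hob X n" "tgt v = Hob Y n"
    "\<And>z h. hrep X n z h \<Longrightarrow> hrep Y n (F n \<cdot> z) (v \<cdot> h)"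
  shows "Hmap X Y F n = v"
  using induces_unique[OF hdata_sel[OF assms(1)] hdata_sel[OF assms(2)] Hmap_induces[OF assms(1,2,3)]] assms(4-)
  by (simp add: induces_def Hob_def)

lemma hrep_cocycle:
  assumes "bounded_complex A X" "hrep X n z h"
  shows "cocycle X n z" "wt h" "tgt h = Hob X n" "src h = src z"
  using represents_cocycle[OF hdata_sel[OF assms(1)] assms(2,1)] by (simp_all add: Hob_def)

lemma chmap_ident: "bounded_complex A X \<Longrightarrow> chmap X X (\<lambda>n. ident (deg X n))"
  by (simp add: chmap_def)

lemma chmap_compose:
  assumes "chmap X Y F" "chmap Y Z G" shows "chmap X Z (\<lambda>n. G n \<cdot> F n)"
  unfolding chmap_def using chD[OF assms(1)] chD[OF assms(2)] by simp

lemma Hmap_ident: "bounded_complex A X \<Longrightarrow> Hmap X X (\<lambda>n. ident (deg X n)) n = ident (Hob X n)"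
proof (rule Hmap_eqI)
  assume b: "bounded_complex A X"
  fix z h assume h: "hrep X n z h"
  note c = hrep_cocycle[OF b h]
  show "hrep X n (ident (deg X n) \<cdot> z) (ident (Hob X n) \<cdot> h)"
    using c(2,3) cocycleD(1,2)[OF c(1)] h by simp
qed (simp_all add: chmap_ident)

lemma Hmap_compose:
  assumes "bounded_complex A X" "bounded_complex A Y" "bounded_complex A Z" "chmap X Y F" "chmap Y Z G"
  shows "Hmap X Z (\<lambda>n. G n \<cdot> F n) n = Hmap Y Z G n \<cdot> Hmap X Y F n"
proof (rule Hmap_eqI)
  note f = Hmap[OF assms(1,2,4)] and g = Hmap[OF assms(2,3,5)]
  show "chmap X Z (\<lambda>n. G n \<cdot> F n)" using chmap_compose assms by blast
  fix z h assume "hrep X n z h"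
  then show "hrep Z n ((G n \<cdot> F n) \<cdot> z) ((Hmap Y Z G n \<cdot> Hmap X Y F n) \<cdot> h)"
    using f(4) g(4) by simp
qed (use assms Hmap in simp_all)

lemma hob_zero_local_bd:
  assumes "bounded_complex A X" "zero_object A (Hob X n)" "cocycle X n z"
  shows "local_bd X n z"
proof -
  obtain h where h: "hrep X n z h" using cocycle_represents[OF hdata_sel[OF assms(1)] assms(3)] by blast
  note d = hrep_cocycle[OF assms(1) h]
  have "h = zarr (src z) (Hob X n)" using to_zero[OF assms(2) d(2,3)] d by simp
  then show ?thesis
    using represents_zero_iff[OF hdata_sel[OF assms(1)] h assms(1)] by (simp add: Hob_def)
qed

lemma hob_deg_zero:
  assumes "bounded_complex A X" "zero_object A (deg X n)"
  shows "zero_object A (Hob X n)"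
proof -
  note d = hdatD[OF hdata_sel[OF assms(1)], of n]
  have "zero_object A (src (hker X n))" using mon_to_zero[OF d(2)] d assms by simp
  then show ?thesis using epi_from_zero[OF d(6)] d by (simp add: Hob_def)
qed

text \<open>The identity chain map, read between two sets of cohomology data of the same complex,
  induces a map that is mono and epi.\<close>

lemma cohomology_unique:
  assumes "bounded_complex A X" "is_cohomology A X n H"
  shows "isomorphic A H (Hob X n)"
proof -
  obtain K k c where "cohomology_data A X n K k H c" using assms(2) by (auto simp: is_cohomology_def)
  then have h: "hdata X n (Some (K, deg X n, k)) (Some (K, H, c))" (is "hdata X n ?k ?c")
    using cohomology_data_iff[OF assms(1)] by simp
  note s = hdata_sel[OF assms(1), of n]
  let ?F = "\<lambda>n. ident (deg X n)"
  have chmap: "chmap X X ?F" using chmap_ident assms by simp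
  obtain v where v: "induces ?F n ?k ?c (hker X n) (hproj X n) v" using ex_induces[OF h s chmap assms(1,1)] by blast
  have "hinj X X ?F n" unfolding hinj_def
  proof (intro allI impI)
    fix z y assume a: "cocycle X n z" "wt y" "src y = src z" "tgt y = deg X (n - 1)" "diff X (n - 1) \<cdot> y = ident (deg X n) \<cdot> z"
    show "local_bd X n z"
      by (rule lbdI[of "ident (src z)" z y]) (use a cocycleD[OF a(1)] assms(1) in simp_all)
  qed
  moreover have "hsurj X X ?F n" unfolding hsurj_def
  proof (intro allI impI)
    fix z assume a: "cocycle X n z"
    have "local_bd X n (ident (deg X n) \<cdot> z \<oplus> \<ominus> (z \<cdot> ident (src z)))"
      by (rule lbdI[of "ident (src z)" _ "zarr (src z) (deg X (n - 1))"]) (use a cocycleD[OF a] assms(1) in simp_all)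
    then show "\<exists>e z'. epi e \<and> tgt e = src z \<and> cocycle X n z' \<and> src z' = src e \<and>
       local_bd X n (ident (deg X n) \<cdot> z' \<oplus> \<ominus> (z \<cdot> e))"
      using a cocycleD[OF a] by (intro exI[of _ "ident (src z)"] exI[of _ z]) simp
  qed
  ultimately have "mon v" "epi v"
    using hinj_mon[OF h s v chmap assms(1,1)] hsurj_epi[OF h s v chmap assms(1,1)] by auto
  then show ?thesis using isomorphicI[of v] indD[OF v] by (simp add: Hob_def)
qed

lemma is_cohomology_Hob: "bounded_complex A X \<Longrightarrow> is_cohomology A X n (Hob X n)"
proof -
  assume b: "bounded_complex A X"
  note h = hdata_sel[OF b, of n] and d = hdatD[OF hdata_sel[OF b, of n]]
  have "hker X n = Some (src (hker X n), deg X n, und (hker X n))" "hproj X n = Some (src (hker X n), Hob X n, und (hproj X n))"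
    using d wt_eta[of "hker X n"] wt_eta[of "hproj X n"] by (simp_all add: Hob_def)
  then show ?thesis using h cohomology_data_iff[OF b] unfolding is_cohomology_def by metis
qed

end


section \<open>The long exact sequence of a mapping cone\<close>

context abelian_category
begin

lemma shift_deg [simp]: "deg (shift A X) n = deg X (n + 1)"
  by (simp add: shift_def)

lemma diff_shift [simp]:
  assumes "bounded_complex A X" shows "diff (shift A X) n = \<ominus> diff X (n + 1)"
proof -
  have "dif X (n + 1) \<in> mor A (deg X (n + 1)) (deg X (n + 1 + 1))"
    using assms unfolding bounded_complex_def by blast
  then show ?thesis by (simp add: diff_def minus_arr_Some shift_def add.commute[of n 2])
qed

lemma bounded_complexI:
  assumes "\<And>n. wt (diff X n)" "\<And>n. diff X (n + 1) \<cdot> diff X n = zarr (deg X n) (deg X (n + 2))"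
    "\<And>n. \<bar>n\<bar> > N \<Longrightarrow> zero_object A (deg X n)"
  shows "bounded_complex A X"
proof -
  have m: "dif X n \<in> mor A (deg X n) (deg X (n + 1))" for n using assms(1)[of n] by (simp add: diff_def)
  moreover have "cmp A (dif X (n + 1)) (dif X n) = mzero A (deg X n) (deg X (n + 2))" for n
    using assms(2)[of n] compose_Some[OF m[of n] m[of "n + 1"]] by (simp add: diff_def zarr_def add.commute[of n 2])
  moreover have "deg X n \<in> obj A" for n using m mor_obj by blast
  ultimately show ?thesis using assms(3) unfolding bounded_complex_def by blast
qed

lemma bounded_complexE:
  assumes "bounded_complex A X" obtains N where "\<And>n. \<bar>n\<bar> > N \<Longrightarrow> zero_object A (deg X n)"
  using assms unfolding bounded_complex_def by blast

lemma bc_shift [simp]: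
  assumes "bounded_complex A X" shows "bounded_complex A (shift A X)"
proof -
  obtain N where N: "\<And>n. \<bar>n\<bar> > N \<Longrightarrow> zero_object A (deg X n)" using bounded_complexE[OF assms] by blast
  show ?thesis
    by (rule bounded_complexI[of _ "\<bar>N\<bar> + 1"]) (use assms N in \<open>auto simp: wt_diff algebra_simps simp del: tgt_diff\<close>)
qed

lemma chmap_shift: "chmap X Y F \<Longrightarrow> bounded_complex A X \<Longrightarrow> bounded_complex A Y \<Longrightarrow>
    chmap (shift A X) (shift A Y) (\<lambda>n. F (n + 1))"
  unfolding chmap_def by simp

lemma ker_minus_arr: "wt f \<Longrightarrow> ker (\<ominus> f) k \<longleftrightarrow> ker f k"
  by (auto simp: ker_def minus_arr_eq_zarr)

lemma coker_minus_arr: "wt f \<Longrightarrow> coker (\<ominus> f) c \<longleftrightarrow> coker f c"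
  by (auto simp: coker_def minus_arr_eq_zarr)

lemma hdata_shift:
  assumes "bounded_complex A X"
  shows "hdata (shift A X) n k c \<longleftrightarrow> hdata X (n + 1) k c"
proof -
  have *: "(\<exists>e. wt e \<and> src e = S \<and> tgt e = src k \<and> k \<cdot> e = \<ominus> d \<and> coker e c) \<longleftrightarrow>
    (\<exists>e. wt e \<and> src e = S \<and> tgt e = src k \<and> k \<cdot> e = d \<and> coker e c)" if "wt d" for S d
  proof
    assume "\<exists>e. wt e \<and> src e = S \<and> tgt e = src k \<and> k \<cdot> e = \<ominus> d \<and> coker e c"
    then obtain e where e: "wt e" "src e = S" "tgt e = src k" "k \<cdot> e = \<ominus> d" "coker e c" by blast
    then show "\<exists>e. wt e \<and> src e = S \<and> tgt e = src k \<and> k \<cdot> e = d \<and> coker e c"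
      using that by (intro exI[of _ "\<ominus> e"]) (simp add: coker_minus_arr)
  next
    assume "\<exists>e. wt e \<and> src e = S \<and> tgt e = src k \<and> k \<cdot> e = d \<and> coker e c"
    then obtain e where e: "wt e" "src e = S" "tgt e = src k" "k \<cdot> e = d" "coker e c" by blast
    then show "\<exists>e. wt e \<and> src e = S \<and> tgt e = src k \<and> k \<cdot> e = \<ominus> d \<and> coker e c"
      by (intro exI[of _ "\<ominus> e"]) (simp add: coker_minus_arr)
  qed
  show ?thesis unfolding hdata_def using assms by (simp add: ker_minus_arr *)
qed

text \<open>
  The data that define the cohomology of \<open>X[1]\<close> in degree \<open>n\<close> and that of \<open>X\<close> in degree \<open>n + 1\<close> are
  the same, so the choices made for them are equal and not merely isomorphic.
\<close>

lemma hsel_shift [simp]: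
  assumes "bounded_complex A X"
  shows "hker (shift A X) n = hker X (n + 1)" "hproj (shift A X) n = hproj X (n + 1)"
    "Hob (shift A X) n = Hob X (n + 1)"
  unfolding Hob_def hker_def hproj_def hsel_def hdata_shift[OF assms] by simp_all

lemma Hmap_shift [simp]:
  assumes "bounded_complex A X" "bounded_complex A Y"
  shows "Hmap (shift A X) (shift A Y) (\<lambda>n. F (n + 1)) n = Hmap X Y F (n + 1)"
proof -
  have "induces (\<lambda>n. F (n + 1)) n k c k' c' = induces F (n + 1) k c k' c'" for k c k' c'
    by (simp add: fun_eq_iff induces_def)
  then show ?thesis unfolding Hmap_def using assms by simp
qed

lemma local_bd_zarr: "bounded_complex A X \<Longrightarrow> T \<in> obj A \<Longrightarrow> local_bd X n (zarr T (deg X n))"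
  by (rule lbdI[of "ident T" _ "zarr T (deg X (n - 1))"]) simp_all

lemma local_bd_diff:
  assumes "bounded_complex A X" "wt w" "tgt w = deg X (n - 1)"
  shows "local_bd X n (diff X (n - 1) \<cdot> w)"
  by (rule lbdI[of "ident (src w)" _ w]) (use assms in simp_all)

text \<open>Reduces exactness on cohomology to a chase with cocycles, where equality of classes is
  equality up to a local boundary.\<close>

lemma exact_HmI:
  assumes b: "bounded_complex A X" "bounded_complex A Y" "bounded_complex A Z"
    and f: "chmap X Y F" "chmap Y Z G"
    and 1: "\<And>x. cocycle X n x \<Longrightarrow> local_bd Z n (G n \<cdot> F n \<cdot> x)"
    and 2: "\<And>y. cocycle Y n y \<Longrightarrow> local_bd Z n (G n \<cdot> y) \<Longrightarrow> \<exists>e x. epi e \<and> tgt e = src y \<and> cocycle X n x \<and> src x = src e \<and>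
       local_bd Y n (F n \<cdot> x \<oplus> \<ominus> (y \<cdot> e))"
  shows "exact (Hmap X Y F n) (Hmap Y Z G n)"
  unfolding exact_def
proof (intro conjI allI impI)
  note hf = Hmap[OF b(1,2) f(1), of n] and hg = Hmap[OF b(2,3) f(2), of n]
  show "wt (Hmap X Y F n)" "wt (Hmap Y Z G n)" "tgt (Hmap X Y F n) = src (Hmap Y Z G n)"
    using hf hg by simp_all
  note sX = hdata_sel[OF b(1), of n] and sY = hdata_sel[OF b(2), of n] and sZ = hdata_sel[OF b(3), of n]
  \<comment> \<open>The kernel inclusion is the tautological cocycle, with class
    \<open>hproj X n\<close>. That projection is epi, so the composite vanishes as soon as it
    vanishes on this one class.\<close>
  have r: "hrep X n (hker X n) (hproj X n)" using represents_self[OF sX] .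
  have r2: "hrep Z n (G n \<cdot> F n \<cdot> hker X n) (Hmap Y Z G n \<cdot> Hmap X Y F n \<cdot> hproj X n)"
    using hg(4)[OF hf(4)[OF r]] .
  note dX = hdatD[OF sX]
  have "local_bd Z n (G n \<cdot> F n \<cdot> hker X n)" using 1[OF hrep_cocycle(1)[OF b(1) r]] .
  then have "Hmap Y Z G n \<cdot> Hmap X Y F n \<cdot> hproj X n = zarr (src (G n \<cdot> F n \<cdot> hker X n)) (tgt (hproj Z n))"
    using represents_zero_iff[OF sZ r2 b(3)] by blast
  then have k: "(Hmap Y Z G n \<cdot> Hmap X Y F n) \<cdot> hproj X n = zarr (src (hproj X n)) (Hob Z n)"
    using chD[OF f(1)] chD[OF f(2)] dX by (simp add: Hob_def)
  have "Hmap Y Z G n \<cdot> Hmap X Y F n = zarr (tgt (hproj X n)) (Hob Z n)"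
    by (rule epD[OF dX(6) _ _ _ _ _ k]) (use hf(1-3) hg(1-3) in \<open>simp_all add: Hob_def\<close>)
  then show "Hmap Y Z G n \<cdot> Hmap X Y F n = zarr (src (Hmap X Y F n)) (tgt (Hmap Y Z G n))"
    using hf(1-3) hg(1-3) by (simp add: Hob_def)
  fix y assume y: "wt y" "tgt y = src (Hmap Y Z G n)" "Hmap Y Z G n \<cdot> y = zarr (src y) (tgt (Hmap Y Z G n))"
  have ty: "tgt y = tgt (hproj Y n)" using y hg by (simp add: Hob_def)
  obtain e z where e: "epi e" "tgt e = src y" "hrep Y n z (y \<cdot> e)" "src z = src e"
    using represents_ex[OF sY y(1) ty] by blast
  have zc: "cocycle Y n z" using hrep_cocycle(1)[OF b(2) e(3)] .
  have r3: "hrep Z n (G n \<cdot> z) (Hmap Y Z G n \<cdot> y \<cdot> e)" using hg(4)[OF e(3)] .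
  have "Hmap Y Z G n \<cdot> y \<cdot> e = (Hmap Y Z G n \<cdot> y) \<cdot> e" by simp
  also have "\<dots> = zarr (src e) (Hob Z n)" unfolding y(3) using e y hg b by simp
  finally have "local_bd Z n (G n \<cdot> z)"
    using represents_zero_iff[OF sZ r3 b(3)] e cocycleD[OF zc] chD[OF f(2)] by (simp add: Hob_def)
  then obtain e2 x where x: "epi e2" "tgt e2 = src z" "cocycle X n x" "src x = src e2"
    "local_bd Y n (F n \<cdot> x \<oplus> \<ominus> (z \<cdot> e2))" using 2[OF zc] by blast
  obtain h where h: "hrep X n x h" using cocycle_represents[OF sX x(3)] by blast
  note hh = hrep_cocycle[OF b(1) h]
  have sx: "src (F n \<cdot> x) = src (z \<cdot> e2)"
    using x cocycleD[OF x(3)] cocycleD[OF zc] chD[OF f(1)] by simp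
  have "hrep Y n (F n \<cdot> x \<oplus> \<ominus> (z \<cdot> e2)) (Hmap X Y F n \<cdot> h \<oplus> \<ominus> ((y \<cdot> e) \<cdot> e2))"
    using represents_diff[OF sY hf(4)[OF h] represents_compose[OF _ x(2) sY e(3)] sx] x by simp
  then have "Hmap X Y F n \<cdot> h \<oplus> \<ominus> ((y \<cdot> e) \<cdot> e2) = zarr (src (F n \<cdot> x \<oplus> \<ominus> (z \<cdot> e2))) (tgt (hproj Y n))"
    using represents_zero_iff[OF sY _ b(2)] x(5) by blast
  also have "src (F n \<cdot> x \<oplus> \<ominus> (z \<cdot> e2)) = src e2"
    using x cocycleD[OF x(3)] cocycleD[OF zc] chD[OF f(1)] by simp
  finally have "\<ominus> ((y \<cdot> e) \<cdot> e2) = \<ominus> (Hmap X Y F n \<cdot> h)"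
    using hh hf y ty hg x e by (intro plus_arr_eq_zarr[of _ _ "src e2" "tgt (hproj Y n)"]) (simp_all add: Hob_def)
  then have "\<ominus> \<ominus> ((y \<cdot> e) \<cdot> e2) = \<ominus> \<ominus> (Hmap X Y F n \<cdot> h)" by simp
  then have "Hmap X Y F n \<cdot> h = y \<cdot> (e \<cdot> e2)" using hh hf y hg x e by simp
  then show "\<exists>e h. epi e \<and> tgt e = src y \<and> wt h \<and> src h = src e \<and> tgt h = src (Hmap X Y F n) \<and>
      Hmap X Y F n \<cdot> h = y \<cdot> e"
    using hh hf x e epi_compose[OF e(1) x(1)] by (intro exI[of _ "e \<cdot> e2"] exI[of _ h]) simp
qed

definition cone where
  "cone X Y Z F G H I Q \<longleftrightarrow> bounded_complex A X \<and> bounded_complex A Y \<and> bounded_complex A Z \<and>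
     chmap X Y F \<and> chmap Y Z G \<and> chmap Z (shift A X) H \<and>
     (\<forall>n. biprod (I n) (G n) (H n) (Q n) \<and> src (I n) = deg X (n + 1) \<and> tgt (I n) = deg Z n \<and>
       diff Z n = I (n + 1) \<cdot> diff (shift A X) n \<cdot> H n \<oplus>
         (G (n + 1) \<cdot> F (n + 1) \<cdot> H n \<oplus> G (n + 1) \<cdot> diff Y n \<cdot> Q n))"

section \<open>The long exact sequence of a fixed cone\<close>

context
  fixes X Y Z F G H I Q assumes c: "cone X Y Z F G H I Q"
begin

lemma cone_bc: "bounded_complex A X" "bounded_complex A Y" "bounded_complex A Z"
  and cone_chmap: "chmap X Y F" "chmap Y Z G" "chmap Z (shift A X) H"
  and cone_biprod: "biprod (I n) (G n) (H n) (Q n)"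
  and cone_diff: "diff Z n = I (n + 1) \<cdot> diff (shift A X) n \<cdot> H n \<oplus>
         (G (n + 1) \<cdot> F (n + 1) \<cdot> H n \<oplus> G (n + 1) \<cdot> diff Y n \<cdot> Q n)"
  and cone_src_I: "src (I n) = deg X (n + 1)" and cone_tgt_I: "tgt (I n) = deg Z n"
  using c unfolding cone_def by blast+

lemma cone_ty:
  "wt (F n)" "src (F n) = deg X n" "tgt (F n) = deg Y n"
  "wt (G n)" "src (G n) = deg Y n" "tgt (G n) = deg Z n"
  "wt (H n)" "src (H n) = deg Z n" "tgt (H n) = deg X (n + 1)"
  "wt (I n)" "src (I n) = deg X (n + 1)" "tgt (I n) = deg Z n"
  "wt (Q n)" "src (Q n) = deg Z n" "tgt (Q n) = deg Y n"
  using chD[OF cone_chmap(1)] chD[OF cone_chmap(2)] chD[OF cone_chmap(3)] biprod_rw[OF cone_biprod, of n] cone_src_I cone_tgt_I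
  by simp_all

lemma cone_rw:
  "wt x \<Longrightarrow> tgt x = deg X (n + 1) \<Longrightarrow> H n \<cdot> I n \<cdot> x = x"
  "wt y \<Longrightarrow> tgt y = deg Y n \<Longrightarrow> Q n \<cdot> G n \<cdot> y = y"
  "wt x \<Longrightarrow> tgt x = deg X (n + 1) \<Longrightarrow> Q n \<cdot> I n \<cdot> x = zarr (src x) (deg Y n)"
  "wt y \<Longrightarrow> tgt y = deg Y n \<Longrightarrow> H n \<cdot> G n \<cdot> y = zarr (src y) (deg X (n + 1))"
  using biprod_rw[OF cone_biprod, of n] cone_ty[of n] cone_bc by simp_all

lemma cone_decomp: "wt z \<Longrightarrow> tgt z = deg Z n \<Longrightarrow> I n \<cdot> H n \<cdot> z \<oplus> G n \<cdot> Q n \<cdot> z = z"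
  using biprod_decomp[OF cone_biprod, of z n] cone_ty[of n] by simp

lemma cone_d:
  assumes "wt u" "wt v" "src u = src v" "tgt u = deg X (n + 1)" "tgt v = deg Y n" "m = n + 1"
  shows "diff Z n \<cdot> (I n \<cdot> u \<oplus> G n \<cdot> v) =
    \<ominus> (I m \<cdot> diff X m \<cdot> u) \<oplus> (G m \<cdot> F m \<cdot> u \<oplus> G m \<cdot> diff Y n \<cdot> v)"
  unfolding cone_diff[of n] assms(6) using assms(1-5) cone_ty[of n] cone_ty[of "n + 1"] cone_bc
  by (simp add: cone_rw plus_arr_assoc)

lemma cone_dH:
  assumes "wt z" "tgt z = deg Z n" "m = n + 1"
  shows "H m \<cdot> diff Z n \<cdot> z = \<ominus> (diff X m \<cdot> H n \<cdot> z)"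
  using chD(5)[OF cone_chmap(3), of n z] assms cone_bc by simp

lemma cone_dQ:
  assumes "wt z" "tgt z = deg Z n" "m = n + 1"
  shows "Q m \<cdot> diff Z n \<cdot> z = F m \<cdot> H n \<cdot> z \<oplus> diff Y n \<cdot> Q n \<cdot> z"
  unfolding cone_diff[of n] assms(3) using assms(1-2) cone_ty[of n] cone_ty[of "n + 1"] cone_bc
  by (simp add: cone_rw)

text \<open>These are the \<open>H\<close>- and \<open>Q\<close>-components of the equation dz =
  0.\<close>

lemma cone_cocycle:
  assumes "cocycle Z n z"
  shows "diff X (n + 1) \<cdot> H n \<cdot> z = zarr (src z) (deg X (n + 2))"
    "F (n + 1) \<cdot> H n \<cdot> z = \<ominus> (diff Y n \<cdot> Q n \<cdot> z)"
proof -
  note d = cocycleD[OF assms] and t = cone_ty[of n] cone_ty[of "n + 1"] cone_bc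
  have "\<ominus> (diff X (n + 1) \<cdot> H n \<cdot> z) = zarr (src z) (deg X (n + 2))"
    using cone_dH[OF d(1,2) HOL.refl] d t by (simp add: add.commute[of n 2])
  then show "diff X (n + 1) \<cdot> H n \<cdot> z = zarr (src z) (deg X (n + 2))"
    using minus_arr_eq_zarr[of "diff X (n + 1) \<cdot> H n \<cdot> z"] d t by simp
  have "F (n + 1) \<cdot> H n \<cdot> z \<oplus> diff Y n \<cdot> Q n \<cdot> z = zarr (src z) (deg Y (n + 1))"
    using cone_dQ[OF d(1,2) HOL.refl] d t by simp
  then show "F (n + 1) \<cdot> H n \<cdot> z = \<ominus> (diff Y n \<cdot> Q n \<cdot> z)"
    using d t by (intro plus_arr_eq_zarr[of _ _ "src z" "deg Y (n + 1)"]) (simp_all add: plus_arr_comm)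
qed

text \<open>In the cone, G F x is the boundary of I x. Conversely, if d w = G y e, the components of
  \<open>w\<close> are the witnesses: H w is a cocycle, and F (H w) - y e is the boundary of - Q
  w.\<close>

lemma cone_exact1: "exact (Hmap X Y F n) (Hmap Y Z G n)"
proof (rule exact_HmI)
  note t = cone_ty[of n] cone_ty[of "n - 1"] cone_bc
  fix x assume "cocycle X n x"
  note x = cocycleD[OF this]
  have "G n \<cdot> F n \<cdot> x = diff Z (n - 1) \<cdot> (I (n - 1) \<cdot> x \<oplus> G (n - 1) \<cdot> zarr (src x) (deg Y (n - 1)))"
    using cone_d[of x "zarr (src x) (deg Y (n - 1))" "n - 1" n] x t by simp
  then show "local_bd Z n (G n \<cdot> F n \<cdot> x)" using local_bd_diff[of Z _ n] x t by simp
next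
  note t = cone_ty[of n] cone_ty[of "n - 1"] cone_bc
  fix y assume yc: "cocycle Y n y" and l: "local_bd Z n (G n \<cdot> y)"
  note y = cocycleD[OF yc]
  obtain e w where w: "epi e" "tgt e = src (G n \<cdot> y)" "wt w" "src w = src e" "tgt w = deg Z (n - 1)"
    "diff Z (n - 1) \<cdot> w = (G n \<cdot> y) \<cdot> e" using l by (rule lbdE)
  have te: "tgt e = src y" using w y t by simp
  have "\<ominus> (diff X n \<cdot> H (n - 1) \<cdot> w) = zarr (src e) (deg X (n + 1))"
    using cone_dH[OF w(3,5), of n] w y te t by (simp add: cone_rw)
  then have u: "cocycle X n (H (n - 1) \<cdot> w)"
    using minus_arr_eq_zarr[of "diff X n \<cdot> H (n - 1) \<cdot> w"] w t by (intro cocycleI) simp_all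
  have "F n \<cdot> H (n - 1) \<cdot> w \<oplus> diff Y (n - 1) \<cdot> Q (n - 1) \<cdot> w = y \<cdot> e"
    using cone_dQ[OF w(3,5), of n] w y te t by (simp add: cone_rw)
  then have "F n \<cdot> (H (n - 1) \<cdot> w) \<oplus> \<ominus> (y \<cdot> e) = diff Y (n - 1) \<cdot> \<ominus> (Q (n - 1) \<cdot> w)"
    using w t by (simp flip: \<open>_ = y \<cdot> e\<close>)
  moreover have "local_bd Y n (diff Y (n - 1) \<cdot> \<ominus> (Q (n - 1) \<cdot> w))"
    using w t by (intro local_bd_diff) simp_all
  ultimately have "local_bd Y n (F n \<cdot> (H (n - 1) \<cdot> w) \<oplus> \<ominus> (y \<cdot> e))" by simp
  then show "\<exists>e x. epi e \<and> tgt e = src y \<and> cocycle X n x \<and> src x = src e \<and> local_bd Y n (F n \<cdot> x \<oplus> \<ominus> (y \<cdot> e))"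
    using w te u t by (intro exI[of _ e] exI[of _ "H (n - 1) \<cdot> w"]) simp
qed (fact cone_bc cone_chmap)+

lemma cone_exact2: "exact (Hmap Y Z G n) (Hmap Z (shift A X) H n)"
proof (rule exact_HmI)
  note t = cone_ty[of n] cone_ty[of "n - 1"] cone_bc
  fix y assume "cocycle Y n y"
  note y = cocycleD[OF this]
  show "local_bd (shift A X) n (H n \<cdot> G n \<cdot> y)"
    using local_bd_zarr[of "shift A X" "src y" n] y t by (simp add: cone_rw)
next
  note t = cone_ty[of n] cone_ty[of "n - 1"] cone_ty[of "n + 1"] cone_bc
  fix z assume zc: "cocycle Z n z" and l: "local_bd (shift A X) n (H n \<cdot> z)"
  note z = cocycleD[OF zc]
  obtain e w where w: "epi e" "tgt e = src (H n \<cdot> z)" "wt w" "src w = src e" "tgt w = deg (shift A X) (n - 1)"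
    "diff (shift A X) (n - 1) \<cdot> w = (H n \<cdot> z) \<cdot> e" using l by (rule lbdE)
  have te: "tgt e = src z" and tw: "tgt w = deg X n" using w z t by simp_all
  have dw: "\<ominus> (diff X n \<cdot> w) = H n \<cdot> z \<cdot> e" using w t by simp
  then have "\<ominus> \<ominus> (diff X n \<cdot> w) = \<ominus> (H n \<cdot> z \<cdot> e)" by simp
  then have dw': "diff X n \<cdot> w = \<ominus> (H n \<cdot> z \<cdot> e)" using w tw t by simp
  \<comment> \<open>The Y-part of \<open>z\<close> is not a cocycle: its boundary is - F H z. As H z
    e = - d w, subtracting F w corrects this, and then G ?y - z e is the boundary of - I w.\<close>
  let ?y = "Q n \<cdot> z \<cdot> e \<oplus> \<ominus> (F n \<cdot> w)"
  have ye: "wt ?y" "src ?y = src e" "tgt ?y = deg Y n" using w te tw z t by simp_all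
  have "F (n + 1) \<cdot> H n \<cdot> z \<cdot> e = (F (n + 1) \<cdot> H n \<cdot> z) \<cdot> e" by simp
  also have "\<dots> = \<ominus> (diff Y n \<cdot> Q n \<cdot> z \<cdot> e)" unfolding cone_cocycle(2)[OF zc] by simp
  finally have "cocycle Y n ?y"
    using ye w te tw z t chD(5)[OF cone_chmap(1), of n w] by (intro cocycleI) (simp_all add: dw')
  moreover have "local_bd Z n (G n \<cdot> ?y \<oplus> \<ominus> (z \<cdot> e))"
  proof -
    have dz: "I n \<cdot> H n \<cdot> z \<cdot> e \<oplus> G n \<cdot> Q n \<cdot> z \<cdot> e = z \<cdot> e"
      using cone_decomp[of "z \<cdot> e" n] z te w by simp
    have m: "\<ominus> (z \<cdot> e) = \<ominus> (I n \<cdot> H n \<cdot> z \<cdot> e) \<oplus> \<ominus> (G n \<cdot> Q n \<cdot> z \<cdot> e)"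
      unfolding minus_arr_plus_arr[symmetric] dz ..
    have "G n \<cdot> ?y \<oplus> \<ominus> (z \<cdot> e) = (G n \<cdot> Q n \<cdot> z \<cdot> e \<oplus> \<ominus> (G n \<cdot> F n \<cdot> w)) \<oplus>
       (\<ominus> (I n \<cdot> H n \<cdot> z \<cdot> e) \<oplus> \<ominus> (G n \<cdot> Q n \<cdot> z \<cdot> e))" unfolding m by simp
    also have "\<dots> = (\<ominus> (I n \<cdot> H n \<cdot> z \<cdot> e) \<oplus> \<ominus> (G n \<cdot> F n \<cdot> w)) \<oplus> (G n \<cdot> Q n \<cdot> z \<cdot> e \<oplus> \<ominus> (G n \<cdot> Q n \<cdot> z \<cdot> e))"
      by (simp only: plus_arr_ac)
    also have "\<dots> = \<ominus> (I n \<cdot> H n \<cdot> z \<cdot> e) \<oplus> \<ominus> (G n \<cdot> F n \<cdot> w)"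
      using z w te tw t by simp
    also have "\<dots> = diff Z (n - 1) \<cdot> \<ominus> (I (n - 1) \<cdot> w)"
      using cone_d[of w "zarr (src w) (deg Y (n - 1))" "n - 1" n] w tw z te t by (simp add: dw')
    finally show ?thesis using local_bd_diff[of Z "\<ominus> (I (n - 1) \<cdot> w)" n] w tw t by simp
  qed
  ultimately show "\<exists>e x. epi e \<and> tgt e = src z \<and> cocycle Y n x \<and> src x = src e \<and> local_bd Z n (G n \<cdot> x \<oplus> \<ominus> (z \<cdot> e))"
    using w te ye by (intro exI[of _ e] exI[of _ ?y]) simp
qed (use cone_bc cone_chmap in simp_all)

lemma cone_exact3: "exact (Hmap Z (shift A X) H n) (Hmap X Y F (n + 1))"
proof -
  note t = cone_ty[of n] cone_ty[of "n + 1"] cone_bc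
  \<comment> \<open>Shown first in degree \<open>n\<close> of the shifted map;
    \<open>Hmap_shift\<close> then reads it as degree \<open>n + 1\<close> of
    \<open>F\<close>.\<close>
  have "exact (Hmap Z (shift A X) H n) (Hmap (shift A X) (shift A Y) (\<lambda>n. F (n + 1)) n)"
  proof (rule exact_HmI)
    fix z assume zc: "cocycle Z n z"
    note z = cocycleD[OF zc]
    \<comment> \<open>By \<open>cone_cocycle\<close> this is minus a boundary of \<open>Y\<close>,
      and the sign is that of the shifted differential.\<close>
    have "F (n + 1) \<cdot> H n \<cdot> z = diff (shift A Y) (n - 1) \<cdot> (Q n \<cdot> z)"
      using cone_cocycle(2)[OF zc] t by simp
    then show "local_bd (shift A Y) n (F (n + 1) \<cdot> H n \<cdot> z)"
      using local_bd_diff[of "shift A Y" "Q n \<cdot> z" n] z t by simp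
  next
    fix a assume ac: "cocycle (shift A X) n a" and l: "local_bd (shift A Y) n (F (n + 1) \<cdot> a)"
    note a = cocycleD[OF ac]
    have ta: "tgt a = deg X (n + 1)" using a by simp
    have "\<ominus> (diff X (n + 1) \<cdot> a) = zarr (src a) (deg X (n + 1 + 1))" using a t by simp
    then have da: "diff X (n + 1) \<cdot> a = zarr (src a) (deg X (n + 1 + 1))"
      using minus_arr_eq_zarr[of "diff X (n + 1) \<cdot> a"] a t by simp
    obtain e w where w: "epi e" "tgt e = src (F (n + 1) \<cdot> a)" "wt w" "src w = src e" "tgt w = deg (shift A Y) (n - 1)"
      "diff (shift A Y) (n - 1) \<cdot> w = (F (n + 1) \<cdot> a) \<cdot> e" using l by (rule lbdE)
    have te: "tgt e = src a" and tw: "tgt w = deg Y n" using w a t by simp_all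
    have fa: "F (n + 1) \<cdot> a \<cdot> e = \<ominus> (diff Y n \<cdot> w)" using w t by simp
    have dae: "diff X (n + 1) \<cdot> a \<cdot> e = zarr (src e) (deg X (n + 1 + 1))"
      using w te t by (simp add: da flip: compose_assoc)
    \<comment> \<open>Since F a e = - d w, adding G w to I a e cancels the Y-part of the boundary of
      the latter.\<close>
    let ?z = "I n \<cdot> (a \<cdot> e) \<oplus> G n \<cdot> w"
    have ze: "wt ?z" "src ?z = src e" "tgt ?z = deg Z n" using w te tw ta a t by simp_all
    have "diff Z n \<cdot> ?z = \<ominus> (I (n + 1) \<cdot> diff X (n + 1) \<cdot> a \<cdot> e) \<oplus>
        (G (n + 1) \<cdot> F (n + 1) \<cdot> a \<cdot> e \<oplus> G (n + 1) \<cdot> diff Y n \<cdot> w)"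
      using w te tw ta a t by (subst cone_d) simp_all
    also have "\<dots> = zarr (src e) (deg Z (n + 1))"
      unfolding fa dae using w(1-5) te tw ta a t by simp
    finally have "cocycle Z n ?z" using ze by (intro cocycleI) simp_all
    moreover have "H n \<cdot> ?z \<oplus> \<ominus> (a \<cdot> e) = zarr (src e) (deg (shift A X) n)"
      using w te tw ta a t by (simp add: cone_rw)
    then have "local_bd (shift A X) n (H n \<cdot> ?z \<oplus> \<ominus> (a \<cdot> e))"
      using local_bd_zarr[of "shift A X" "src e" n] w t by simp
    ultimately show "\<exists>e x. epi e \<and> tgt e = src a \<and> cocycle Z n x \<and> src x = src e \<and> local_bd (shift A X) n (H n \<cdot> x \<oplus> \<ominus> (a \<cdot> e))"
      using w te ze by (intro exI[of _ e] exI[of _ ?z]) simp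
  qed (use cone_bc cone_chmap chmap_shift in simp_all)
  then show ?thesis using cone_bc by simp
qed

end

end


section \<open>Mapping cones, stalk complexes and truncations\<close>

context abelian_category
begin

text \<open>Bridge from raw chain maps, families of untyped arrows, to families of typed arrows;
  \<open>level_und\<close> concerns the way back.\<close>

definition level :: "('o, 'm) cochain \<Rightarrow> ('o, 'm) cochain \<Rightarrow> (int \<Rightarrow> 'm) \<Rightarrow> int \<Rightarrow> ('o \<times> 'o \<times> 'm) option" where
  "level X Y f n = Some (deg X n, deg Y n, f n)"

lemma chain_map_iff:
  assumes "bounded_complex A X" "bounded_complex A Y"
  shows "chain_map A X Y f \<longleftrightarrow> chmap X Y (level X Y f)"
proof -
  have d: "dif X n \<in> mor A (deg X n) (deg X (n + 1))" "dif Y n \<in> mor A (deg Y n) (deg Y (n + 1))" for n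
    using wt_diff[OF assms(1), of n] wt_diff[OF assms(2), of n] by (simp_all add: diff_def)
  show ?thesis
  proof
    assume "chain_map A X Y f"
    then have m: "f n \<in> mor A (deg X n) (deg Y n)" "cmp A (f (n + 1)) (dif X n) = cmp A (dif Y n) (f n)" for n
      by (auto simp: chain_map_def)
    show "chmap X Y (level X Y f)"
      unfolding chmap_def using m d by (simp add: level_def diff_def compose_Some)
  next
    assume c: "chmap X Y (level X Y f)"
    have m: "f n \<in> mor A (deg X n) (deg Y n)" for n using chD(1)[OF c, of n] by (simp add: level_def)
    have "cmp A (f (n + 1)) (dif X n) = cmp A (dif Y n) (f n)" for n
      using chD(4)[OF c, of n] compose_Some[OF m[of n] d(2)[of n]] compose_Some[OF d(1)[of n] m[of "n + 1"]]
      by (simp add: level_def diff_def)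
    then show "chain_map A X Y f" using m by (simp add: chain_map_def)
  qed
qed

lemma Cb_mor: "f \<in> mor (Cb A) X Y \<longleftrightarrow> bounded_complex A X \<and> bounded_complex A Y \<and> chmap X Y (level X Y f)"
  using chain_map_iff by (auto simp: Cb_def)

lemma level_und: "chmap X Y F \<Longrightarrow> level X Y (\<lambda>n. und (F n)) = F"
  using wt_eta chD by (fastforce simp: level_def fun_eq_iff)

lemma Cb_morI: "bounded_complex A X \<Longrightarrow> bounded_complex A Y \<Longrightarrow> chmap X Y F \<Longrightarrow> (\<lambda>n. und (F n)) \<in> mor (Cb A) X Y"
  by (simp add: Cb_mor level_und)

lemma cone_conv:
  assumes "bounded_complex A X" "bounded_complex A Y"
    "f' \<in> mor A (deg X (n + 1)) (deg Y (n + 1))" "h \<in> mor A P (deg X (n + 1))" "q \<in> mor A P (deg Y n)"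
    "i' \<in> mor A (deg X (n + 1 + 1)) P'" "g' \<in> mor A (deg Y (n + 1)) P'"
  shows "Some (P, P', madd A (cmp A i' (cmp A (dif (shift A X) n) h))
      (madd A (cmp A g' (cmp A f' h)) (cmp A g' (cmp A (dif Y n) q)))) =
    Some (deg X (n + 1 + 1), P', i') \<cdot> diff (shift A X) n \<cdot> Some (P, deg X (n + 1), h) \<oplus>
     (Some (deg Y (n + 1), P', g') \<cdot> Some (deg X (n + 1), deg Y (n + 1), f') \<cdot> Some (P, deg X (n + 1), h) \<oplus>
      Some (deg Y (n + 1), P', g') \<cdot> diff Y n \<cdot> Some (P, deg Y n, q))"
proof -
  have d: "dif (shift A X) n \<in> mor A (deg X (n + 1)) (deg X (n + 1 + 1))" "dif Y n \<in> mor A (deg Y n) (deg Y (n + 1))"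
    using wt_diff[OF bc_shift[OF assms(1)], of n] wt_diff[OF assms(2), of n] by (simp_all add: diff_def del: diff_shift)
  have D: "diff (shift A X) n = Some (deg X (n + 1), deg X (n + 1 + 1), dif (shift A X) n)"
    "diff Y n = Some (deg Y n, deg Y (n + 1), dif Y n)" by (simp_all add: diff_def del: diff_shift)
  note m1 = cmp_mor[OF assms(4) d(1)] and m2 = cmp_mor[OF assms(4,3)] and m3 = cmp_mor[OF assms(5) d(2)]
  note m1' = cmp_mor[OF m1 assms(6)] and m2' = cmp_mor[OF m2 assms(7)] and m3' = cmp_mor[OF m3 assms(7)]
  show ?thesis
    unfolding D compose_Some[OF assms(4) d(1)] compose_Some[OF assms(4,3)] compose_Some[OF assms(5) d(2)]
      compose_Some[OF m1 assms(6)] compose_Some[OF m2 assms(7)] compose_Some[OF m3 assms(7)]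
      plus_arr_Some[OF m2' m3'] plus_arr_Some[OF m1' madd_mor[OF m2' m3']] ..
qed

lemma cone_triangleD:
  assumes "cone_triangle A X Y Z f g h"
  obtains I Q where "cone X Y Z (level X Y f) (level Y Z g) (level Z (shift A X) h) I Q"
proof -
  obtain i q where m: "f \<in> mor (Cb A) X Y" "g \<in> mor (Cb A) Y Z" "h \<in> mor (Cb A) Z (shift A X)"
    and d: "\<And>n. direct_sum A (deg (shift A X) n) (deg Y n) (deg Z n) (i n) (g n) (h n) (q n)"
    and z: "\<And>n. dif Z n = madd A (cmp A (i (n + 1)) (cmp A (dif (shift A X) n) (h n)))
                 (madd A (cmp A (g (n + 1)) (cmp A (f (n + 1)) (h n)))
                         (cmp A (g (n + 1)) (cmp A (dif Y n) (q n))))"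
    using assms unfolding cone_triangle_def by blast
  have b: "bounded_complex A X" "bounded_complex A Y" "bounded_complex A Z"
    and c: "chmap X Y (level X Y f)" "chmap Y Z (level Y Z g)" "chmap Z (shift A X) (level Z (shift A X) h)"
    using m by (auto simp: Cb_mor)
  let ?I = "\<lambda>n. Some (deg X (n + 1), deg Z n, i n)" and ?Q = "\<lambda>n. Some (deg Z n, deg Y n, q n)"
  have biprod: "biprod (?I n) (level Y Z g n) (level Z (shift A X) h n) (?Q n)" for n
    using d[of n] unfolding direct_sum_iff by (simp add: level_def)
  have t: "f n \<in> mor A (deg X n) (deg Y n)" "g n \<in> mor A (deg Y n) (deg Z n)"
    "h n \<in> mor A (deg Z n) (deg X (n + 1))" "i n \<in> mor A (deg X (n + 1)) (deg Z n)" "q n \<in> mor A (deg Z n) (deg Y n)" for n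
    using chD(1)[OF c(1), of n] chD(1)[OF c(2), of n] chD(1)[OF c(3), of n] biprod_rw(1,4)[OF biprod[of n]]
    by (simp_all add: level_def)
  have "diff Z n = ?I (n + 1) \<cdot> diff (shift A X) n \<cdot> level Z (shift A X) h n \<oplus>
         (level Y Z g (n + 1) \<cdot> level X Y f (n + 1) \<cdot> level Z (shift A X) h n \<oplus> level Y Z g (n + 1) \<cdot> diff Y n \<cdot> ?Q n)" for n
    using cone_conv[OF b(1,2) t(1) t(3) t(5) t(4) t(2), of n] unfolding z[of n, symmetric]
    by (simp only: diff_def[of Z] level_def shift_deg)
  then have "cone X Y Z (level X Y f) (level Y Z g) (level Z (shift A X) h) ?I ?Q"
    unfolding cone_def using b c biprod by simp
  then show ?thesis by (rule that)
qed

lemma biprod_zero: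
  assumes "biprod i j p q" "zero_object A (src i)" "zero_object A (src j)"
  shows "zero_object A (tgt i)"
proof -
  note r = biprod_rw[OF assms(1)]
  have e: "p = zarr (tgt i) (src i)" "q = zarr (tgt i) (src j)"
    using to_zero[OF assms(2), of p] to_zero[OF assms(3), of q] r by simp_all
  then have "i \<cdot> p \<oplus> j \<cdot> q = zarr (tgt i) (tgt i)" unfolding e using r(1-5) by simp
  then show ?thesis using r(1,14) by (simp add: zero_object_iff)
qed

lemma ex_cone_triangle:
  assumes f: "f \<in> mor (Cb A) X Y"
  obtains Z g h where "cone_triangle A X Y Z f g h"
proof -
  have b: "bounded_complex A X" "bounded_complex A Y" and cf: "chmap X Y (level X Y f)"
    using f by (auto simp: Cb_mor)
  have "\<forall>n. \<exists>P i g h q. direct_sum A (deg (shift A X) n) (deg Y n) P i g h q"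
    using b ex_direct_sum by simp
  then obtain P i g h q where d: "\<And>n. direct_sum A (deg (shift A X) n) (deg Y n) (P n) (i n) (g n) (h n) (q n)"
    by metis
  define Z where "Z = \<lparr>deg = P, dif = (\<lambda>n. madd A (cmp A (i (n + 1)) (cmp A (dif (shift A X) n) (h n)))
                 (madd A (cmp A (g (n + 1)) (cmp A (f (n + 1)) (h n)))
                         (cmp A (g (n + 1)) (cmp A (dif Y n) (q n)))))\<rparr>"
  define I where "I = (\<lambda>n. Some (deg X (n + 1), deg Z n, i n))"
  define Q where "Q = (\<lambda>n. Some (deg Z n, deg Y n, q n))"
  define G where "G = level Y Z g"
  define H where "H = level Z (shift A X) h"
  define F where "F = level X Y f"
  note defs = I_def Q_def G_def H_def F_def
  have biprod: "biprod (I n) (G n) (H n) (Q n)" for n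
    using d[of n] unfolding direct_sum_iff by (simp add: defs level_def Z_def)
  have t: "f n \<in> mor A (deg X n) (deg Y n)" "g n \<in> mor A (deg Y n) (P n)"
    "h n \<in> mor A (P n) (deg X (n + 1))" "i n \<in> mor A (deg X (n + 1)) (P n)" "q n \<in> mor A (P n) (deg Y n)" for n
    using chD(1)[OF cf, of n] biprod_rw(1-4)[OF biprod[of n]] by (simp_all add: defs level_def Z_def)
  have Dz: "diff Z n = I (n + 1) \<cdot> diff (shift A X) n \<cdot> H n \<oplus>
         (G (n + 1) \<cdot> F (n + 1) \<cdot> H n \<oplus> G (n + 1) \<cdot> diff Y n \<cdot> Q n)" for n
    using cone_conv[OF b t(1) t(3) t(5) t(4) t(2), of n]
    unfolding diff_def[of Z] defs level_def shift_deg by (simp only: Z_def cochain.simps)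
  have ty: "wt (F n)" "src (F n) = deg X n" "tgt (F n) = deg Y n"
    "wt (G n)" "src (G n) = deg Y n" "tgt (G n) = deg Z n"
    "wt (H n)" "src (H n) = deg Z n" "tgt (H n) = deg X (n + 1)"
    "wt (I n)" "src (I n) = deg X (n + 1)" "tgt (I n) = deg Z n"
    "wt (Q n)" "src (Q n) = deg Z n" "tgt (Q n) = deg Y n" for n
    using chD(1)[OF cf, of n] biprod_rw(1-4)[OF biprod[of n]] by (simp_all add: defs level_def)
  have r: "H n \<cdot> I n = ident (deg X (n + 1))" "Q n \<cdot> G n = ident (deg Y n)"
    "Q n \<cdot> I n = zarr (deg X (n + 1)) (deg Y n)" "H n \<cdot> G n = zarr (deg Y n) (deg X (n + 1))" for n
    using biprod_rw[OF biprod, of n] ty[of n] by simp_all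
  have rx: "wt x \<Longrightarrow> tgt x = deg X (n + 1) \<Longrightarrow> H n \<cdot> I n \<cdot> x = x"
    "wt y \<Longrightarrow> tgt y = deg Y n \<Longrightarrow> Q n \<cdot> G n \<cdot> y = y"
    "wt x \<Longrightarrow> tgt x = deg X (n + 1) \<Longrightarrow> Q n \<cdot> I n \<cdot> x = zarr (src x) (deg Y n)"
    "wt y \<Longrightarrow> tgt y = deg Y n \<Longrightarrow> H n \<cdot> G n \<cdot> y = zarr (src y) (deg X (n + 1))" for n x y
    using b by (simp_all add: r flip: compose_assoc)
  note chF = chD(5)[OF cf[folded F_def]]
  have wz: "wt (diff Z n)" for n
    unfolding Dz using ty[of n] ty[of "n + 1"] b by simp
  have oz: "deg Z n \<in> obj A" for n using wt_obj(2)[of "G n"] ty[of n] by simp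
  \<comment> \<open>The two terms containing \<open>F\<close> cancel, because \<open>F\<close>
    commutes with the differentials and the shift contributes a sign.\<close>
  have zz: "diff Z (n + 1) \<cdot> diff Z n = zarr (deg Z n) (deg Z (n + 2))" for n
    unfolding Dz[of n] Dz[of "n + 1"]
    using ty[of n] ty[of "n + 1"] ty[of "n + 2"] b chF[of "n + 1" "H n"]
    by (simp add: rx oz add.assoc add.commute[of n 2])
  obtain N where N: "\<And>n. \<bar>n\<bar> > N \<Longrightarrow> zero_object A (deg X n)" using bounded_complexE[OF b(1)] by blast
  obtain N' where N': "\<And>n. \<bar>n\<bar> > N' \<Longrightarrow> zero_object A (deg Y n)" using bounded_complexE[OF b(2)] by blast
  have bz: "bounded_complex A Z"
  proof (rule bounded_complexI[OF wz zz, of "\<bar>N\<bar> + \<bar>N'\<bar> + 1"])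
    fix n :: int assume "\<bar>n\<bar> > \<bar>N\<bar> + \<bar>N'\<bar> + 1"
    then show "zero_object A (deg Z n)"
      using biprod_zero[OF biprod, of n] ty[of n] N[of "n + 1"] N'[of n] by simp
  qed
  have "chmap Y Z G"
    unfolding chmap_def using ty b by (simp add: Dz r rx oz)
  moreover have "chmap Z (shift A X) H"
    unfolding chmap_def using ty b by (simp add: Dz r rx oz add.commute)
  ultimately have "g \<in> mor (Cb A) Y Z" "h \<in> mor (Cb A) Z (shift A X)"
    using b bz by (simp_all add: Cb_mor G_def H_def)
  then have "cone_triangle A X Y Z f g h"
    unfolding cone_triangle_def using f d by (intro conjI exI[of _ i] exI[of _ q]) (simp_all add: Z_def)
  then show ?thesis by (rule that)
qed

text \<open>Without the mixing term in the differential, the degreewise splitting is one of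
  complexes. This supplies the chain-level direct sums of \<open>ext_cond_sum\<close>.\<close>

lemma cone_split:
  assumes c: "cone X Y Z F G H I Q" and F: "\<And>n. F n = zarr (deg X n) (deg Y n)"
  shows "chmap (shift A X) Z I" "chmap Z Y Q"
proof -
  note ty = cone_ty[OF c] and b = cone_bc[OF c]
  show "chmap (shift A X) Z I"
    unfolding chmap_def
  proof (intro allI conjI)
    fix n
    show "wt (I n)" "src (I n) = deg (shift A X) n" "tgt (I n) = deg Z n" using ty[of n] by simp_all
    have "diff Z n \<cdot> I n = diff Z n \<cdot> (I n \<cdot> ident (deg X (n + 1)) \<oplus> G n \<cdot> zarr (deg X (n + 1)) (deg Y n))"
      using ty[of n] b by simp
    also have "\<dots> = I (n + 1) \<cdot> diff (shift A X) n"
      using ty[of n] ty[of "n + 1"] b by (subst cone_d[OF c, where m = "n + 1"]) (simp_all add: F)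
    finally show "diff Z n \<cdot> I n = I (n + 1) \<cdot> diff (shift A X) n" .
  qed
  show "chmap Z Y Q"
    unfolding chmap_def
  proof (intro allI conjI)
    fix n
    show "wt (Q n)" "src (Q n) = deg Z n" "tgt (Q n) = deg Y n" using ty[of n] by simp_all
    have "Q (n + 1) \<cdot> diff Z n \<cdot> ident (deg Z n) = diff Y n \<cdot> Q n \<cdot> ident (deg Z n)"
      using ty[of n] ty[of "n + 1"] b by (subst cone_dQ[OF c, where m = "n + 1"]) (simp_all add: F)
    then show "diff Y n \<cdot> Q n = Q (n + 1) \<cdot> diff Z n" using ty[of n] b by simp
  qed
qed

text \<open>The sign is repeated so that shifting back returns \<open>X\<close> itself and not
  merely an isomorphic complex. This serves to present a given complex as a shift.\<close>

definition unshift :: "('o, 'm) cochain \<Rightarrow> ('o, 'm) cochain" where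
  "unshift X = \<lparr>deg = (\<lambda>n. deg X (n - 1)), dif = (\<lambda>n. und (\<ominus> diff X (n - 1)))\<rparr>"

lemma unshift:
  assumes "bounded_complex A X"
  shows "bounded_complex A (unshift X)" "shift A (unshift X) = X"
proof -
  have D: "diff (unshift X) n = \<ominus> diff X (n - 1)" for n
    using assms wt_eta[of "\<ominus> diff X (n - 1)"] unfolding diff_def[of "unshift X"] by (simp add: unshift_def)
  have g: "deg (unshift X) n = deg X (n - 1)" for n by (simp add: unshift_def)
  obtain N where N: "\<And>n. \<bar>n\<bar> > N \<Longrightarrow> zero_object A (deg X n)" using bounded_complexE[OF assms] by blast
  show b: "bounded_complex A (unshift X)"
    by (rule bounded_complexI[of _ "\<bar>N\<bar> + 1"]) (use assms N in \<open>auto simp: D g algebra_simps\<close>)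
  have "diff (shift A (unshift X)) n = diff X n" for n
    using assms b by (simp add: D)
  then show "shift A (unshift X) = X"
    by (intro cochain.equality) (auto simp: fun_eq_iff diff_def g simp del: diff_shift)
qed

section \<open>Recognizing quasi-isomorphisms\<close>

lemma induces_rel:
  assumes "hdata X n k c" "induces F n k c k' c' v"
  obtains u where "wt u" "tgt u = src k'" "k' \<cdot> u = F n \<cdot> k" "v \<cdot> c = c' \<cdot> u"
  using indD(4)[OF assms(2) represents_self[OF assms(1)]] unfolding represents_def by metis

lemma quasi_isoI:
  assumes "bounded_complex A X" "bounded_complex A Y" "chmap X Y F" "\<And>n. hinj X Y F n" "\<And>n. hsurj X Y F n"
  shows "quasi_iso A X Y (\<lambda>n. und (F n))"
  unfolding quasi_iso_def
proof (intro conjI allI impI)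
  show "(\<lambda>n. und (F n)) \<in> mor (Cb A) X Y" using Cb_morI assms by blast
  fix n K k H c K' k' H' c' u v
  assume a: "cohomology_data A X n K k H c \<and> cohomology_data A Y n K' k' H' c' \<and>
        u \<in> mor A K K' \<and> cmp A k' u = cmp A (und (F n)) k \<and>
        v \<in> mor A H H' \<and> cmp A v c = cmp A c' u"
  have h: "hdata X n (Some (K, deg X n, k)) (Some (K, H, c))" (is "hdata X n ?k ?c")
    and h': "hdata Y n (Some (K', deg Y n, k')) (Some (K', H', c'))" (is "hdata Y n ?k' ?c'")
    using a cohomology_data_iff[OF assms(1)] cohomology_data_iff[OF assms(2)] by simp_all
  note m = hdatD(1,5)[OF h] hdatD(1,5)[OF h'] and f = chD[OF assms(3), of n]
  have fn: "F n = Some (deg X n, deg Y n, und (F n))" "und (F n) \<in> mor A (deg X n) (deg Y n)"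
    using f wt_eta[of "F n"] und_mor[of "F n"] by simp_all
  have "?k' \<cdot> Some (K, K', u) = Some (deg X n, deg Y n, und (F n)) \<cdot> ?k"
    using m a fn(2) by (simp add: compose_Some)
  also have "\<dots> = F n \<cdot> ?k" by (simp only: fn(1)[symmetric])
  finally have "?k' \<cdot> Some (K, K', u) = F n \<cdot> ?k" .
  moreover have "Some (H, H', v) \<cdot> ?c = ?c' \<cdot> Some (K, K', u)"
    using m a by (simp add: compose_Some)
  ultimately have i: "induces F n ?k ?c ?k' ?c' (Some (H, H', v))"
    using a by (intro indI[OF h h', of "Some (K, K', u)"]) simp_all
  show "iso_arrow A H H' v"
    using hinj_mon[OF h h' i assms(3,1,2,4)] hsurj_epi[OF h h' i assms(3,1,2,5)] by (rule iso_arrowI)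
qed

text \<open>\<open>quasi_iso\<close> speaks of all cohomology data and of raw arrows. Its instance
  at the chosen data is what the universal property of the localization requires of H^n.\<close>

lemma quasi_iso_Hmap:
  assumes "quasi_iso A X Y f"
  shows "iso_arrow A (Hob X n) (Hob Y n) (und (Hmap X Y (level X Y f) n))"
proof -
  have b: "bounded_complex A X" "bounded_complex A Y" "chmap X Y (level X Y f)"
    using assms by (auto simp: quasi_iso_def Cb_mor)
  note hX = hdata_sel[OF b(1), of n] and hY = hdata_sel[OF b(2), of n]
  note i = Hmap_induces[OF b, of n]
  obtain u where u: "wt u" "tgt u = src (hker Y n)" "hker Y n \<cdot> u = level X Y f n \<cdot> hker X n"
    "Hmap X Y (level X Y f) n \<cdot> hproj X n = hproj Y n \<cdot> u" using induces_rel[OF hX i] by blast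
  note dX = hdatD[OF hX] and dY = hdatD[OF hY] and m = Hmap(1-3)[OF b, of n] and f = chD[OF b(3), of n]
  have "src u = src (hker Y n \<cdot> u)" using u(1,2) dY by simp
  also have "\<dots> = src (hker X n)" unfolding u(3) using dX f by simp
  finally have su: "src u = src (hker X n)" .
  have e: "hker X n = Some (src (hker X n), deg X n, und (hker X n))" "hproj X n = Some (src (hker X n), Hob X n, und (hproj X n))"
    "hker Y n = Some (src (hker Y n), deg Y n, und (hker Y n))" "hproj Y n = Some (src (hker Y n), Hob Y n, und (hproj Y n))"
    "u = Some (src (hker X n), src (hker Y n), und u)" "Hmap X Y (level X Y f) n = Some (Hob X n, Hob Y n, und (Hmap X Y (level X Y f) n))"
    using dX dY wt_eta[of "hker X n"] wt_eta[of "hproj X n"] wt_eta[of "hker Y n"] wt_eta[of "hproj Y n"] wt_eta[of u]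
      wt_eta[of "Hmap X Y (level X Y f) n"] u su m by (simp_all add: Hob_def)
  have um: "und (hker X n) \<in> mor A (src (hker X n)) (deg X n)" "und (hproj X n) \<in> mor A (src (hker X n)) (Hob X n)"
    "und (hker Y n) \<in> mor A (src (hker Y n)) (deg Y n)" "und (hproj Y n) \<in> mor A (src (hker Y n)) (Hob Y n)"
    "und u \<in> mor A (src (hker X n)) (src (hker Y n))" "und (Hmap X Y (level X Y f) n) \<in> mor A (Hob X n) (Hob Y n)"
    "f n \<in> mor A (deg X n) (deg Y n)"
    using dX dY und_mor[of "hker X n"] und_mor[of "hproj X n"] und_mor[of "hker Y n"] und_mor[of "hproj Y n"] und_mor[of u]
      und_mor[of "Hmap X Y (level X Y f) n"] u su m f by (simp_all add: Hob_def level_def)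
  have "cohomology_data A X n (src (hker X n)) (und (hker X n)) (Hob X n) (und (hproj X n))"
    "cohomology_data A Y n (src (hker Y n)) (und (hker Y n)) (Hob Y n) (und (hproj Y n))"
    using hX hY unfolding cohomology_data_iff[OF b(1)] cohomology_data_iff[OF b(2)] e(1-4)[symmetric] by simp_all
  moreover have "cmp A (und (hker Y n)) (und u) = cmp A (f n) (und (hker X n))"
    using u(3) compose_Some[OF um(5,3)] compose_Some[OF um(1,7)] e(1,3,5) by (simp add: level_def)
  moreover have "cmp A (und (Hmap X Y (level X Y f) n)) (und (hproj X n)) = cmp A (und (hproj Y n)) (und u)"
    using u(4) compose_Some[OF um(5,4)] compose_Some[OF um(2,6)] e(2,4,5,6) by simp
  ultimately have "cohomology_data A X n (src (hker X n)) (und (hker X n)) (Hob X n) (und (hproj X n)) \<and>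
    cohomology_data A Y n (src (hker Y n)) (und (hker Y n)) (Hob Y n) (und (hproj Y n)) \<and>
    und u \<in> mor A (src (hker X n)) (src (hker Y n)) \<and> cmp A (und (hker Y n)) (und u) = cmp A (f n) (und (hker X n)) \<and>
    und (Hmap X Y (level X Y f) n) \<in> mor A (Hob X n) (Hob Y n) \<and>
    cmp A (und (Hmap X Y (level X Y f) n)) (und (hproj X n)) = cmp A (und (hproj Y n)) (und u)"
    using um by simp
  then show ?thesis by (rule conjunct2[OF assms[unfolded quasi_iso_def], rule_format])
qed

section \<open>Stalk complexes and canonical truncation\<close>

definition zob :: 'o where "zob = (SOME Z. zero_object A Z)"

lemma zob [simp]: "zero_object A zob" "zob \<in> obj A"
  using someI_ex[OF ex_zero] zero_obj by (auto simp: zob_def)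

definition stalk :: "'o \<Rightarrow> ('o, 'm) cochain" where
  "stalk H = \<lparr>deg = (\<lambda>n. if n = 0 then H else zob),
     dif = (\<lambda>n. mzero A (if n = 0 then H else zob) (if n + 1 = 0 then H else zob))\<rparr>"

lemma stalk_deg: "deg (stalk H) n = (if n = 0 then H else zob)"
  by (simp add: stalk_def)

lemma diff_stalk [simp]: "diff (stalk H) n = zarr (deg (stalk H) n) (deg (stalk H) (n + 1))"
  by (simp add: diff_def zarr_def stalk_def)

lemma bc_stalk [simp]: "H \<in> obj A \<Longrightarrow> bounded_complex A (stalk H)"
  by (rule bounded_complexI[of _ 0]) (auto simp: stalk_deg)

lemma stalk_chmap:
  assumes "wt a" "src a = X" "tgt a = Y"
  shows "chmap (stalk X) (stalk Y) (\<lambda>n. if n = 0 then a else zarr zob zob)"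
  unfolding chmap_def using assms by (auto simp: stalk_deg)

text \<open>The differential into degree \<open>m\<close>, corestricted to the cocycles. The choice
  also fixes \<open>hproj X m\<close> as its cokernel.\<close>

definition trunc_diff :: "('o, 'm) cochain \<Rightarrow> int \<Rightarrow> ('o \<times> 'o \<times> 'm) option" where
  "trunc_diff X m = (SOME e. wt e \<and> src e = deg X (m - 1) \<and> tgt e = src (hker X m) \<and> hker X m \<cdot> e = diff X (m - 1) \<and> coker e (hproj X m))"

lemma trunc_diff:
  assumes "bounded_complex A X"
  shows "wt (trunc_diff X m)" "src (trunc_diff X m) = deg X (m - 1)" "tgt (trunc_diff X m) = src (hker X m)" "hker X m \<cdot> trunc_diff X m = diff X (m - 1)"
    "coker (trunc_diff X m) (hproj X m)"
proof -
  have "\<exists>e. wt e \<and> src e = deg X (m - 1) \<and> tgt e = src (hker X m) \<and> hker X m \<cdot> e = diff X (m - 1) \<and> coker e (hproj X m)"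
    using hdata_sel[OF assms, of m] by (simp add: hdata_def)
  from someI_ex[OF this] show "wt (trunc_diff X m)" "src (trunc_diff X m) = deg X (m - 1)" "tgt (trunc_diff X m) = src (hker X m)"
    "hker X m \<cdot> trunc_diff X m = diff X (m - 1)" "coker (trunc_diff X m) (hproj X m)"
    unfolding trunc_diff_def by blast+
qed

text \<open>The canonical truncation: degree \<open>m\<close> keeps only the cocycles, so that
  cohomology is unchanged up to and including degree \<open>m\<close>.\<close>

definition trunc :: "int \<Rightarrow> ('o, 'm) cochain \<Rightarrow> ('o, 'm) cochain" where
  "trunc m X = (let D = (\<lambda>n. if n < m then deg X n else if n = m then src (hker X m) else zob) in
     \<lparr>deg = D, dif = (\<lambda>n. if n < m - 1 then dif X n else if n = m - 1 then und (trunc_diff X m) else mzero A (D n) (D (n + 1)))\<rparr>)"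

lemma trunc_deg: "deg (trunc m X) n = (if n < m then deg X n else if n = m then src (hker X m) else zob)"
  by (simp add: trunc_def Let_def)

lemma diff_trunc:
  assumes "bounded_complex A X"
  shows "diff (trunc m X) n = (if n < m - 1 then diff X n else if n = m - 1 then trunc_diff X m
     else zarr (deg (trunc m X) n) (deg (trunc m X) (n + 1)))"
  using trunc_diff[OF assms, of m] wt_eta[of "trunc_diff X m"] by (auto simp: diff_def trunc_def Let_def zarr_def)

lemma hker_trunc_diff_x: "bounded_complex A X \<Longrightarrow> hker X m \<cdot> trunc_diff X m \<cdot> x = diff X (m - 1) \<cdot> x"
  using trunc_diff(4)[of X m] by (simp flip: compose_assoc)

lemma bc_trunc [simp]:
  assumes "bounded_complex A X" shows "bounded_complex A (trunc m X)"
proof -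
  note h = trunc_diff[OF assms, of m] and d = hdatD[OF hdata_sel[OF assms, of m]]
  obtain N where N: "\<And>n. \<bar>n\<bar> > N \<Longrightarrow> zero_object A (deg X n)" using bounded_complexE[OF assms] by blast
  have e: "trunc_diff X m \<cdot> diff X (m - 2) = zarr (deg X (m - 2)) (src (hker X m))"
  proof (rule mon_cancel[OF d(2)])
    show "hker X m \<cdot> trunc_diff X m \<cdot> diff X (m - 2) = hker X m \<cdot> zarr (deg X (m - 2)) (src (hker X m))"
      using h d assms by (simp add: hker_trunc_diff_x)
  qed (use h d assms in simp_all)
  show ?thesis
  proof (rule bounded_complexI[of _ "\<bar>N\<bar> + \<bar>m\<bar>"])
    show "wt (diff (trunc m X) n)" for n
      using h d assms by (auto simp: diff_trunc trunc_deg)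
    show "diff (trunc m X) (n + 1) \<cdot> diff (trunc m X) n = zarr (deg (trunc m X) n) (deg (trunc m X) (n + 2))" for n
    proof -
      consider "n < m - 2" | "n = m - 2" | "n = m - 1" | "n \<ge> m" by linarith
      then show ?thesis
        using h d assms e by cases (auto simp: diff_trunc trunc_deg add.commute[of n 2])
    qed
    show "zero_object A (deg (trunc m X) n)" if "\<bar>n\<bar> > \<bar>N\<bar> + \<bar>m\<bar>" for n
      using that N[of n] by (auto simp: trunc_deg)
  qed
qed

definition trunc_incl :: "int \<Rightarrow> ('o, 'm) cochain \<Rightarrow> int \<Rightarrow> ('o \<times> 'o \<times> 'm) option" where
  "trunc_incl m X n = (if n < m then ident (deg X n) else if n = m then hker X m else zarr zob (deg X n))"

lemma chmap_trunc_incl: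
  assumes "bounded_complex A X" shows "chmap (trunc m X) X (trunc_incl m X)"
  unfolding chmap_def
proof (intro allI)
  note h = trunc_diff[OF assms, of m] and d = hdatD[OF hdata_sel[OF assms, of m]]
  fix n
  consider "n < m - 1" | "n = m - 1" | "n = m" | "n > m" by linarith
  then show "wt (trunc_incl m X n) \<and> src (trunc_incl m X n) = deg (trunc m X) n \<and> tgt (trunc_incl m X n) = deg X n \<and>
      diff X n \<cdot> trunc_incl m X n = trunc_incl m X (n + 1) \<cdot> diff (trunc m X) n"
    using h d assms by cases (auto simp: trunc_incl_def diff_trunc trunc_deg)
qed

lemma trunc_incl_mon: "bounded_complex A X \<Longrightarrow> n \<le> m \<Longrightarrow> mon (trunc_incl m X n)"
  using hdatD(2)[OF hdata_sel, of X m] by (simp add: trunc_incl_def)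

text \<open>In degree \<open>n - 1\<close> the inclusion is the identity, so a bounding element in
  \<open>X\<close> already lies in the truncation. It bounds there too, since the inclusion is mono
  in degree \<open>n\<close>.\<close>

lemma hinj_trunc_incl:
  assumes "bounded_complex A X" "n \<le> m" shows "hinj (trunc m X) X (trunc_incl m X) n"
  unfolding hinj_def
proof (intro allI impI)
  note f = chD[OF chmap_trunc_incl[OF assms(1), of m]]
  fix z y assume a: "cocycle (trunc m X) n z" "wt y" "src y = src z" "tgt y = deg X (n - 1)" "diff X (n - 1) \<cdot> y = trunc_incl m X n \<cdot> z"
  note z = cocycleD[OF a(1)]
  have ty: "deg (trunc m X) (n - 1) = deg X (n - 1)" "trunc_incl m X (n - 1) = ident (deg X (n - 1))"
    using assms(2) by (simp_all add: trunc_deg trunc_incl_def)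
  have "trunc_incl m X n \<cdot> diff (trunc m X) (n - 1) \<cdot> y = diff X (n - 1) \<cdot> trunc_incl m X (n - 1) \<cdot> y"
    using f(5)[of "n - 1" y] by simp
  also have "\<dots> = trunc_incl m X n \<cdot> z" using a ty by simp
  finally have "diff (trunc m X) (n - 1) \<cdot> y = z"
    using mon_cancel[OF trunc_incl_mon[OF assms], of "diff (trunc m X) (n - 1) \<cdot> y" z] f a z ty assms by simp
  then show "local_bd (trunc m X) n z" using local_bd_diff[of "trunc m X" y n] a ty assms by simp
qed

lemma hsurjI0:
  assumes "bounded_complex A Y" "chmap X Y F"
    "\<And>z'. cocycle Y n z' \<Longrightarrow> \<exists>e z. epi e \<and> tgt e = src z' \<and> cocycle X n z \<and> src z = src e \<and> F n \<cdot> z = z' \<cdot> e"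
  shows "hsurj X Y F n"
  unfolding hsurj_def
proof (intro allI impI)
  fix z' assume z': "cocycle Y n z'"
  then obtain e z where e: "epi e" "tgt e = src z'" "cocycle X n z" "src z = src e" "F n \<cdot> z = z' \<cdot> e"
    using assms(3) by blast
  have "F n \<cdot> z \<oplus> \<ominus> (z' \<cdot> e) = zarr (src e) (deg Y n)"
    using e cocycleD[OF z'] by simp
  then show "\<exists>e z. epi e \<and> tgt e = src z' \<and> cocycle X n z \<and> src z = src e \<and> local_bd Y n (F n \<cdot> z \<oplus> \<ominus> (z' \<cdot> e))"
    using e local_bd_zarr[OF assms(1), of "src e" n] by (intro exI[of _ e] exI[of _ z]) simp
qed

lemma hsurj_trunc_incl:
  assumes "bounded_complex A X" "n \<le> m" shows "hsurj (trunc m X) X (trunc_incl m X) n"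
proof (rule hsurjI0[OF assms(1) chmap_trunc_incl[OF assms(1)]])
  note f = chD[OF chmap_trunc_incl[OF assms(1), of m]]
  fix z assume zc: "cocycle X n z"
  note z = cocycleD[OF zc]
  obtain u where u: "wt u" "src u = src z" "tgt u = deg (trunc m X) n" "trunc_incl m X n \<cdot> u = z"
  proof (cases "n = m")
    case True
    have "ker (diff X m) (hker X m)" using hdata_sel[OF assms(1), of m] by (simp add: hdata_def)
    moreover have "tgt z = src (diff X m)" "diff X m \<cdot> z = zarr (src z) (tgt (diff X m))" using z True by simp_all
    ultimately obtain u where "wt u" "src u = src z" "tgt u = src (hker X m)" "hker X m \<cdot> u = z"
      using ker_lift z(1) by blast
    then show ?thesis using that True by (simp add: trunc_incl_def trunc_deg)
  next
    case False
    then show ?thesis using that[of z] z assms by (simp add: trunc_incl_def trunc_deg)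
  qed
  have "trunc_incl m X (n + 1) \<cdot> diff (trunc m X) n \<cdot> u = diff X n \<cdot> trunc_incl m X n \<cdot> u" using f(5)[of n u] by simp
  also have "\<dots> = zarr (src z) (deg X (n + 1))" unfolding u(4) using z by simp
  finally have k: "trunc_incl m X (n + 1) \<cdot> diff (trunc m X) n \<cdot> u = zarr (src z) (deg X (n + 1))" .
  \<comment> \<open>Below degree \<open>m\<close> the inclusion is mono in degree
    \<open>n + 1\<close> and detects vanishing; in degree \<open>m\<close> the truncated
    differential is zero.\<close>
  have "diff (trunc m X) n \<cdot> u = zarr (src z) (deg (trunc m X) (n + 1))"
  proof (cases "n = m")
    case True
    then show ?thesis using u assms by (simp add: diff_trunc trunc_deg)
  next
    case False
    then have "n + 1 \<le> m" using assms by simp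
    from moD[OF trunc_incl_mon[OF assms(1) this] _ _ _ _ _ k] show ?thesis using u f assms by simp
  qed
  then have "cocycle (trunc m X) n u" using u by (intro cocycleI) simp_all
  then show "\<exists>e z'. epi e \<and> tgt e = src z \<and> cocycle (trunc m X) n z' \<and> src z' = src e \<and> trunc_incl m X n \<cdot> z' = z \<cdot> e"
    using u z by (intro exI[of _ "ident (src z)"] exI[of _ u]) simp
qed

end


section \<open>The bounded derived category\<close>

context abelian_category
begin

lemma Cb_simps [simp]: "idt (Cb A) X = (\<lambda>n. idt A (deg X n))" "cmp (Cb A) g f = (\<lambda>n. cmp A (g n) (f n))"
  "obj (Cb A) = {X. bounded_complex A X}"
  by (simp_all add: Cb_def)

lemma level_cmp:
  assumes "chmap X Y (level X Y f)" "chmap Y Z (level Y Z g)"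
  shows "level X Z (\<lambda>n. cmp A (g n) (f n)) = (\<lambda>n. level Y Z g n \<cdot> level X Y f n)"
  using chD(1)[OF assms(1)] chD(1)[OF assms(2)] by (auto simp: level_def compose_Some fun_eq_iff)

lemma level_idt: "level X X (\<lambda>n. idt A (deg X n)) = (\<lambda>n. ident (deg X n))"
  by (simp add: level_def ident_def fun_eq_iff)

lemma Cb_mor_D: "f \<in> mor (Cb A) X Y \<Longrightarrow> f n \<in> mor A (deg X n) (deg Y n)"
  using chD(1)[of X Y "level X Y f" n] by (simp add: Cb_mor level_def)

lemma category_Cb: "category (Cb A)"
proof
  fix X Y Z V f g h
  show "f \<in> mor (Cb A) X Y \<Longrightarrow> X \<in> obj (Cb A) \<and> Y \<in> obj (Cb A)" by (simp add: Cb_mor)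
  show "X \<in> obj (Cb A) \<Longrightarrow> idt (Cb A) X \<in> mor (Cb A) X X"
    using chmap_ident by (simp add: Cb_mor level_idt)
  show "f \<in> mor (Cb A) X Y \<Longrightarrow> g \<in> mor (Cb A) Y Z \<Longrightarrow> cmp (Cb A) g f \<in> mor (Cb A) X Z"
    using chmap_compose[of X Y "level X Y f" Z "level Y Z g"] level_cmp[of X Y f Z g] by (simp add: Cb_mor)
  show "f \<in> mor (Cb A) X Y \<Longrightarrow> cmp (Cb A) (idt (Cb A) Y) f = f"
    "f \<in> mor (Cb A) X Y \<Longrightarrow> cmp (Cb A) f (idt (Cb A) X) = f"
    by (rule ext, simp, rule idt_left, erule Cb_mor_D) (rule ext, simp, rule idt_right, erule Cb_mor_D)
  show "f \<in> mor (Cb A) V X \<Longrightarrow> g \<in> mor (Cb A) X Y \<Longrightarrow> h \<in> mor (Cb A) Y Z \<Longrightarrow>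
      cmp (Cb A) h (cmp (Cb A) g f) = cmp (Cb A) (cmp (Cb A) h g) f"
    using Cb_mor_D cmp_assoc by (simp add: fun_eq_iff) blast
qed

lemma category_Db: "category (Db A)"
  unfolding Db_def by (rule category.category_loc_cat[OF category_Cb])

lemma Db_obj [simp]: "obj (Db A) = {X. bounded_complex A X}"
  by (simp add: Db_def loc_cat_def)

lemma Db_arrow_mor: "f \<in> mor (Cb A) X Y \<Longrightarrow> Db_arrow A X Y f \<in> mor (Db A) X Y"
  unfolding Db_def by (rule category.loc_arrow_mor[OF category_Cb])

lemma Db_arrow_cmp: "f \<in> mor (Cb A) X Y \<Longrightarrow> g \<in> mor (Cb A) Y Z \<Longrightarrow>
    cmp (Db A) (Db_arrow A Y Z g) (Db_arrow A X Y f) = Db_arrow A X Z (cmp (Cb A) g f)"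
  unfolding Db_def by (rule category.loc_arrow_cmp[OF category_Cb])

lemma Db_arrow_idt: "Db_arrow A X X (idt (Cb A) X) = idt (Db A) X"
  unfolding Db_def by (rule category.loc_arrow_idt[OF category_Cb])

lemma quasi_iso_isomorphic:
  assumes "quasi_iso A X Y f" shows "isomorphic (Db A) X Y"
  using category.loc_arrow_iso[OF category_Cb, of f X Y "quasi_iso A"] assms
  unfolding isomorphic_def Db_def by (auto simp: quasi_iso_def)

text \<open>Arrows of \<open>Db A\<close> have no normal form, so the values of H^n on them come
  from the universal property. The functor \<open>K\<close> is never computed: only its
  functoriality is used.\<close>

lemma H_functor:
  obtains K where "is_functor (Db A) A (\<lambda>X. Hob X n) K"
proof -
  let ?H = "\<lambda>X Y f. und (Hmap X Y (level X Y f) n)"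
  have e: "Hmap X Y (level X Y f) n = Some (Hob X n, Hob Y n, ?H X Y f)" "?H X Y f \<in> mor A (Hob X n) (Hob Y n)"
    if "f \<in> mor (Cb A) X Y" for X Y f
  proof -
    note h = Hmap[of X Y "level X Y f" n]
    show "Hmap X Y (level X Y f) n = Some (Hob X n, Hob Y n, ?H X Y f)" "?H X Y f \<in> mor A (Hob X n) (Hob Y n)"
      using h wt_eta[of "Hmap X Y (level X Y f) n"] und_mor[of "Hmap X Y (level X Y f) n"] that by (simp_all add: Cb_mor)
  qed
  have "is_functor (Cb A) A (\<lambda>X. Hob X n) ?H"
    unfolding is_functor_def
  proof (intro conjI ballI allI)
    fix X assume "X \<in> obj (Cb A)"
    then show "Hob X n \<in> obj A" "?H X X (idt (Cb A) X) = idt A (Hob X n)"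
      using Hmap_ident[of X n] by (simp_all add: level_idt) (simp add: ident_def)
  next
    fix X Y f assume f: "f \<in> mor (Cb A) X Y"
    show "?H X Y f \<in> mor A (Hob X n) (Hob Y n)" using e[OF f] by simp
    fix Z g assume g: "g \<in> mor (Cb A) Y Z"
    have "Hmap X Z (level X Z (cmp (Cb A) g f)) n = Hmap Y Z (level Y Z g) n \<cdot> Hmap X Y (level X Y f) n"
      using f g Hmap_compose[of X Y Z "level X Y f" "level Y Z g" n] level_cmp[of X Y f Z g] by (simp add: Cb_mor)
    also have "\<dots> = Some (Hob X n, Hob Z n, cmp A (?H Y Z g) (?H X Y f))"
      using arg_cong2[OF e(1)[OF g] e(1)[OF f], of compose] unfolding compose_Some[OF e(2)[OF f] e(2)[OF g]] .
    finally show "?H X Z (cmp (Cb A) g f) = cmp A (?H Y Z g) (?H X Y f)" by simp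
  qed
  then show ?thesis
    using that category.loc_cat_universal[OF category_Cb category_axioms, of "\<lambda>X. Hob X n" ?H "quasi_iso A"]
      quasi_iso_Hmap unfolding Db_def by blast
qed

text \<open>A functor preserves the retraction, so the image of \<open>a\<close> is a split
  monomorphism.\<close>

lemma Hob_retract:
  assumes "a \<in> mor (Db A) X Y" "b \<in> mor (Db A) Y X" "cmp (Db A) b a = idt (Db A) X"
  obtains m where "mon m" "src m = Hob X n" "tgt m = Hob Y n"
proof -
  obtain K where K: "is_functor (Db A) A (\<lambda>X. Hob X n) K" using H_functor by blast
  have o: "X \<in> obj (Db A)" using category.mor_obj[OF category_Db assms(1)] by blast
  note Kd = K[unfolded is_functor_def]
  have m: "K X Y a \<in> mor A (Hob X n) (Hob Y n)" "K Y X b \<in> mor A (Hob Y n) (Hob X n)"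
    using Kd assms by blast+
  have "cmp A (K Y X b) (K X Y a) = K X X (cmp (Db A) b a)" using Kd assms by metis
  also have "\<dots> = idt A (Hob X n)" unfolding assms(3) using Kd o by blast
  finally have e: "Some (Hob Y n, Hob X n, K Y X b) \<cdot> Some (Hob X n, Hob Y n, K X Y a) = ident (Hob X n)"
    using m by (simp add: compose_Some ident_def)
  let ?a = "Some (Hob X n, Hob Y n, K X Y a)" and ?b = "Some (Hob Y n, Hob X n, K Y X b)"
  have "mon ?a"
    unfolding mon_def
  proof (intro conjI allI impI)
    show "wt ?a" using m by simp
    fix s assume s: "wt s" "tgt s = src ?a" "?a \<cdot> s = zarr (src s) (tgt ?a)"
    have "s = (?b \<cdot> ?a) \<cdot> s" unfolding e using s by simp
    also have "\<dots> = ?b \<cdot> (?a \<cdot> s)" by simp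
    also have "\<dots> = zarr (src s) (src ?a)" unfolding s(3) using m s by simp
    finally show "s = zarr (src s) (src ?a)" .
  qed
  then show ?thesis using that by simp
qed

lemma Hob_isomorphic:
  assumes "isomorphic (Db A) X Y" shows "isomorphic A (Hob X n) (Hob Y n)"
proof -
  obtain a b where ab: "a \<in> mor (Db A) X Y" "b \<in> mor (Db A) Y X" "cmp (Db A) b a = idt (Db A) X"
    "cmp (Db A) a b = idt (Db A) Y" using assms by (auto simp: isomorphic_def iso_arrow_def)
  obtain K where K: "is_functor (Db A) A (\<lambda>X. Hob X n) K" using H_functor by blast
  have o: "X \<in> obj (Db A)" "Y \<in> obj (Db A)" using category.mor_obj[OF category_Db ab(1)] by blast+
  note Kd = K[unfolded is_functor_def]
  have m: "K X Y a \<in> mor A (Hob X n) (Hob Y n)" "K Y X b \<in> mor A (Hob Y n) (Hob X n)"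
    using Kd ab by blast+
  have "cmp A (K Y X b) (K X Y a) = idt A (Hob X n)" "cmp A (K X Y a) (K Y X b) = idt A (Hob Y n)"
    using Kd ab o by metis+
  then show ?thesis using m unfolding isomorphic_def iso_arrow_def by blast
qed

lemma zero_object_Cb:
  assumes "bounded_complex A Z" "\<And>n. zero_object A (deg Z n)"
  shows "zero_object (Cb A) Z"
  unfolding zero_object_def
proof (intro conjI ballI)
  show "Z \<in> obj (Cb A)" using assms by simp
  fix X assume "X \<in> obj (Cb A)"
  then have b: "bounded_complex A X" by simp
  show "\<exists>!f. f \<in> mor (Cb A) X Z"
  proof (rule ex1I[of _ "\<lambda>n. und (zarr (deg X n) (deg Z n))"])
    show "(\<lambda>n. und (zarr (deg X n) (deg Z n))) \<in> mor (Cb A) X Z"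
      by (rule Cb_morI[OF b assms(1)]) (use b assms in \<open>simp add: chmap_def\<close>)
    fix f assume f: "f \<in> mor (Cb A) X Z"
    show "f = (\<lambda>n. und (zarr (deg X n) (deg Z n)))"
    proof
      fix n show "f n = und (zarr (deg X n) (deg Z n))"
        using to_zero[OF assms(2), of "Some (deg X n, deg Z n, f n)" n] Cb_mor_D[OF f, of n] by (metis src_Some tgt_Some wt_Some und_Some)
    qed
  qed
  show "\<exists>!f. f \<in> mor (Cb A) Z X"
  proof (rule ex1I[of _ "\<lambda>n. und (zarr (deg Z n) (deg X n))"])
    show "(\<lambda>n. und (zarr (deg Z n) (deg X n))) \<in> mor (Cb A) Z X"
      by (rule Cb_morI[OF assms(1) b]) (use b assms in \<open>simp add: chmap_def\<close>)
    fix f assume f: "f \<in> mor (Cb A) Z X"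
    show "f = (\<lambda>n. und (zarr (deg Z n) (deg X n)))"
    proof
      fix n show "f n = und (zarr (deg Z n) (deg X n))"
        using from_zero[OF assms(2), of "Some (deg Z n, deg X n, f n)" n] Cb_mor_D[OF f, of n] by (metis src_Some tgt_Some wt_Some und_Some)
    qed
  qed
qed

lemma zero_object_Db:
  assumes "bounded_complex A Z" "\<And>n. zero_object A (deg Z n)"
  shows "zero_object (Db A) Z"
  unfolding Db_def by (rule category.zero_object_loc[OF category_Cb zero_object_Cb[OF assms]])

section \<open>The shift on the derived category, and triangles from cones\<close>

lemma cohomology_data_shift:
  assumes "bounded_complex A X"
  shows "cohomology_data A (shift A X) n K k H c \<longleftrightarrow> cohomology_data A X (n + 1) K k H c"
  using cohomology_data_iff[OF assms] cohomology_data_iff[OF bc_shift[OF assms]] hdata_shift[OF assms] by simp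

lemma shift_map_mor:
  assumes "f \<in> mor (Cb A) X Y" shows "shift_map f \<in> mor (Cb A) (shift A X) (shift A Y)"
proof -
  have "level (shift A X) (shift A Y) (shift_map f) = (\<lambda>n. level X Y f (n + 1))"
    by (simp add: level_def shift_map_def fun_eq_iff)
  then show ?thesis using assms chmap_shift by (simp add: Cb_mor)
qed

lemma shift_quasi_iso:
  assumes "quasi_iso A X Y f" shows "quasi_iso A (shift A X) (shift A Y) (shift_map f)"
proof -
  have f: "f \<in> mor (Cb A) X Y" and b: "bounded_complex A X" "bounded_complex A Y"
    using assms by (auto simp: quasi_iso_def Cb_mor)
  show ?thesis
    unfolding quasi_iso_def cohomology_data_shift[OF b(1)] cohomology_data_shift[OF b(2)] shift_map_def
    using assms shift_map_mor[OF f] unfolding quasi_iso_def shift_map_def by (intro conjI) (blast, metis)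
qed

text \<open>Each generating relation of the congruence is carried to one of the same kind, so
  shifting is well defined on arrows of the localization.\<close>

lemma loc_eq_shift:
  "loc_eq (Cb A) (quasi_iso A) X Y t u \<Longrightarrow> loc_eq (Cb A) (quasi_iso A) (shift A X) (shift A Y)
     (map_zigzag (shift A) shift_map t) (map_zigzag (shift A) shift_map u)"
proof (induction rule: loc_eq.induct)
  case (Fwd f X Y) then show ?case using shift_map_mor by (auto intro: loc_eq.Fwd)
next
  case (Bwd w X Y) then show ?case using shift_map_mor shift_quasi_iso by (auto intro: loc_eq.Bwd)
next
  case (After Y Z t t' X u u') then show ?case by (auto intro: loc_eq.After)
next
  case (sym X Y t u) then show ?case by (auto intro: loc_eq.sym)
next
  case (trans X Y t u v) then show ?case by (auto intro: loc_eq.trans)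
next
  case (assoc Y Z t X u V v) then show ?case by (auto intro: loc_eq.assoc)
next
  case (unit_left X Y t)
  have "shift_map (idt (Cb A) Y) = idt (Cb A) (shift A Y)" by (simp add: shift_map_def)
  then show ?case using loc_eq.unit_left[OF unit_left.IH] by simp
next
  case (unit_right X Y t)
  have "shift_map (idt (Cb A) X) = idt (Cb A) (shift A X)" by (simp add: shift_map_def)
  then show ?case using loc_eq.unit_right[OF unit_right.IH] by simp
next
  case (cmp f X Y g Z)
  have "shift_map (cmp (Cb A) g f) = cmp (Cb A) (shift_map g) (shift_map f)" by (simp add: shift_map_def)
  then show ?case using loc_eq.cmp[OF shift_map_mor[OF cmp(1)] shift_map_mor[OF cmp(2)]] by simp
next
  case (inv_left w X Y)
  have "shift_map (idt (Cb A) X) = idt (Cb A) (shift A X)" by (simp add: shift_map_def)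
  then show ?case using loc_eq.inv_left[where W = "quasi_iso A", OF shift_map_mor[OF inv_left(1)] shift_quasi_iso[OF inv_left(2)]] by simp
next
  case (inv_right w X Y)
  have "shift_map (idt (Cb A) Y) = idt (Cb A) (shift A Y)" by (simp add: shift_map_def)
  then show ?case using loc_eq.inv_right[where W = "quasi_iso A", OF shift_map_mor[OF inv_right(1)] shift_quasi_iso[OF inv_right(2)]] by simp
qed

text \<open>The third square of an isomorphism of triangles involves the shift of its first
  component; for an identity component this removes it.\<close>

lemma Db_shift_idt:
  assumes "bounded_complex A X" shows "Db_shift A X X (idt (Db A) X) = idt (Db A) (shift A X)"
proof -
  let ?E = "loc_eq (Cb A) (quasi_iso A)"
  let ?i = "Fwd X X (idt (Cb A) X)" and ?j = "Fwd (shift A X) (shift A X) (idt (Cb A) (shift A X))"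
  have i: "idt (Db A) X = Collect (?E X X ?i)" "idt (Db A) (shift A X) = Collect (?E (shift A X) (shift A X) ?j)"
    unfolding Db_def by (rule category.loc_idt[OF category_Cb])+
  have m: "map_zigzag (shift A) shift_map ?i = ?j" by (simp add: shift_map_def)
  have "?E X X ?i ?i" using category.idt_mor[OF category_Cb, of X] assms by (intro loc_eq.Fwd) simp
  moreover have "?E (shift A X) (shift A X) ?j (map_zigzag (shift A) shift_map t)" if "?E X X ?i t" for t
    using loc_eq_shift[OF that] m by simp
  ultimately have "{r. \<exists>t \<in> Collect (?E X X ?i). ?E (shift A X) (shift A X) (map_zigzag (shift A) shift_map t) r}
      = Collect (?E (shift A X) (shift A X) ?j)"
    using m by (metis (no_types, lifting) loc_eq.sym loc_eq.trans mem_Collect_eq)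
  then show ?thesis unfolding Db_shift_def i .
qed

text \<open>Only the third vertex of the cone is exchanged. The isomorphisms on the other two are
  identities, so \<open>Db_shift\<close> has to be known on an identity only.\<close>

lemma triangle_coneI:
  assumes c: "cone_triangle A X Y Z f g h" and i: "isomorphic (Db A) Z Z'"
  shows "\<exists>u v w. triangle A X Y Z' u v w"
proof -
  interpret D: category "Db A" by (rule category_Db)
  have m: "f \<in> mor (Cb A) X Y" "g \<in> mor (Cb A) Y Z" "h \<in> mor (Cb A) Z (shift A X)"
    using c by (auto simp: cone_triangle_def)
  note m' = Db_arrow_mor[OF m(1)] Db_arrow_mor[OF m(2)] Db_arrow_mor[OF m(3)]
  have b: "bounded_complex A X" "bounded_complex A Y" using m by (auto simp: Cb_mor)
  obtain r r' where r: "r \<in> mor (Db A) Z Z'" "r' \<in> mor (Db A) Z' Z" "cmp (Db A) r' r = idt (Db A) Z"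
    "cmp (Db A) r r' = idt (Db A) Z'" using i by (auto simp: isomorphic_def iso_arrow_def)
  let ?f = "Db_arrow A X Y f" and ?g = "Db_arrow A Y Z g" and ?h = "Db_arrow A Z (shift A X) h"
  have id: "iso_arrow (Db A) X X (idt (Db A) X)" if "bounded_complex A X" for X
    using D.idt_mor[of X] D.idt_left[of "idt (Db A) X" X X] that by (auto simp: iso_arrow_def)
  have "triangle A X Y Z' ?f (cmp (Db A) r ?g) (cmp (Db A) ?h r')"
    unfolding triangle_def
  proof (intro conjI exI)
    show "?f \<in> mor (Db A) X Y" "cmp (Db A) r ?g \<in> mor (Db A) Y Z'" "cmp (Db A) ?h r' \<in> mor (Db A) Z' (shift A X)"
      using m' r D.cmp_mor by blast+
    show "cone_triangle A X Y Z f g h" by (fact c)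
    show "iso_arrow (Db A) X X (idt (Db A) X)" "iso_arrow (Db A) Y Y (idt (Db A) Y)" using id b by auto
    show "iso_arrow (Db A) Z Z' r" using r by (auto simp: iso_arrow_def)
    show "cmp (Db A) (idt (Db A) Y) ?f = cmp (Db A) ?f (idt (Db A) X)"
      using D.idt_left[OF m'(1)] D.idt_right[OF m'(1)] by simp
    show "cmp (Db A) r ?g = cmp (Db A) (cmp (Db A) r ?g) (idt (Db A) Y)"
      using D.idt_right[OF D.cmp_mor[OF m'(2) r(1)]] by simp
    show "cmp (Db A) (Db_shift A X X (idt (Db A) X)) ?h = cmp (Db A) (cmp (Db A) ?h r') r"
      unfolding Db_shift_idt[OF b(1)] D.idt_left[OF m'(3)] D.cmp_assoc[OF r(1,2) m'(3), symmetric] r(3)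
      using D.idt_right[OF m'(3)] by simp
  qed
  then show ?thesis by blast
qed

lemma triangleD:
  assumes "triangle A X Y Z u v w"
  obtains X' Y' Z' f g h where "cone_triangle A X' Y' Z' f g h"
    "isomorphic (Db A) X' X" "isomorphic (Db A) Y' Y" "isomorphic (Db A) Z' Z"
  using assms unfolding triangle_def isomorphic_def by blast

end


section \<open>Stalk complexes in the derived category\<close>

context abelian_category
begin

lemma hinjI0:
  assumes "bounded_complex A X" "zero_object A (Hob X n)" shows "hinj X Y F n"
  unfolding hinj_def using hob_zero_local_bd[OF assms] by blast

lemma hsurjI1:
  assumes "bounded_complex A X" "bounded_complex A Y" "chmap X Y F" "zero_object A (Hob Y n)"
  shows "hsurj X Y F n"
  unfolding hsurj_def
proof (intro allI impI)
  note f = chD[OF assms(3), of n]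
  fix z' assume zc: "cocycle Y n z'"
  note z = cocycleD[OF zc]
  \<comment> \<open>The lift chosen below is zero, so the difference that has to be a local boundary
    is - z'.\<close>
  have "cocycle Y n (\<ominus> z')" using z assms by (intro cocycleI) simp_all
  then have "local_bd Y n (\<ominus> z')" using hob_zero_local_bd[OF assms(2,4)] by blast
  moreover have "F n \<cdot> zarr (src z') (deg X n) \<oplus> \<ominus> (z' \<cdot> ident (src z')) = \<ominus> z'"
    using z f assms by simp
  moreover have "cocycle X n (zarr (src z') (deg X n))" using z assms by (intro cocycleI) simp_all
  ultimately show "\<exists>e z. epi e \<and> tgt e = src z' \<and> cocycle X n z \<and> src z = src e \<and> local_bd Y n (F n \<cdot> z \<oplus> \<ominus> (z' \<cdot> e))"
    using z by (intro exI[of _ "ident (src z')"] exI[of _ "zarr (src z') (deg X n)"]) simp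
qed

lemma Hmap_mon:
  assumes "bounded_complex A X" "bounded_complex A Y" "chmap X Y F" "hinj X Y F n"
  shows "mon (Hmap X Y F n)"
  using hinj_mon[OF hdata_sel[OF assms(1)] hdata_sel[OF assms(2)] Hmap_induces[OF assms(1,2,3)] assms(3,1,2,4)] .

lemma Hmap_epi:
  assumes "bounded_complex A X" "bounded_complex A Y" "chmap X Y F" "hsurj X Y F n"
  shows "epi (Hmap X Y F n)"
  using hsurj_epi[OF hdata_sel[OF assms(1)] hdata_sel[OF assms(2)] Hmap_induces[OF assms(1,2,3)] assms(3,1,2,4)] .

lemma Hob_trunc:
  assumes "bounded_complex A X"
  shows "n \<le> m \<Longrightarrow> isomorphic A (Hob (trunc m X) n) (Hob X n)"
    and "n > m \<Longrightarrow> zero_object A (Hob (trunc m X) n)"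
proof -
  have b: "bounded_complex A (trunc m X)" using assms by simp
  note c = chmap_trunc_incl[OF assms, of m]
  show "isomorphic A (Hob (trunc m X) n) (Hob X n)" if n: "n \<le> m"
    using isomorphicI[OF Hmap_mon[OF b assms c hinj_trunc_incl[OF assms n]] Hmap_epi[OF b assms c hsurj_trunc_incl[OF assms n]]]
      Hmap(2,3)[OF b assms c] by simp
  show "zero_object A (Hob (trunc m X) n)" if n: "n > m"
    using hob_deg_zero[OF b, of n] n by (simp add: trunc_deg)
qed

lemma trunc_quasi_iso:
  assumes b: "bounded_complex A X" and z: "\<And>n. n > m \<Longrightarrow> zero_object A (Hob X n)"
  shows "quasi_iso A (trunc m X) X (\<lambda>n. und (trunc_incl m X n))"
proof (rule quasi_isoI[OF _ b chmap_trunc_incl[OF b]])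
  show bt: "bounded_complex A (trunc m X)" using b by simp
  fix n
  show "hinj (trunc m X) X (trunc_incl m X) n"
    using hinj_trunc_incl[OF b, of n m] hinjI0[OF bt Hob_trunc(2)[OF b, of m n]] by (cases "n \<le> m") auto
  show "hsurj (trunc m X) X (trunc_incl m X) n"
    using hsurj_trunc_incl[OF b, of n m] hsurjI1[OF bt b chmap_trunc_incl[OF b] z[of n]] by (cases "n \<le> m") auto
qed

lemma Hob_stalk_zero: "H \<in> obj A \<Longrightarrow> n \<noteq> 0 \<Longrightarrow> zero_object A (Hob (stalk H) n)"
  using hob_deg_zero[of "stalk H" n] by (simp add: stalk_deg)

lemma cocycle_stalk: "H \<in> obj A \<Longrightarrow> wt z \<Longrightarrow> tgt z = deg (stalk H) n \<Longrightarrow> cocycle (stalk H) n z"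
  by (rule cocycleI) simp_all

text \<open>Degree 0 of the truncation consists of the cocycles, so the projection onto H^0 is
  defined on it. This is the second leg of the roof in
  \<open>concentrated_isomorphic\<close>.\<close>

definition trunc_proj :: "('o, 'm) cochain \<Rightarrow> int \<Rightarrow> ('o \<times> 'o \<times> 'm) option" where
  "trunc_proj X n = (if n = 0 then hproj X 0 else zarr (deg (trunc 0 X) n) zob)"

lemma chmap_trunc_proj:
  assumes "bounded_complex A X" shows "chmap (trunc 0 X) (stalk (Hob X 0)) (trunc_proj X)"
  unfolding chmap_def
proof (intro allI)
  note h = trunc_diff[OF assms, of 0] and d = hdatD[OF hdata_sel[OF assms, of 0]]
  have oz: "deg (trunc 0 X) n \<in> obj A" for n using assms by simp
  fix n :: int
  consider "n = -1" | "n = 0" | "n \<noteq> 0" "n \<noteq> -1" by linarith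
  then show "wt (trunc_proj X n) \<and> src (trunc_proj X n) = deg (trunc 0 X) n \<and> tgt (trunc_proj X n) = deg (stalk (Hob X 0)) n \<and>
      diff (stalk (Hob X 0)) n \<cdot> trunc_proj X n = trunc_proj X (n + 1) \<cdot> diff (trunc 0 X) n"
  proof cases
    case 1
    then show ?thesis using h d ckD(5)[OF h(5)] assms
      by (simp add: trunc_proj_def stalk_deg diff_trunc trunc_deg Hob_def)
  next
    case 2
    then show ?thesis using h d assms by (simp add: trunc_proj_def stalk_deg diff_trunc trunc_deg Hob_def)
  next
    case 3
    then show ?thesis using h d assms oz[of n] oz[of "n + 1"] wt_diff[OF bc_trunc[OF assms], of 0 n]
      by (simp add: trunc_proj_def stalk_deg)
  qed
qed

lemma trunc_proj_quasi_iso: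
  assumes b: "bounded_complex A X" and z: "\<And>n. n \<noteq> 0 \<Longrightarrow> zero_object A (Hob X n)"
  shows "quasi_iso A (trunc 0 X) (stalk (Hob X 0)) (\<lambda>n. und (trunc_proj X n))"
proof (rule quasi_isoI[OF _ _ chmap_trunc_proj[OF b]])
  show bt: "bounded_complex A (trunc 0 X)" and bs: "bounded_complex A (stalk (Hob X 0))" using b by simp_all
  note h = trunc_diff[OF b, of 0] and d = hdatD[OF hdata_sel[OF b, of 0]]
  have s0: "deg (stalk (Hob X 0)) 0 = Hob X 0" "deg (trunc 0 X) 0 = src (hker X 0)" "deg (trunc 0 X) (- 1) = deg X (- 1)"
    "trunc_proj X 0 = hproj X 0" "diff (trunc 0 X) (- 1) = trunc_diff X 0" by (simp_all add: stalk_deg trunc_deg trunc_proj_def diff_trunc[OF b])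
  fix n :: int
  show "hinj (trunc 0 X) (stalk (Hob X 0)) (trunc_proj X) n"
  proof (cases "n = 0")
    case False
    have "zero_object A (Hob (trunc 0 X) n)"
      using Hob_trunc[OF b, where n = n and m = 0] z[OF False] False zero_isomorphic isomorphic_sym by (cases "n \<le> 0") (blast, simp)
    then show ?thesis by (rule hinjI0[OF bt])
  next
    case True
    show ?thesis
      unfolding hinj_def True
    proof (intro allI impI)
      fix z y assume a: "cocycle (trunc 0 X) 0 z" "wt y" "src y = src z" "tgt y = deg (stalk (Hob X 0)) (0 - 1)"
        "diff (stalk (Hob X 0)) (0 - 1) \<cdot> y = trunc_proj X 0 \<cdot> z"
      note zd = cocycleD[OF a(1)]
      \<comment> \<open>The differential of the stalk complex is zero, so the class of
        \<open>z\<close> vanishes; \<open>hproj X 0\<close> being a cokernel of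
        \<open>trunc_diff X 0\<close> then gives a local preimage.\<close>
      have "hproj X 0 \<cdot> z = zarr (src z) (tgt (hproj X 0))"
        using a s0 b d by (simp add: Hob_def)
      moreover have "tgt z = src (hproj X 0)" using zd s0 d by simp
      ultimately obtain e w where w: "epi e" "tgt e = src z" "wt w" "src w = src e" "tgt w = src (trunc_diff X 0)" "trunc_diff X 0 \<cdot> w = z \<cdot> e"
        using exactE[OF coker_exact[OF h(5)] zd(1)] by blast
      then show "local_bd (trunc 0 X) 0 z" using s0 h by (intro lbdI[of e z w]) simp_all
    qed
  qed
  show "hsurj (trunc 0 X) (stalk (Hob X 0)) (trunc_proj X) n"
  proof (cases "n = 0")
    case False
    then show ?thesis using hsurjI1[OF bt bs chmap_trunc_proj[OF b]] Hob_stalk_zero b by simp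
  next
    case True
    show ?thesis
      unfolding True
    proof (rule hsurjI0[OF bs chmap_trunc_proj[OF b]])
      fix z' assume zc: "cocycle (stalk (Hob X 0)) 0 z'"
      have "tgt z' = tgt (hproj X 0)" using cocycleD(2)[OF zc] s0 by (simp add: Hob_def)
      then obtain e u where e: "epi e" "tgt e = src z'" "wt u" "src u = src e" "tgt u = src (hproj X 0)" "hproj X 0 \<cdot> u = z' \<cdot> e"
        using epi_lift[OF d(6) cocycleD(1)[OF zc]] by metis
      have "diff (trunc 0 X) 0 = zarr (src (hker X 0)) zob" by (simp add: diff_trunc[OF b] trunc_deg)
      then have "cocycle (trunc 0 X) 0 u"
        using e d s0 by (intro cocycleI) (simp_all add: trunc_deg)
      then show "\<exists>e z. epi e \<and> tgt e = src z' \<and> cocycle (trunc 0 X) 0 z \<and> src z = src e \<and> trunc_proj X 0 \<cdot> z = z' \<cdot> e"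
        using e s0 by (intro exI[of _ e] exI[of _ u]) simp
    qed
  qed
qed

text \<open>Roof: the truncation in degree 0 maps to \<open>X\<close> and to the stalk complex, and
  both legs are quasi-isomorphisms.\<close>

lemma concentrated_isomorphic:
  assumes "bounded_complex A X" "\<And>n. n \<noteq> 0 \<Longrightarrow> zero_object A (Hob X n)"
  shows "isomorphic (Db A) X (stalk (Hob X 0))"
proof -
  have "isomorphic (Db A) (trunc 0 X) X" using quasi_iso_isomorphic[OF trunc_quasi_iso[OF assms(1)]] assms(2) by simp
  moreover have "isomorphic (Db A) (trunc 0 X) (stalk (Hob X 0))"
    using quasi_iso_isomorphic[OF trunc_proj_quasi_iso[OF assms]] .
  ultimately show ?thesis
    using category.isomorphic_trans[OF category_Db] category.isomorphic_sym[OF category_Db] by blast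
qed

lemma hinj_st0:
  assumes "wt a" "mon a" "src a = X" "tgt a = Y"
  shows "hinj (stalk X) (stalk Y) (\<lambda>n. if n = 0 then a else zarr zob zob) 0"
  unfolding hinj_def
proof (intro allI impI)
  have o: "X \<in> obj A" "Y \<in> obj A" using assms by auto
  fix z y assume h: "cocycle (stalk X) 0 z" "wt y" "src y = src z" "tgt y = deg (stalk Y) (0 - 1)"
    "diff (stalk Y) (0 - 1) \<cdot> y = (if (0::int) = 0 then a else zarr zob zob) \<cdot> z"
  note z = cocycleD[OF h(1)]
  have "a \<cdot> z = zarr (src z) Y" using h o by (simp add: stalk_deg)
  then have "z = zarr (src z) X" using moD[OF assms(2) z(1)] z assms by (simp add: stalk_deg)
  then show "local_bd (stalk X) 0 z" using local_bd_zarr[of "stalk X" "src z" 0] z o by (simp add: stalk_deg)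
qed

lemma stalk_isomorphic:
  assumes "isomorphic A X Y" shows "isomorphic (Db A) (stalk X) (stalk Y)"
proof -
  obtain a where a: "mon a" "epi a" "src a = X" "tgt a = Y" using isomorphicE[OF assms] by blast
  have o: "X \<in> obj A" "Y \<in> obj A" using a by auto
  let ?F = "\<lambda>n::int. if n = 0 then a else zarr zob zob"
  have c: "chmap (stalk X) (stalk Y) ?F" using stalk_chmap a by simp
  have "quasi_iso A (stalk X) (stalk Y) (\<lambda>n. und (?F n))"
  proof (rule quasi_isoI[OF bc_stalk[OF o(1)] bc_stalk[OF o(2)] c])
    fix n :: int
    show "hinj (stalk X) (stalk Y) ?F n"
      using hinj_st0[OF _ a(1,3,4)] hinjI0[OF bc_stalk[OF o(1)] Hob_stalk_zero[OF o(1)], of n] a by (cases "n = 0") simp_all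
    show "hsurj (stalk X) (stalk Y) ?F n"
    proof (cases "n = 0")
      case False
      then show ?thesis using hsurjI1[OF bc_stalk[OF o(1)] bc_stalk[OF o(2)] c] Hob_stalk_zero[OF o(2)] by simp
    next
      case True
      show ?thesis
        unfolding True
      proof (rule hsurjI0[OF bc_stalk[OF o(2)] c])
        fix z' assume zc: "cocycle (stalk Y) 0 z'"
        have "tgt z' = tgt a" using cocycleD(2)[OF zc] a by (simp add: stalk_deg)
        then obtain e u where e: "epi e" "tgt e = src z'" "wt u" "src u = src e" "tgt u = src a" "a \<cdot> u = z' \<cdot> e"
          using epi_lift[OF a(2) cocycleD(1)[OF zc]] by metis
        then show "\<exists>e z. epi e \<and> tgt e = src z' \<and> cocycle (stalk X) 0 z \<and> src z = src e \<and> ?F 0 \<cdot> z = z' \<cdot> e"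
          using cocycle_stalk[OF o(1), of u 0] a by (intro exI[of _ e] exI[of _ u]) (simp add: stalk_deg)
      qed
    qed
  qed
  then show ?thesis by (rule quasi_iso_isomorphic)
qed

lemma Hob_stalk:
  assumes "X \<in> obj A" shows "isomorphic A X (Hob (stalk X) 0)"
proof -
  have "ker (zarr X zob) (ident X)"
    unfolding ker_def using assms by (auto intro!: exI)
  moreover have "coker (zarr zob X) (ident X)"
    unfolding coker_def using assms by (auto intro!: exI)
  ultimately have "hdata (stalk X) 0 (ident X) (ident X)"
    unfolding hdata_def using assms by (intro conjI exI[of _ "zarr zob X"]) (simp_all add: stalk_deg)
  then have "cohomology_data A (stalk X) 0 X (idt A X) X (idt A X)"
    using assms by (subst cohomology_data_iff) (simp_all add: ident_def stalk_deg)
  then show ?thesis using cohomology_unique[OF bc_stalk[OF assms]] unfolding is_cohomology_def by blast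
qed

text \<open>Up to zero summands, the cone \<open>W\<close> is the complex X -> Y in degrees -1 and
  0. As \<open>a\<close> is mono and its image is the kernel of \<open>b\<close>, the map to the
  stalk complex of \<open>Z\<close> given by the epimorphism \<open>b\<close> is a
  quasi-isomorphism.\<close>

lemma short_exact_triangle:
  assumes "short_exact A X Y Z"
  shows "\<exists>u v w. triangle A (stalk X) (stalk Y) (stalk Z) u v w"
proof -
  obtain a b where ab: "mon a" "epi b" "exact a b" "src a = X" "tgt a = Y" "src b = Y" "tgt b = Z" "ker b a"
    using short_exactE[OF assms] by metis
  have o: "X \<in> obj A" "Y \<in> obj A" "Z \<in> obj A" using ab by auto
  have bo: "bounded_complex A (stalk X)" "bounded_complex A (stalk Y)" "bounded_complex A (stalk Z)" using o by simp_all
  let ?F = "\<lambda>n::int. if n = 0 then a else zarr zob zob"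
  have cF: "chmap (stalk X) (stalk Y) ?F" using stalk_chmap ab by simp
  obtain W g h where W: "cone_triangle A (stalk X) (stalk Y) W (\<lambda>n. und (?F n)) g h"
    using ex_cone_triangle[OF Cb_morI[OF bo(1,2) cF]] by blast
  obtain I Q where "cone (stalk X) (stalk Y) W (level (stalk X) (stalk Y) (\<lambda>n. und (?F n))) (level (stalk Y) W g) (level W (shift A (stalk X)) h) I Q"
    using cone_triangleD[OF W] by blast
  then obtain G H where c: "cone (stalk X) (stalk Y) W ?F G H I Q" unfolding level_und[OF cF] by blast
  note t = cone_ty[OF c] and bW = cone_bc(3)[OF c]
  note t0 = t[of 0, simplified] and tm = t[of "-1", simplified] and t1 = t[of 1, simplified]
  have sd: "deg (stalk X) 0 = X" "deg (stalk Y) 0 = Y" "deg (stalk Z) 0 = Z" by (simp_all add: stalk_deg)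
  \<comment> \<open>In degree 0 the cone is \<open>Y\<close> up to a zero summand, and
    \<open>Q 0\<close> projects onto it. The one square with content lies in degree -1, where it
    says b a = 0.\<close>
  define P where "P = (\<lambda>n::int. if n = 0 then b \<cdot> Q 0 else zarr (deg W n) zob)"
  have P0: "P 0 = b \<cdot> Q 0" by (simp add: P_def)
  have Pt: "wt (P n)" "src (P n) = deg W n" "tgt (P n) = deg (stalk Z) n" for n
    using t0 t[of n] ab bW by (auto simp: P_def stalk_deg)
  have cP: "chmap W (stalk Z) P"
    unfolding chmap_def
  proof (intro allI conjI Pt)
    fix n :: int
    have l: "diff (stalk Z) n \<cdot> P n = zarr (deg W n) (deg (stalk Z) (n + 1))" using Pt[of n] bo by simp
    have "P (n + 1) \<cdot> diff W n = zarr (deg W n) (deg (stalk Z) (n + 1))"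
    proof (cases "n = -1")
      case True
      have "b \<cdot> a \<cdot> H (- 1) = zarr (deg W (- 1)) Z"
        using compose_cong_right[OF exactD(4)[OF ab(3)], of "H (- 1)"] tm ab sd bW o by simp
      moreover have "Q 0 \<cdot> diff W (- 1) \<cdot> ident (deg W (- 1)) = a \<cdot> H (- 1) \<oplus> diff (stalk Y) (- 1) \<cdot> Q (- 1)"
        using cone_dQ[OF c, of "ident (deg W (- 1))" "- 1" 0] tm bW by simp
      ultimately show ?thesis using True P0 tm t0 ab sd bW bo o by simp
    next
      case False
      then show ?thesis using bW by (simp add: P_def stalk_deg)
    qed
    then show "diff (stalk Z) n \<cdot> P n = P (n + 1) \<cdot> diff W n" using l by simp
  qed
  have "quasi_iso A W (stalk Z) (\<lambda>n. und (P n))"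
  proof (rule quasi_isoI[OF bW bo(3) cP])
    fix n :: int
    show "hsurj W (stalk Z) P n"
    proof (cases "n = 0")
      case False
      then show ?thesis using hsurjI1[OF bW bo(3) cP] Hob_stalk_zero[OF o(3)] by simp
    next
      case True
      show ?thesis
        unfolding True
      proof (rule hsurjI0[OF bo(3) cP])
        fix z' assume zc: "cocycle (stalk Z) 0 z'"
        have "tgt z' = tgt b" using cocycleD(2)[OF zc] ab sd by simp
        then obtain e u where e: "epi e" "tgt e = src z'" "wt u" "src u = src e" "tgt u = src b" "b \<cdot> u = z' \<cdot> e"
          using epi_lift[OF ab(2) cocycleD(1)[OF zc]] by metis
        have u: "tgt u = deg (stalk Y) 0" using e ab sd by simp
        have "diff W 0 \<cdot> G 0 \<cdot> u = G 1 \<cdot> diff (stalk Y) 0 \<cdot> u" using chD(5)[OF cone_chmap(2)[OF c], of 0 u] by simp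
        also have "\<dots> = zarr (src u) (deg W 1)" using u e t1 bo by simp
        finally have "cocycle W 0 (G 0 \<cdot> u)" using u e t0 by (intro cocycleI) simp_all
        moreover have "P 0 \<cdot> G 0 \<cdot> u = z' \<cdot> e"
          using cone_rw(2)[OF c, of u 0] u e by (simp add: P0)
        ultimately show "\<exists>e z. epi e \<and> tgt e = src z' \<and> cocycle W 0 z \<and> src z = src e \<and> P 0 \<cdot> z = z' \<cdot> e"
          using e u t0 by (intro exI[of _ e] exI[of _ "G 0 \<cdot> u"]) simp
      qed
    qed
    show "hinj W (stalk Z) P n"
      unfolding hinj_def
    proof (intro allI impI)
      fix z y assume h: "cocycle W n z" "wt y" "src y = src z" "tgt y = deg (stalk Z) (n - 1)"
        "diff (stalk Z) (n - 1) \<cdot> y = P n \<cdot> z"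
      note z = cocycleD[OF h(1)]
      have dz: "I n \<cdot> H n \<cdot> z \<oplus> G n \<cdot> Q n \<cdot> z = z" using cone_decomp[OF c z(1,2)] .
      consider "n = 0" | "n = -1" | "n \<noteq> 0" "n \<noteq> -1" by linarith
      then show "local_bd W n z"
      proof cases
        case 1
        \<comment> \<open>Degree 0: \<open>b\<close> kills the Y-part of \<open>z\<close>, which is
          therefore a x for some \<open>x\<close>, and z = G a x is the boundary of I x.\<close>
        have "b \<cdot> (Q 0 \<cdot> z) = zarr (src (Q 0 \<cdot> z)) (tgt b)"
          using h z 1 t0 ab sd bo o by (simp add: P0)
        moreover have "wt (Q 0 \<cdot> z)" "tgt (Q 0 \<cdot> z) = src b" using z 1 t0 ab sd by simp_all
        ultimately obtain x where x: "wt x" "src x = src (Q 0 \<cdot> z)" "tgt x = src a" "a \<cdot> x = Q 0 \<cdot> z"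
          using ker_lift[OF ab(8)] by blast
        have x': "src x = src z" "tgt x = deg (stalk X) 0" using x z 1 t0 ab sd by simp_all
        have "H 0 \<cdot> z = zarr (src z) zob" using to_zero[of zob "H 0 \<cdot> z"] z 1 t0 by (simp add: stalk_deg)
        then have "z = G 0 \<cdot> a \<cdot> x" using dz x 1 t0 z by (simp add: stalk_deg)
        also have "\<dots> = diff W (- 1) \<cdot> (I (- 1) \<cdot> x \<oplus> G (- 1) \<cdot> zarr (src x) (deg (stalk Y) (- 1)))"
          using cone_d[OF c, of x "zarr (src x) (deg (stalk Y) (- 1))" "- 1" 0] x(1) x' wt_obj(1)[OF z(1)] t0 tm bo bW o ab sd by simp
        finally have "z = diff W (n - 1) \<cdot> (I (- 1) \<cdot> x \<oplus> G (- 1) \<cdot> zarr (src x) (deg (stalk Y) (- 1)))"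
          using 1 by simp
        then show ?thesis using local_bd_diff[OF bW, of _ n] x(1) x' wt_obj(1)[OF z(1)] tm bo 1 by simp
      next
        case 2
        \<comment> \<open>Degree -1: by the cocycle condition \<open>a\<close> kills the X-part of
          \<open>z\<close>, and the other part lies in a zero object, so z = 0.\<close>
        have "a \<cdot> H (- 1) \<cdot> z = \<ominus> (diff (stalk Y) (- 1) \<cdot> Q (- 1) \<cdot> z)"
          using cone_cocycle(2)[OF c h(1)] 2 by simp
        then have "a \<cdot> H (- 1) \<cdot> z = zarr (src z) Y" using z 2 tm bo sd o by simp
        then have hz: "H (- 1) \<cdot> z = zarr (src z) X"
          using moD[OF ab(1), of "H (- 1) \<cdot> z" "src z" X Y] z 2 tm ab sd by simp
        have qz: "Q (- 1) \<cdot> z = zarr (src z) zob"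
          by (rule to_zero[OF zob(1)]) (use z(1,2) 2 t(13-15)[of "- 1"] in \<open>simp_all add: stalk_deg\<close>)
        have "I n \<cdot> H n \<cdot> z = zarr (src z) (deg W n)" "G n \<cdot> Q n \<cdot> z = zarr (src z) (deg W n)"
          using z(1) 2 t(4-15)[of "- 1"] o by (simp_all add: hz qz stalk_deg)
        then have "z = zarr (src z) (deg W n) \<oplus> zarr (src z) (deg W n)" using dz by metis
        also have "\<dots> = zarr (src z) (deg W n)" using z bW by simp
        finally have "z = zarr (src z) (deg W n)" .
        then show ?thesis using local_bd_zarr[OF bW, of "src z" n] z by simp
      next
        case 3
        have "zero_object A (deg W n)" using biprod_zero[OF cone_biprod[OF c], of n] t[of n] 3 by (simp add: stalk_deg)
        then have "z = zarr (src z) (deg W n)" using to_zero[of "deg W n" z] z by simp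
        then show ?thesis using local_bd_zarr[OF bW, of "src z" n] z by simp
      qed
    qed
  qed
  then show ?thesis using triangle_coneI[OF W] quasi_iso_isomorphic by blast
qed

text \<open>The cone of B -> 0 is formed with identities as inclusion of and projection onto the
  first summand, so that it is \<open>shift A B\<close> on the nose.\<close>

lemma rotate_triangle:
  assumes b: "bounded_complex A B"
  shows "\<exists>u v w. triangle A B (stalk zob) (shift A B) u v w"
proof -
  let ?f = "\<lambda>n. mzero A (deg B n) zob" and ?g = "\<lambda>n. mzero A zob (deg B (n + 1))" and ?h = "\<lambda>n. idt A (deg B (n + 1))"
  have sd: "deg (stalk zob) n = zob" for n by (simp add: stalk_deg)
  have bz: "bounded_complex A (stalk zob)" by simp
  have e: "?f = (\<lambda>n. und (zarr (deg B n) zob))" "?g = (\<lambda>n. und (zarr zob (deg B (n + 1))))" "?h = (\<lambda>n. und (ident (deg B (n + 1))))"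
    by (simp_all add: zarr_def ident_def)
  have m: "?f \<in> mor (Cb A) B (stalk zob)" "?g \<in> mor (Cb A) (stalk zob) (shift A B)" "?h \<in> mor (Cb A) (shift A B) (shift A B)"
    unfolding e by (rule Cb_morI; use b in \<open>simp add: chmap_def sd\<close>)+
  have biprod: "biprod (ident (deg B n)) (zarr zob (deg B n)) (ident (deg B n)) (zarr (deg B n) zob)" for n
    unfolding biprod_def using b by (simp add: zero_object_iff[THEN iffD1, OF zob(1), THEN conjunct2])
  have r: "?f n \<in> mor A (deg B n) zob" "?g n \<in> mor A zob (deg B (n + 1))" "?h n \<in> mor A (deg B (n + 1)) (deg B (n + 1))"
    "mzero A (deg B (n + 1)) zob \<in> mor A (deg B (n + 1)) zob" for n
    using b by (simp_all add: mzero_mor idt_mor)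
  have key: "direct_sum A (deg (shift A B) n) (deg (stalk zob) n) (deg (shift A B) n) (?h n) (?g n) (?h n) (mzero A (deg B (n + 1)) zob) \<and>
     dif (shift A B) n = madd A (cmp A (?h (n + 1)) (cmp A (dif (shift A B) n) (?h n)))
                 (madd A (cmp A (?g (n + 1)) (cmp A (?f (n + 1)) (?h n)))
                         (cmp A (?g (n + 1)) (cmp A (dif (stalk zob) n) (mzero A (deg B (n + 1)) zob))))" for n
  proof
    show "direct_sum A (deg (shift A B) n) (deg (stalk zob) n) (deg (shift A B) n) (?h n) (?g n) (?h n) (mzero A (deg B (n + 1)) zob)"
      unfolding direct_sum_iff using biprod[of "n + 1"] by (simp add: sd ident_def zarr_def)
    have "Some (deg B (n + 1), deg B (n + 1 + 1), madd A (cmp A (?h (n + 1)) (cmp A (dif (shift A B) n) (?h n)))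
                 (madd A (cmp A (?g (n + 1)) (cmp A (?f (n + 1)) (?h n)))
                         (cmp A (?g (n + 1)) (cmp A (dif (stalk zob) n) (mzero A (deg B (n + 1)) zob))))) =
      ident (deg B (n + 1 + 1)) \<cdot> diff (shift A B) n \<cdot> ident (deg B (n + 1)) \<oplus>
      (zarr zob (deg B (n + 1 + 1)) \<cdot> zarr (deg B (n + 1)) zob \<cdot> ident (deg B (n + 1)) \<oplus>
       zarr zob (deg B (n + 1 + 1)) \<cdot> diff (stalk zob) n \<cdot> zarr (deg B (n + 1)) zob)"
      using cone_conv[OF b bz, of "?f (n + 1)" n "?h n" "deg B (n + 1)" "mzero A (deg B (n + 1)) zob" "?h (n + 1)"
          "deg B (n + 1 + 1)" "?g (n + 1)"] r by (simp only: sd ident_def zarr_def)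
    also have "\<dots> = diff (shift A B) n" using b by (simp add: sd)
    also have "diff (shift A B) n = Some (deg B (n + 1), deg B (n + 1 + 1), dif (shift A B) n)"
      by (simp add: diff_def del: diff_shift)
    finally show "dif (shift A B) n = madd A (cmp A (?h (n + 1)) (cmp A (dif (shift A B) n) (?h n)))
                 (madd A (cmp A (?g (n + 1)) (cmp A (?f (n + 1)) (?h n)))
                         (cmp A (?g (n + 1)) (cmp A (dif (stalk zob) n) (mzero A (deg B (n + 1)) zob))))" by simp
  qed
  have "cone_triangle A B (stalk zob) (shift A B) ?f ?g ?h"
    unfolding cone_triangle_def
    by (intro conjI m exI[of _ ?h] exI[of _ "\<lambda>n. mzero A (deg B (n + 1)) zob"] allI
      key[THEN conjunct1] key[THEN conjunct2])
  then show ?thesis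
    by (rule triangle_coneI) (use category.isomorphic_refl[OF category_Db] b in simp)
qed

end


section \<open>The intermediate subcategory\<close>

context abelian_category
begin

section \<open>Serre subcategories and exact sequences\<close>

lemma serre_iso:
  assumes "serre_subcategory A U" "isomorphic A X Y" "X \<in> U" shows "Y \<in> U"
  using assms unfolding serre_subcategory_def subcategory_def by blast

lemma serre_zero: "serre_subcategory A U \<Longrightarrow> zero_object A Z \<Longrightarrow> Z \<in> U"
  unfolding serre_subcategory_def subcategory_def by blast

lemma serre_obj: "serre_subcategory A U \<Longrightarrow> X \<in> U \<Longrightarrow> X \<in> obj A"
  unfolding serre_subcategory_def subcategory_def by blast

lemma serre_mon:
  assumes "serre_subcategory A U" "mon f" "tgt f \<in> U" shows "src f \<in> U"
proof -
  have "monic A (src f) (tgt f) (und f)" using assms(2) wt_eta[of f] by (simp add: monic_iff)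
  then show ?thesis using assms unfolding serre_subcategory_def closed_under_subobjects_def by blast
qed

lemma serre_epi:
  assumes "serre_subcategory A U" "epi f" "src f \<in> U" shows "tgt f \<in> U"
proof -
  have "epic A (src f) (tgt f) (und f)" using assms(2) wt_eta[of f] by (simp add: epic_iff)
  then show ?thesis using assms unfolding serre_subcategory_def closed_under_quotients_def by blast
qed

text \<open>The middle term is an extension of the image of \<open>g\<close>, a subobject of its
  target, by the image of \<open>f\<close>, a quotient of its source.\<close>

lemma serre_exact:
  assumes s: "serre_subcategory A U" and e: "exact f g" and "src f \<in> U" "tgt g \<in> U"
  shows "src g \<in> U"
proof -
  obtain m p where f: "mon m" "epi p" "src m = img f" "tgt p = img f" "src p = src f" "tgt m = tgt f"
    using img exactD[OF e] by metis
  obtain m' p' where g: "mon m'" "epi p'" "src m' = img g" "tgt p' = img g" "src p' = src g" "tgt m' = tgt g"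
    using img exactD[OF e] by metis
  have "img f \<in> U" using serre_epi[OF s f(2)] f assms by simp
  moreover have "img g \<in> U" using serre_mon[OF s g(1)] g assms by simp
  ultimately show ?thesis
    using exact_img[OF e] s unfolding serre_subcategory_def closed_under_extensions_def by blast
qed

lemma serre_UNIV: "serre_subcategory A (obj A)"
proof -
  have "Y \<in> obj A" if "isomorphic A X Y" for X Y
    using that mor_obj by (auto simp: isomorphic_def iso_arrow_def)
  moreover have "P \<in> obj A" if "direct_sum A X Y P i j p q" for X Y P i j p q
    using that mor_obj by (auto simp: direct_sum_def is_product_def)
  moreover have "X \<in> obj A" if "monic A X Y f" for X Y f using that mor_obj by (auto simp: monic_def)
  moreover have "Y \<in> obj A" if "epic A X Y f" for X Y f using that mor_obj by (auto simp: epic_def)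
  moreover have "Y \<in> obj A" if "short_exact A X Y Z" for X Y Z
    using that mor_obj by (auto simp: short_exact_def is_kernel_def)
  ultimately show ?thesis
    unfolding serre_subcategory_def subcategory_def closed_under_subobjects_def
      closed_under_quotients_def closed_under_extensions_def using zero_obj by blast
qed

lemma in_degree_0_iff:
  assumes "serre_subcategory A U"
  shows "X \<in> in_degree_0 A U \<longleftrightarrow> bounded_complex A X \<and> (\<forall>n. n \<noteq> 0 \<longrightarrow> zero_object A (Hob X n)) \<and> Hob X 0 \<in> U"
proof
  assume "X \<in> in_degree_0 A U"
  then have b: "bounded_complex A X" and z: "\<And>n. n \<noteq> 0 \<Longrightarrow> \<exists>Z. zero_object A Z \<and> is_cohomology A X n Z"
    and h: "\<exists>H \<in> U. is_cohomology A X 0 H" by (auto simp: in_degree_0_def)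
  have "zero_object A (Hob X n)" if "n \<noteq> 0" for n
    using z[OF that] cohomology_unique[OF b] zero_isomorphic by blast
  moreover have "Hob X 0 \<in> U" using h cohomology_unique[OF b] serre_iso[OF assms] by blast
  ultimately show "bounded_complex A X \<and> (\<forall>n. n \<noteq> 0 \<longrightarrow> zero_object A (Hob X n)) \<and> Hob X 0 \<in> U"
    using b by blast
next
  assume h: "bounded_complex A X \<and> (\<forall>n. n \<noteq> 0 \<longrightarrow> zero_object A (Hob X n)) \<and> Hob X 0 \<in> U"
  then show "X \<in> in_degree_0 A U"
    using is_cohomology_Hob unfolding in_degree_0_def by auto
qed

text \<open>The sequence is that of the cone to which the triangle is isomorphic; only its objects
  are compared with the cohomology of \<open>X\<close>, \<open>Y\<close> and \<open>Z\<close>. This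
  avoids transporting connecting maps along isomorphisms of \<open>Db A\<close>, and the
  applications depend only on the objects up to isomorphism.\<close>

lemma triangle_les:
  assumes "triangle A X Y Z u v w"
  obtains a b c hx hy hz where "\<And>n. exact (a n) (b n)" "\<And>n. exact (b n) (c n)" "\<And>n. exact (c n) (a (n + 1))"
    "\<And>n. src (a n) = hx n" "\<And>n. src (b n) = hy n" "\<And>n. src (c n) = hz n"
    "\<And>n. isomorphic A (hx n) (Hob X n)" "\<And>n. isomorphic A (hy n) (Hob Y n)" "\<And>n. isomorphic A (hz n) (Hob Z n)"
    "bounded_complex A X" "bounded_complex A Y" "bounded_complex A Z"
proof -
  obtain X' Y' Z' f g h where t: "cone_triangle A X' Y' Z' f g h"
    "isomorphic (Db A) X' X" "isomorphic (Db A) Y' Y" "isomorphic (Db A) Z' Z"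
    using triangleD[OF assms] by blast
  obtain I Q where "cone X' Y' Z' (level X' Y' f) (level Y' Z' g) (level Z' (shift A X') h) I Q"
    using cone_triangleD[OF t(1)] by blast
  note e = cone_exact1[OF this] cone_exact2[OF this] cone_exact3[OF this]
    and b = cone_bc[OF this] and chmap = cone_chmap[OF this]
  have bb: "bounded_complex A X" "bounded_complex A Y" "bounded_complex A Z"
    using t(2-4) category.mor_obj[OF category_Db] by (auto simp: isomorphic_def iso_arrow_def)
  note s = Hmap(2)[OF b(1,2) chmap(1)] Hmap(2)[OF b(2,3) chmap(2)] Hmap(2)[OF b(3) bc_shift[OF b(1)] chmap(3)]
  show ?thesis
    by (rule that[OF e s Hob_isomorphic[OF t(2)] Hob_isomorphic[OF t(3)] Hob_isomorphic[OF t(4)] bb])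
qed

text \<open>\<open>f\<close> epi forces g = 0, and \<open>k\<close> mono forces h = 0, so the
  identity of the object between \<open>g\<close> and \<open>h\<close> becomes zero after an
  epimorphism.\<close>

lemma exact_squeeze:
  assumes "exact f g" "exact g h" "exact h k" "epi f" "mon k"
  shows "zero_object A (src h)"
proof -
  note d = exactD[OF assms(1)] exactD[OF assms(2)] exactD[OF assms(3)]
  have g: "g = zarr (src g) (tgt g)" using epD[OF assms(4) d(2)] d by simp
  have h: "h = zarr (src h) (tgt h)" using moD[OF assms(5) d(9)] d by simp
  have "h \<cdot> ident (src h) = h" using d by simp
  also have "h = zarr (src (ident (src h))) (tgt h)" unfolding src_ident by (fact h)
  finally have "h \<cdot> ident (src h) = zarr (src (ident (src h))) (tgt h)" .
  moreover have "wt (ident (src h))" "tgt (ident (src h)) = src h" using d by simp_all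
  ultimately obtain e x where x: "epi e" "tgt e = src (ident (src h))" "wt x" "src x = src e" "tgt x = src g" "g \<cdot> x = ident (src h) \<cdot> e"
    using exactE[OF assms(2)] by blast
  have "g \<cdot> x = zarr (src g) (tgt g) \<cdot> x" by (rule arg_cong[OF g, of "\<lambda>a. a \<cdot> x"])
  also have "\<dots> = zarr (src e) (src h)" using x d by simp
  finally have "ident (src h) \<cdot> e = zarr (src e) (src h)" unfolding x(6) .
  then have "ident (src h) = zarr (src h) (src h)"
    using epD[OF x(1), of "ident (src h)" "src h" "src e" "src h"] x d by simp
  then show ?thesis using d by (simp add: zero_object_iff)
qed

definition ext_cond :: "'o set \<Rightarrow> ('o, 'm) cochain \<Rightarrow> bool" where
  "ext_cond U X \<longleftrightarrow> bounded_complex A X \<and> (\<forall>n. n \<noteq> 0 \<longrightarrow> n \<noteq> -1 \<longrightarrow> zero_object A (Hob X n)) \<and> Hob X (-1) \<in> U"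

text \<open>One direction is the long exact sequence. For the other, the truncation in degree -1 is
  the part B[1], and the cone of its inclusion, with cohomology in degree 0 only, is the part in
  \<open>A\<close>.\<close>

lemma shift_star_iff:
  assumes s: "serre_subcategory A U"
  shows "X \<in> shift_star A U (obj A) \<longleftrightarrow> ext_cond U X"
proof
  assume "X \<in> shift_star A U (obj A)"
  then obtain B B' u v w where B: "B \<in> in_degree_0 A U" "B' \<in> in_degree_0 A (obj A)"
    "triangle A (shift A B) X B' u v w" by (auto simp: shift_star_def)
  note b = B(1)[unfolded in_degree_0_iff[OF s]] and b' = B(2)[unfolded in_degree_0_iff[OF serre_UNIV]]
  obtain f g h hx hy hz where t: "\<And>n. exact (f n) (g n)" "\<And>n. exact (g n) (h n)" "\<And>n. exact (h n) (f (n + 1))"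
    "\<And>n. src (f n) = hx n" "\<And>n. src (g n) = hy n" "\<And>n. src (h n) = hz n"
    "\<And>n. isomorphic A (hx n) (Hob (shift A B) n)" "\<And>n. isomorphic A (hy n) (Hob X n)" "\<And>n. isomorphic A (hz n) (Hob B' n)"
    "bounded_complex A (shift A B)" "bounded_complex A X" "bounded_complex A B'" by (rule triangle_les[OF B(3)]) (rule that)
  have tg: "tgt (g n) = hz n" for n using exactD(3)[OF t(2)[of n]] t(6) by simp
  have x: "isomorphic A (Hob B (n + 1)) (hx n)" for n
    using isomorphic_sym[OF t(7)[of n]] b by simp
  have z: "isomorphic A (Hob B' n) (hz n)" for n using isomorphic_sym[OF t(9)] .
  have "zero_object A (Hob X n)" if n: "n \<noteq> 0" "n \<noteq> -1" for n
  proof -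
    have "zero_object A (hx n)" using zero_isomorphic[OF x[of n]] b n by simp
    moreover have "zero_object A (hz n)" using zero_isomorphic[OF z[of n]] b' n by simp
    ultimately have "zero_object A (hy n)" using exact_zero[OF t(1)[of n]] t(4-5) tg by simp
    then show ?thesis using zero_isomorphic[OF t(8)] by blast
  qed
  moreover have "Hob X (- 1) \<in> U"
  proof -
    have "hx (- 1) \<in> U" using serre_iso[OF s x[of "-1"]] b by simp
    moreover have "hz (- 1) \<in> U" using serre_zero[OF s] zero_isomorphic[OF z[of "-1"]] b' by simp
    ultimately have "hy (- 1) \<in> U" using serre_exact[OF s t(1)[of "-1"]] t(4-5) tg by simp
    then show ?thesis using serre_iso[OF s t(8)] by blast
  qed
  ultimately show "ext_cond U X" using t(11) by (simp add: ext_cond_def)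
next
  assume "ext_cond U X"
  then have b: "bounded_complex A X" and z: "\<And>n. n \<noteq> 0 \<Longrightarrow> n \<noteq> -1 \<Longrightarrow> zero_object A (Hob X n)"
    and U: "Hob X (-1) \<in> U" by (auto simp: ext_cond_def)
  \<comment> \<open>\<open>X\<close> lies in the triangle of \<open>?T \<rightarrow> X\<close> and its cone \<open>Z\<close>.\<close>
  let ?T = "trunc (-1) X" and ?f = "\<lambda>n. und (trunc_incl (-1) X n)"
  have bt: "bounded_complex A ?T" using b by simp
  note c = chmap_trunc_incl[OF b, of "-1"]
  obtain Z g h where Z: "cone_triangle A ?T X Z ?f g h" using ex_cone_triangle[OF Cb_morI[OF bt b c]] by blast
  obtain I Q where "cone ?T X Z (level ?T X ?f) (level X Z g) (level Z (shift A ?T) h) I Q"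
    using cone_triangleD[OF Z] by blast
  then have cn: "cone ?T X Z (trunc_incl (-1) X) (level X Z g) (level Z (shift A ?T) h) I Q" unfolding level_und[OF c] .
  note e = cone_exact1[OF cn] cone_exact2[OF cn] cone_exact3[OF cn] and bZ = cone_bc(3)[OF cn] and chmap = cone_chmap[OF cn]
  note sz = Hmap(2)[OF bZ bc_shift[OF bt] chmap(3)] and tz = Hmap(3)[OF bZ bc_shift[OF bt] chmap(3)] and sx = Hmap(2)[OF b bZ chmap(2)]
    and stalk = Hmap(2)[OF bt b c]
  \<comment> \<open>\<open>shift_star\<close> asks for the first vertex literally as a
    shift.\<close>
  define B where "B = unshift ?T"
  have B: "bounded_complex A B" "shift A B = ?T" using unshift[OF bt] by (auto simp: B_def)
  have hB: "Hob ?T n = Hob B (n + 1)" for n using hsel_shift(3)[OF B(1), of n] B(2) by simp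
  have hT: "zero_object A (Hob ?T n)" if "n \<noteq> -1" for n
  proof (cases "n \<le> -1")
    case True
    then show ?thesis using zero_isomorphic[OF isomorphic_sym[OF Hob_trunc(1)[OF b True]] z[of n]] that by simp
  next
    case False
    then show ?thesis using Hob_trunc(2)[OF b, of "-1" n] by simp
  qed
  have "B \<in> in_degree_0 A U"
    unfolding in_degree_0_iff[OF s]
  proof (intro conjI allI impI B(1))
    show "zero_object A (Hob B n)" if "n \<noteq> 0" for n using hT[of "n - 1"] hB[of "n - 1"] that by simp
    have "Hob ?T (-1) \<in> U" using serre_iso[OF s isomorphic_sym[OF Hob_trunc(1)[OF b, of "-1" "-1"]] U] by simp
    then show "Hob B 0 \<in> U" using hB[of "-1"] by simp
  qed
  moreover have "Z \<in> in_degree_0 A (obj A)"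
    unfolding in_degree_0_iff[OF serre_UNIV]
  proof (intro conjI allI impI bZ)
    show "Hob Z 0 \<in> obj A" using bZ by simp
    fix n :: int assume n: "n \<noteq> 0"
    \<comment> \<open>In degrees up to -1 the inclusion is epi on H^n and mono on H^(n+1); for n =
      -1 the latter holds because H^0 of the truncation is zero. In positive degrees both neighbours
      of H^n of \<open>Z\<close> are zero.\<close>
    show "zero_object A (Hob Z n)"
    proof (cases "n \<le> -1")
      case True
      have f: "epi (Hmap ?T X (trunc_incl (-1) X) n)" using Hmap_epi[OF bt b c hsurj_trunc_incl[OF b True]] .
      have "mon (Hmap ?T X (trunc_incl (-1) X) (n + 1))"
      proof (cases "n = -1")
        case True
        then show ?thesis using Hmap_mon[OF bt b c hinjI0[OF bt hT]] by simp
      next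
        case False
        then show ?thesis using Hmap_mon[OF bt b c hinj_trunc_incl[OF b]] True by simp
      qed
      then show ?thesis using exact_squeeze[OF e f] sz by simp
    next
      case False
      then have "zero_object A (Hob X n)" "zero_object A (Hob ?T (n + 1))" using z[of n] hT[of "n + 1"] n by simp_all
      then show ?thesis using exact_zero[OF e(2)[of n]] sx tz sz bt by simp
    qed
  qed
  moreover have "\<exists>u v w. triangle A (shift A B) X Z u v w"
    unfolding B(2) using triangle_coneI[OF Z] category.isomorphic_refl[OF category_Db] bZ by simp
  ultimately show "X \<in> shift_star A U (obj A)" using b unfolding shift_star_def Db_obj by blast
qed

lemma ext_cond_iso:
  assumes "serre_subcategory A U" "ext_cond U X" "isomorphic (Db A) X Y" shows "ext_cond U Y"
proof -
  have "bounded_complex A Y"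
    using assms(3) category.mor_obj[OF category_Db] by (auto simp: isomorphic_def iso_arrow_def)
  then show ?thesis
    using assms(2) zero_isomorphic[OF Hob_isomorphic[OF assms(3)]] serre_iso[OF assms(1) Hob_isomorphic[OF assms(3)]]
    unfolding ext_cond_def by blast
qed

lemma ext_cond_retract:
  assumes "serre_subcategory A U" "ext_cond U Y" "a \<in> mor (Db A) X Y" "b \<in> mor (Db A) Y X" "cmp (Db A) b a = idt (Db A) X"
  shows "ext_cond U X"
proof -
  have "bounded_complex A X" using category.mor_obj[OF category_Db assms(3)] by simp
  moreover have "zero_object A (Hob X n)" if "zero_object A (Hob Y n)" for n
  proof -
    obtain m where "mon m" "src m = Hob X n" "tgt m = Hob Y n" using Hob_retract[OF assms(3-5)] by blast
    then show ?thesis using mon_to_zero[of m] that by simp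
  qed
  moreover have "Hob X n \<in> U" if "Hob Y n \<in> U" for n
  proof -
    obtain m where "mon m" "src m = Hob X n" "tgt m = Hob Y n" using Hob_retract[OF assms(3-5)] by blast
    then show ?thesis using serre_mon[OF assms(1), of m] that by simp
  qed
  ultimately show ?thesis using assms(2) unfolding ext_cond_def by blast
qed

lemma ext_cond_triangle:
  assumes s: "serre_subcategory A U" and t: "triangle A X Y Z u v w" and "ext_cond U X" "ext_cond U Z"
  shows "ext_cond U Y"
proof -
  obtain f g h hx hy hz where t: "\<And>n. exact (f n) (g n)" "\<And>n. exact (g n) (h n)" "\<And>n. exact (h n) (f (n + 1))"
    "\<And>n. src (f n) = hx n" "\<And>n. src (g n) = hy n" "\<And>n. src (h n) = hz n"
    "\<And>n. isomorphic A (hx n) (Hob X n)" "\<And>n. isomorphic A (hy n) (Hob Y n)" "\<And>n. isomorphic A (hz n) (Hob Z n)"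
    "bounded_complex A X" "bounded_complex A Y" "bounded_complex A Z" by (rule triangle_les[OF t]) (rule that)
  have tg: "tgt (g n) = hz n" for n using exactD(3)[OF t(2)[of n]] t(6) by simp
  have "zero_object A (Hob Y n)" if "zero_object A (Hob X n)" "zero_object A (Hob Z n)" for n
    using exact_zero[OF t(1)[of n]] t(4,5) tg zero_isomorphic[OF isomorphic_sym[OF t(7)[of n]] that(1)]
      zero_isomorphic[OF isomorphic_sym[OF t(9)[of n]] that(2)] zero_isomorphic[OF t(8)[of n]] by simp
  moreover have "Hob Y n \<in> U" if "Hob X n \<in> U" "Hob Z n \<in> U" for n
    using serre_exact[OF s t(1)[of n]] t(4,5) tg serre_iso[OF s isomorphic_sym[OF t(7)[of n]] that(1)]
      serre_iso[OF s isomorphic_sym[OF t(9)[of n]] that(2)] serre_iso[OF s t(8)[of n]] by simp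
  ultimately show ?thesis using assms(3,4) t(11) unfolding ext_cond_def by blast
qed

lemma stalk_zob_zero: "zero_object (Db A) (stalk zob)"
  by (rule zero_object_Db) (simp_all add: stalk_deg)

lemma ext_cond_zero:
  assumes "serre_subcategory A U" "zero_object (Db A) Z" shows "ext_cond U Z"
proof -
  have "zero_object A (Hob (stalk zob) n)" for n by (rule hob_deg_zero) (simp_all add: stalk_deg)
  then have "ext_cond U (stalk zob)" using serre_zero[OF assms(1)] by (simp add: ext_cond_def)
  then show ?thesis
    using ext_cond_iso[OF assms(1)] category.zero_objects_isomorphic[OF category_Db stalk_zob_zero assms(2)] by blast
qed

text \<open>The factorization through \<open>stalk zob\<close> exists already on complexes and is
  carried over to the localization.\<close>

lemma Cb_zero_arrow:
  assumes "bounded_complex A X" "bounded_complex A Y" "f \<in> mor (Cb A) X Y" "\<And>n. f n = mzero A (deg X n) (deg Y n)"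
  shows "zero_arrow (Db A) X Y (Db_arrow A X Y f)"
proof -
  let ?p = "\<lambda>n. mzero A (deg X n) zob" and ?i = "\<lambda>n. mzero A zob (deg Y n)"
  have bz: "bounded_complex A (stalk zob)" by simp
  have e: "?p = (\<lambda>n. und (zarr (deg X n) zob))" "?i = (\<lambda>n. und (zarr zob (deg Y n)))" by (simp_all add: zarr_def)
  have m: "?p \<in> mor (Cb A) X (stalk zob)" "?i \<in> mor (Cb A) (stalk zob) Y"
    unfolding e by (rule Cb_morI; use assms in \<open>simp add: chmap_def stalk_deg\<close>)+
  have "cmp (Cb A) ?i ?p = f"
    using assms cmp_mzero[OF mzero_mor] by (simp add: fun_eq_iff)
  then have "Db_arrow A X Y f = cmp (Db A) (Db_arrow A (stalk zob) Y ?i) (Db_arrow A X (stalk zob) ?p)"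
    using Db_arrow_cmp[OF m] by simp
  then show ?thesis unfolding zero_arrow_def using stalk_zob_zero Db_arrow_mor[OF m(1)] Db_arrow_mor[OF m(2)] by blast
qed

text \<open>\<open>P\<close> is known only by its universal properties in the derived category. The
  cone \<open>Z\<close> of the zero map X[-1] -> Y is the direct sum of complexes, and
  \<open>P\<close> is a retract of it by \<open>direct_sum_retract\<close>. The cohomology of
  \<open>Z\<close> is the middle term of an exact sequence with that of \<open>Y\<close> and that of
  \<open>X\<close>.\<close>

lemma ext_cond_sum:
  assumes s: "serre_subcategory A U" and d: "direct_sum (Db A) X Y P i j p q" and x: "ext_cond U X" and y: "ext_cond U Y"
  shows "ext_cond U P"
proof -
  have b: "bounded_complex A X" "bounded_complex A Y" using x y by (auto simp: ext_cond_def)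
  let ?X = "unshift X"
  note u = unshift[OF b(1)]
  let ?z = "\<lambda>n. zarr (deg ?X n) (deg Y n)"
  have cz: "chmap ?X Y ?z" unfolding chmap_def using u b by simp
  obtain Z g h where Z: "cone_triangle A ?X Y Z (\<lambda>n. und (?z n)) g h"
    using ex_cone_triangle[OF Cb_morI[OF u(1) b(2) cz]] by blast
  obtain I Q where "cone ?X Y Z (level ?X Y (\<lambda>n. und (?z n))) (level Y Z g) (level Z (shift A ?X) h) I Q"
    using cone_triangleD[OF Z] by blast
  then have c: "cone ?X Y Z ?z (level Y Z g) (level Z X h) I Q" unfolding level_und[OF cz] u(2) .
  note bZ = cone_bc(3)[OF c] and chmap = cone_chmap[OF c] and t = cone_ty[OF c] and r = biprod_rw[OF cone_biprod[OF c]]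
  have chI: "chmap X Z I" and chQ: "chmap Z Y Q" using cone_split[OF c] u(2) by simp_all
  have dX: "deg ?X (n + 1) = deg X n" for n by (simp add: unshift_def)
  have m: "(\<lambda>n. und (I n)) \<in> mor (Cb A) X Z" "g \<in> mor (Cb A) Y Z" "h \<in> mor (Cb A) Z X" "(\<lambda>n. und (Q n)) \<in> mor (Cb A) Z Y"
    using Cb_morI[OF b(1) bZ chI] Cb_morI[OF bZ b(2) chQ] b bZ chmap u(2) by (simp_all add: Cb_mor)
  have eI: "I n = Some (deg X n, deg Z n, und (I n))" and eQ: "Q n = Some (deg Z n, deg Y n, und (Q n))" for n
    using wt_eta[of "I n"] wt_eta[of "Q n"] chD[OF chI, of n] chD[OF chQ, of n] by simp_all
  have m': "und (I n) \<in> mor A (deg X n) (deg Z n)" "g n \<in> mor A (deg Y n) (deg Z n)" "h n \<in> mor A (deg Z n) (deg X n)"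
    "und (Q n) \<in> mor A (deg Z n) (deg Y n)" for n
    using Cb_mor_D[OF m(1), of n] Cb_mor_D[OF m(2), of n] Cb_mor_D[OF m(3), of n] Cb_mor_D[OF m(4), of n] by simp_all
  have rr: "level Z X h n \<cdot> I n = ident (deg X n)" "Q n \<cdot> level Y Z g n = ident (deg Y n)" "Q n \<cdot> I n = zarr (deg X n) (deg Y n)"
    "level Z X h n \<cdot> level Y Z g n = zarr (deg Y n) (deg X n)" for n
    using r(10-13)[of n] t[of n] dX[of n] by simp_all
  have e: "cmp A (h n) (und (I n)) = idt A (deg X n)" "cmp A (und (Q n)) (g n) = idt A (deg Y n)"
    "cmp A (und (Q n)) (und (I n)) = mzero A (deg X n) (deg Y n)" "cmp A (h n) (g n) = mzero A (deg Y n) (deg X n)" for n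
    using rr[of n] compose_Some[OF m'(1)[of n] m'(3)] compose_Some[OF m'(2)[of n] m'(4)] compose_Some[OF m'(1)[of n] m'(4)] compose_Some[OF m'(2)[of n] m'(3)]
    unfolding eI[of n, symmetric] eQ[of n, symmetric] by (simp_all add: level_def ident_def zarr_def)
  note a = Db_arrow_mor[OF m(1)] Db_arrow_mor[OF m(2)] Db_arrow_mor[OF m(3)] Db_arrow_mor[OF m(4)]
  have "cmp (Db A) (Db_arrow A Z X h) (Db_arrow A X Z (\<lambda>n. und (I n))) = idt (Db A) X"
    "cmp (Db A) (Db_arrow A Z Y (\<lambda>n. und (Q n))) (Db_arrow A Y Z g) = idt (Db A) Y"
    unfolding Db_arrow_cmp[OF m(1,3)] Db_arrow_cmp[OF m(2,4)] using Db_arrow_idt[of X] Db_arrow_idt[of Y] by (simp_all add: e)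
  moreover have "zero_arrow (Db A) X Y (cmp (Db A) (Db_arrow A Z Y (\<lambda>n. und (Q n))) (Db_arrow A X Z (\<lambda>n. und (I n))))"
    unfolding Db_arrow_cmp[OF m(1,4)]
    by (rule Cb_zero_arrow[OF b category.cmp_mor[OF category_Cb m(1,4)]]) (simp add: e)
  moreover have "zero_arrow (Db A) Y X (cmp (Db A) (Db_arrow A Z X h) (Db_arrow A Y Z g))"
    unfolding Db_arrow_cmp[OF m(2,3)]
    by (rule Cb_zero_arrow[OF b(2,1) category.cmp_mor[OF category_Cb m(2,3)]]) (simp add: e)
  ultimately obtain k l where kl: "k \<in> mor (Db A) P Z" "l \<in> mor (Db A) Z P" "cmp (Db A) l k = idt (Db A) P"
    using category.direct_sum_retract[OF category_Db d a] by blast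
  have ex: "exact (Hmap Y Z (level Y Z g) n) (Hmap Z X (level Z X h) n)" for n
    using cone_exact2[OF c] u(2) by simp
  have hb: "src (Hmap Y Z (level Y Z g) n) = Hob Y n" "src (Hmap Z X (level Z X h) n) = Hob Z n" "tgt (Hmap Z X (level Z X h) n) = Hob X n" for n
    using Hmap(2)[OF b(2) bZ chmap(2)] Hmap(2,3)[OF bZ b(1)] chmap(3) u(2) by simp_all
  have "ext_cond U Z"
    using x y bZ exact_zero[OF ex] serre_exact[OF s ex] unfolding ext_cond_def hb by blast
  then show ?thesis using ext_cond_retract[OF s _ kl] by blast
qed

lemma intermediate_shift_star:
  assumes s: "serre_subcategory A U"
  shows "intermediate_subcategory A (shift_star A U (obj A))"
proof -
  note i = shift_star_iff[OF s]
  have "subcategory (Db A) (shift_star A U (obj A))"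
    unfolding subcategory_def i
  proof (intro conjI allI impI)
    show "shift_star A U (obj A) \<subseteq> obj (Db A)" by (auto simp: shift_star_def)
  qed (use ext_cond_iso[OF s] ext_cond_zero[OF s] ext_cond_sum[OF s] in blast)+
  moreover have "in_degree_0 A (obj A) \<subseteq> shift_star A U (obj A)"
  proof
    fix X assume "X \<in> in_degree_0 A (obj A)"
    then show "X \<in> shift_star A U (obj A)"
      unfolding i in_degree_0_iff[OF serre_UNIV] ext_cond_def using serre_zero[OF s] by simp
  qed
  moreover have "shift_star A U (obj A) \<subseteq> shift_star A (obj A) (obj A)"
  proof
    fix X assume "X \<in> shift_star A U (obj A)"
    then show "X \<in> shift_star A (obj A) (obj A)"
      unfolding i shift_star_iff[OF serre_UNIV] ext_cond_def using serre_obj[OF s] by simp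
  qed
  moreover have "X \<in> shift_star A U (obj A) \<and> Y \<in> shift_star A U (obj A)"
    if d: "direct_sum (Db A) X Y P i' j p q" and P: "P \<in> shift_star A U (obj A)" for X Y P i' j p q
  proof -
    have "p \<in> mor (Db A) P X" "q \<in> mor (Db A) P Y" "i' \<in> mor (Db A) X P" "j \<in> mor (Db A) Y P"
      "cmp (Db A) p i' = idt (Db A) X" "cmp (Db A) q j = idt (Db A) Y"
      using d by (auto simp: direct_sum_def is_product_def is_coproduct_def)
    then show ?thesis using ext_cond_retract[OF s P[unfolded i]] i by blast
  qed
  ultimately show ?thesis
    unfolding intermediate_subcategory_def using ext_cond_triangle[OF s] i by blast
qed

end


section \<open>Grothendieck monoids\<close>

lemma groth_class_carrier: "X \<in> U \<Longrightarrow> groth_class C U E X \<in> carrier (groth_monoid C U E)"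
  by (auto simp: groth_class_def groth_monoid_def)

lemma groth_class_iso: "X \<in> U \<Longrightarrow> Y \<in> U \<Longrightarrow> isomorphic C X Y \<Longrightarrow> groth_class C U E X = groth_class C U E Y"
  unfolding groth_class_def by (subst groth_eq_iff) (auto intro: groth_eq.iso)

lemma groth_class_zero: "Z \<in> U \<Longrightarrow> zero_object C Z \<Longrightarrow> groth_class C U E Z = \<one>\<^bsub>groth_monoid C U E\<^esub>"
  unfolding groth_class_def groth_monoid_def by (simp, subst groth_eq_iff) (auto intro: groth_eq.zero)

lemma groth_class_conflation:
  assumes "X \<in> U" "Y \<in> U" "Z \<in> U" "E X Y Z"
  shows "groth_class C U E Y = groth_class C U E X \<otimes>\<^bsub>groth_monoid C U E\<^esub> groth_class C U E Z"
proof -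
  have "groth_class C U E Y = Collect (groth_eq C U E {#X, Z#})"
    unfolding groth_class_def using assms by (subst groth_eq_iff) (auto intro: groth_eq.conflation)
  then show ?thesis
    unfolding groth_class_def using assms mult_groth[of "{#X#}" U "{#Z#}" C E] by (simp add: add_mset_commute)
qed

lemma groth_induct [consumes 1, case_names one mult]:
  assumes "P \<in> carrier (groth_monoid C U E)" and one: "Q \<one>\<^bsub>groth_monoid C U E\<^esub>"
    and mult: "\<And>X P. X \<in> U \<Longrightarrow> P \<in> carrier (groth_monoid C U E) \<Longrightarrow> Q P \<Longrightarrow>
      Q (groth_class C U E X \<otimes>\<^bsub>groth_monoid C U E\<^esub> P)"
  shows "Q P"
proof -
  have "Q (Collect (groth_eq C U E m))" if "set_mset m \<subseteq> U" for m
    using that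
  proof (induction m)
    case empty
    then show ?case using one by (simp add: groth_monoid_def)
  next
    case (add X m)
    then have "Collect (groth_eq C U E m) \<in> carrier (groth_monoid C U E)" "X \<in> U" "set_mset m \<subseteq> U"
      by (auto simp: groth_monoid_def)
    then show ?case
      using mult[of X "Collect (groth_eq C U E m)"] add mult_groth[of "{#X#}" U m C E]
      by (simp add: groth_class_def)
  qed
  then show ?thesis using assms(1) by (auto simp: groth_monoid_def)
qed

section \<open>Units and faces of commutative monoids\<close>

context comm_monoid
begin

text \<open>An inverse of the product, multiplied by one factor, inverts the other. So units form a
  face, which is why localizing at \<open>S\<close> inverts the whole face generated by
  \<open>S\<close>.\<close>

lemma Units_factor: "a \<in> carrier G \<Longrightarrow> b \<in> carrier G \<Longrightarrow> a \<otimes> b \<in> Units G \<longleftrightarrow> a \<in> Units G \<and> b \<in> Units G"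
proof
  assume ab: "a \<in> carrier G" "b \<in> carrier G" "a \<otimes> b \<in> Units G"
  then obtain c where c: "c \<in> carrier G" "c \<otimes> (a \<otimes> b) = \<one>" by (auto simp: Units_def)
  then have "(c \<otimes> b) \<otimes> a = \<one>" "(c \<otimes> a) \<otimes> b = \<one>" using ab by (simp_all add: m_ac)
  moreover have "a \<otimes> (c \<otimes> b) = \<one>" "b \<otimes> (c \<otimes> a) = \<one>" using ab c by (simp_all add: m_ac)
  ultimately show "a \<in> Units G \<and> b \<in> Units G" using ab c unfolding Units_def by blast
qed simp

lemma inv_mult_Units:
  assumes ab: "a \<in> Units G" "b \<in> Units G"
  shows "inv (a \<otimes> b) = inv a \<otimes> inv b"
proof (rule inv_unique'[symmetric])
  have "(a \<otimes> b) \<otimes> (inv a \<otimes> inv b) = (a \<otimes> inv a) \<otimes> (b \<otimes> inv b)"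
    using ab by (simp add: m_ac Units_closed del: Units_r_inv Units_l_inv)
  then show *: "(a \<otimes> b) \<otimes> (inv a \<otimes> inv b) = \<one>" using ab by simp
  show "a \<otimes> b \<in> carrier G" "inv a \<otimes> inv b \<in> carrier G" using ab by (simp_all add: Units_closed)
  then show "(inv a \<otimes> inv b) \<otimes> (a \<otimes> b) = \<one>" using * by (simp add: m_comm)
qed

text \<open>Additively, (p + q) - (a + b) = (c + p - a) + (q - (b + c)). In
  \<open>euler_triangle\<close> the letters are classes of images in the long exact sequence, and
  \<open>c\<close> belongs to the connecting map.\<close>

lemma euler_Units:
  assumes u: "a \<in> Units G" "b \<in> Units G" "c \<in> Units G" and "p \<in> carrier G" "q \<in> carrier G"
  shows "(p \<otimes> q) \<otimes> inv (a \<otimes> b) = ((c \<otimes> p) \<otimes> inv a) \<otimes> (q \<otimes> inv (b \<otimes> c))"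
proof -
  have "((c \<otimes> p) \<otimes> inv a) \<otimes> (q \<otimes> inv (b \<otimes> c)) = (c \<otimes> inv c) \<otimes> ((p \<otimes> q) \<otimes> (inv a \<otimes> inv b))"
    unfolding inv_mult_Units[OF u(2,3)] using assms
    by (simp add: m_ac Units_closed del: Units_r_inv Units_l_inv)
  then show ?thesis using assms by (simp add: inv_mult_Units Units_closed)
qed

end

text \<open>The elements that become invertible are the preimage of the units; they form a face, and
  it contains \<open>S\<close>.\<close>

lemma mon_loc_face_unit:
  assumes M: "comm_monoid M" and S: "S \<subseteq> carrier M" and s: "s \<in> face_hull M S"
  shows "mon_loc_map M S s \<in> Units (mon_loc M S)"
proof -
  interpret M: comm_monoid M by fact
  interpret L: comm_monoid "mon_loc M S" by (rule comm_monoid_mon_loc[OF M S])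
  note h = mon_loc_map_hom[OF M S]
  let ?F = "{a \<in> carrier M. mon_loc_map M S a \<in> Units (mon_loc M S)}"
  have m: "mon_loc_map M S (a \<otimes>\<^bsub>M\<^esub> b) = mon_loc_map M S a \<otimes>\<^bsub>mon_loc M S\<^esub> mon_loc_map M S b"
    "mon_loc_map M S a \<in> carrier (mon_loc M S)" if "a \<in> carrier M" "b \<in> carrier M" for a b
    using h(1) that by (auto simp: hom_def)
  have "face ?F M"
    unfolding face_def
  proof
    show "submonoid ?F M" using m h(2) by unfold_locales auto
    show "\<forall>a \<in> carrier M. \<forall>b \<in> carrier M. a \<otimes>\<^bsub>M\<^esub> b \<in> ?F \<longleftrightarrow> a \<in> ?F \<and> b \<in> ?F"
      using m L.Units_factor by auto
  qed
  moreover have "S \<subseteq> ?F" using S mon_loc_map_unit[OF M S] by auto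
  ultimately show ?thesis using face_face_hull(3)[OF M S] s by blast
qed

context abelian_category
begin

lemma ker_exact:
  assumes "ker g k" shows "exact k g"
  unfolding exact_def
proof (intro conjI allI impI)
  fix y assume y: "wt y" "tgt y = src g" "g \<cdot> y = zarr (src y) (tgt g)"
  then obtain u where "wt u" "src u = src y" "tgt u = src k" "k \<cdot> u = y" using ker_lift[OF assms] by blast
  then show "\<exists>e x. epi e \<and> tgt e = src y \<and> wt x \<and> src x = src e \<and> tgt x = src k \<and> k \<cdot> x = y \<cdot> e"
    using y by (intro exI[of _ "ident (src y)"] exI[of _ u]) simp
qed (use krD[OF assms] in simp_all)

lemma biprod_short_exact:
  assumes "biprod i j p q" shows "short_exact A (src i) (tgt i) (src j)"
proof (rule short_exactI)
  note r = biprod_rw[OF assms]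
  show "mon i"
    unfolding mon_def
  proof (intro conjI allI impI r(1))
    fix s assume s: "wt s" "tgt s = src i" "i \<cdot> s = zarr (src s) (tgt i)"
    have "s = p \<cdot> (i \<cdot> s)" using r s(1,2) by simp
    also have "\<dots> = zarr (src s) (src i)" unfolding s(3) using r s(1) by simp
    finally show "s = zarr (src s) (src i)" .
  qed
  show "epi q"
    unfolding epi_def
  proof (intro conjI allI impI r(4))
    fix s assume s: "wt s" "src s = tgt q" "s \<cdot> q = zarr (src q) (tgt s)"
    have "s = (s \<cdot> q) \<cdot> j" using r s(1,2) by simp
    also have "\<dots> = zarr (tgt q) (tgt s)" unfolding s(3) using r(1-9) s(1) by simp
    finally show "s = zarr (tgt q) (tgt s)" .
  qed
  show "exact i q"
    unfolding exact_def
  proof (intro conjI allI impI r(1,4))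
    show "tgt i = src q" "q \<cdot> i = zarr (src i) (tgt q)" using r by simp_all
    fix y assume y: "wt y" "tgt y = src q" "q \<cdot> y = zarr (src y) (tgt q)"
    have "j \<cdot> q \<cdot> y = zarr (src y) (tgt i)" unfolding y(3) using r(1-9) y(1) by simp
    then have "i \<cdot> (p \<cdot> y) = y" using biprod_decomp[OF assms y(1)] y(1,2) r(1-9) by simp
    then show "\<exists>e x. epi e \<and> tgt e = src y \<and> wt x \<and> src x = src e \<and> tgt x = src i \<and> i \<cdot> x = y \<cdot> e"
      using y(1,2) r(1-9) by (intro exI[of _ "ident (src y)"] exI[of _ "p \<cdot> y"]) simp
  qed
  show "src i = src i" "tgt i = tgt i" "tgt q = src j" using r by simp_all
qed

section \<open>The Grothendieck monoid of the abelian category and its faces\<close>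

lemma comm_monoid_M_ab: "comm_monoid (M_ab A)"
  unfolding M_ab_def by (rule comm_monoid_groth)

lemma short_exact_obj: "short_exact A X Y Z \<Longrightarrow> X \<in> obj A \<and> Y \<in> obj A \<and> Z \<in> obj A"
  using mor_obj unfolding short_exact_def is_kernel_def by blast

lemma isomorphic_obj: "isomorphic A X Y \<Longrightarrow> X \<in> obj A \<and> Y \<in> obj A"
  using mor_obj unfolding isomorphic_def iso_arrow_def by blast

lemma M_ab_class_carrier: "X \<in> obj A \<Longrightarrow> M_ab_class A X \<in> carrier (M_ab A)"
  unfolding M_ab_class_def M_ab_def by (rule groth_class_carrier)

lemma M_ab_class_iso: "isomorphic A X Y \<Longrightarrow> M_ab_class A X = M_ab_class A Y"
  using isomorphic_obj[of X Y] groth_class_iso[of X "obj A" Y A "short_exact A"] by (simp add: M_ab_class_def)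

lemma M_ab_class_zero: "zero_object A Z \<Longrightarrow> M_ab_class A Z = \<one>\<^bsub>M_ab A\<^esub>"
  using zero_obj[of Z] groth_class_zero[of Z "obj A" A "short_exact A"] by (simp add: M_ab_class_def M_ab_def)

lemma M_ab_class_short_exact:
  "short_exact A X Y Z \<Longrightarrow> M_ab_class A Y = M_ab_class A X \<otimes>\<^bsub>M_ab A\<^esub> M_ab_class A Z"
  using short_exact_obj[of X Y Z] groth_class_conflation[of X "obj A" Y Z "short_exact A" A]
  by (simp add: M_ab_class_def M_ab_def)

text \<open>Direct sums realize sums of classes. Without this, a face, whose elements are classes of
  formal sums, could not be recovered from the objects whose classes it contains.\<close>

lemma M_ab_class_surj:
  assumes "P \<in> carrier (M_ab A)" obtains X where "X \<in> obj A" "P = M_ab_class A X"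
proof -
  have "\<exists>X \<in> obj A. P = M_ab_class A X"
    using assms unfolding M_ab_def
  proof (induction rule: groth_induct)
    case one
    then show ?case using M_ab_class_zero[OF zob(1)] zob(2) unfolding M_ab_def by metis
  next
    case (mult X P)
    then obtain Y where Y: "Y \<in> obj A" "P = M_ab_class A Y" by blast
    obtain i j p q where d: "biprod i j p q" "src i = X" "src j = Y" using ex_biprod mult Y by blast
    have "short_exact A X (tgt i) Y" using biprod_short_exact[OF d(1)] d by simp
    from M_ab_class_short_exact[OF this] show ?case
      unfolding Y(2) M_ab_def M_ab_class_def[of A X] using biprod_rw(1)[OF d(1)] by (intro bexI[of _ "tgt i"]) simp_all
  qed
  then show ?thesis using that by blast
qed

text \<open>The two-way condition in \<open>face\<close> says that the middle term of a short exact
  sequence belongs to the set iff both ends do. Closure under subobjects, quotients, direct sums and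
  extensions are instances of this.\<close>

lemma serre_face:
  assumes "face T (M_ab A)" shows "serre_subcategory A {X \<in> obj A. M_ab_class A X \<in> T}" (is "serre_subcategory A ?F")
proof -
  have one: "\<one>\<^bsub>M_ab A\<^esub> \<in> T" using assms by (auto simp: face_def submonoid.one_closed)
  have se: "Y \<in> ?F \<longleftrightarrow> X \<in> ?F \<and> Z \<in> ?F" if "short_exact A X Y Z" for X Y Z
    using short_exact_obj[OF that] M_ab_class_short_exact[OF that] assms M_ab_class_carrier unfolding face_def by simp
  have "X \<in> ?F" if "monic A X Y f" "Y \<in> ?F" for X Y f
  proof -
    have m: "mon (Some (X, Y, f))" using that monic_iff by simp
    obtain c where c: "coker (Some (X, Y, f)) c" using ex_coker[OF mon_wt[OF m]] by blast
    have "short_exact A X Y (tgt c)" by (rule short_exactI[OF m ckD(2)[OF c] coker_exact[OF c]]) simp_all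
    then show ?thesis using se that(2) by blast
  qed
  moreover have "Y \<in> ?F" if "epic A X Y f" "X \<in> ?F" for X Y f
  proof -
    have m: "epi (Some (X, Y, f))" using that epic_iff by simp
    obtain k where k: "ker (Some (X, Y, f)) k" using ex_ker[OF epi_wt[OF m]] by blast
    have "short_exact A (src k) X Y"
      by (rule short_exactI[OF krD(2)[OF k] m ker_exact[OF k]]) (use krD(4)[OF k] in simp_all)
    then show ?thesis using se that(2) by blast
  qed
  moreover have "P \<in> ?F" if "X \<in> ?F" "Y \<in> ?F" "direct_sum A X Y P i j p q" for X Y P i j p q
    using biprod_short_exact[OF that(3)[unfolded direct_sum_iff]] se that(1,2) by simp
  moreover have "Y \<in> ?F" if "X \<in> ?F" "isomorphic A X Y" for X Y
    using that isomorphic_obj M_ab_class_iso[OF that(2)] by simp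
  moreover have "Z \<in> ?F" if "zero_object A Z" for Z
    using that zero_obj M_ab_class_zero[OF that] one by simp
  ultimately show ?thesis
    using se unfolding serre_subcategory_def subcategory_def closed_under_subobjects_def
      closed_under_quotients_def closed_under_extensions_def by blast
qed

section \<open>Comparison of the localization with the Grothendieck monoid of F[1] * A\<close>

context
  fixes S F
  assumes S: "S \<subseteq> carrier (M_ab A)" and F: "F = {X \<in> obj A. M_ab_class A X \<in> face_hull (M_ab A) S}"
begin

interpretation M: comm_monoid "M_ab A" by (rule comm_monoid_M_ab)
interpretation L: comm_monoid "mon_loc (M_ab A) S" by (rule comm_monoid_mon_loc[OF comm_monoid_M_ab S])

abbreviation U where "U \<equiv> shift_star A F (obj A)"
abbreviation N where "N \<equiv> M_Db A U"
abbreviation dcl where "dcl \<equiv> groth_class (Db A) U (\<lambda>X Y Z. \<exists>u v w. triangle A X Y Z u v w)"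
abbreviation lcl where "lcl X \<equiv> mon_loc_map (M_ab A) S (M_ab_class A X)"

lemma comm_monoid_N: "comm_monoid N"
  unfolding M_Db_def by (rule comm_monoid_groth)

interpretation N: comm_monoid N by (rule comm_monoid_N)

lemma face_S: "face (face_hull (M_ab A) S) (M_ab A)"
  using face_face_hull(1)[OF comm_monoid_M_ab S] .

lemma serre_F: "serre_subcategory A F"
  unfolding F using serre_face[OF face_S] .

lemma image_F: "M_ab_class A ` F = face_hull (M_ab A) S"
proof
  show "M_ab_class A ` F \<subseteq> face_hull (M_ab A) S" by (auto simp: F)
  show "face_hull (M_ab A) S \<subseteq> M_ab_class A ` F"
  proof
    fix P assume P: "P \<in> face_hull (M_ab A) S"
    then have "P \<in> carrier (M_ab A)" using face_S by (auto simp: face_def dest: submonoid.subset)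
    then obtain X where "X \<in> obj A" "P = M_ab_class A X" by (rule M_ab_class_surj)
    then show "P \<in> M_ab_class A ` F" using P by (simp add: F)
  qed
qed

lemma lcl_carrier [simp]: "X \<in> obj A \<Longrightarrow> lcl X \<in> carrier (mon_loc (M_ab A) S)"
  using mon_loc_map_hom(1)[OF comm_monoid_M_ab S] M_ab_class_carrier by (auto simp: hom_def)

lemma lcl_iso: "isomorphic A X Y \<Longrightarrow> lcl X = lcl Y"
  using M_ab_class_iso by simp

lemma lcl_zero: "zero_object A Z \<Longrightarrow> lcl Z = \<one>\<^bsub>mon_loc (M_ab A) S\<^esub>"
  using M_ab_class_zero mon_loc_map_hom(2)[OF comm_monoid_M_ab S] by simp

lemma lcl_short_exact: "short_exact A X Y Z \<Longrightarrow> lcl Y = lcl X \<otimes>\<^bsub>mon_loc (M_ab A) S\<^esub> lcl Z"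
  using M_ab_class_short_exact mon_loc_map_hom(1)[OF comm_monoid_M_ab S] M_ab_class_carrier short_exact_obj
  by (simp add: hom_def)

lemma lcl_unit: "X \<in> F \<Longrightarrow> lcl X \<in> Units (mon_loc (M_ab A) S)"
  using mon_loc_face_unit[OF comm_monoid_M_ab S] by (simp add: F)

lemma dcl_carrier: "X \<in> U \<Longrightarrow> dcl X \<in> carrier N"
  unfolding M_Db_def by (rule groth_class_carrier)

lemma dcl_iso: "X \<in> U \<Longrightarrow> Y \<in> U \<Longrightarrow> isomorphic (Db A) X Y \<Longrightarrow> dcl X = dcl Y"
  by (rule groth_class_iso)

lemma dcl_zero: "Z \<in> U \<Longrightarrow> zero_object (Db A) Z \<Longrightarrow> dcl Z = \<one>\<^bsub>N\<^esub>"
  unfolding M_Db_def by (rule groth_class_zero)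

lemma dcl_triangle: "X \<in> U \<Longrightarrow> Y \<in> U \<Longrightarrow> Z \<in> U \<Longrightarrow> \<exists>u v w. triangle A X Y Z u v w \<Longrightarrow> dcl Y = dcl X \<otimes>\<^bsub>N\<^esub> dcl Z"
  unfolding M_Db_def by (rule groth_class_conflation)

lemma U_iff: "X \<in> U \<longleftrightarrow> ext_cond F X"
  by (rule shift_star_iff[OF serre_F])

lemma stalk_U: "X \<in> obj A \<Longrightarrow> stalk X \<in> U"
  unfolding U_iff ext_cond_def using Hob_stalk_zero serre_zero[OF serre_F] by simp

lemma in_degree_0_U: "X \<in> in_degree_0 A (obj A) \<Longrightarrow> X \<in> U"
  unfolding U_iff ext_cond_def in_degree_0_iff[OF serre_UNIV] using serre_zero[OF serre_F] by simp

lemma shift_U: "B \<in> in_degree_0 A F \<Longrightarrow> shift A B \<in> U"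
  unfolding U_iff ext_cond_def in_degree_0_iff[OF serre_F] by simp

lemma in_degree_0_mono: "B \<in> in_degree_0 A F \<Longrightarrow> B \<in> in_degree_0 A (obj A)"
  unfolding in_degree_0_iff[OF serre_F] in_degree_0_iff[OF serre_UNIV] using serre_obj[OF serre_F] by blast

lemma dcl_shift:
  assumes "B \<in> in_degree_0 A F" shows "dcl B \<otimes>\<^bsub>N\<^esub> dcl (shift A B) = \<one>\<^bsub>N\<^esub>"
proof -
  have b: "bounded_complex A B" using assms by (simp add: in_degree_0_def)
  have "dcl (stalk zob) = dcl B \<otimes>\<^bsub>N\<^esub> dcl (shift A B)"
    using dcl_triangle[OF in_degree_0_U[OF in_degree_0_mono[OF assms]] stalk_U[OF zob(2)] shift_U[OF assms] rotate_triangle[OF b]] .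
  then show ?thesis using dcl_zero[OF stalk_U[OF zob(2)] stalk_zob_zero] by simp
qed

lemma dcl_concentrated:
  assumes "B \<in> in_degree_0 A (obj A)" shows "dcl B = dcl (stalk (Hob B 0))"
proof -
  have "isomorphic (Db A) B (stalk (Hob B 0))" and b: "bounded_complex A B"
    using assms concentrated_isomorphic[of B] unfolding in_degree_0_iff[OF serre_UNIV] by auto
  then show ?thesis using dcl_iso in_degree_0_U[OF assms] stalk_U[OF Hob_obj[OF b]] by blast
qed

lemma stalk_in_degree_0: "X \<in> F \<Longrightarrow> stalk X \<in> in_degree_0 A F"
  unfolding in_degree_0_iff[OF serre_F]
  using Hob_stalk_zero serre_iso[OF serre_F Hob_stalk] serre_obj[OF serre_F] by simp

lemma ex_phi:
  obtains \<phi> where "\<phi> \<in> hom (mon_loc (M_ab A) S) N" "\<phi> \<one>\<^bsub>mon_loc (M_ab A) S\<^esub> = \<one>\<^bsub>N\<^esub>"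
    "\<And>X. X \<in> obj A \<Longrightarrow> \<phi> (lcl X) = dcl (stalk X)"
proof -
  have "\<exists>!g. g \<in> extensional (carrier (M_ab A)) \<and> g \<in> hom (M_ab A) N \<and> g \<one>\<^bsub>M_ab A\<^esub> = \<one>\<^bsub>N\<^esub> \<and>
      (\<forall>X \<in> obj A. g (M_ab_class A X) = dcl (stalk X))"
    unfolding M_ab_def M_ab_class_def
  proof (rule groth_universal[OF comm_monoid_N])
    show "dcl (stalk X) \<in> carrier N" if "X \<in> obj A" for X
      using dcl_carrier[OF stalk_U[OF that]] .
    show "dcl (stalk X) = dcl (stalk Y)" if "X \<in> obj A" "Y \<in> obj A" "isomorphic A X Y" for X Y
      using dcl_iso[OF stalk_U[OF that(1)] stalk_U[OF that(2)] stalk_isomorphic[OF that(3)]] .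
    show "dcl (stalk Z) = \<one>\<^bsub>N\<^esub>" if Z: "Z \<in> obj A" "zero_object A Z" for Z
    proof -
      have "zero_object (Db A) (stalk Z)" by (rule zero_object_Db) (use Z in \<open>simp_all add: stalk_deg\<close>)
      then show ?thesis using dcl_zero[OF stalk_U[OF Z(1)]] by simp
    qed
    show "dcl (stalk Y) = dcl (stalk X) \<otimes>\<^bsub>N\<^esub> dcl (stalk Z)"
      if "X \<in> obj A" "Y \<in> obj A" "Z \<in> obj A" "short_exact A X Y Z" for X Y Z
      using dcl_triangle[OF stalk_U[OF that(1)] stalk_U[OF that(2)] stalk_U[OF that(3)] short_exact_triangle[OF that(4)]] .
  qed
  then obtain g where g: "g \<in> hom (M_ab A) N" "g \<one>\<^bsub>M_ab A\<^esub> = \<one>\<^bsub>N\<^esub>" "\<And>X. X \<in> obj A \<Longrightarrow> g (M_ab_class A X) = dcl (stalk X)"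
    by blast
  have "g ` S \<subseteq> Units N"
  proof
    fix y assume "y \<in> g ` S"
    then obtain s where s: "s \<in> S" "y = g s" by blast
    \<comment> \<open>\<open>s\<close> is given as a class of formal sums; \<open>image_F\<close>
      replaces it by the class of one object of \<open>F\<close>, to which the triangle with its
      shift applies.\<close>
    then have "s \<in> M_ab_class A ` F" using image_F face_face_hull(2)[OF comm_monoid_M_ab S] by blast
    then obtain X where X: "X \<in> F" "s = M_ab_class A X" by blast
    have o: "X \<in> obj A" using serre_obj[OF serre_F X(1)] .
    have y: "y = dcl (stalk X)" using g(3)[OF o] s X by simp
    have "dcl (stalk X) \<otimes>\<^bsub>N\<^esub> dcl (shift A (stalk X)) \<in> Units N"
      using dcl_shift[OF stalk_in_degree_0[OF X(1)]] by simp
    then show "y \<in> Units N"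
      using N.Units_factor dcl_carrier[OF stalk_U[OF o]] dcl_carrier[OF shift_U[OF stalk_in_degree_0[OF X(1)]]] y by blast
  qed
  then obtain \<phi> where "\<phi> \<in> hom (mon_loc (M_ab A) S) N" "\<phi> \<one>\<^bsub>mon_loc (M_ab A) S\<^esub> = \<one>\<^bsub>N\<^esub>"
    "\<And>a. a \<in> carrier (M_ab A) \<Longrightarrow> \<phi> (mon_loc_map (M_ab A) S a) = g a"
    using mon_loc_universal[OF comm_monoid_M_ab S comm_monoid_N g(1,2)] by blast
  then show ?thesis using that[of \<phi>] g(3) M_ab_class_carrier by simp
qed

text \<open>\<open>[H\<^sup>0 X] - [H\<^sup>-\<^sup>1 X]\<close>, meaningful for \<open>X \<in> U\<close> only, as \<open>inv\<close> is junk off the units.\<close>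

definition euler where
  "euler X = lcl (Hob X 0) \<otimes>\<^bsub>mon_loc (M_ab A) S\<^esub> inv\<^bsub>mon_loc (M_ab A) S\<^esub> lcl (Hob X (-1))"

text \<open>The classes in degrees -1 and 0 are written through images of the maps in the long exact
  sequence. The images at both ends vanish because H^-2 of \<open>Z\<close> and H^1 of
  \<open>X\<close> are zero, and \<open>euler_Units\<close> gives the rest.\<close>

lemma euler_triangle:
  assumes "X \<in> U" "Y \<in> U" "Z \<in> U" "triangle A X Y Z u v w"
  shows "euler Y = euler X \<otimes>\<^bsub>mon_loc (M_ab A) S\<^esub> euler Z"
proof -
  obtain a b c hx hy hz where t: "\<And>n. exact (a n) (b n)" "\<And>n. exact (b n) (c n)" "\<And>n. exact (c n) (a (n + 1))"
    "\<And>n. src (a n) = hx n" "\<And>n. src (b n) = hy n" "\<And>n. src (c n) = hz n"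
    "\<And>n. isomorphic A (hx n) (Hob X n)" "\<And>n. isomorphic A (hy n) (Hob Y n)" "\<And>n. isomorphic A (hz n) (Hob Z n)"
    "bounded_complex A X" "bounded_complex A Y" "bounded_complex A Z" by (rule triangle_les[OF assms(4)]) (rule that)
  note uX = assms(1)[unfolded U_iff ext_cond_def] and uY = assms(2)[unfolded U_iff ext_cond_def]
    and uZ = assms(3)[unfolded U_iff ext_cond_def]
  let ?L = "mon_loc (M_ab A) S"
  have w: "wt (a n)" "wt (b n)" "wt (c n)" for n using exactD[OF t(1)[of n]] exactD[OF t(2)[of n]] by simp_all
  have o: "img (a n) \<in> obj A" "img (b n) \<in> obj A" "img (c n) \<in> obj A" for n
    using short_exact_obj[OF exact_img[OF t(1)]] short_exact_obj[OF exact_img[OF t(2)]] by blast+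
  have hx: "lcl (Hob X (n + 1)) = lcl (img (c n)) \<otimes>\<^bsub>?L\<^esub> lcl (img (a (n + 1)))" for n
    using lcl_short_exact[OF exact_img[OF t(3)[of n]]] lcl_iso[OF t(7)] t(4) by simp
  have hy: "lcl (Hob Y n) = lcl (img (a n)) \<otimes>\<^bsub>?L\<^esub> lcl (img (b n))" for n
    using lcl_short_exact[OF exact_img[OF t(1)[of n]]] lcl_iso[OF t(8)] t(5) by simp
  have hz: "lcl (Hob Z n) = lcl (img (b n)) \<otimes>\<^bsub>?L\<^esub> lcl (img (c n))" for n
    using lcl_short_exact[OF exact_img[OF t(2)[of n]]] lcl_iso[OF t(9)] t(6) by simp
  have "zero_object A (hz (-2))" using zero_isomorphic[OF isomorphic_sym[OF t(9)]] uZ by simp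
  then have c2: "lcl (img (c (-2))) = \<one>\<^bsub>?L\<^esub>" using lcl_zero img_src_zero[OF w(3)] t(6) by simp
  have "zero_object A (hx 1)" using zero_isomorphic[OF isomorphic_sym[OF t(7)]] uX by simp
  moreover have "tgt (c 0) = hx 1" using exactD(3)[OF t(3)[of 0]] t(4) by simp
  ultimately have c0: "lcl (img (c 0)) = \<one>\<^bsub>?L\<^esub>" using lcl_zero img_tgt_zero[OF w(3), of 0] by simp
  have x1: "lcl (Hob X (-1)) = lcl (img (a (-1)))" using hx[of "-2"] c2 o by simp
  have x0: "lcl (Hob X 0) = lcl (img (c (-1))) \<otimes>\<^bsub>?L\<^esub> lcl (img (a 0))" using hx[of "-1"] by simp
  have z0: "lcl (Hob Z 0) = lcl (img (b 0))" using hz[of 0] c0 o by simp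
  \<comment> \<open>Each of these is a factor of the class of H^-1 of \<open>X\<close> or of
    \<open>Z\<close>, both objects of \<open>F\<close>. In particular the image of the connecting
    map \<open>c (-1)\<close> is invertible as a factor of H^-1 of \<open>Z\<close>.\<close>
  have u: "lcl (img (a (-1))) \<in> Units ?L" "lcl (img (b (-1))) \<in> Units ?L" "lcl (img (c (-1))) \<in> Units ?L"
    using lcl_unit[of "Hob X (-1)"] lcl_unit[of "Hob Z (-1)"] uX uZ L.Units_factor o
    unfolding x1 hz[of "-1"] by auto
  show ?thesis
    unfolding euler_def x1 x0 z0 hy hz[of "-1"] using L.euler_Units[OF u] o by simp
qed

lemma euler_concentrated:
  assumes "B \<in> in_degree_0 A (obj A)" shows "euler B = lcl (Hob B 0)"
proof -
  have "lcl (Hob B (-1)) = \<one>\<^bsub>mon_loc (M_ab A) S\<^esub>" "Hob B 0 \<in> obj A"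
    using assms lcl_zero unfolding in_degree_0_iff[OF serre_UNIV] by auto
  then show ?thesis by (simp add: euler_def)
qed

lemma ex_psi:
  obtains \<psi> where "\<psi> \<in> hom N (mon_loc (M_ab A) S)" "\<psi> \<one>\<^bsub>N\<^esub> = \<one>\<^bsub>mon_loc (M_ab A) S\<^esub>"
    "\<And>X. X \<in> U \<Longrightarrow> \<psi> (dcl X) = euler X"
proof -
  have "\<exists>!g. g \<in> extensional (carrier N) \<and> g \<in> hom N (mon_loc (M_ab A) S) \<and> g \<one>\<^bsub>N\<^esub> = \<one>\<^bsub>mon_loc (M_ab A) S\<^esub> \<and>
      (\<forall>X \<in> U. g (dcl X) = euler X)"
    unfolding M_Db_def
  proof (rule groth_universal[OF L.comm_monoid_axioms])
    fix X assume "X \<in> U"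
    then have "bounded_complex A X" "Hob X (-1) \<in> F" by (auto simp: U_iff ext_cond_def)
    then show "euler X \<in> carrier (mon_loc (M_ab A) S)"
      unfolding euler_def using lcl_unit by (intro L.m_closed L.Units_inv_closed) simp_all
  next
    fix X Y assume "X \<in> U" "Y \<in> U" and i: "isomorphic (Db A) X Y"
    then show "euler X = euler Y" unfolding euler_def using lcl_iso[OF Hob_isomorphic[OF i]] by simp
  next
    fix Z assume Z: "Z \<in> U" "zero_object (Db A) Z"
    have "zero_object A (Hob Z n)" for n
    proof -
      have "zero_object A (Hob (stalk zob) n)" by (rule hob_deg_zero) (simp_all add: stalk_deg)
      then show ?thesis
        using zero_isomorphic Hob_isomorphic category.zero_objects_isomorphic[OF category_Db stalk_zob_zero Z(2)] by blast
    qed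
    then show "euler Z = \<one>\<^bsub>mon_loc (M_ab A) S\<^esub>" by (simp add: euler_def lcl_zero)
  next
    fix X Y Z assume "X \<in> U" "Y \<in> U" "Z \<in> U" "\<exists>u v w. triangle A X Y Z u v w"
    then show "euler Y = euler X \<otimes>\<^bsub>mon_loc (M_ab A) S\<^esub> euler Z" using euler_triangle by blast
  qed
  then show ?thesis using that by blast
qed

text \<open>Both composites are checked on generators. A fraction is tested after multiplication by
  its denominator; an object of \<open>U\<close> is split by its defining triangle into a shift and
  an object in degree 0.\<close>

lemma localization_iso: "mon_loc (M_ab A) S \<cong> N"
proof -
  let ?L = "mon_loc (M_ab A) S"
  obtain \<phi> where p: "\<phi> \<in> hom ?L N" "\<phi> \<one>\<^bsub>?L\<^esub> = \<one>\<^bsub>N\<^esub>" "\<And>X. X \<in> obj A \<Longrightarrow> \<phi> (lcl X) = dcl (stalk X)"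
    using ex_phi by blast
  obtain \<psi> where q: "\<psi> \<in> hom N ?L" "\<psi> \<one>\<^bsub>N\<^esub> = \<one>\<^bsub>?L\<^esub>" "\<And>X. X \<in> U \<Longrightarrow> \<psi> (dcl X) = euler X"
    using ex_psi by blast
  have pc: "\<phi> P \<in> carrier N" and pm: "P' \<in> carrier ?L \<Longrightarrow> \<phi> (P \<otimes>\<^bsub>?L\<^esub> P') = \<phi> P \<otimes>\<^bsub>N\<^esub> \<phi> P'" if "P \<in> carrier ?L" for P P'
    using p(1) that by (auto simp: hom_def)
  have qc: "\<psi> P \<in> carrier ?L" and qm: "P' \<in> carrier N \<Longrightarrow> \<psi> (P \<otimes>\<^bsub>N\<^esub> P') = \<psi> P \<otimes>\<^bsub>?L\<^esub> \<psi> P'" if "P \<in> carrier N" for P P'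
    using q(1) that by (auto simp: hom_def)
  have stalk: "\<psi> (\<phi> (lcl X)) = lcl X" if X: "X \<in> obj A" for X
  proof -
    have "stalk X \<in> in_degree_0 A (obj A)"
      unfolding in_degree_0_iff[OF serre_UNIV] using X Hob_stalk_zero by simp
    then have "euler (stalk X) = lcl (Hob (stalk X) 0)" by (rule euler_concentrated)
    then show ?thesis using p(3)[OF X] q(3)[OF stalk_U[OF X]] lcl_iso[OF Hob_stalk[OF X]] by simp
  qed
  have "\<psi> (\<phi> P) = P" if P: "P \<in> carrier ?L" for P
  proof -
    obtain x s where xs: "x \<in> carrier (M_ab A)" "s \<in> submonoid_hull (M_ab A) S" "P = frac_rel (M_ab A) S `` {(x, s)}"
      using frac_cases[OF comm_monoid_M_ab S P] by blast
    have sM: "s \<in> carrier (M_ab A)" using hull_carrier[OF comm_monoid_M_ab S xs(2)] .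
    obtain X Y where X: "X \<in> obj A" "x = M_ab_class A X" and Y: "Y \<in> obj A" "s = M_ab_class A Y"
      using M_ab_class_surj[OF xs(1)] M_ab_class_surj[OF sM] by metis
    \<comment> \<open>A face is a submonoid, so the denominators lie in the face hull and become
      units.\<close>
    have "submonoid_hull (M_ab A) S \<subseteq> face_hull (M_ab A) S"
      unfolding submonoid_hull_def using face_S face_face_hull(2)[OF comm_monoid_M_ab S] by (auto simp: face_def)
    then have u: "lcl Y \<in> Units ?L" using mon_loc_face_unit[OF comm_monoid_M_ab S] xs(2) Y by blast
    have e: "P \<otimes>\<^bsub>?L\<^esub> lcl Y = lcl X" using frac_decomp[OF comm_monoid_M_ab S xs(1,2)] xs(3) X Y by simp
    have "\<psi> (\<phi> P) \<otimes>\<^bsub>?L\<^esub> lcl Y = \<psi> (\<phi> (P \<otimes>\<^bsub>?L\<^esub> lcl Y))"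
      using pm[OF P] qm pc P Y stalk by simp
    also have "\<dots> = P \<otimes>\<^bsub>?L\<^esub> lcl Y" unfolding e using stalk X by simp
    finally show ?thesis
      using L.Units_l_cancel[OF u, of "\<psi> (\<phi> P)" P] P pc qc Y by (simp add: L.m_comm)
  qed
  moreover have "\<phi> (\<psi> Q) = Q" if "Q \<in> carrier N" for Q
  proof -
    have conc: "\<phi> (\<psi> (dcl B)) = dcl B" if B: "B \<in> in_degree_0 A (obj A)" for B
    proof -
      have "bounded_complex A B" using B by (simp add: in_degree_0_def)
      then show ?thesis
        using q(3)[OF in_degree_0_U[OF B]] euler_concentrated[OF B] p(3)[of "Hob B 0"] dcl_concentrated[OF B] by simp
    qed
    \<comment> \<open>The composite fixes the class of \<open>B\<close> and the product of the
      classes of \<open>B\<close> and its shift, which is 1; cancelling the unit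
      \<open>dcl B\<close> leaves the shift.\<close>
    have sh: "\<phi> (\<psi> (dcl (shift A B))) = dcl (shift A B)" if B: "B \<in> in_degree_0 A F" for B
    proof -
      note c = dcl_carrier[OF in_degree_0_U[OF in_degree_0_mono[OF B]]] dcl_carrier[OF shift_U[OF B]]
      have "\<phi> (\<psi> (dcl B)) \<otimes>\<^bsub>N\<^esub> \<phi> (\<psi> (dcl (shift A B))) = \<phi> (\<psi> (dcl B \<otimes>\<^bsub>N\<^esub> dcl (shift A B)))"
        using pm qm qc c by simp
      also have "\<dots> = dcl B \<otimes>\<^bsub>N\<^esub> dcl (shift A B)" unfolding dcl_shift[OF B] using p q by simp
      finally have e: "dcl B \<otimes>\<^bsub>N\<^esub> \<phi> (\<psi> (dcl (shift A B))) = dcl B \<otimes>\<^bsub>N\<^esub> dcl (shift A B)"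
        unfolding conc[OF in_degree_0_mono[OF B]] .
      have "dcl B \<in> Units N" using N.Units_factor[OF c] dcl_shift[OF B] by simp
      then show ?thesis using N.Units_l_cancel e c pc qc by blast
    qed
    have gen: "\<phi> (\<psi> (dcl X)) = dcl X" if X: "X \<in> U" for X
    proof -
      obtain B B' where B: "B \<in> in_degree_0 A F" "B' \<in> in_degree_0 A (obj A)" "\<exists>u v w. triangle A (shift A B) X B' u v w"
        using X unfolding shift_star_def by blast
      have e: "dcl X = dcl (shift A B) \<otimes>\<^bsub>N\<^esub> dcl B'"
        using dcl_triangle[OF shift_U[OF B(1)] X in_degree_0_U[OF B(2)] B(3)] .
      show ?thesis
        unfolding e using sh[OF B(1)] conc[OF B(2)] pm qm qc dcl_carrier[OF shift_U[OF B(1)]] dcl_carrier[OF in_degree_0_U[OF B(2)]]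
        by simp
    qed
    show ?thesis
      using that[unfolded M_Db_def]
    proof (induction rule: groth_induct)
      case one
      then show ?case using p(2) q(2) unfolding M_Db_def by simp
    next
      case (mult X P)
      then show ?case
        using gen[OF mult(1)] pm qm qc dcl_carrier[OF mult(1)] unfolding M_Db_def by simp
    qed
  qed
  ultimately have "bij_betw \<phi> (carrier ?L) (carrier N)"
    using pc qc by (intro bij_betw_byWitness[of _ \<psi>]) auto
  then show ?thesis using p(1) unfolding is_iso_def iso_def by blast
qed

end

end

theorem mainTheorem9:
  fixes A :: "('o, 'm, 'z) addcat_scheme"
    and S :: "'o multiset set set"
    and F :: "'o set"
  assumes "abelian_category A"
    and "S \<subseteq> carrier (M_ab A)"
    and "F = {X \<in> obj A. M_ab_class A X \<in> face_hull (M_ab A) S}"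
  shows "serre_subcategory A F \<and>
    torsionfree_class A F \<and>
    M_ab_class A ` F = face_hull (M_ab A) S \<and>
    intermediate_subcategory A (shift_star A F (obj A)) \<and>
    mon_loc (M_ab A) S \<cong> M_Db A (shift_star A F (obj A))"
proof -
  interpret abelian_category A by fact
  have "serre_subcategory A F" using serre_F[OF assms(2,3)] .
  moreover from this have "torsionfree_class A F"
    by (simp add: serre_subcategory_def torsionfree_class_def)
  ultimately show ?thesis
    using image_F[OF assms(2,3)] intermediate_shift_star localization_iso[OF assms(2,3)] by simp
qed

end
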